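(* Let $m\ge 2$, $1\le s\le m-1$ and $k\in\mathbb N_0$. Then: (i) Under the H-action of $Pin(m)$, the space $\mathrm{Ker}_k^s\partial^+$ has the multiplicity-free decomposition into irreducible submodules $$\mathrm{Ker}_k^s\partial^+=\mathcal{H}_k^s\oplus\bigoplus_{j=0}^{\lfloor (k-1)/2\rfloor}\mathbf{x}^{2j}(\mathbf{x}\wedge)\mathcal{H}_{k-2j-1}^{s-1}\oplus\bigoplus_{j=0}^{\lfloor (k-2)/2\rfloor}\dot{\mathbf{y}}_{2j+2}\mathcal{H}_{k-2j-2}^s,$$ where $\dot{\mathbf{y}}_{2j+2}=\mathbf{x}^{2j+1}\big((\mathbf{x}\bullet)(A+2j+2)+(\mathbf{x}\wedge)A\big)$. (ii) Under the H-action, the space $\mathrm{Ker}_k^s\partial^-$ has the multiplicity-free decomposition into irreducible submodules $$\mathrm{Ker}_k^s\partial^-=\mathcal{H}_k^s\oplus\bigoplus_{j=0}^{\lfloor (k-1)/2\rfloor}\mathbf{x}^{2j}(\mathbf{x}\bullet)\mathcal{H}_{k-2j-1}^{s+1}\oplus\bigoplus_{j=0}^{\lfloor (k-2)/2\rfloor}\hat{\mathbf{y}}_{2j+2}\mathcal{H}_{k-2j-2}^s,$$ where $\hat{\mathbf{y}}_{2j+2}=\mathbf{x}^{2j+1}\big((\mathbf{x}\wedge)(B+2j+2)+(\mathbf{x}\bullet)B\big)$.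
   Context: $\mathcal{C}\ell_m$ denotes either the real Clifford algebra $\mathbb{R}_{0,m}$ or the complex Clifford algebra $\mathbb{C}_m$ generated by the standard basis $e_1,\dots,e_m$ of $\mathbb{R}^m$ with relations $e_ie_j+e_je_i=-2\delta_{ij}$; $\mathcal{C}\ell_m=\bigoplus_{s=0}^m\mathcal{C}\ell_m^s$, where $\mathcal{C}\ell_m^s$ is the space of $s$-vectors. A point $\mathbf{x}\in\mathbb R^m$ is identified with the 1-vector $\sum_j x_je_j$; $\mathbf x^n$ is the $n$-th Clifford power (so $\mathbf x^2=-|\mathbf x|^2$). For a 1-vector $u$ and an $s$-vector $v$, $u\bullet v=\frac12(uv-(-1)^svu)$ and $u\wedge v=\frac12(uv+(-1)^svu)$, extended linearly in $v$; $(\mathbf{x}\wedge)$ and $(\mathbf{x}\bullet)$ denote the pointwise operators $P\mapsto\mathbf x\wedge P$, $P\mapsto \mathbf x\bullet P$. $\mathcal P_k^s$ is the space of $k$-homogeneous $\mathcal C\ell_m^s$-valued polynomials on $\mathbb R^m$ (zero if $k<0$). $\partial=\sum_je_j\partial_{x_j}$ (from the left), $\partial^+P=\sum_je_j\wedge\partial_{x_j}P$, $\partial^-P=\sum_je_j\bullet\partial_{x_j}P$; $\mathcal H_k^s=\{P\in\mathcal P_k^s:\partial P=0\}$; $\mathrm{Ker}_k^s\partial^\pm=\{P\in\mathcal P_k^s:\partial^\pm P=0\}$. $A,B$ are the linear operators with $AP=(s+k)P$, $BP=(m-s+k)P$ for $P\in\mathcal P_k^s$ (operators compose right-to-left, so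 e.g. $(\mathbf x\bullet)(A+2j+2)P=(s+k+2j+2)\,\mathbf x\bullet P$ for $P\in\mathcal P^s_k$). The H-action of $Pin(m)$ is $[H(r)P](\mathbf x)=rP(r^{-1}\mathbf xr)r^{-1}$.
   Formalization: Irreducibility and pairwise non-isomorphism are stated for the nonzero summands only, since some summands vanish (e.g. those from H^0_d when s=1, or from H^m_d when s=m-1, with d≥1); which summands are nonzero is not asserted. *)

theory Defs
  imports "HOL-Analysis.Analysis" "HOL-Library.Function_Algebras"
begin

(* Clifford algebra Cl_m over scalars 'a: elements are coefficient functions on
   blades, i.e. subsets of {..<m} (basis e_0,...,e_{m-1}); values outside Pow {..<m}
   are ignored/zero.  e_i e_j + e_j e_i = -2 delta_ij. *)

definition blade_sign :: "nat set \<Rightarrow> nat set \<Rightarrow> 'a::comm_ring_1" where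
  "blade_sign A B = (-1) ^ (card {(a,b). a \<in> A \<and> b \<in> B \<and> b < a} + card (A \<inter> B))"

definition cl_mult :: "nat \<Rightarrow> (nat set \<Rightarrow> 'a::comm_ring_1) \<Rightarrow> (nat set \<Rightarrow> 'a) \<Rightarrow> nat set \<Rightarrow> 'a" where
  "cl_mult m u v = (\<lambda>C. if C \<subseteq> {..<m}
      then (\<Sum>A\<in>Pow {..<m}. u A * v ((A - C) \<union> (C - A)) * blade_sign A ((A - C) \<union> (C - A)))
      else 0)"

definition cl_one :: "nat set \<Rightarrow> 'a::comm_ring_1" where
  "cl_one = (\<lambda>A. if A = {} then 1 else 0)"

definition cl_basis :: "nat \<Rightarrow> nat set \<Rightarrow> 'a::comm_ring_1" where
  "cl_basis j = (\<lambda>A. if A = {j} then 1 else 0)"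

definition cl_grade :: "nat \<Rightarrow> (nat set \<Rightarrow> 'a::comm_ring_1) \<Rightarrow> nat set \<Rightarrow> 'a" where
  "cl_grade g v = (\<lambda>A. if card A = g then v A else 0)"

definition cl_vec :: "nat \<Rightarrow> (nat \<Rightarrow> real) \<Rightarrow> nat set \<Rightarrow> 'a::real_algebra_1" where
  "cl_vec m x = (\<lambda>A. if A \<subseteq> {..<m} \<and> card A = 1 then of_real (x (the_elem A)) else 0)"

(* u wedge v and u dot v for a 1-vector u, extended linearly in v over the grades *)
definition cl_wedge :: "nat \<Rightarrow> (nat set \<Rightarrow> 'a::field) \<Rightarrow> (nat set \<Rightarrow> 'a) \<Rightarrow> nat set \<Rightarrow> 'a" where
  "cl_wedge m u v = (\<lambda>C. \<Sum>g\<le>m. (cl_mult m u (cl_grade g v) C + (-1) ^ g * cl_mult m (cl_grade g v) u C) / 2)"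

definition cl_dot :: "nat \<Rightarrow> (nat set \<Rightarrow> 'a::field) \<Rightarrow> (nat set \<Rightarrow> 'a) \<Rightarrow> nat set \<Rightarrow> 'a" where
  "cl_dot m u v = (\<lambda>C. \<Sum>g\<le>m. (cl_mult m u (cl_grade g v) C - (-1) ^ g * cl_mult m (cl_grade g v) u C) / 2)"

definition cl_pow :: "nat \<Rightarrow> (nat set \<Rightarrow> 'a::comm_ring_1) \<Rightarrow> nat \<Rightarrow> nat set \<Rightarrow> 'a" where
  "cl_pow m v n = ((cl_mult m v) ^^ n) cl_one"

(* Clifford-valued functions on R^m (points as nat => real, only coordinates < m used) *)
type_synonym 'a clfun = "(nat \<Rightarrow> real) \<Rightarrow> nat set \<Rightarrow> 'a"

definition multi_idx :: "nat \<Rightarrow> nat \<Rightarrow> (nat \<Rightarrow> nat) set" where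
  "multi_idx m k = {\<alpha>. (\<forall>i. m \<le> i \<longrightarrow> \<alpha> i = 0) \<and> (\<Sum>i<m. \<alpha> i) = k}"

definition hpoly :: "nat \<Rightarrow> nat \<Rightarrow> nat \<Rightarrow> ('a::real_normed_field) clfun set" where
  "hpoly m k s = {P. \<exists>c. \<forall>x. P x = (\<lambda>A. if A \<subseteq> {..<m} \<and> card A = s
        then (\<Sum>\<alpha>\<in>multi_idx m k. c \<alpha> A * (\<Prod>i<m. of_real (x i) ^ \<alpha> i)) else 0)}"

definition pderiv_cl :: "nat \<Rightarrow> ('a::real_normed_field) clfun \<Rightarrow> 'a clfun" where
  "pderiv_cl j P = (\<lambda>x A. vector_derivative (\<lambda>t::real. P (x(j := x j + t)) A) (at 0))"

definition dirac :: "nat \<Rightarrow> ('a::real_normed_field) clfun \<Rightarrow> 'a clfun" where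
  "dirac m P = (\<lambda>x. \<Sum>j<m. cl_mult m (cl_basis j) (pderiv_cl j P x))"

definition dplus :: "nat \<Rightarrow> ('a::real_normed_field) clfun \<Rightarrow> 'a clfun" where
  "dplus m P = (\<lambda>x. \<Sum>j<m. cl_wedge m (cl_basis j) (pderiv_cl j P x))"

definition dminus :: "nat \<Rightarrow> ('a::real_normed_field) clfun \<Rightarrow> 'a clfun" where
  "dminus m P = (\<lambda>x. \<Sum>j<m. cl_dot m (cl_basis j) (pderiv_cl j P x))"

definition harm :: "nat \<Rightarrow> nat \<Rightarrow> nat \<Rightarrow> ('a::real_normed_field) clfun set" where
  "harm m s k = {P \<in> hpoly m k s. dirac m P = 0}"

definition ker_plus :: "nat \<Rightarrow> nat \<Rightarrow> nat \<Rightarrow> ('a::real_normed_field) clfun set" where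
  "ker_plus m s k = {P \<in> hpoly m k s. dplus m P = 0}"

definition ker_minus :: "nat \<Rightarrow> nat \<Rightarrow> nat \<Rightarrow> ('a::real_normed_field) clfun set" where
  "ker_minus m s k = {P \<in> hpoly m k s. dminus m P = 0}"

(* the operators A and B acting on P \<in> P_d^s *)
definition opA :: "nat \<Rightarrow> nat \<Rightarrow> ('a::real_normed_field) clfun \<Rightarrow> 'a clfun" where
  "opA s d P = (\<lambda>x A. of_nat (s + d) * P x A)"

definition opB :: "nat \<Rightarrow> nat \<Rightarrow> nat \<Rightarrow> ('a::real_normed_field) clfun \<Rightarrow> 'a clfun" where
  "opB m s d P = (\<lambda>x A. of_nat (m - s + d) * P x A)"

definition ydot :: "nat \<Rightarrow> nat \<Rightarrow> nat \<Rightarrow> nat \<Rightarrow> ('a::real_normed_field) clfun \<Rightarrow> 'a clfun" where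
  "ydot m s d j P = (\<lambda>x. cl_mult m (cl_pow m (cl_vec m x) (2*j+1))
      (\<lambda>C. cl_dot m (cl_vec m x) (\<lambda>A. opA s d P x A + of_nat (2*j+2) * P x A) C
          + cl_wedge m (cl_vec m x) (opA s d P x) C))"

definition yhat :: "nat \<Rightarrow> nat \<Rightarrow> nat \<Rightarrow> nat \<Rightarrow> ('a::real_normed_field) clfun \<Rightarrow> 'a clfun" where
  "yhat m s d j P = (\<lambda>x. cl_mult m (cl_pow m (cl_vec m x) (2*j+1))
      (\<lambda>C. cl_wedge m (cl_vec m x) (\<lambda>A. opB m s d P x A + of_nat (2*j+2) * P x A) C
          + cl_dot m (cl_vec m x) (opB m s d P x) C))"

definition pin :: "nat \<Rightarrow> (nat set \<Rightarrow> real) set" where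
  "pin m = {foldr (cl_mult m) (map (cl_vec m) xs) cl_one | xs.
              \<forall>x \<in> set xs. (\<Sum>i<m. (x i)\<^sup>2) = 1}"

definition cl_inv :: "nat \<Rightarrow> (nat set \<Rightarrow> real) \<Rightarrow> nat set \<Rightarrow> real" where
  "cl_inv m r = (SOME t. cl_mult m r t = cl_one \<and> cl_mult m t r = cl_one)"

definition coords :: "(nat set \<Rightarrow> real) \<Rightarrow> nat \<Rightarrow> real" where
  "coords v = (\<lambda>i. v {i})"

definition cl_embed :: "(nat set \<Rightarrow> real) \<Rightarrow> nat set \<Rightarrow> 'a::real_algebra_1" where
  "cl_embed r = (\<lambda>A. of_real (r A))"

definition Hact :: "nat \<Rightarrow> (nat set \<Rightarrow> real) \<Rightarrow> ('a::real_normed_field) clfun \<Rightarrow> 'a clfun" where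
  "Hact m r P = (\<lambda>x. cl_mult m (cl_embed r)
      (cl_mult m (P (coords (cl_mult m (cl_mult m (cl_inv m r) (cl_vec m x)) r))) (cl_embed (cl_inv m r))))"

definition fsubspace :: "('a::real_normed_field) clfun set \<Rightarrow> bool" where
  "fsubspace W \<longleftrightarrow> 0 \<in> W \<and> (\<forall>P\<in>W. \<forall>Q\<in>W. P + Q \<in> W) \<and> (\<forall>c. \<forall>P\<in>W. (\<lambda>x A. c * P x A) \<in> W)"

definition invariant :: "nat \<Rightarrow> ('a::real_normed_field) clfun set \<Rightarrow> bool" where
  "invariant m W \<longleftrightarrow> (\<forall>r\<in>pin m. \<forall>P\<in>W. Hact m r P \<in> W)"

definition irreducible_sub :: "nat \<Rightarrow> ('a::real_normed_field) clfun set \<Rightarrow> bool" where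
  "irreducible_sub m W \<longleftrightarrow> W \<noteq> {0} \<and> fsubspace W \<and> invariant m W \<and>
     (\<forall>U. fsubspace U \<and> U \<subseteq> W \<and> invariant m U \<longrightarrow> U = {0} \<or> U = W)"

definition isomorphic_rep :: "nat \<Rightarrow> ('a::real_normed_field) clfun set \<Rightarrow> 'a clfun set \<Rightarrow> bool" where
  "isomorphic_rep m W1 W2 \<longleftrightarrow> (\<exists>T. bij_betw T W1 W2 \<and>
     (\<forall>c P Q. P \<in> W1 \<and> Q \<in> W1 \<longrightarrow> T ((\<lambda>x A. c * P x A) + Q) = (\<lambda>x A. c * T P x A) + T Q) \<and>
     (\<forall>r\<in>pin m. \<forall>P\<in>W1. T (Hact m r P) = Hact m r (T P)))"

definition mf_decomp :: "nat \<Rightarrow> ('a::real_normed_field) clfun set \<Rightarrow> 'i set \<Rightarrow> ('i \<Rightarrow> 'a clfun set) \<Rightarrow> bool" where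
  "mf_decomp m V I W \<longleftrightarrow>
     V = {\<Sum>i\<in>I. f i | f. \<forall>i\<in>I. f i \<in> W i} \<and>
     (\<forall>f. (\<forall>i\<in>I. f i \<in> W i) \<and> (\<Sum>i\<in>I. f i) = 0 \<longrightarrow> (\<forall>i\<in>I. f i = 0)) \<and>
     (\<forall>i\<in>I. W i \<noteq> {0} \<longrightarrow> irreducible_sub m (W i)) \<and>
     (\<forall>i\<in>I. \<forall>j\<in>I. i \<noteq> j \<and> W i \<noteq> {0} \<and> W j \<noteq> {0} \<longrightarrow> \<not> isomorphic_rep m (W i) (W j))"

(* index set: (0,0) for H_k^s, (1,j) for 0 \<le> j \<le> floor((k-1)/2), (2,j) for 0 \<le> j \<le> floor((k-2)/2) *)
definition idx :: "nat \<Rightarrow> (nat \<times> nat) set" where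
  "idx k = {(0,0)} \<union> {(1,j) | j. 2*j+1 \<le> k} \<union> {(2,j) | j. 2*j+2 \<le> k}"

definition summands_plus :: "nat \<Rightarrow> nat \<Rightarrow> nat \<Rightarrow> nat \<times> nat \<Rightarrow> ('a::real_normed_field) clfun set" where
  "summands_plus m s k = (\<lambda>(i,j).
     if i = 0 then harm m s k
     else if i = 1 then (\<lambda>P x. cl_mult m (cl_pow m (cl_vec m x) (2*j)) (cl_wedge m (cl_vec m x) (P x)))
                         ` harm m (s-1) (k-2*j-1)
     else ydot m s (k-2*j-2) j ` harm m s (k-2*j-2))"

definition summands_minus :: "nat \<Rightarrow> nat \<Rightarrow> nat \<Rightarrow> nat \<times> nat \<Rightarrow> ('a::real_normed_field) clfun set" where
  "summands_minus m s k = (\<lambda>(i,j).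
     if i = 0 then harm m s k
     else if i = 1 then (\<lambda>P x. cl_mult m (cl_pow m (cl_vec m x) (2*j)) (cl_dot m (cl_vec m x) (P x)))
                         ` harm m (s+1) (k-2*j-1)
     else yhat m s (k-2*j-2) j ` harm m s (k-2*j-2))"

end

theory Submission
  imports Defs
begin

text \<open>
  Write $d = \partial^+$, $\delta = \partial^-$, $e = (x \wedge)$, $i = (x \bullet)$. These operators satisfy
  $de + ed = 0$, $\delta i + i\delta = 0$, $di + id = -A$, $\delta e + e\delta = -B$ and $ei + ie = x^2$.
  Hence $\delta$ maps the kernel of $d$ in degree $k + 1$ to the kernel of $\delta$ in degree $k$, with kernel the
  harmonic elements, and permutes the claimed summands up to nonzero constants; together with the duality
  $s \leftrightarrow m - s$ this gives both decompositions by induction on $k$.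

  All the maps that produce the summands from harmonic spaces commute with the H-action, which is generated by
  reflections. A harmonic space is irreducible because projections to an invariant subspace and to its Fischer orthogonal
  complement produce two families of polynomials that are equivariant under the stabiliser of $e_0$; such families form
  a one-dimensional space, by looking at $e_1$ and a Cauchy--Kovalevskaya argument. Two summands come from harmonic
  spaces of different degrees $d < d'$, and an alternating sum of $2d' + 2$ reflections in the plane of $e_0$ and $e_1$
  annihilates the summand of degree $d$ but not the one of degree $d'$.
\<close>

text \<open>The coefficients of the y-summands are forced: they are the weights for which d kills
  the combination of x^(2j) e i h and x^(2j) i e h. Applying \<delta> to it gives x^(2j) i h times a
  difference of two products, nonzero for 0 <= s <= m. The induction on k needs no more than this.

  The irreducibility argument is Frobenius reciprocity made explicit: the Fischer product with x_0^k
  w evaluates at e_0, so the projections to an invariant subspace cannot all vanish unless the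
  subspace does. Grades 0 and m, reached by s - 1 and s + 1, fall outside this argument; their
  harmonic spaces are zero or a line.

  The harmonic sources of the summands have degrees k, k - 2j - 1 and k - 2j - 2, which are pairwise
  distinct. Under a reflection whose direction rotates in a plane, a polynomial of degree d has
  trigonometric degree at most d + 1 in the angle: d from the argument and only one from the values,
  whatever the grade. This is the origin of the number 2d' + 2.

  Real and complex scalars are one case: a normed field with a Euclidean structure over the
  reals.\<close>

lemma sum_fun_app: "(\<Sum>i\<in>I. f i) x = (\<Sum>i\<in>I. (f i x :: 'b::comm_monoid_add))"
  by (induction I rule: infinite_finite_induct) auto

section \<open>Exterior multiplication and contraction on blades\<close>

text \<open>The sign of moving e_j past those basis vectors of the blade A that have a smaller
  index.\<close>

definition sg :: "nat \<Rightarrow> nat set \<Rightarrow> 'a::comm_ring_1" where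
  "sg j A = (-1) ^ card {a \<in> A. a < j}"

text \<open>The maps $v \mapsto e_j \wedge v$ and $v \mapsto e_j \bullet v$ on coefficient functions;
  the sign in \<open>iot\<close> comes from $e_j^2 = -1$.\<close>

definition eps :: "nat \<Rightarrow> (nat set \<Rightarrow> 'a::comm_ring_1) \<Rightarrow> nat set \<Rightarrow> 'a" where
  "eps j v = (\<lambda>A. if j \<in> A then sg j A * v (A - {j}) else 0)"

definition iot :: "nat \<Rightarrow> (nat set \<Rightarrow> 'a::comm_ring_1) \<Rightarrow> nat set \<Rightarrow> 'a" where
  "iot j v = (\<lambda>A. if j \<in> A then 0 else - sg j A * v (insert j A))"

lemma sg_square [simp]: "sg j A * sg j A = 1"
  by (simp add: sg_def flip: power_mult_distrib)

lemma sg_square_left [simp]: "sg j A * (sg j A * x) = x"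
  by (metis mult.assoc mult_1 sg_square)

lemma sg_remove: "sg i (A - {j}) = (if j \<in> A \<and> j < i then - sg i A else (sg i A :: 'a::comm_ring_1))"
proof (cases "j \<in> A \<and> j < i")
  case True
  have "{a \<in> A. a < i} = insert j {a \<in> A - {j}. a < i}" using True by auto
  moreover have "finite {a \<in> A - {j}. a < i}" by (rule finite_subset[of _ "{..<i}"]) auto
  ultimately have "card {a \<in> A. a < i} = Suc (card {a \<in> A - {j}. a < i})" by simp
  then show ?thesis using True by (simp add: sg_def)
next
  case False
  then have "{a \<in> A - {j}. a < i} = {a \<in> A. a < i}" by auto
  then have "sg i (A - {j}) = (sg i A :: 'a)" unfolding sg_def by (rule arg_cong)
  then show ?thesis using False by auto
qed

lemma sg_insert: "sg i (insert j A) = (if j \<notin> A \<and> j < i then - sg i A else (sg i A :: 'a::comm_ring_1))"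
proof (cases "j \<in> A")
  case True
  then show ?thesis by (simp add: insert_absorb)
next
  case False
  then show ?thesis using sg_remove[of i "insert j A" j, where 'a='a] by (auto simp: Diff_insert_absorb)
qed

lemma eps_eps: "eps i (eps j v) A = - eps j (eps i v) A"
  by (cases "i = j"; cases "i < j")
    (auto simp: eps_def sg_remove algebra_simps Diff_insert2[symmetric] insert_commute)

lemma iot_iot: "iot i (iot j v) A = - iot j (iot i v) A"
  by (cases "i = j"; cases "i < j")
    (auto simp: iot_def sg_insert algebra_simps insert_commute)

text \<open>The canonical anticommutation relation on blades. For i = j exactly one of the two terms
  survives at A, depending on whether i is in A, and its sign is that of e_i^2 = -1. For different
  indices the two orders differ by one transposition.\<close>

lemma eps_iot: "eps i (iot j v) A + iot j (eps i v) A = (if i = j then - v A else 0)"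
proof (cases "i = j")
  case True
  then show ?thesis
    by (auto simp: eps_def iot_def sg_remove sg_insert insert_absorb Diff_insert_absorb)
next
  case False
  moreover have "i \<in> A \<Longrightarrow> j \<notin> A \<Longrightarrow> insert j (A - {i}) = insert j A - {i}" using False by auto
  ultimately show ?thesis
    by (cases "i < j") (auto simp: eps_def iot_def sg_remove sg_insert algebra_simps)
qed

lemma eps_add: "eps j (v + w) = eps j v + (eps j w)" and iot_add: "iot j (v + w) = iot j v + (iot j w)"
  by (auto simp: eps_def iot_def fun_eq_iff algebra_simps)

lemma eps_zero [simp]: "eps j 0 = 0" and iot_zero [simp]: "iot j 0 = 0"
  by (auto simp: eps_def iot_def fun_eq_iff)

lemma eps_scale: "eps j (\<lambda>A. c * v A) = (\<lambda>A. c * eps j v A)"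
  and iot_scale: "iot j (\<lambda>A. c * v A) = (\<lambda>A. c * iot j v A)"
  by (auto simp: eps_def iot_def fun_eq_iff algebra_simps)

lemma eps_fsum: "eps j (\<lambda>A. \<Sum>i\<in>I. f i A) = (\<lambda>A. \<Sum>i\<in>I. eps j (f i) A)"
  by (auto simp: eps_def fun_eq_iff sum_distrib_left)

lemma iot_fsum: "iot j (\<lambda>A. \<Sum>i\<in>I. f i A) = (\<lambda>A. \<Sum>i\<in>I. iot j (f i) A)"
  by (auto simp: iot_def fun_eq_iff sum_distrib_left sum_negf)

definition graded :: "nat \<Rightarrow> nat \<Rightarrow> (nat set \<Rightarrow> 'a::zero) \<Rightarrow> bool" where
  "graded m s v \<longleftrightarrow> (\<forall>A. \<not> (A \<subseteq> {..<m} \<and> card A = s) \<longrightarrow> v A = 0)"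

lemma graded_eps: "graded m s v \<Longrightarrow> j < m \<Longrightarrow> graded m (Suc s) (eps j v)"
  unfolding graded_def eps_def
proof (intro allI impI)
  fix A assume a: "\<forall>A. \<not> (A \<subseteq> {..<m} \<and> card A = s) \<longrightarrow> v A = 0" "j < m" "\<not> (A \<subseteq> {..<m} \<and> card A = Suc s)"
  have "v (A - {j}) = 0" if "j \<in> A"
  proof (rule a(1)[rule_format], rule notI)
    assume b: "A - {j} \<subseteq> {..<m} \<and> card (A - {j}) = s"
    then have "finite A" by (metis finite_Diff_insert finite.emptyI finite_lessThan finite_subset Diff_empty)
    then have "card A = Suc s" using b that by (metis card_Suc_Diff1)
    then show False using a b that by auto
  qed
  then show "(if j \<in> A then sg j A * v (A - {j}) else 0) = 0" by simp
qed

lemma graded_iot: "graded m (Suc s) v \<Longrightarrow> graded m s (iot j v)"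
  unfolding graded_def iot_def
proof (intro allI impI)
  fix A assume a: "\<forall>A. \<not> (A \<subseteq> {..<m} \<and> card A = Suc s) \<longrightarrow> v A = 0" "\<not> (A \<subseteq> {..<m} \<and> card A = s)"
  have "v (insert j A) = 0" if "j \<notin> A"
  proof (rule a(1)[rule_format], rule notI)
    assume b: "insert j A \<subseteq> {..<m} \<and> card (insert j A) = Suc s"
    then have "finite A" by (meson finite_insert finite_lessThan finite_subset)
    then show False using b that a by auto
  qed
  then show "(if j \<in> A then 0 else - sg j A * v (insert j A)) = 0" by simp
qed

lemma iot_graded_0: "graded m 0 v \<Longrightarrow> iot j v = 0"
proof
  fix A assume v: "graded m 0 v"
  have "v (insert j A) = 0"
  proof (rule v[unfolded graded_def, rule_format], rule notI)
    assume "insert j A \<subseteq> {..<m} \<and> card (insert j A) = 0"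
    then show False by (metis card_0_eq finite_lessThan finite_subset insert_not_empty)
  qed
  then show "iot j v A = 0 A" by (simp add: iot_def)
qed

lemma graded_scale: "graded m s v \<Longrightarrow> graded m s (\<lambda>A. c * (v A::'a::comm_ring_1))"
  by (auto simp: graded_def)

lemma graded_sum: "(\<And>i. i \<in> I \<Longrightarrow> graded m s (f i)) \<Longrightarrow> graded m s (\<lambda>A. \<Sum>i\<in>I. (f i A::'a::comm_ring_1))"
  by (auto simp: graded_def intro!: sum.neutral)

section \<open>Wedge and contraction by an arbitrary real vector: anticommutation relations\<close>

definition evec :: "nat \<Rightarrow> (nat \<Rightarrow> real) \<Rightarrow> (nat set \<Rightarrow> 'a::real_normed_field) \<Rightarrow> nat set \<Rightarrow> 'a" where
  "evec m x v = (\<lambda>A. \<Sum>j<m. of_real (x j) * eps j v A)"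

definition ivec :: "nat \<Rightarrow> (nat \<Rightarrow> real) \<Rightarrow> (nat set \<Rightarrow> 'a::real_normed_field) \<Rightarrow> nat set \<Rightarrow> 'a" where
  "ivec m x v = (\<lambda>A. \<Sum>j<m. of_real (x j) * iot j v A)"

definition dotp :: "nat \<Rightarrow> (nat \<Rightarrow> real) \<Rightarrow> (nat \<Rightarrow> real) \<Rightarrow> real" where
  "dotp m x y = (\<Sum>j<m. x j * y j)"

lemma evec_evec: "evec m x (evec m y v) A = - evec m y (evec m x v) A"
proof -
  have *: "evec m x (evec m y v) A = (\<Sum>i<m. \<Sum>j<m. of_real (x i) * of_real (y j) * eps i (eps j v) A)" for x y
    by (simp add: evec_def eps_fsum eps_scale sum_distrib_left mult.assoc)
  have "evec m x (evec m y v) A = (\<Sum>i<m. \<Sum>j<m. - (of_real (y j) * of_real (x i) * eps j (eps i v) A))"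
    unfolding * by (rule sum.cong[OF refl], rule sum.cong[OF refl]) (subst eps_eps, simp)
  also have "\<dots> = (\<Sum>j<m. \<Sum>i<m. - (of_real (y j) * of_real (x i) * eps j (eps i v) A))"
    by (rule sum.swap)
  finally show ?thesis by (simp only: * sum_negf)
qed

lemma ivec_ivec: "ivec m x (ivec m y v) A = - ivec m y (ivec m x v) A"
proof -
  have *: "ivec m x (ivec m y v) A = (\<Sum>i<m. \<Sum>j<m. of_real (x i) * of_real (y j) * iot i (iot j v) A)" for x y
    by (simp add: ivec_def iot_fsum iot_scale sum_distrib_left mult.assoc)
  have "ivec m x (ivec m y v) A = (\<Sum>i<m. \<Sum>j<m. - (of_real (y j) * of_real (x i) * iot j (iot i v) A))"
    unfolding * by (rule sum.cong[OF refl], rule sum.cong[OF refl]) (subst iot_iot, simp)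
  also have "\<dots> = (\<Sum>j<m. \<Sum>i<m. - (of_real (y j) * of_real (x i) * iot j (iot i v) A))"
    by (rule sum.swap)
  finally show ?thesis by (simp only: * sum_negf)
qed

lemma evec_ivec: "evec m x (ivec m y v) A + ivec m y (evec m x v) A = - of_real (dotp m x y) * v A"
proof -
  have 1: "evec m x (ivec m y v) A = (\<Sum>i<m. \<Sum>j<m. of_real (x i) * of_real (y j) * eps i (iot j v) A)"
    by (simp add: evec_def ivec_def eps_fsum eps_scale sum_distrib_left mult.assoc)
  have "ivec m y (evec m x v) A = (\<Sum>j<m. \<Sum>i<m. of_real (y j) * of_real (x i) * iot j (eps i v) A)"
    by (simp add: evec_def ivec_def iot_fsum iot_scale sum_distrib_left mult.assoc)
  also have "\<dots> = (\<Sum>i<m. \<Sum>j<m. of_real (x i) * of_real (y j) * iot j (eps i v) A)"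
    by (subst sum.swap) (simp add: mult_ac)
  finally have 2: "ivec m y (evec m x v) A = \<dots>" .
  have "evec m x (ivec m y v) A + ivec m y (evec m x v) A
      = (\<Sum>i<m. \<Sum>j<m. of_real (x i) * of_real (y j) * (eps i (iot j v) A + iot j (eps i v) A))"
    unfolding 1 2 by (simp add: sum.distrib distrib_left)
  also have "\<dots> = (\<Sum>i<m. \<Sum>j<m. if j = i then - (of_real (x i) * of_real (y i) * v A) else 0)"
    unfolding eps_iot by (intro sum.cong) auto
  also have "\<dots> = - of_real (dotp m x y) * v A"
    by (simp add: sum_negf dotp_def sum_distrib_right)
  finally show ?thesis .
qed

lemma evec_self: "evec m x (evec m x v) A = 0"
  using evec_evec[of m x x v A] by (simp add: eq_neg_iff_add_eq_0 flip: mult_2)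

lemma ivec_self: "ivec m x (ivec m x v) A = 0"
  using ivec_ivec[of m x x v A] by (simp add: eq_neg_iff_add_eq_0 flip: mult_2)

lemma evec_add: "evec m x (v + w) = evec m x v + evec m x w"
  and ivec_add: "ivec m x (v + w) = ivec m x v + ivec m x w"
  by (auto simp: evec_def ivec_def eps_add iot_add fun_eq_iff algebra_simps sum.distrib)

lemma evec_scale: "evec m x (\<lambda>A. c * v A) = (\<lambda>A. c * evec m x v A)"
  and ivec_scale: "ivec m x (\<lambda>A. c * v A) = (\<lambda>A. c * ivec m x v A)"
  by (auto simp: evec_def ivec_def eps_scale iot_scale fun_eq_iff sum_distrib_left algebra_simps)

lemma evec_zero [simp]: "evec m x 0 = 0" and ivec_zero [simp]: "ivec m x 0 = 0"
  by (auto simp: evec_def ivec_def fun_eq_iff)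

lemma graded_evec: "graded m s v \<Longrightarrow> graded m (Suc s) (evec m x v)"
  unfolding evec_def by (intro graded_sum graded_scale graded_eps) auto

lemma graded_ivec: "graded m (Suc s) v \<Longrightarrow> graded m s (ivec m x v)"
  unfolding ivec_def by (intro graded_sum graded_scale graded_iot) auto

lemma ivec_graded_0: "graded m 0 v \<Longrightarrow> ivec m x v = 0"
  by (simp add: ivec_def iot_graded_0 fun_eq_iff)

section \<open>Homogeneous polynomials\<close>

text \<open>A scalar description of \<open>hpoly\<close> whose induction principle avoids multi-indices.\<close>

inductive hp :: "nat \<Rightarrow> nat \<Rightarrow> ((nat \<Rightarrow> real) \<Rightarrow> 'a::real_normed_field) \<Rightarrow> bool" for m where
  const: "hp m 0 (\<lambda>x. c)"
| zero: "hp m k (\<lambda>x. 0)"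
| add: "hp m k f \<Longrightarrow> hp m k g \<Longrightarrow> hp m k (\<lambda>x. f x + g x)"
| mulx: "hp m k f \<Longrightarrow> i < m \<Longrightarrow> hp m (Suc k) (\<lambda>x. of_real (x i) * f x)"

lemma hp_scale: "hp m k f \<Longrightarrow> hp m k (\<lambda>x. c * f x)"
proof (induction rule: hp.induct)
  case (mulx k f i)
  have "hp m (Suc k) (\<lambda>x. of_real (x i) * (c * f x))" using mulx hp.mulx by blast
  then show ?case by (simp add: mult.left_commute)
qed (auto simp: distrib_left intro: hp.intros)

lemma hp_sum: "(\<And>i. i \<in> I \<Longrightarrow> hp m k (f i)) \<Longrightarrow> hp m k (\<lambda>x. \<Sum>i\<in>I. f i x)"
  by (induction I rule: infinite_finite_induct) (auto intro: hp.intros)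

lemma hp_uminus: "hp m k f \<Longrightarrow> hp m k (\<lambda>x. - f x)"
  using hp_scale[of m k f "-1"] by simp

section \<open>Partial derivatives of homogeneous polynomials, Euler's identity\<close>

definition pd :: "nat \<Rightarrow> ((nat \<Rightarrow> real) \<Rightarrow> 'a::real_normed_field) \<Rightarrow> (nat \<Rightarrow> real) \<Rightarrow> 'a" where
  "pd j f x = vector_derivative (\<lambda>t. f (x(j := x j + t))) (at 0)"

lemma pd_eqI: "((\<lambda>t. f (x(j := x j + t))) has_vector_derivative d) (at 0) \<Longrightarrow> pd j f x = d"
  unfolding pd_def by (rule vector_derivative_at)

text \<open>Differentiability in every variable, stated with \<open>pd\<close> itself as the
  derivative, so that the derivative rules become equations for \<open>pd\<close>.\<close>

definition pdable :: "((nat \<Rightarrow> real) \<Rightarrow> 'a::real_normed_field) \<Rightarrow> bool" where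
  "pdable f \<longleftrightarrow> (\<forall>j x. ((\<lambda>t. f (x(j := x j + t))) has_vector_derivative pd j f x) (at 0))"

lemma pdable_const: "pdable (\<lambda>x. c)" and pd_const: "pd j (\<lambda>x. c) x = 0"
proof -
  show *: "pd j (\<lambda>x. c) x = 0" for j x by (rule pd_eqI) (auto intro: derivative_eq_intros)
  show "pdable (\<lambda>x. c)" unfolding pdable_def * by (auto intro: derivative_eq_intros)
qed

lemma
  assumes "pdable f" "pdable g"
  shows pdable_add: "pdable (\<lambda>x. f x + g x)" and pd_add: "pd j (\<lambda>x. f x + g x) x = pd j f x + pd j g x"
proof -
  have h: "((\<lambda>t. f (x(j := x j + t)) + g (x(j := x j + t))) has_vector_derivative (pd j f x + pd j g x)) (at 0)" for j x
    using assms unfolding pdable_def by (intro has_vector_derivative_add) auto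
  show *: "pd j (\<lambda>x. f x + g x) x = pd j f x + pd j g x" for j x by (rule pd_eqI[OF h])
  show "pdable (\<lambda>x. f x + g x)" unfolding pdable_def * using h by blast
qed

lemma
  assumes "pdable f"
  shows pdable_mulx: "pdable (\<lambda>x. of_real (x i) * f x)"
    and pd_mulx: "pd j (\<lambda>x. of_real (x i) * f x) x = (if i = j then f x else 0) + of_real (x i) * pd j f x"
proof -
  have h: "((\<lambda>t. of_real ((x(j := x j + t)) i) * f (x(j := x j + t))) has_vector_derivative
     ((if i = j then f x else 0) + of_real (x i) * pd j f x)) (at 0)" for j x
  proof -
    have 1: "((\<lambda>t. of_real ((x(j := x j + t)) i)::'a) has_vector_derivative (if i = j then 1 else 0)) (at 0)"
    proof (cases "i = j")
      case True
      have "((\<lambda>t. of_real (x j) + of_real t :: 'a) has_vector_derivative (0 + 1)) (at 0)"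
        by (intro has_vector_derivative_add has_vector_derivative_const)
          (use has_vector_derivative_of_real[OF DERIV_ident, where 'a='a] in simp)
      then show ?thesis using True by simp
    qed (auto intro: derivative_eq_intros)
    have 2: "((\<lambda>t. f (x(j := x j + t))) has_vector_derivative pd j f x) (at 0)"
      using assms by (auto simp: pdable_def)
    show ?thesis using has_vector_derivative_mult[OF 1 2] by (auto simp: algebra_simps)
  qed
  show *: "pd j (\<lambda>x. of_real (x i) * f x) x = (if i = j then f x else 0) + of_real (x i) * pd j f x" for j x
    by (rule pd_eqI[OF h])
  show "pdable (\<lambda>x. of_real (x i) * f x)" unfolding pdable_def * using h by blast
qed

lemma
  assumes "pdable f"
  shows pdable_scale: "pdable (\<lambda>x. c * f x)" and pd_scale: "pd j (\<lambda>x. c * f x) x = c * pd j f x"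
proof -
  have h: "((\<lambda>t. c * f (x(j := x j + t))) has_vector_derivative (c * pd j f x)) (at 0)" for j x
    using assms unfolding pdable_def by (intro has_vector_derivative_mult_right) auto
  show *: "pd j (\<lambda>x. c * f x) x = c * pd j f x" for j x by (rule pd_eqI[OF h])
  show "pdable (\<lambda>x. c * f x)" unfolding pdable_def * using h by blast
qed

lemma pdable_hp: "hp m k f \<Longrightarrow> pdable f"
  by (induction rule: hp.induct) (auto intro: pdable_const pdable_add pdable_mulx)

lemma
  assumes "\<And>i. i \<in> I \<Longrightarrow> pdable (f i)"
  shows pdable_sum: "pdable (\<lambda>x. \<Sum>i\<in>I. f i x)"
    and pd_sum: "pd j (\<lambda>x. \<Sum>i\<in>I. f i x) x = (\<Sum>i\<in>I. pd j (f i) x)"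
proof -
  have "pdable (\<lambda>x. \<Sum>i\<in>I. f i x) \<and> (\<forall>j x. pd j (\<lambda>x. \<Sum>i\<in>I. f i x) x = (\<Sum>i\<in>I. pd j (f i) x))"
    using assms by (induction I rule: infinite_finite_induct)
      (auto simp: pdable_const pd_const pdable_add pd_add)
  then show "pdable (\<lambda>x. \<Sum>i\<in>I. f i x)" "pd j (\<lambda>x. \<Sum>i\<in>I. f i x) x = (\<Sum>i\<in>I. pd j (f i) x)" by auto
qed

lemma pd_hp_0: "hp m 0 f \<Longrightarrow> pd j f = (\<lambda>x. 0)"
  by (induction "0::nat" f rule: hp.induct) (auto simp: fun_eq_iff pd_const pd_add pdable_hp)

lemma hp_0_const: "hp m 0 f \<Longrightarrow> f x = f y"
  by (induction "0::nat" f rule: hp.induct) auto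

lemma pd_hp: "hp m k f \<Longrightarrow> hp m (k - 1) (pd j f)"
proof (induction rule: hp.induct)
  case (const c)
  have "pd j (\<lambda>x. c) = (\<lambda>x. 0)" by (auto simp: pd_const)
  then show ?case by (simp add: hp.zero)
next
  case (zero k)
  have "pd j (\<lambda>x. 0) = (\<lambda>x. 0::'a)" by (auto simp: pd_const)
  then show ?case by (simp add: hp.zero)
next
  case (add k f g)
  have "pd j (\<lambda>x. f x + g x) = (\<lambda>x. pd j f x + pd j g x)"
    using add pdable_hp pd_add by blast
  then show ?case using add by (simp add: hp.add)
next
  case (mulx k f i)
  have e: "pd j (\<lambda>x. of_real (x i) * f x) = (\<lambda>x. (if i = j then f x else 0) + of_real (x i) * pd j f x)"
    using mulx pdable_hp pd_mulx by blast
  have 1: "hp m k (\<lambda>x. if i = j then f x else 0)" using mulx by (cases "i = j") (auto intro: hp.zero)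
  have 2: "hp m k (\<lambda>x. of_real (x i) * pd j f x)"
  proof (cases k)
    case 0
    then show ?thesis using pd_hp_0[of m f j] mulx by (simp add: hp.zero)
  next
    case (Suc l)
    then show ?thesis using mulx hp.mulx[of m l "pd j f" i] by simp
  qed
  show ?case unfolding e using hp.add[OF 1 2] by simp
qed

lemma pd_hp_Suc: "hp m (Suc k) f \<Longrightarrow> hp m k (pd j f)"
  using pd_hp[of m "Suc k" f j] by simp

lemma euler: "hp m k f \<Longrightarrow> (\<Sum>j<m. of_real (x j) * pd j f x) = of_nat k * f x"
proof (induction rule: hp.induct)
  case (add k f g)
  then show ?case by (simp add: pd_add pdable_hp distrib_left sum.distrib)
next
  case (mulx k f i)
  have "(\<Sum>j<m. of_real (x j) * pd j (\<lambda>x. of_real (x i) * f x) x)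
      = (\<Sum>j<m. (if j = i then of_real (x j) * f x else 0) + of_real (x i) * (of_real (x j) * pd j f x))"
    by (rule sum.cong[OF refl], simp only: pd_mulx[OF pdable_hp[OF mulx.hyps(1)]]) (auto simp: algebra_simps)
  also have "\<dots> = of_real (x i) * f x + of_real (x i) * (\<Sum>j<m. of_real (x j) * pd j f x)"
    using mulx(2) by (simp add: sum.distrib flip: sum_distrib_left)
  also have "\<dots> = of_nat (Suc k) * (of_real (x i) * f x)" unfolding mulx.IH by (simp add: algebra_simps)
  finally show ?case .
qed (auto simp: pd_const)

text \<open>Induction on the polynomial avoids any smoothness theorem: for x_l * f the product rule
  produces terms that are visibly symmetric in i and j.\<close>

lemma pd_commute: "hp m k f \<Longrightarrow> pd i (pd j f) x = pd j (pd i f) x"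
proof (induction arbitrary: x rule: hp.induct)
  case (const c)
  have "pd j (\<lambda>x. c) = (\<lambda>x. 0)" for j by (auto simp: pd_const)
  then show ?case by (simp add: pd_const)
next
  case (zero k)
  have "pd j (\<lambda>x. 0) = (\<lambda>x. 0::'a)" for j by (auto simp: pd_const)
  then show ?case by (simp add: pd_const)
next
  case (add k f g)
  have "pd j (\<lambda>x. f x + g x) = (\<lambda>x. pd j f x + pd j g x)" for j
    using add pdable_hp pd_add by blast
  moreover have "pdable (pd j f)" "pdable (pd j g)" for j using add pd_hp pdable_hp by blast+
  ultimately show ?case using add by (simp add: pd_add)
next
  case (mulx k f l)
  have e: "pd j (\<lambda>x. of_real (x l) * f x) = (\<lambda>x. (if l = j then f x else 0) + of_real (x l) * pd j f x)" for j
    using mulx pdable_hp pd_mulx by blast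
  have p: "pdable (pd j f)" "pdable f" for j using mulx pd_hp pdable_hp by blast+
  have q: "pdable (\<lambda>x. if l = j then f x else 0)" for j using p by (cases "l = j") (auto simp: pdable_const)
  have r: "pd i (\<lambda>x. if l = j then f x else 0) x = (if l = j then pd i f x else 0)" for i j
    by (auto simp: pd_const)
  show ?case unfolding e
    by (simp add: pd_add q r pdable_mulx p pd_mulx mulx.IH)
qed

section \<open>Agreement of the inductive polynomials with sums of monomials\<close>

lemma finite_multi_idx: "finite (multi_idx m k)"
proof (rule finite_subset)
  show "multi_idx m k \<subseteq> {f. (\<forall>x. (x \<in> {..<m} \<longrightarrow> f x \<in> {..k}) \<and> (x \<notin> {..<m} \<longrightarrow> f x = 0))}"
  proof (clarsimp simp: multi_idx_def)
    fix \<alpha> :: "nat \<Rightarrow> nat" and x assume "x < m"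
    then show "\<alpha> x \<le> sum \<alpha> {..<m}" by (intro member_le_sum) auto
  qed
qed (intro finite_set_of_finite_funs; simp)

lemma monomial_Suc:
  fixes i m :: nat
  assumes "i < m"
  shows "(\<Prod>j<m. of_real (x j) ^ ((\<beta>(i := Suc (\<beta> i))) j)) = of_real (x i) * (\<Prod>j<m. (of_real (x j)::'a::real_normed_field) ^ \<beta> j)"
proof -
  have "(\<Prod>j\<in>{..<m} - {i}. (of_real (x j)::'a) ^ ((\<beta>(i := Suc (\<beta> i))) j)) = (\<Prod>j\<in>{..<m} - {i}. of_real (x j) ^ \<beta> j)"
    by (intro prod.cong) auto
  then show ?thesis using assms by (simp add: prod.remove[of "{..<m}" i])
qed

lemma multi_idx_Suc: "\<beta> \<in> multi_idx m k \<Longrightarrow> i < m \<Longrightarrow> \<beta>(i := Suc (\<beta> i)) \<in> multi_idx m (Suc k)"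
  by (auto simp: multi_idx_def sum.remove[of "{..<m}" i])

lemma multi_idx_pred: "\<alpha> \<in> multi_idx m (Suc k) \<Longrightarrow> i < m \<Longrightarrow> 0 < \<alpha> i \<Longrightarrow> \<alpha>(i := \<alpha> i - 1) \<in> multi_idx m k"
  by (auto simp: multi_idx_def sum.remove[of "{..<m}" i])

lemma hp_monomial: "\<alpha> \<in> multi_idx m k \<Longrightarrow> hp m k (\<lambda>x. \<Prod>j<m. (of_real (x j) :: 'a::real_normed_field) ^ \<alpha> j)"
proof (induction k arbitrary: \<alpha>)
  case 0
  then have "(\<lambda>x. \<Prod>j<m. (of_real (x j) :: 'a) ^ \<alpha> j) = (\<lambda>x. 1)" by (auto simp: multi_idx_def)
  then show ?case using hp.const[of m 1] by simp
next
  case (Suc k)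
  obtain i where i: "i < m" "0 < \<alpha> i"
    using Suc.prems by (auto simp: multi_idx_def) (metis lessThan_iff neq0_conv sum.neutral nat.distinct(1))
  define \<beta> where "\<beta> = \<alpha>(i := \<alpha> i - 1)"
  have a: "\<alpha> = \<beta>(i := Suc (\<beta> i))" using i by (auto simp: \<beta>_def)
  have "\<beta> \<in> multi_idx m k" using multi_idx_pred[OF Suc.prems i] by (simp add: \<beta>_def)
  then show ?case unfolding a monomial_Suc[OF i(1)] using i Suc.IH by (intro hp.mulx)
qed

lemma hp_iff: "hp m k f \<longleftrightarrow> (\<exists>c. f = (\<lambda>x. \<Sum>\<alpha>\<in>multi_idx m k. c \<alpha> * (\<Prod>i<m. of_real (x i) ^ \<alpha> i)))"
proof
  assume "hp m k f"
  then show "\<exists>c. f = (\<lambda>x. \<Sum>\<alpha>\<in>multi_idx m k. c \<alpha> * (\<Prod>i<m. of_real (x i) ^ \<alpha> i))"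
  proof (induction rule: hp.induct)
    case (const c)
    have "multi_idx m 0 = {\<lambda>_. 0}"
      by (auto simp: multi_idx_def fun_eq_iff) (metis lessThan_iff not_le)
    then show ?case by (intro exI[of _ "\<lambda>_. c"]) simp
  next
    case (zero k)
    then show ?case by (intro exI[of _ "\<lambda>_. 0"]) simp
  next
    case (add k f g)
    then obtain c c' where
      "f = (\<lambda>x. \<Sum>\<alpha>\<in>multi_idx m k. c \<alpha> * (\<Prod>i<m. of_real (x i) ^ \<alpha> i))"
      "g = (\<lambda>x. \<Sum>\<alpha>\<in>multi_idx m k. c' \<alpha> * (\<Prod>i<m. of_real (x i) ^ \<alpha> i))" by auto
    then show ?case by (intro exI[of _ "\<lambda>\<alpha>. c \<alpha> + c' \<alpha>"]) (simp add: distrib_right sum.distrib)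
  next
    case (mulx k f i)
    then obtain c where f: "f = (\<lambda>x. \<Sum>\<alpha>\<in>multi_idx m k. c \<alpha> * (\<Prod>i<m. of_real (x i) ^ \<alpha> i))" by auto
    \<comment> \<open>Multiplication by x_i raises the exponent of x_i, so the coefficient at
      \<alpha> is taken from \<alpha> lowered at i; exponents with \<alpha> i = 0 receive
      nothing.\<close>
    define c' where "c' = (\<lambda>\<alpha>. if 0 < \<alpha> i then c (\<alpha>(i := \<alpha> i - 1)) else 0)"
    have "of_real (x i) * f x = (\<Sum>\<alpha>\<in>multi_idx m (Suc k). c' \<alpha> * (\<Prod>i<m. of_real (x i) ^ \<alpha> i))" for x
    proof -
      have "of_real (x i) * f x = (\<Sum>\<beta>\<in>multi_idx m k. c \<beta> * (of_real (x i) * (\<Prod>j<m. of_real (x j) ^ \<beta> j)))"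
        by (simp add: f sum_distrib_left mult.left_commute)
      also have "\<dots> = (\<Sum>\<alpha>\<in>{\<alpha> \<in> multi_idx m (Suc k). 0 < \<alpha> i}. c' \<alpha> * (\<Prod>i<m. of_real (x i) ^ \<alpha> i))"
      proof (rule sum.reindex_bij_witness[where i = "\<lambda>\<alpha>. \<alpha>(i := \<alpha> i - 1)" and j = "\<lambda>\<beta>. \<beta>(i := Suc (\<beta> i))"])
        fix \<beta> assume b: "\<beta> \<in> multi_idx m k"
        show "\<beta>(i := Suc (\<beta> i)) \<in> {\<alpha> \<in> multi_idx m (Suc k). 0 < \<alpha> i}" using multi_idx_Suc[OF b mulx.hyps(2)] by simp
        show "c' (\<beta>(i := Suc (\<beta> i))) * (\<Prod>j<m. of_real (x j) ^ (\<beta>(i := Suc (\<beta> i))) j) =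
          c \<beta> * (of_real (x i) * (\<Prod>j<m. of_real (x j) ^ \<beta> j))"
          unfolding monomial_Suc[OF mulx.hyps(2)] by (simp add: c'_def)
      qed (use multi_idx_pred[OF _ mulx.hyps(2)] in auto)
      also have "\<dots> = (\<Sum>\<alpha>\<in>multi_idx m (Suc k). c' \<alpha> * (\<Prod>i<m. of_real (x i) ^ \<alpha> i))"
        by (rule sum.mono_neutral_left) (auto simp: finite_multi_idx c'_def)
      finally show ?thesis .
    qed
    then show ?case by auto
  qed
next
  assume "\<exists>c. f = (\<lambda>x. \<Sum>\<alpha>\<in>multi_idx m k. c \<alpha> * (\<Prod>i<m. of_real (x i) ^ \<alpha> i))"
  then show "hp m k f" by (auto intro!: hp_sum hp_scale hp_monomial)
qed

lemma hpoly_iff: "P \<in> hpoly m k s \<longleftrightarrow> (\<forall>x. graded m s (P x)) \<and> (\<forall>A. hp m k (\<lambda>x. P x A))"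
proof
  assume "P \<in> hpoly m k s"
  then obtain c where c: "P x = (\<lambda>A. if A \<subseteq> {..<m} \<and> card A = s
        then (\<Sum>\<alpha>\<in>multi_idx m k. c \<alpha> A * (\<Prod>i<m. of_real (x i) ^ \<alpha> i)) else 0)" for x
    by (auto simp: hpoly_def)
  have "hp m k (\<lambda>x. P x A)" for A
  proof (cases "A \<subseteq> {..<m} \<and> card A = s")
    case True
    then show ?thesis unfolding c by (auto simp: hp_iff)
  next
    case False
    have "P x A = 0" for x by (subst c) (rule if_not_P[OF False])
    then show ?thesis by (simp add: hp.zero)
  qed
  then show "(\<forall>x. graded m s (P x)) \<and> (\<forall>A. hp m k (\<lambda>x. P x A))" by (auto simp: c graded_def)
next
  assume r: "(\<forall>x. graded m s (P x)) \<and> (\<forall>A. hp m k (\<lambda>x. P x A))"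
  then obtain c where c: "\<And>A. (\<lambda>x. P x A) = (\<lambda>x. \<Sum>\<alpha>\<in>multi_idx m k. c A \<alpha> * (\<Prod>i<m. of_real (x i) ^ \<alpha> i))"
    unfolding hp_iff by metis
  show "P \<in> hpoly m k s" unfolding hpoly_def
    using r fun_cong[OF c] by (auto intro!: exI[of _ "\<lambda>\<alpha> A. c A \<alpha>"] simp: fun_eq_iff graded_def)
qed

lemma hpolyI: "(\<And>x. graded m s (P x)) \<Longrightarrow> (\<And>A. hp m k (\<lambda>x. P x A)) \<Longrightarrow> P \<in> hpoly m k s"
  by (simp add: hpoly_iff)

lemma hpoly_graded: "P \<in> hpoly m k s \<Longrightarrow> graded m s (P x)"
  and hpoly_hp: "P \<in> hpoly m k s \<Longrightarrow> hp m k (\<lambda>x. P x A)"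
  by (simp_all add: hpoly_iff)

lemma hpoly_pdable: "P \<in> hpoly m k s \<Longrightarrow> pdable (\<lambda>x. P x A)"
  by (rule pdable_hp[OF hpoly_hp])

lemma hpoly_zero: "0 \<in> hpoly m k s"
  by (auto intro!: hpolyI simp: graded_def hp.zero)

lemma hpoly_add: "P \<in> hpoly m k s \<Longrightarrow> Q \<in> hpoly m k s \<Longrightarrow> P + Q \<in> hpoly m k s"
  by (auto simp: hpoly_iff graded_def intro: hp.add)

lemma hpoly_scale: "P \<in> hpoly m k s \<Longrightarrow> (\<lambda>x A. c * P x A) \<in> hpoly m k s"
  by (auto simp: hpoly_iff graded_def intro: hp_scale)

lemma pderiv_cl_pd: "pderiv_cl j P x A = pd j (\<lambda>x. P x A) x"
  by (simp add: pderiv_cl_def pd_def)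

lemma pderiv_cl_hpoly: "P \<in> hpoly m (Suc k) s \<Longrightarrow> pderiv_cl j P \<in> hpoly m k s"
proof (rule hpolyI)
  fix x assume P: "P \<in> hpoly m (Suc k) s"
  show "graded m s (pderiv_cl j P x)"
    using hpoly_graded[OF P] by (auto simp: graded_def pderiv_cl_pd pd_const)
next
  fix A assume P: "P \<in> hpoly m (Suc k) s"
  have "pd j (\<lambda>x. P x A) = (\<lambda>x. pderiv_cl j P x A)" by (simp add: pderiv_cl_pd)
  then show "hp m k (\<lambda>x. pderiv_cl j P x A)" using pd_hp_Suc[OF hpoly_hp[OF P]] by metis
qed

lemma pderiv_cl_hpoly_0: "P \<in> hpoly m 0 s \<Longrightarrow> pderiv_cl j P = 0"
  using fun_cong[OF pd_hp_0[OF hpoly_hp]] by (auto simp: fun_eq_iff pderiv_cl_pd)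

lemma pderiv_cl_hpoly_pred: "P \<in> hpoly m k s \<Longrightarrow> pderiv_cl j P \<in> hpoly m (k - 1) s"
  by (cases k) (auto simp: pderiv_cl_hpoly_0 hpoly_zero pderiv_cl_hpoly)

lemma pderiv_cl_add: "P \<in> hpoly m k s \<Longrightarrow> Q \<in> hpoly m l t \<Longrightarrow> pderiv_cl j (P + Q) = pderiv_cl j P + pderiv_cl j Q"
  by (auto simp: fun_eq_iff pderiv_cl_pd pd_add hpoly_pdable)

lemma pderiv_cl_scale: "P \<in> hpoly m k s \<Longrightarrow> pderiv_cl j (\<lambda>x A. c * P x A) = (\<lambda>x A. c * pderiv_cl j P x A)"
  by (auto simp: fun_eq_iff pderiv_cl_pd pd_scale hpoly_pdable)

lemma pderiv_cl_commute: "P \<in> hpoly m k s \<Longrightarrow> pderiv_cl i (pderiv_cl j P) = pderiv_cl j (pderiv_cl i P)"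
proof (intro ext)
  fix x A assume P: "P \<in> hpoly m k s"
  have e: "pd j (\<lambda>x. P x A) = (\<lambda>x. pderiv_cl j P x A)" for j by (simp add: pderiv_cl_pd)
  show "pderiv_cl i (pderiv_cl j P) x A = pderiv_cl j (pderiv_cl i P) x A"
    using pd_commute[OF hpoly_hp[OF P], of i j A x] unfolding e by (simp add: pderiv_cl_pd)
qed

lemma hpoly_euler: "P \<in> hpoly m k s \<Longrightarrow> (\<Sum>j<m. of_real (x j) * pderiv_cl j P x A) = of_nat k * P x A"
  using euler[OF hpoly_hp] by (auto simp: pderiv_cl_pd)

lemma hpoly_zero_if_pderiv_zero:
  assumes "P \<in> hpoly m (Suc k) s" "\<And>j. j < m \<Longrightarrow> pderiv_cl j P = 0"
  shows "P = 0"
proof (intro ext)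
  fix x A
  show "P x A = 0 x A" using hpoly_euler[OF assms(1), of x A] assms(2) by (simp del: of_nat_Suc)
qed

lemma eps_self: "eps j (eps j v) A = 0" and iot_self: "iot j (iot j v) A = 0"
  by (auto simp: eps_def iot_def)

lemma eps_evec: "eps j (evec m x v) A = - evec m x (eps j v) A"
  by (simp add: evec_def eps_fsum eps_scale sum_negf[symmetric] eps_eps[of j] cong: sum.cong)

lemma iot_ivec: "iot j (ivec m x v) A = - ivec m x (iot j v) A"
  by (simp add: ivec_def iot_fsum iot_scale sum_negf[symmetric] iot_iot[of j] cong: sum.cong)

lemma eps_ivec:
  assumes "j < m"
  shows "eps j (ivec m x v) A = - of_real (x j) * v A - ivec m x (eps j v) A"
proof -
  have e: "eps j (iot i v) A = (if j = i then - v A else 0) - iot i (eps j v) A" for i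
    using eps_iot[of j i v A] by (simp add: eq_diff_eq)
  have "eps j (ivec m x v) A = (\<Sum>i<m. (if i = j then - of_real (x j) * v A else 0) - of_real (x i) * iot i (eps j v) A)"
    unfolding ivec_def[of m x v] eps_fsum eps_scale by (rule sum.cong[OF refl], subst e) (auto simp: right_diff_distrib)
  then show ?thesis using assms by (simp add: sum_subtractf ivec_def)
qed

lemma iot_evec:
  assumes "j < m"
  shows "iot j (evec m x v) A = - of_real (x j) * v A - evec m x (iot j v) A"
proof -
  have e: "iot j (eps i v) A = (if i = j then - v A else 0) - eps i (iot j v) A" for i
    using eps_iot[of i j v A] by (simp add: eq_diff_eq add.commute)
  have "iot j (evec m x v) A = (\<Sum>i<m. (if i = j then - of_real (x j) * v A else 0) - of_real (x i) * eps i (iot j v) A)"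
    unfolding evec_def[of m x v] iot_fsum iot_scale by (rule sum.cong[OF refl], subst e) (auto simp: right_diff_distrib)
  then show ?thesis using assms by (simp add: sum_subtractf evec_def)
qed

lemma evec_fsum: "evec m x (\<lambda>A. \<Sum>i\<in>I. f i A) = (\<lambda>A. \<Sum>i\<in>I. evec m x (f i) A)"
  by (simp add: evec_def eps_fsum sum_distrib_left fun_eq_iff sum.swap[of _ I])

lemma ivec_fsum: "ivec m x (\<lambda>A. \<Sum>i\<in>I. f i A) = (\<lambda>A. \<Sum>i\<in>I. ivec m x (f i) A)"
  by (simp add: ivec_def iot_fsum sum_distrib_left fun_eq_iff sum.swap[of _ I])

text \<open>At the blade A each j in A contributes -1, by e_j^2 = -1, and the other j contribute 0.
  So this sum is minus the grade operator; it supplies the s in A, and its companion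
  \<open>sum_iot_eps\<close> supplies the m - s in B.\<close>

lemma sum_eps_iot:
  assumes "graded m s v"
  shows "(\<Sum>j<m. eps j (iot j v) A) = - of_nat s * v A"
proof (cases "A \<subseteq> {..<m} \<and> card A = s")
  case True
  have "eps j (iot j v) A = (if j \<in> A then - v A else 0)" for j
    by (auto simp: eps_def iot_def sg_remove insert_absorb)
  then have "(\<Sum>j<m. eps j (iot j v) A) = (\<Sum>j<m. if j \<in> A then - v A else 0)" by simp
  also have "\<dots> = (\<Sum>j\<in>{..<m} \<inter> A. - v A)" by (rule sum.inter_restrict[symmetric]) simp
  also have "{..<m} \<inter> A = A" using True by auto
  finally show ?thesis using True by simp
next
  case False
  then have "v A = 0" using assms by (auto simp: graded_def)
  then have "eps j (iot j v) A = 0" for j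
    by (auto simp: eps_def iot_def sg_remove insert_absorb)
  then show ?thesis using \<open>v A = 0\<close> by simp
qed

lemma sum_iot_eps:
  assumes "graded m s v"
  shows "(\<Sum>j<m. iot j (eps j v) A) = - (of_nat m - of_nat s) * v A"
proof -
  have "(\<Sum>j<m. iot j (eps j v) A) = (\<Sum>j<m. - v A - eps j (iot j v) A)"
    using eps_iot[of j j v A for j] by (intro sum.cong) (auto simp: eq_diff_eq add.commute)
  then show ?thesis by (simp add: sum_subtractf sum_eps_iot[OF assms] algebra_simps)
qed

section \<open>Differential operators and multiplication by the vector variable\<close>

text \<open>In the notation of the theorem, \<open>dd\<close>, \<open>de\<close>, \<open>xe\<close>, \<open>xi\<close> and \<open>xx\<close> are
  $\partial^+$, $\partial^-$, $(x \wedge)$, $(x \bullet)$ and multiplication by $x^2 = -|x|^2$.\<close>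

definition dd :: "nat \<Rightarrow> 'a::real_normed_field clfun \<Rightarrow> 'a clfun" where
  "dd m P = (\<lambda>x A. \<Sum>j<m. eps j (pderiv_cl j P x) A)"

definition de :: "nat \<Rightarrow> 'a::real_normed_field clfun \<Rightarrow> 'a clfun" where
  "de m P = (\<lambda>x A. \<Sum>j<m. iot j (pderiv_cl j P x) A)"

definition xe :: "nat \<Rightarrow> 'a::real_normed_field clfun \<Rightarrow> 'a clfun" where
  "xe m P = (\<lambda>x. evec m x (P x))"

definition xi :: "nat \<Rightarrow> 'a::real_normed_field clfun \<Rightarrow> 'a clfun" where
  "xi m P = (\<lambda>x. ivec m x (P x))"

definition xx :: "nat \<Rightarrow> 'a::real_normed_field clfun \<Rightarrow> 'a clfun" where
  "xx m P = (\<lambda>x A. - of_real (dotp m x x) * P x A)"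

lemma hp_eps: "(\<And>A. hp m k (\<lambda>x. P x A)) \<Longrightarrow> hp m k (\<lambda>x. eps j (P x) A)"
  by (cases "j \<in> A") (auto simp: eps_def hp.zero intro: hp_scale)

lemma hp_iot: "(\<And>A. hp m k (\<lambda>x. P x A)) \<Longrightarrow> hp m k (\<lambda>x. iot j (P x) A)"
  using hp_scale[of m k _ "- sg j A"] by (cases "j \<in> A") (auto simp: iot_def hp.zero)

lemma pd_eps: "(\<And>A. pdable (\<lambda>x. P x A)) \<Longrightarrow> pd i (\<lambda>x. eps j (P x) A) x = eps j (pderiv_cl i P x) A"
  by (auto simp: eps_def pd_const pd_scale pderiv_cl_pd)

lemma pd_iot: "(\<And>A. pdable (\<lambda>x. P x A)) \<Longrightarrow> pd i (\<lambda>x. iot j (P x) A) x = iot j (pderiv_cl i P x) A"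
  using pd_scale[of _ i "- sg j A" x] by (auto simp: iot_def pd_const pderiv_cl_pd)

lemma dd_hpoly: "P \<in> hpoly m (Suc k) s \<Longrightarrow> dd m P \<in> hpoly m k (Suc s)"
  unfolding dd_def
  by (intro hpolyI graded_sum graded_eps hp_sum hp_eps) (auto intro: hpoly_graded hpoly_hp dest: pderiv_cl_hpoly)

lemma de_hpoly: "P \<in> hpoly m (Suc k) (Suc s) \<Longrightarrow> de m P \<in> hpoly m k s"
  unfolding de_def
  by (intro hpolyI graded_sum graded_iot hp_sum hp_iot) (auto intro: hpoly_graded hpoly_hp dest: pderiv_cl_hpoly)

lemma de_hpoly_0: "P \<in> hpoly m k 0 \<Longrightarrow> de m P = 0"
  by (simp add: de_def fun_eq_iff iot_graded_0[OF hpoly_graded[OF pderiv_cl_hpoly_pred]])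

lemma dd_deg_0: "P \<in> hpoly m 0 s \<Longrightarrow> dd m P = 0"
  by (simp add: dd_def fun_eq_iff pderiv_cl_hpoly_0)

lemma de_deg_0: "P \<in> hpoly m 0 s \<Longrightarrow> de m P = 0"
  by (simp add: de_def fun_eq_iff pderiv_cl_hpoly_0)

lemma xe_hpoly: "P \<in> hpoly m k s \<Longrightarrow> xe m P \<in> hpoly m (Suc k) (Suc s)"
proof (rule hpolyI)
  fix x A
  assume P: "P \<in> hpoly m k s"
  show "graded m (Suc s) (xe m P x)" unfolding xe_def by (rule graded_evec[OF hpoly_graded[OF P]])
  show "hp m (Suc k) (\<lambda>x. xe m P x A)" unfolding xe_def evec_def by (intro hp_sum hp.mulx hp_eps hpoly_hp[OF P]) auto
qed

lemma xi_hpoly: "P \<in> hpoly m k (Suc s) \<Longrightarrow> xi m P \<in> hpoly m (Suc k) s"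
proof (rule hpolyI)
  fix x A
  assume P: "P \<in> hpoly m k (Suc s)"
  show "graded m s (xi m P x)" unfolding xi_def by (rule graded_ivec[OF hpoly_graded[OF P]])
  show "hp m (Suc k) (\<lambda>x. xi m P x A)" unfolding xi_def ivec_def by (intro hp_sum hp.mulx hp_iot hpoly_hp[OF P]) auto
qed

lemma xi_hpoly_0: "P \<in> hpoly m k 0 \<Longrightarrow> xi m P = 0"
  by (simp add: xi_def fun_eq_iff ivec_graded_0[OF hpoly_graded])

lemma hp_xx: "hp m k f \<Longrightarrow> hp m (Suc (Suc k)) (\<lambda>x. - of_real (dotp m x x) * f x)"
proof -
  assume f: "hp m k f"
  have "(\<lambda>x. - of_real (dotp m x x) * f x) = (\<lambda>x. - (\<Sum>j<m. of_real (x j) * (of_real (x j) * f x)))"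
    by (simp add: dotp_def sum_distrib_right mult.assoc)
  then show ?thesis using f by (auto intro!: hp_uminus hp_sum hp.mulx)
qed

lemma xx_hpoly: "P \<in> hpoly m k s \<Longrightarrow> xx m P \<in> hpoly m (Suc (Suc k)) s"
  unfolding xx_def
  by (intro hpolyI graded_scale hp_xx) (auto intro: hpoly_graded hpoly_hp)

lemma pderiv_cl_xe:
  assumes "P \<in> hpoly m k s" "j < m"
  shows "pderiv_cl j (xe m P) x = eps j (P x) + evec m x (pderiv_cl j P x)"
proof
  fix A
  have p: "pdable (\<lambda>x. eps i (P x) A)" for i by (rule pdable_hp[OF hp_eps[OF hpoly_hp[OF assms(1)]]])
  have "pderiv_cl j (xe m P) x A = (\<Sum>i<m. (if i = j then eps i (P x) A else 0) + of_real (x i) * eps i (pderiv_cl j P x) A)"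
    unfolding pderiv_cl_pd[of j "xe m P"] unfolding xe_def evec_def
    by (simp add: pd_sum pd_mulx pdable_mulx p pd_eps hpoly_pdable[OF assms(1)])
  then show "pderiv_cl j (xe m P) x A = (eps j (P x) + evec m x (pderiv_cl j P x)) A"
    using assms(2) by (simp add: sum.distrib evec_def)
qed

lemma pderiv_cl_xi:
  assumes "P \<in> hpoly m k s" "j < m"
  shows "pderiv_cl j (xi m P) x = iot j (P x) + ivec m x (pderiv_cl j P x)"
proof
  fix A
  have p: "pdable (\<lambda>x. iot i (P x) A)" for i by (rule pdable_hp[OF hp_iot[OF hpoly_hp[OF assms(1)]]])
  have "pderiv_cl j (xi m P) x A = (\<Sum>i<m. (if i = j then iot i (P x) A else 0) + of_real (x i) * iot i (pderiv_cl j P x) A)"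
    unfolding pderiv_cl_pd[of j "xi m P"] unfolding xi_def ivec_def
    by (simp add: pd_sum pd_mulx pdable_mulx p pd_iot hpoly_pdable[OF assms(1)])
  then show "pderiv_cl j (xi m P) x A = (iot j (P x) + ivec m x (pderiv_cl j P x)) A"
    using assms(2) by (simp add: sum.distrib ivec_def)
qed

lemma pderiv_cl_xx:
  assumes "P \<in> hpoly m k s" "j < m"
  shows "pderiv_cl j (xx m P) x A = - 2 * of_real (x j) * P x A - of_real (dotp m x x) * pderiv_cl j P x A"
proof -
  let ?f = "\<lambda>x. P x A"
  have p: "pdable ?f" by (rule hpoly_pdable[OF assms(1)])
  have "(\<lambda>x. xx m P x A) = (\<lambda>x. (-1) * (\<Sum>j<m. of_real (x j) * (of_real (x j) * ?f x)))"
    by (simp add: xx_def dotp_def sum_distrib_right mult.assoc)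
  then have "pderiv_cl j (xx m P) x A
     = - (\<Sum>i<m. (if i = j then of_real (x i) * ?f x else 0) + of_real (x i) * ((if i = j then ?f x else 0) + of_real (x i) * pd j ?f x))"
    by (simp only: pderiv_cl_pd pd_scale pdable_sum pd_sum pdable_mulx pd_mulx p) simp
  also have "\<dots> = - 2 * of_real (x j) * ?f x - of_real (dotp m x x) * pd j ?f x"
    using assms(2)
    by (simp add: dotp_def distrib_left sum.distrib if_distrib[of "\<lambda>u. _ * u"] sum_distrib_right mult.assoc cong: if_cong)
  finally show ?thesis by (simp add: pderiv_cl_pd)
qed

lemma dd_xe:
  assumes "P \<in> hpoly m k s"
  shows "dd m (xe m P) x A + xe m (dd m P) x A = 0"
proof -
  have "dd m (xe m P) x A = (\<Sum>j<m. eps j (eps j (P x)) A + eps j (evec m x (pderiv_cl j P x)) A)"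
    unfolding dd_def by (simp add: pderiv_cl_xe[OF assms] eps_add)
  also have "\<dots> = (\<Sum>j<m. - evec m x (eps j (pderiv_cl j P x)) A)"
    by (simp add: eps_evec eps_self)
  also have "\<dots> = - xe m (dd m P) x A" by (simp add: xe_def dd_def evec_fsum sum_negf)
  finally show ?thesis by simp
qed

lemma de_xi:
  assumes "P \<in> hpoly m k s"
  shows "de m (xi m P) x A + xi m (de m P) x A = 0"
proof -
  have "de m (xi m P) x A = (\<Sum>j<m. iot j (iot j (P x)) A + iot j (ivec m x (pderiv_cl j P x)) A)"
    unfolding de_def by (simp add: pderiv_cl_xi[OF assms] iot_add)
  also have "\<dots> = (\<Sum>j<m. - ivec m x (iot j (pderiv_cl j P x)) A)"
    by (simp add: iot_ivec iot_self)
  also have "\<dots> = - xi m (de m P) x A" by (simp add: xi_def de_def ivec_fsum sum_negf)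
  finally show ?thesis by simp
qed

text \<open>The derivative that falls on the factor x gives the grade s; moving e_j past (x dot)
  releases x_j times the j-th derivative, hence by Euler the degree k. This is the origin of A = s +
  k, and \<open>de_xe\<close> gives B in the same way.\<close>

lemma dd_xi:
  assumes "P \<in> hpoly m k s"
  shows "dd m (xi m P) x A + xi m (dd m P) x A = - (of_nat s + of_nat k) * P x A"
proof -
  have "dd m (xi m P) x A = (\<Sum>j<m. eps j (iot j (P x)) A + eps j (ivec m x (pderiv_cl j P x)) A)"
    unfolding dd_def by (simp add: pderiv_cl_xi[OF assms] eps_add)
  also have "\<dots> = (\<Sum>j<m. eps j (iot j (P x)) A - of_real (x j) * pderiv_cl j P x A - ivec m x (eps j (pderiv_cl j P x)) A)"
    by (intro sum.cong) (simp_all add: eps_ivec)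
  also have "\<dots> = - of_nat s * P x A - of_nat k * P x A - xi m (dd m P) x A"
    by (simp add: sum_subtractf sum_eps_iot[OF hpoly_graded[OF assms]] hpoly_euler[OF assms] xi_def dd_def ivec_fsum)
  finally show ?thesis by (simp only:) (simp add: algebra_simps)
qed

lemma de_xe:
  assumes "P \<in> hpoly m k s"
  shows "de m (xe m P) x A + xe m (de m P) x A = - (of_nat m - of_nat s + of_nat k) * P x A"
proof -
  have "de m (xe m P) x A = (\<Sum>j<m. iot j (eps j (P x)) A + iot j (evec m x (pderiv_cl j P x)) A)"
    unfolding de_def by (simp add: pderiv_cl_xe[OF assms] iot_add)
  also have "\<dots> = (\<Sum>j<m. iot j (eps j (P x)) A - of_real (x j) * pderiv_cl j P x A - evec m x (iot j (pderiv_cl j P x)) A)"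
    by (intro sum.cong) (simp_all add: iot_evec)
  also have "\<dots> = - (of_nat m - of_nat s) * P x A - of_nat k * P x A - xe m (de m P) x A"
    by (simp add: sum_subtractf sum_iot_eps[OF hpoly_graded[OF assms]] hpoly_euler[OF assms] xe_def de_def evec_fsum)
  finally show ?thesis by (simp only:) (simp add: algebra_simps)
qed

lemma dd_xx:
  assumes "P \<in> hpoly m k s"
  shows "dd m (xx m P) x A = xx m (dd m P) x A - 2 * xe m P x A"
proof -
  have e: "pderiv_cl j (xx m P) x = (\<lambda>A. (- 2 * of_real (x j)) * P x A) + (\<lambda>A. (- of_real (dotp m x x)) * pderiv_cl j P x A)"
    if "j < m" for j using pderiv_cl_xx[OF assms that] by (simp add: fun_eq_iff)
  have "dd m (xx m P) x A = (\<Sum>j<m. (- 2 * of_real (x j)) * eps j (P x) A + (- of_real (dotp m x x)) * eps j (pderiv_cl j P x) A)"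
    unfolding dd_def by (intro sum.cong) (simp_all only: e eps_add eps_scale plus_fun_apply lessThan_iff)
  also have "\<dots> = xx m (dd m P) x A - 2 * xe m P x A"
    by (simp add: sum.distrib sum_subtractf xx_def dd_def xe_def evec_def sum_distrib_left sum_negf mult.assoc)
  finally show ?thesis .
qed

lemma de_xx:
  assumes "P \<in> hpoly m k s"
  shows "de m (xx m P) x A = xx m (de m P) x A - 2 * xi m P x A"
proof -
  have e: "pderiv_cl j (xx m P) x = (\<lambda>A. (- 2 * of_real (x j)) * P x A) + (\<lambda>A. (- of_real (dotp m x x)) * pderiv_cl j P x A)"
    if "j < m" for j using pderiv_cl_xx[OF assms that] by (simp add: fun_eq_iff)
  have "de m (xx m P) x A = (\<Sum>j<m. (- 2 * of_real (x j)) * iot j (P x) A + (- of_real (dotp m x x)) * iot j (pderiv_cl j P x) A)"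
    unfolding de_def by (intro sum.cong) (simp_all only: e iot_add iot_scale plus_fun_apply lessThan_iff)
  also have "\<dots> = xx m (de m P) x A - 2 * xi m P x A"
    by (simp add: sum.distrib sum_subtractf xx_def de_def xi_def ivec_def sum_distrib_left sum_negf mult.assoc)
  finally show ?thesis .
qed

lemma dd_add: "P \<in> hpoly m k s \<Longrightarrow> Q \<in> hpoly m l t \<Longrightarrow> dd m (P + Q) = dd m P + dd m Q"
  by (simp add: dd_def pderiv_cl_add eps_add sum.distrib fun_eq_iff)

lemma de_add: "P \<in> hpoly m k s \<Longrightarrow> Q \<in> hpoly m l t \<Longrightarrow> de m (P + Q) = de m P + de m Q"
  by (simp add: de_def pderiv_cl_add iot_add sum.distrib fun_eq_iff)

lemma dd_scale: "P \<in> hpoly m k s \<Longrightarrow> dd m (\<lambda>x A. c * P x A) = (\<lambda>x A. c * dd m P x A)"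
  by (simp add: dd_def pderiv_cl_scale eps_scale sum_distrib_left)

lemma de_scale: "P \<in> hpoly m k s \<Longrightarrow> de m (\<lambda>x A. c * P x A) = (\<lambda>x A. c * de m P x A)"
  by (simp add: de_def pderiv_cl_scale iot_scale sum_distrib_left)

lemma dd_dd:
  assumes "P \<in> hpoly m k s"
  shows "dd m (dd m P) = 0"
proof (intro ext)
  fix x A
  have e: "pderiv_cl i (dd m P) x = (\<lambda>A. \<Sum>j<m. eps j (pderiv_cl i (pderiv_cl j P) x) A)" for i
  proof
    fix A
    have p: "pdable (\<lambda>x. eps j (pderiv_cl j P x) A)" for j
      by (rule pdable_hp[OF hp_eps[OF hpoly_hp[OF pderiv_cl_hpoly_pred[OF assms]]]])
    show "pderiv_cl i (dd m P) x A = (\<Sum>j<m. eps j (pderiv_cl i (pderiv_cl j P) x) A)"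
      unfolding dd_def pderiv_cl_pd[of i "\<lambda>x A. \<Sum>j<m. eps j (pderiv_cl j P x) A"]
      by (simp add: pd_sum p pd_eps hpoly_pdable[OF pderiv_cl_hpoly_pred[OF assms]])
  qed
  let ?t = "\<lambda>i j. eps i (eps j (pderiv_cl i (pderiv_cl j P) x)) A"
  have 1: "dd m (dd m P) x A = (\<Sum>i<m. \<Sum>j<m. ?t i j)"
    unfolding dd_def[of m "dd m P"] e by (simp add: eps_fsum)
  also have "\<dots> = (\<Sum>i<m. \<Sum>j<m. - ?t j i)"
    by (rule sum.cong[OF refl], rule sum.cong[OF refl], subst eps_eps) (simp add: pderiv_cl_commute[OF assms])
  also have "\<dots> = - (\<Sum>i<m. \<Sum>j<m. ?t i j)" by (subst sum.swap) (simp add: sum_negf)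
  finally show "dd m (dd m P) x A = 0 x A" using 1 by (simp add: eq_neg_iff_add_eq_0 flip: mult_2)
qed

lemma de_de:
  assumes "P \<in> hpoly m k s"
  shows "de m (de m P) = 0"
proof (intro ext)
  fix x A
  have e: "pderiv_cl i (de m P) x = (\<lambda>A. \<Sum>j<m. iot j (pderiv_cl i (pderiv_cl j P) x) A)" for i
  proof
    fix A
    have p: "pdable (\<lambda>x. iot j (pderiv_cl j P x) A)" for j
      by (rule pdable_hp[OF hp_iot[OF hpoly_hp[OF pderiv_cl_hpoly_pred[OF assms]]]])
    show "pderiv_cl i (de m P) x A = (\<Sum>j<m. iot j (pderiv_cl i (pderiv_cl j P) x) A)"
      unfolding de_def pderiv_cl_pd[of i "\<lambda>x A. \<Sum>j<m. iot j (pderiv_cl j P x) A"]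
      by (simp add: pd_sum p pd_iot hpoly_pdable[OF pderiv_cl_hpoly_pred[OF assms]])
  qed
  let ?t = "\<lambda>i j. iot i (iot j (pderiv_cl i (pderiv_cl j P) x)) A"
  have 1: "de m (de m P) x A = (\<Sum>i<m. \<Sum>j<m. ?t i j)"
    unfolding de_def[of m "de m P"] e by (simp add: iot_fsum)
  also have "\<dots> = (\<Sum>i<m. \<Sum>j<m. - ?t j i)"
    by (rule sum.cong[OF refl], rule sum.cong[OF refl], subst iot_iot) (simp add: pderiv_cl_commute[OF assms])
  also have "\<dots> = - (\<Sum>i<m. \<Sum>j<m. ?t i j)" by (subst sum.swap) (simp add: sum_negf)
  finally show "de m (de m P) x A = 0 x A" using 1 by (simp add: eq_neg_iff_add_eq_0 flip: mult_2)
qed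

lemma xe_xi: "xe m (xi m P) x A + xi m (xe m P) x A = xx m P x A"
  by (simp add: xe_def xi_def xx_def evec_ivec)

lemma xe_xe: "xe m (xe m P) = 0" and xi_xi: "xi m (xi m P) = 0"
  by (auto simp: xe_def xi_def evec_self ivec_self fun_eq_iff)

lemma xe_xx: "xe m (xx m P) = xx m (xe m P)" and xi_xx: "xi m (xx m P) = xx m (xi m P)"
  by (auto simp: xe_def xi_def xx_def evec_scale[of m _ "- of_real _", simplified]
    ivec_scale[of m _ "- of_real _", simplified] fun_eq_iff)

lemma xe_add: "xe m (P + Q) = xe m P + xe m Q" and xi_add: "xi m (P + Q) = xi m P + xi m Q"
  and xx_add: "xx m (P + Q) = xx m P + xx m Q"
  by (auto simp: xe_def xi_def xx_def evec_add ivec_add fun_eq_iff algebra_simps)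

lemma xe_scale: "xe m (\<lambda>x A. c * P x A) = (\<lambda>x A. c * xe m P x A)"
  and xi_scale: "xi m (\<lambda>x A. c * P x A) = (\<lambda>x A. c * xi m P x A)"
  and xx_scale: "xx m (\<lambda>x A. c * P x A) = (\<lambda>x A. c * xx m P x A)"
  by (auto simp: xe_def xi_def xx_def evec_scale ivec_scale fun_eq_iff algebra_simps)

lemma hp_cong: "hp m k f \<Longrightarrow> (\<And>i. i < m \<Longrightarrow> x i = y i) \<Longrightarrow> f x = f y"
  by (induction rule: hp.induct) auto

lemma hp_homogeneous: "hp m k f \<Longrightarrow> (\<And>i. i < m \<Longrightarrow> y i = t * x i) \<Longrightarrow> f y = of_real t ^ k * f x"
  by (induction rule: hp.induct) (auto simp: algebra_simps)

lemma dotp_self_eq_0: "dotp m x x = 0 \<Longrightarrow> i < m \<Longrightarrow> x i = 0"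
  unfolding dotp_def by (subst (asm) sum_nonneg_eq_0_iff) auto

lemma xx_eq_0:
  assumes "0 < m" "xx m P = 0" "P \<in> hpoly m k s"
  shows "P = 0"
proof (intro ext)
  have nz: "P x A = 0" if "dotp m x x \<noteq> 0" for x A
    using fun_cong[OF fun_cong[OF assms(2), of x], of A] that by (simp add: xx_def)
  fix x A
  show "P x A = 0 x A"
  proof (cases "dotp m x x = 0")
    case True
    define u where "u = (\<lambda>i. if i = (0::nat) then 1 else 0 :: real)"
    have "dotp m u u = (\<Sum>j<m. if j = 0 then 1 else 0)" unfolding dotp_def u_def by (intro sum.cong) auto
    then have u: "dotp m u u \<noteq> 0" using assms(1) by simp
    \<comment> \<open>The zero vector is 0 times the unit vector u. In degree k = 0 the factor is
      0^0 = 1, as it must be for a constant.\<close>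
    have "P x A = of_real 0 ^ k * P u A"
      by (rule hp_homogeneous[OF hpoly_hp[OF assms(3)]]) (simp add: dotp_self_eq_0[OF True])
    then show ?thesis using nz[OF u] by simp
  qed (simp add: nz)
qed

text \<open>Closure under linear substitution and the chain rule go through one induction, because
  the product rule for x_l * f uses both for f. It serves the reflections as well as the restriction
  to a hyperplane.\<close>

lemma hp_linear_subst:
  assumes "hp m k f" and g: "\<And>x i. i < m \<Longrightarrow> g x i = (\<Sum>j<m. a i j * x j)"
  shows "hp m k (\<lambda>x. f (g x))" "j < m \<Longrightarrow> pd j (\<lambda>x. f (g x)) x = (\<Sum>i<m. of_real (a i j) * pd i f (g x))"
proof -
  have "hp m k (\<lambda>x. f (g x)) \<and> (\<forall>j<m. \<forall>x. pd j (\<lambda>x. f (g x)) x = (\<Sum>i<m. of_real (a i j) * pd i f (g x)))"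
    using assms(1)
  proof (induction rule: hp.induct)
    case (const c)
    then show ?case by (simp add: hp.const pd_const)
  next
    case (zero k)
    then show ?case by (simp add: hp.zero pd_const)
  next
    case (add k f h)
    then show ?case by (auto simp: hp.add pd_add pdable_hp sum.distrib distrib_left)
  next
    case (mulx k f l)
    have e: "(\<lambda>x. of_real (g x l) * f (g x)) = (\<lambda>x. \<Sum>i<m. of_real (a l i) * (of_real (x i) * f (g x)))"
      using g[OF mulx.hyps(2)] by (simp add: sum_distrib_right mult.assoc)
    have p: "pdable (\<lambda>x. f (g x))" "pdable f" using mulx pdable_hp by blast+
    have "pd j (\<lambda>x. of_real (g x l) * f (g x)) x = (\<Sum>i<m. of_real (a i j) * pd i (\<lambda>x. of_real (x l) * f x) (g x))"
      if "j < m" for j x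
    proof -
      have "pd j (\<lambda>x. of_real (g x l) * f (g x)) x
          = (\<Sum>i<m. of_real (a l i) * ((if i = j then f (g x) else 0) + of_real (x i) * pd j (\<lambda>x. f (g x)) x))"
        unfolding e by (simp add: pd_sum pd_scale pd_mulx pdable_mulx pdable_scale p)
      also have "\<dots> = of_real (a l j) * f (g x) + (\<Sum>i<m. of_real (a l i) * of_real (x i)) * pd j (\<lambda>x. f (g x)) x"
        using that by (simp add: distrib_left sum.distrib if_distrib[of "\<lambda>u. _ * u"] sum_distrib_right mult.assoc cong: if_cong)
      also have "(\<Sum>i<m. of_real (a l i) * of_real (x i)) = (of_real (g x l) :: 'a)"
        using g[OF mulx.hyps(2)] by simp
      finally have 1: "pd j (\<lambda>x. of_real (g x l) * f (g x)) x = of_real (a l j) * f (g x) + of_real (g x l) * pd j (\<lambda>x. f (g x)) x" .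
      have "(\<Sum>i<m. of_real (a i j) * pd i (\<lambda>x. of_real (x l) * f x) (g x))
         = (\<Sum>i<m. (if i = l then of_real (a i j) * f (g x) else 0) + of_real (g x l) * (of_real (a i j) * pd i f (g x)))"
        by (rule sum.cong[OF refl], simp only: pd_mulx p) (auto simp: algebra_simps)
      also have "\<dots> = of_real (a l j) * f (g x) + of_real (g x l) * pd j (\<lambda>x. f (g x)) x"
        using that mulx by (simp add: sum.distrib flip: sum_distrib_left)
      finally show ?thesis using 1 by simp
    qed
    moreover have "hp m (Suc k) (\<lambda>x. of_real (g x l) * f (g x))"
      unfolding e using mulx by (auto intro!: hp_sum hp_scale hp.mulx)
    ultimately show ?case by simp
  qed
  then show "hp m k (\<lambda>x. f (g x))" "j < m \<Longrightarrow> pd j (\<lambda>x. f (g x)) x = (\<Sum>i<m. of_real (a i j) * pd i f (g x))" by auto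
qed

section \<open>Decomposition of the kernels\<close>

text \<open>The part of \<open>mf_decomp\<close> that concerns addition only, so that it can be
  transported along additive maps between different spaces.\<close>

definition dsum :: "'v::comm_monoid_add set \<Rightarrow> 'i set \<Rightarrow> ('i \<Rightarrow> 'v set) \<Rightarrow> bool" where
  "dsum V I W \<longleftrightarrow> V = {\<Sum>i\<in>I. f i | f. \<forall>i\<in>I. f i \<in> W i} \<and>
     (\<forall>f. (\<forall>i\<in>I. f i \<in> W i) \<and> (\<Sum>i\<in>I. f i) = 0 \<longrightarrow> (\<forall>i\<in>I. f i = 0))"

text \<open>Lifting a direct sum along D. Each component of D P is the image of an element of the
  matching summand, and P minus the sum of these lies in the kernel of D, which is the one
  additional summand. For uniqueness, D turns a vanishing sum into one in K'; injectivity on the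
  summands kills all terms but the kernel one, which then vanishes too.\<close>

lemma dsum_lift:
  fixes D :: "'v::ab_group_add \<Rightarrow> 'w::ab_group_add"
  assumes K: "\<And>P Q. P \<in> K \<Longrightarrow> Q \<in> K \<Longrightarrow> P - Q \<in> K" "0 \<in> K"
    and D: "\<And>P Q. P \<in> K \<Longrightarrow> Q \<in> K \<Longrightarrow> D (P - Q) = D P - D Q"
    and K': "dsum K' J W'" and DK: "\<And>P. P \<in> K \<Longrightarrow> D P \<in> K'"
    and I: "finite I'" "o' \<notin> I'" "bij_betw \<tau> I' J"
    and W: "\<And>i. i \<in> I' \<Longrightarrow> W i \<subseteq> K"
    and into: "\<And>i P. i \<in> I' \<Longrightarrow> P \<in> W i \<Longrightarrow> D P \<in> W' (\<tau> i)"
    and onto: "\<And>i Q. i \<in> I' \<Longrightarrow> Q \<in> W' (\<tau> i) \<Longrightarrow> \<exists>P\<in>W i. D P = Q"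
    and inj: "\<And>i P. i \<in> I' \<Longrightarrow> P \<in> W i \<Longrightarrow> D P = 0 \<Longrightarrow> P = 0"
    and o: "W o' = {P \<in> K. D P = 0}"
  shows "dsum K (insert o' I') W"
proof -
  have D0: "D 0 = 0" using D[OF K(2) K(2)] by simp
  have neg: "- P \<in> K" if "P \<in> K" for P using K(1)[OF K(2) that] by simp
  have Kadd: "P + Q \<in> K" if "P \<in> K" "Q \<in> K" for P Q using K(1)[OF that(1) neg[OF that(2)]] by simp
  have Dadd: "D (P + Q) = D P + D Q" if "P \<in> K" "Q \<in> K" for P Q
    using D[OF that(1) neg[OF that(2)]] D[OF K(2) that(2)] D0 by simp
  note K'1 = conjunct1[OF K'[unfolded dsum_def]] and K'2 = conjunct2[OF K'[unfolded dsum_def]]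
  have WoK: "W o' \<subseteq> K" unfolding o by blast
  have Ksum: "(\<Sum>i\<in>I0. f i) \<in> K \<and> D (\<Sum>i\<in>I0. f i) = (\<Sum>i\<in>I0. D (f i))" if "\<And>i. i \<in> I0 \<Longrightarrow> f i \<in> K" for f and I0 :: "'c set"
    using that by (induction I0 rule: infinite_finite_induct) (auto simp: D0 K Kadd Dadd)
  show ?thesis unfolding dsum_def
  proof (intro conjI allI impI ballI equalityI subsetI)
    fix P assume P: "P \<in> K"
    obtain g where g: "D P = (\<Sum>j\<in>J. g j)" "\<forall>j\<in>J. g j \<in> W' j"
      using DK[OF P] K'1 by auto
    have "\<exists>Q. Q \<in> W i \<and> D Q = g (\<tau> i)" if "i \<in> I'" for i
      using onto[OF that] g(2) bij_betw_apply[OF I(3) that] by blast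
    then obtain f where f: "\<And>i. i \<in> I' \<Longrightarrow> f i \<in> W i \<and> D (f i) = g (\<tau> i)" by metis
    have fK: "f i \<in> K" if "i \<in> I'" for i using f[OF that] W[OF that] by auto
    have s: "(\<Sum>i\<in>I'. f i) \<in> K" "D (\<Sum>i\<in>I'. f i) = (\<Sum>i\<in>I'. D (f i))" using Ksum[of I' f] fK by blast+
    have "(\<Sum>i\<in>I'. D (f i)) = (\<Sum>i\<in>I'. g (\<tau> i))" using f by simp
    also have "\<dots> = D P" unfolding g(1) by (rule sum.reindex_bij_betw[OF I(3)])
    finally have "P - (\<Sum>i\<in>I'. f i) \<in> W o'" unfolding o
      using K(1)[OF P s(1)] D[OF P s(1)] s(2) by simp
    moreover have "P = (\<Sum>i\<in>insert o' I'. (f(o' := P - (\<Sum>i\<in>I'. f i))) i)"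
    proof -
      have "(\<Sum>i\<in>I'. (f(o' := P - (\<Sum>i\<in>I'. f i))) i) = (\<Sum>i\<in>I'. f i)"
        using I(2) by (intro sum.cong) auto
      then show ?thesis using I by simp
    qed
    ultimately show "P \<in> {\<Sum>i\<in>insert o' I'. f i |f. \<forall>i\<in>insert o' I'. f i \<in> W i}"
      using f I(2) by (intro CollectI exI[of _ "f(o' := P - (\<Sum>i\<in>I'. f i))"]) simp
  next
    fix P assume "P \<in> {\<Sum>i\<in>insert o' I'. f i |f. \<forall>i\<in>insert o' I'. f i \<in> W i}"
    then obtain f where f: "P = (\<Sum>i\<in>insert o' I'. f i)" "\<forall>i\<in>insert o' I'. f i \<in> W i" by blast
    then have "f i \<in> K" if "i \<in> insert o' I'" for i using that W WoK by blast
    then show "P \<in> K" using f(1) Ksum[of "insert o' I'" f] by blast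
  next
    fix f i assume f: "(\<forall>i\<in>insert o' I'. f i \<in> W i) \<and> (\<Sum>i\<in>insert o' I'. f i) = 0" and i: "i \<in> insert o' I'"
    have fK: "f i \<in> K" if "i \<in> insert o' I'" for i using that W WoK f by blast
    have "D (\<Sum>i\<in>insert o' I'. f i) = (\<Sum>i\<in>insert o' I'. D (f i))" using Ksum[of "insert o' I'" f] fK by blast
    then have "(\<Sum>i\<in>insert o' I'. D (f i)) = 0" using conjunct2[OF f] D0 by (simp only:)
    moreover have "f o' \<in> W o'" using f by blast
    then have "D (f o') = 0" unfolding o by blast
    ultimately have z: "(\<Sum>i\<in>I'. D (f i)) = 0" using I by simp
    define h where "h = (\<lambda>j. D (f (inv_into I' \<tau> j)))"
    have hj: "h (\<tau> i) = D (f i)" if "i \<in> I'" for i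
      using that I(3) by (simp add: h_def bij_betw_def)
    have "(\<Sum>j\<in>J. h j) = (\<Sum>i\<in>I'. h (\<tau> i))" by (rule sum.reindex_bij_betw[OF I(3), symmetric])
    then have 1: "(\<Sum>j\<in>J. h j) = 0" using z hj by simp
    have 2: "h j \<in> W' j" if j: "j \<in> J" for j
    proof -
      obtain i where i: "i \<in> I'" "j = \<tau> i" using j bij_betw_imp_surj_on[OF I(3)] by blast
      have "f i \<in> W i" using conjunct1[OF f] i(1) by simp
      then show ?thesis unfolding i(2) hj[OF i(1)] by (rule into[OF i(1)])
    qed
    have "\<forall>j\<in>J. h j = 0" by (rule mp[OF spec[OF K'2]]) (use 1 2 in simp)
    then have "h j = 0" if "j \<in> J" for j using that by blast
    then have z': "f i = 0" if "i \<in> I'" for i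
      using inj[OF that] hj[OF that] bij_betw_apply[OF I(3) that] f that by force
    have "(\<Sum>i\<in>I'. f i) = 0" by (rule sum.neutral) (use z' in blast)
    then have "f o' = 0" using conjunct2[OF f] I by simp
    then show "f i = 0" using z'[of i] i by (cases "i = o'") auto
  qed
qed

section \<open>The abstract relations and the induction on the degree\<close>

definition scl :: "'a \<Rightarrow> 'a::real_normed_field clfun \<Rightarrow> 'a clfun" where
  "scl c P = (\<lambda>x A. c * P x A)"

lemma scl_apply [simp]: "scl c P x A = c * P x A" by (simp add: scl_def)

lemma scl_simps: "scl c (P + Q) = scl c P + scl c Q" "scl (c + d) P = scl c P + scl d P"
  "scl c (scl d P) = scl (c * d) P" "scl c 0 = 0" "scl 0 P = 0" "scl 1 P = P" "scl c (- P) = - scl c P" "scl (- c) P = - scl c P"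
  by (auto simp: fun_eq_iff algebra_simps)

lemma scl_eq_0: "scl c P = 0 \<longleftrightarrow> c = 0 \<or> P = 0"
  by (auto simp: fun_eq_iff)

text \<open>The effect of \<open>dl\<close> on the labels: up to constants e h goes to h,
  \<open>(R ^^ Suc j) (e h)\<close> goes to the dual y-summand j, and the y-summand j goes to
  \<open>(R ^^ j) (io h)\<close>.\<close>

definition idx_shift :: "nat \<times> nat \<Rightarrow> nat \<times> nat" where
  "idx_shift = (\<lambda>(i, j). if i = 2 then (1, j) else if j = 0 then (0, 0) else (2, j - 1))"

lemma finite_idx: "finite (idx k)"
proof (rule finite_subset)
  show "idx k \<subseteq> {..2} \<times> {..k}" by (auto simp: idx_def)
qed auto

lemma idx_0: "idx 0 = {(0, 0)}"
  by (auto simp: idx_def)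

lemma idx_insert: "idx k = insert (0, 0) (idx k - {(0, 0)})"
  by (auto simp: idx_def)

lemma bij_idx_shift: "bij_betw idx_shift (idx (Suc k) - {(0, 0)}) (idx k)"
proof (rule bij_betw_byWitness[where f' = "\<lambda>(i, j). if i = 0 then (1, 0) else if i = 1 then (2, j) else (1, Suc j)"])
  show "idx_shift ` (idx (Suc k) - {(0, 0)}) \<subseteq> idx k"
  proof
    fix t assume "t \<in> idx_shift ` (idx (Suc k) - {(0, 0)})"
    then obtain i j where "t = idx_shift (i, j)" "i = 1 \<and> 2 * j \<le> k \<or> i = 2 \<and> 2 * j + 1 \<le> k"
      by (auto simp: idx_def)
    then show "t \<in> idx k" by (cases j) (auto simp: idx_def idx_shift_def)
  qed
  show "(\<lambda>(i, j). if i = 0 then (1, 0) else if i = 1 then (2, j) else (1, Suc j)) ` idx k \<subseteq> idx (Suc k) - {(0, 0)}"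
    by (auto simp: idx_def)
qed (auto simp: idx_def idx_shift_def)

text \<open>The grade is an integer so that $s \mapsto n - s$ is an involution: it exchanges $\partial^+$ with
  $\partial^-$ and $(x \wedge)$ with $(x \bullet)$, and yields the statements about $\partial^-$ from those about
  $\partial^+$.\<close>

locale hodge =
  fixes V :: "nat \<Rightarrow> int \<Rightarrow> 'a::real_normed_field clfun set" and n :: int
    and d dl e io R :: "'a clfun \<Rightarrow> 'a clfun"
  assumes V_zero: "0 \<in> V k s"
    and V_add: "P \<in> V k s \<Longrightarrow> Q \<in> V k s \<Longrightarrow> P + Q \<in> V k s"
    and V_scl: "P \<in> V k s \<Longrightarrow> scl c P \<in> V k s"
    and V_range: "P \<in> V k s \<Longrightarrow> s < 0 \<or> n < s \<Longrightarrow> P = 0"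
    and d_V: "P \<in> V (Suc k) s \<Longrightarrow> d P \<in> V k (s + 1)"
    and dl_V: "P \<in> V (Suc k) s \<Longrightarrow> dl P \<in> V k (s - 1)"
    and d_0: "P \<in> V 0 s \<Longrightarrow> d P = 0" and dl_0: "P \<in> V 0 s \<Longrightarrow> dl P = 0"
    and e_V: "P \<in> V k s \<Longrightarrow> e P \<in> V (Suc k) (s + 1)"
    and io_V: "P \<in> V k s \<Longrightarrow> io P \<in> V (Suc k) (s - 1)"
    and R_V: "P \<in> V k s \<Longrightarrow> R P \<in> V (Suc (Suc k)) s"
    and d_add: "P \<in> V k s \<Longrightarrow> Q \<in> V k s \<Longrightarrow> d (P + Q) = d P + d Q"
    and dl_add: "P \<in> V k s \<Longrightarrow> Q \<in> V k s \<Longrightarrow> dl (P + Q) = dl P + dl Q"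
    and d_scl: "P \<in> V k s \<Longrightarrow> d (scl c P) = scl c (d P)"
    and dl_scl: "P \<in> V k s \<Longrightarrow> dl (scl c P) = scl c (dl P)"
    and e_add: "e (P + Q) = e P + e Q" and io_add: "io (P + Q) = io P + io Q" and R_add: "R (P + Q) = R P + R Q"
    and e_scl: "e (scl c P) = scl c (e P)" and io_scl: "io (scl c P) = scl c (io P)" and R_scl: "R (scl c P) = scl c (R P)"
    and d_d: "P \<in> V k s \<Longrightarrow> d (d P) = 0" and dl_dl: "P \<in> V k s \<Longrightarrow> dl (dl P) = 0"
    and e_e: "e (e P) = 0" and io_io: "io (io P) = 0"
    and e_io: "e (io P) + io (e P) = R P"
    and e_R: "e (R P) = R (e P)" and io_R: "io (R P) = R (io P)"
    and R_inj: "P \<in> V k s \<Longrightarrow> R P = 0 \<Longrightarrow> P = 0"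
    and d_e: "P \<in> V k s \<Longrightarrow> d (e P) + e (d P) = 0"
    and dl_io: "P \<in> V k s \<Longrightarrow> dl (io P) + io (dl P) = 0"
    and d_io: "P \<in> V k s \<Longrightarrow> d (io P) + io (d P) = scl (- of_int (s + int k)) P"
    and dl_e: "P \<in> V k s \<Longrightarrow> dl (e P) + e (dl P) = scl (- of_int (n - s + int k)) P"
    and d_R: "P \<in> V k s \<Longrightarrow> d (R P) = R (d P) + scl (-2) (e P)"
    and dl_R: "P \<in> V k s \<Longrightarrow> dl (R P) = R (dl P) + scl (-2) (io P)"

declare plus_fun_apply [simp del] zero_fun_apply [simp del] scl_apply [simp del]

lemmas pointwise = fun_eq_iff plus_fun_apply zero_fun_apply scl_apply

text \<open>Only two relations have a right-hand side depending on the grade, the anticommutators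
  with constants s + k and n - s + k, and the involution exchanges these.\<close>

lemma (in hodge) dual: "hodge (\<lambda>k s. V k (n - s)) n dl d io e R"
proof -
  have e: "n - (s + 1) = (n - s) - 1" "n - (s - 1) = (n - s) + 1" "n - (n - s) = s" "n - s < 0 \<longleftrightarrow> n < s" "n < n - s \<longleftrightarrow> s < 0" for s
    by auto
  have e_io': "io (e P) + e (io P) = R P" for P using e_io[of P] by (simp only: add.commute)
  have r: "P \<in> V k (n - s) \<Longrightarrow> s < 0 \<or> n < s \<Longrightarrow> P = 0" for P k s using V_range[of P k "n - s"] by auto
  have dl_e': "dl (e P) + e (dl P) = scl (- of_int (s + int k)) P" if "P \<in> V k (n - s)" for P k s
    using dl_e[OF that] by simp
  show ?thesis
    by (rule hodge.intro; (unfold e)?; (rule V_zero V_add V_scl r d_V dl_V d_0 dl_0 e_V io_V R_V d_add dl_add d_scl dl_scl e_add io_add R_add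
      e_scl io_scl R_scl d_d dl_dl e_e io_io e_io' e_R io_R R_inj d_e dl_io d_io dl_e' d_R dl_R; assumption))
qed

context hodge
begin

definition harm_V where "harm_V k s = {P \<in> V k s. d P = 0 \<and> dl P = 0}"

text \<open>The operator y of the theorem with its odd power of x resolved: x = e + io applied to a
  (io h) + b (e h) leaves a e (io h) + b io (e h), because e and io square to zero, and the
  remaining x^(2j) is \<open>R ^^ j\<close>.\<close>

definition yd where
  "yd j k s P = (R ^^ j) (scl (of_int (s + int k + 2 * int j + 2)) (e (io P)) + scl (of_int (s + int k)) (io (e P)))"

definition summand where
  "summand k s = (\<lambda>(i, j). if i = 0 then harm_V k s
     else if i = (1::nat) then (\<lambda>P. (R ^^ j) (e P)) ` harm_V (k - 2 * j - 1) (s - 1)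
     else yd j (k - 2 * j - 2) s ` harm_V (k - 2 * j - 2) s)"

definition yd' where
  "yd' j k s P = (R ^^ j) (scl (of_int (n - s + int k + 2 * int j + 2)) (io (e P)) + scl (of_int (n - s + int k)) (e (io P)))"

definition summand' where
  "summand' k s = (\<lambda>(i, j). if i = 0 then harm_V k s
     else if i = (1::nat) then (\<lambda>P. (R ^^ j) (io P)) ` harm_V (k - 2 * j - 1) (s + 1)
     else yd' j (k - 2 * j - 2) s ` harm_V (k - 2 * j - 2) s)"

lemma lin_0 [simp]: "e 0 = 0" "io 0 = 0" "R 0 = 0" "d 0 = 0" "dl 0 = 0"
  using e_scl[of 0 0] io_scl[of 0 0] R_scl[of 0 0] d_scl[OF V_zero, of 0] dl_scl[OF V_zero, of 0]
  by (auto simp: scl_simps)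

lemma Rj_V: "P \<in> V k s \<Longrightarrow> (R ^^ j) P \<in> V (k + 2 * j) s"
  by (induction j) (auto intro: R_V)

lemma Rj_add: "(R ^^ j) (P + Q) = (R ^^ j) P + (R ^^ j) Q"
  by (induction j) (simp_all add: R_add)

lemma Rj_scl: "(R ^^ j) (scl c P) = scl c ((R ^^ j) P)"
  by (induction j) (simp_all only: funpow.simps o_apply id_apply R_scl)

lemma Rj_0 [simp]: "(R ^^ j) 0 = 0"
  by (induction j) simp_all

lemma e_Rj: "e ((R ^^ j) P) = (R ^^ j) (e P)" and io_Rj: "io ((R ^^ j) P) = (R ^^ j) (io P)"
  by (induction j) (simp_all add: e_R io_R)

lemma Rj_inj: "P \<in> V k s \<Longrightarrow> (R ^^ j) P = 0 \<Longrightarrow> P = 0"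
proof (induction j)
  case (Suc j)
  then show ?case using R_inj[OF Rj_V[OF Suc.prems(1)], of j] by simp
qed simp

text \<open>Each of the j factors R contributes -2 e, since the gradient of x^2 is -2x. At j = 0 the
  truncated exponent j - 1 is multiplied by 0.\<close>

lemma d_Rj:
  assumes "P \<in> V k s"
  shows "d ((R ^^ j) P) = (R ^^ j) (d P) + scl (-2 * of_nat j) ((R ^^ (j - 1)) (e P))"
proof (induction j)
  case (Suc j)
  have "d ((R ^^ Suc j) P) = R (d ((R ^^ j) P)) + scl (-2) ((R ^^ j) (e P))"
    using d_R[OF Rj_V[OF assms]] by (simp add: e_Rj)
  also have "\<dots> = (R ^^ Suc j) (d P) + scl (-2 * of_nat j) (R ((R ^^ (j - 1)) (e P))) + scl (-2) ((R ^^ j) (e P))"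
    unfolding Suc by (simp add: R_add R_scl)
  also have "scl (-2 * of_nat j) (R ((R ^^ (j - 1)) (e P))) = scl (-2 * of_nat j) ((R ^^ j) (e P))"
    by (cases j) (auto simp: scl_simps)
  finally show ?case by (simp add: pointwise algebra_simps)
qed (auto simp: scl_simps)

lemma dl_Rj:
  assumes "P \<in> V k s"
  shows "dl ((R ^^ j) P) = (R ^^ j) (dl P) + scl (-2 * of_nat j) ((R ^^ (j - 1)) (io P))"
proof (induction j)
  case (Suc j)
  have "dl ((R ^^ Suc j) P) = R (dl ((R ^^ j) P)) + scl (-2) ((R ^^ j) (io P))"
    using dl_R[OF Rj_V[OF assms]] by (simp add: io_Rj)
  also have "\<dots> = (R ^^ Suc j) (dl P) + scl (-2 * of_nat j) (R ((R ^^ (j - 1)) (io P))) + scl (-2) ((R ^^ j) (io P))"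
    unfolding Suc by (simp add: R_add R_scl)
  also have "scl (-2 * of_nat j) (R ((R ^^ (j - 1)) (io P))) = scl (-2 * of_nat j) ((R ^^ j) (io P))"
    by (cases j) (auto simp: scl_simps)
  finally show ?case by (simp add: pointwise algebra_simps)
qed (auto simp: scl_simps)

context
  fixes l s h
  assumes h: "h \<in> harm_V l s"
begin

lemma h_V: "h \<in> V l s" and d_h: "d h = 0" and dl_h: "dl h = 0"
  using h by (auto simp: harm_V_def)

lemma d_eh: "d (e h) = 0" and dl_ioh: "dl (io h) = 0"
  and d_ioh: "d (io h) = scl (- of_int (s + int l)) h" and dl_eh: "dl (e h) = scl (- of_int (n - s + int l)) h"
  using d_e[OF h_V] dl_io[OF h_V] d_io[OF h_V] dl_e[OF h_V] by (simp_all only: d_h dl_h lin_0 add_0_right)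

lemma e_io_e: "e (io (e h)) = R (e h)" and io_e_io: "io (e (io h)) = R (io h)"
  using e_io[of "e h"] e_io[of "io h"] by (simp_all only: e_e io_io lin_0 add_0_right add_0_left)

lemma dl_e_io: "dl (e (io h)) = scl (- of_int (n - s + int l + 2)) (io h)"
  using dl_e[OF io_V[OF h_V]] by (simp add: dl_ioh algebra_simps)

lemma d_io_e: "d (io (e h)) = scl (- of_int (s + int l + 2)) (e h)"
  using d_io[OF e_V[OF h_V]] by (simp add: d_eh algebra_simps)

lemma d_e_io: "d (e (io h)) = scl (of_int (s + int l)) (e h)"
proof -
  have "d (e (io h)) + scl (- of_int (s + int l)) (e h) = 0"
    using d_e[OF io_V[OF h_V]] by (simp only: d_ioh e_scl)
  then show ?thesis by (simp only: scl_simps add_uminus_conv_diff right_minus_eq)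
qed

lemma dl_io_e: "dl (io (e h)) = scl (of_int (n - s + int l)) (io h)"
proof -
  have "dl (io (e h)) + scl (- of_int (n - s + int l)) (io h) = 0"
    using dl_io[OF e_V[OF h_V]] by (simp only: dl_eh io_scl)
  then show ?thesis by (simp only: scl_simps add_uminus_conv_diff right_minus_eq)
qed

lemma eioh_V: "e (io h) \<in> V (Suc (Suc l)) s" and ioeh_V: "io (e h) \<in> V (Suc (Suc l)) s"
  using e_V[OF io_V[OF h_V]] io_V[OF e_V[OF h_V]] by simp_all

lemma yd_V: "yd j l s h \<in> V (l + 2 * j + 2) s"
proof -
  have e: "Suc (Suc l) + 2 * j = l + 2 * j + 2" by simp
  show ?thesis unfolding yd_def
    using Rj_V[OF V_add[OF V_scl[OF eioh_V] V_scl[OF ioeh_V]], where j = j, unfolded e] .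
qed

lemma d_Rj_e: "d ((R ^^ j) (e h)) = 0"
  using d_Rj[OF e_V[OF h_V], of j] by (simp only: d_eh e_e lin_0 Rj_0 scl_simps add_0_right)

text \<open>For j = i + 1 the term from \<open>dl (e h)\<close> is a multiple of
  \<open>(R ^^ i) (R h)\<close>, and R = e io + io e splits it into both kinds of words with equal
  weights. The correction -2j adds 2i + 2 to the weight of io (e h) alone, which is the pattern of
  \<open>yd'\<close>.\<close>

lemma dl_Rj_e: "dl ((R ^^ j) (e h)) = (if j = 0 then scl (- of_int (n - s + int l)) h else scl (-1) (yd' (j - 1) l s h))"
proof (cases j)
  case 0
  then show ?thesis by (simp add: dl_eh)
next
  case (Suc i)
  have "dl ((R ^^ j) (e h)) = (R ^^ i) (scl (- of_int (n - s + int l)) (R h)) + scl (-2 * of_nat j) ((R ^^ i) (io (e h)))"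
    using dl_Rj[OF e_V[OF h_V], of j] by (simp add: Suc dl_eh R_scl funpow_swap1 del: of_nat_Suc)
  also have "\<dots> = scl (-1) (yd' i l s h)"
    by (simp add: yd'_def Rj_add Rj_scl pointwise Suc algebra_simps flip: e_io)
  finally show ?thesis using Suc by simp
qed

text \<open>This equation dictates the coefficients of \<open>yd\<close>: d maps
  \<open>(R ^^ j) (e (io h))\<close> and \<open>(R ^^ j) (io (e h))\<close> to s + l and -(s + l +
  2j + 2) times \<open>(R ^^ j) (e h)\<close>, so the two words must be weighted crosswise.\<close>

lemma d_yd: "d (yd j l s h) = 0"
proof -
  define a b :: 'a where "a = of_int (s + int l + 2 * int j + 2)" and "b = of_int (s + int l)"
  have "d (yd j l s h) = scl a (d ((R ^^ j) (e (io h)))) + scl b (d ((R ^^ j) (io (e h))))"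
    using d_add[OF V_scl[OF Rj_V[OF eioh_V]] V_scl[OF Rj_V[OF ioeh_V]], of a j b]
    by (simp only: yd_def Rj_add Rj_scl a_def[symmetric] b_def[symmetric] d_scl[OF Rj_V[OF eioh_V]] d_scl[OF Rj_V[OF ioeh_V]])
  also have "\<dots> = scl (a * b - b * of_int (s + int l + 2)) ((R ^^ j) (e h)) + scl (b * (-2 * of_nat j)) ((R ^^ (j - 1)) (R (e h)))"
    unfolding d_Rj[OF eioh_V] d_Rj[OF ioeh_V] d_e_io d_io_e e_e e_io_e Rj_scl Rj_0 b_def[symmetric]
    by (simp add: pointwise algebra_simps)
  also have "scl (b * (-2 * of_nat j)) ((R ^^ (j - 1)) (R (e h))) = scl (b * (-2 * of_nat j)) ((R ^^ j) (e h))"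
    by (cases j) (auto simp: scl_simps funpow_swap1)
  also have "scl (a * b - b * of_int (s + int l + 2)) ((R ^^ j) (e h)) + scl (b * (-2 * of_nat j)) ((R ^^ j) (e h)) = 0"
    by (simp add: pointwise a_def b_def algebra_simps)
  finally show ?thesis .
qed

text \<open>With a = s + l and b = n - s + l the constant is a b - (a + 2j + 2)(b + 2j + 2). It is
  negative when a and b are nonnegative, so \<open>dl\<close> loses nothing on these elements except
  what (x dot) loses.\<close>

lemma dl_yd: "dl (yd j l s h) = scl (of_int ((s + int l) * (n - s + int l)
   - (s + int l + 2 * int j + 2) * (n - s + int l + 2 * int j + 2))) ((R ^^ j) (io h))"
proof -
  define a b :: 'a where "a = of_int (s + int l + 2 * int j + 2)" and "b = of_int (s + int l)"
  have "dl (yd j l s h) = scl a (dl ((R ^^ j) (e (io h)))) + scl b (dl ((R ^^ j) (io (e h))))"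
    using dl_add[OF V_scl[OF Rj_V[OF eioh_V]] V_scl[OF Rj_V[OF ioeh_V]], of a j b]
    by (simp only: yd_def Rj_add Rj_scl a_def[symmetric] b_def[symmetric] dl_scl[OF Rj_V[OF eioh_V]] dl_scl[OF Rj_V[OF ioeh_V]])
  also have "\<dots> = scl (b * of_int (n - s + int l) - a * of_int (n - s + int l + 2)) ((R ^^ j) (io h)) + scl (a * (-2 * of_nat j)) ((R ^^ (j - 1)) (R (io h)))"
    unfolding dl_Rj[OF eioh_V] dl_Rj[OF ioeh_V] dl_e_io dl_io_e io_io io_e_io Rj_scl Rj_0
    by (simp add: pointwise algebra_simps)
  also have "scl (a * (-2 * of_nat j)) ((R ^^ (j - 1)) (R (io h))) = scl (a * (-2 * of_nat j)) ((R ^^ j) (io h))"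
    by (cases j) (auto simp: scl_simps funpow_swap1)
  finally show ?thesis
    by (simp add: pointwise a_def b_def algebra_simps)
qed

text \<open>Wedging with x removes e (io h) and turns io (e h) into R (e h), so the larger
  coefficient alone decides. The conclusion is e h = 0 rather than h = 0: if n - s + l = 0, then h
  itself can survive.\<close>

lemma yd'_zero: "yd' j l s h = 0 \<Longrightarrow> 0 < n - s + int l + 2 * int j + 2 \<Longrightarrow> e h = 0"
proof -
  assume z: "yd' j l s h = 0" and p: "0 < n - s + int l + 2 * int j + 2"
  let ?c = "of_int (n - s + int l + 2 * int j + 2) :: 'a"
  let ?b = "of_int (n - s + int l) :: 'a"
  have "scl ?c (io (e h)) + scl ?b (e (io h)) \<in> V (Suc (Suc l)) s"
    by (intro V_add V_scl ioeh_V eioh_V)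
  from Rj_inj[OF this] z
  have "scl ?c (io (e h)) + scl ?b (e (io h)) = 0"
    unfolding yd'_def by (simp only:)
  then have "e (scl ?c (io (e h)) + scl ?b (e (io h))) = 0" by (simp only: lin_0)
  then have "scl ?c (R (e h)) = 0" by (simp only: e_add e_scl e_e e_io_e scl_simps add_0_right)
  moreover have "?c \<noteq> 0" using p by (simp only: of_int_eq_0_iff)
  ultimately have "R (e h) = 0" unfolding scl_eq_0 by blast
  then show "e h = 0" by (rule R_inj[OF e_V[OF h_V]])
qed

lemma ioh_zero: "io h = 0 \<Longrightarrow> 0 < s + int l \<Longrightarrow> h = 0"
proof -
  assume z: "io h = 0" and p: "0 < s + int l"
  have "scl (- of_int (s + int l)) h = 0" using d_ioh unfolding z lin_0 by (rule sym)
  moreover have "- of_int (s + int l) \<noteq> (0 :: 'a)" using p by (simp only: neg_equal_0_iff_equal of_int_eq_0_iff)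
  ultimately show "h = 0" unfolding scl_eq_0 by blast
qed

end

lemma harm_V_zero: "0 \<in> harm_V k s"
  by (simp add: harm_V_def V_zero)

lemma harm_V_scl: "P \<in> harm_V k s \<Longrightarrow> scl c P \<in> harm_V k s"
proof -
  assume P: "P \<in> harm_V k s"
  then have V: "P \<in> V k s" by (simp add: harm_V_def)
  show ?thesis using P V_scl[OF V] d_scl[OF V] dl_scl[OF V] by (simp add: harm_V_def scl_simps)
qed

definition ker_d where "ker_d k s = {P \<in> V k s. d P = 0}"
definition ker_dl where "ker_dl k s = {P \<in> V k s. dl P = 0}"

lemma yd'_scl: "yd' j l s (scl c h) = scl c (yd' j l s h)"
  unfolding yd'_def e_scl io_scl Rj_scl Rj_add by (simp add: pointwise algebra_simps)

text \<open>On the kernel of \<open>d\<close> in degree $k + 1$, the operator \<open>dl\<close> has the harmonic elements as its kernel, and it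
  maps the other summands, up to nonzero constants, bijectively onto the summands of the kernel of \<open>dl\<close> in
  degree $k$, permuting the indices by \<open>idx_shift\<close>.\<close>

lemma ker_d_step:
  assumes s: "0 \<le> s" "s \<le> n"
    and IH: "dsum (ker_dl k (s - 1)) (idx k) (summand' k (s - 1))"
  shows "dsum (ker_d (Suc k) s) (idx (Suc k)) (summand (Suc k) s)"
proof -
  have diff: "P - Q = P + scl (-1) Q" for P Q :: "'a clfun" by (simp add: scl_simps)
  have cs: "i = (1, 0) \<or> (\<exists>j. i = (1, Suc j) \<and> 2 * j + 2 \<le> k) \<or> (\<exists>j. i = (2, j) \<and> 2 * j + 1 \<le> k)"
    if "i \<in> idx (Suc k) - {(0, 0)}" for i
  proof -
    obtain a j where i: "i = (a, j)" by (cases i)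
    show ?thesis using that unfolding i idx_def by (cases j) auto
  qed
  let ?B = "of_int (n - (s - 1) + int k) :: 'a"
  have B0: "?B \<noteq> 0" using s by (simp only: of_int_eq_0_iff)
  define c where "c j = (of_int ((s + int (k - 2 * j - 1)) * (n - s + int (k - 2 * j - 1))
    - (s + int (k - 2 * j - 1) + 2 * int j + 2) * (n - s + int (k - 2 * j - 1) + 2 * int j + 2)) :: 'a)" for j
  have c0: "c j \<noteq> 0" for j
  proof -
    let ?l = "int (k - 2 * j - 1)"
    have "(s + ?l) * (n - s + ?l) < (s + ?l + 2 * int j + 2) * (n - s + ?l + 2 * int j + 2)"
      using s by (intro mult_strict_mono') auto
    then show ?thesis unfolding c_def by (simp only: of_int_eq_0_iff)
  qed
  have s1: "summand (Suc k) s (1, 0) = e ` harm_V k (s - 1)"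
    and s1': "summand' k (s - 1) (0, 0) = harm_V k (s - 1)" by (simp_all add: summand_def summand'_def)
  have s2: "summand (Suc k) s (1, Suc j) = (\<lambda>h. (R ^^ Suc j) (e h)) ` harm_V (k - 2 * j - 2) (s - 1)"
    and s2': "summand' k (s - 1) (2, j) = yd' j (k - 2 * j - 2) (s - 1) ` harm_V (k - 2 * j - 2) (s - 1)" for j
    by (simp_all add: summand_def summand'_def)
  have s3: "summand (Suc k) s (2, j) = yd j (k - 2 * j - 1) s ` harm_V (k - 2 * j - 1) s"
    and s3': "summand' k (s - 1) (1, j) = (\<lambda>h. (R ^^ j) (io h)) ` harm_V (k - 2 * j - 1) s" for j
    by (simp_all add: summand_def summand'_def)
  have t: "idx_shift (1, 0) = (0, 0)" "idx_shift (1, Suc j) = (2, j)" "idx_shift (2, j) = (1, j)" for j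
    by (simp_all add: idx_shift_def)
  have D1: "dl (e h) = scl (- ?B) h" if "h \<in> harm_V k (s - 1)" for h using dl_eh[OF that] .
  have D2: "dl ((R ^^ Suc j) (e h)) = scl (-1) (yd' j (k - 2 * j - 2) (s - 1) h)"
    if "h \<in> harm_V (k - 2 * j - 2) (s - 1)" for h j
    using dl_Rj_e[OF that, of "Suc j"] by simp
  have D3: "dl (yd j (k - 2 * j - 1) s h) = scl (c j) ((R ^^ j) (io h))" if "h \<in> harm_V (k - 2 * j - 1) s" for h j
    using dl_yd[OF that] unfolding c_def .
  have "dsum (ker_d (Suc k) s) (insert (0, 0) (idx (Suc k) - {(0, 0)})) (summand (Suc k) s)"
  proof (rule dsum_lift[OF _ _ _ IH _ _ _ bij_idx_shift, where D = dl])
    show "P - Q \<in> ker_d (Suc k) s" if "P \<in> ker_d (Suc k) s" "Q \<in> ker_d (Suc k) s" for P Q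
    proof -
      have P: "P \<in> V (Suc k) s" "d P = 0" and Q: "Q \<in> V (Suc k) s" "d Q = 0" using that by (simp_all add: ker_d_def)
      have "d (scl (-1) Q) = 0" unfolding d_scl[OF Q(1)] Q(2) by (simp add: scl_simps)
      then show ?thesis using V_add[OF P(1) V_scl[OF Q(1)], of "-1"] d_add[OF P(1) V_scl[OF Q(1)], of "-1"] P(2)
        unfolding diff ker_d_def by simp
    qed
    show "0 \<in> ker_d (Suc k) s" by (simp add: ker_d_def V_zero)
    show "dl (P - Q) = dl P - dl Q" if "P \<in> ker_d (Suc k) s" "Q \<in> ker_d (Suc k) s" for P Q
    proof -
      have PQ: "P \<in> V (Suc k) s" "Q \<in> V (Suc k) s" using that by (simp_all add: ker_d_def)
      show ?thesis unfolding diff dl_add[OF PQ(1) V_scl[OF PQ(2)]] dl_scl[OF PQ(2)] by (rule refl)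
    qed
    show "dl P \<in> ker_dl k (s - 1)" if "P \<in> ker_d (Suc k) s" for P
    proof -
      have "P \<in> V (Suc k) s" using that by (simp add: ker_d_def)
      then show ?thesis unfolding ker_dl_def using dl_V dl_dl by blast
    qed
    show "summand (Suc k) s (0, 0) = {P \<in> ker_d (Suc k) s. dl P = 0}"
      by (simp add: summand_def ker_d_def harm_V_def conj_assoc)
    fix i assume i: "i \<in> idx (Suc k) - {(0, 0)}"
    show "summand (Suc k) s i \<subseteq> ker_d (Suc k) s"
      using cs[OF i]
    proof (elim disjE exE conjE)
      assume i: "i = (1, 0)"
      have "e h \<in> ker_d (Suc k) s" if "h \<in> harm_V k (s - 1)" for h
        using e_V[OF h_V[OF that]] d_eh[OF that] by (simp add: ker_d_def)
      then show ?thesis unfolding i s1 by blast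
    next
      fix j assume i: "i = (1, Suc j)" and j: "2 * j + 2 \<le> k"
      have "(R ^^ Suc j) (e h) \<in> ker_d (Suc k) s" if "h \<in> harm_V (k - 2 * j - 2) (s - 1)" for h
      proof -
        have e: "Suc (k - 2 * j - 2) + 2 * Suc j = Suc k" using j by simp
        show ?thesis using Rj_V[OF e_V[OF h_V[OF that]], of "Suc j", unfolded e] d_Rj_e[OF that, of "Suc j"]
          by (simp add: ker_d_def)
      qed
      then show ?thesis unfolding i s2 by blast
    next
      fix j assume i: "i = (2, j)" and j: "2 * j + 1 \<le> k"
      have "yd j (k - 2 * j - 1) s h \<in> ker_d (Suc k) s" if "h \<in> harm_V (k - 2 * j - 1) s" for h
      proof -
        have e: "k - 2 * j - 1 + 2 * j + 2 = Suc k" using j by simp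
        show ?thesis using yd_V[OF that, of j, unfolded e] d_yd[OF that, of j] by (simp add: ker_d_def)
      qed
      then show ?thesis unfolding i s3 by blast
    qed
    show "dl P \<in> summand' k (s - 1) (idx_shift i)" if P: "P \<in> summand (Suc k) s i" for P
      using cs[OF i]
    proof (elim disjE exE conjE)
      assume i: "i = (1, 0)"
      show ?thesis using P D1 harm_V_scl unfolding i t s1 s1' by force
    next
      fix j assume i: "i = (1, Suc j)"
      obtain h where h: "h \<in> harm_V (k - 2 * j - 2) (s - 1)" "P = (R ^^ Suc j) (e h)"
        using P unfolding i s2 by blast
      show ?thesis unfolding h(2) D2[OF h(1)] yd'_scl[symmetric] i t s2' by (intro imageI harm_V_scl h(1))
    next
      fix j assume i: "i = (2, j)"
      obtain h where h: "h \<in> harm_V (k - 2 * j - 1) s" "P = yd j (k - 2 * j - 1) s h"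
        using P unfolding i s3 by blast
      show ?thesis unfolding h(2) D3[OF h(1)] Rj_scl[symmetric] io_scl[symmetric] i t s3'
        by (rule image_eqI[OF refl harm_V_scl[OF h(1)]])
    qed
    show "\<exists>P\<in>summand (Suc k) s i. dl P = Q" if Q: "Q \<in> summand' k (s - 1) (idx_shift i)" for Q
      using cs[OF i]
    proof (elim disjE exE conjE)
      assume i: "i = (1, 0)"
      have Qh: "Q \<in> harm_V k (s - 1)" using Q unfolding i t s1' .
      show ?thesis unfolding i s1
      proof (rule bexI[OF _ imageI[OF harm_V_scl[OF Qh]]])
        show "dl (e (scl (inverse (- ?B)) Q)) = Q"
          unfolding D1[OF harm_V_scl[OF Qh]] scl_simps(3) using B0 by (simp add: scl_simps(6) del: of_int_add of_int_diff)
      qed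
    next
      fix j assume i: "i = (1, Suc j)"
      obtain h where h: "h \<in> harm_V (k - 2 * j - 2) (s - 1)" "Q = yd' j (k - 2 * j - 2) (s - 1) h"
        using Q unfolding i t s2' by blast
      show ?thesis unfolding i s2
      proof (rule bexI[OF _ imageI[OF harm_V_scl[OF h(1)]]])
        show "dl ((R ^^ Suc j) (e (scl (-1) h))) = Q"
          unfolding D2[OF harm_V_scl[OF h(1)]] yd'_scl scl_simps(3) h(2) by (simp add: scl_simps)
      qed
    next
      fix j assume i: "i = (2, j)"
      obtain h where h: "h \<in> harm_V (k - 2 * j - 1) s" "Q = (R ^^ j) (io h)"
        using Q unfolding i t s3' by blast
      show ?thesis unfolding i s3
      proof (rule bexI[OF _ imageI[OF harm_V_scl[OF h(1)]]])
        show "dl (yd j (k - 2 * j - 1) s (scl (inverse (c j)) h)) = Q"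
          unfolding D3[OF harm_V_scl[OF h(1)]] io_scl Rj_scl scl_simps(3) h(2) using c0[of j] by (simp add: scl_simps)
      qed
    qed
    show "P = 0" if P: "P \<in> summand (Suc k) s i" "dl P = 0" for P
      using cs[OF i]
    proof (elim disjE exE conjE)
      assume i: "i = (1, 0)"
      obtain h where h: "h \<in> harm_V k (s - 1)" "P = e h" using P(1) unfolding i s1 by blast
      have "h = 0" using P(2) B0 unfolding h(2) D1[OF h(1)] scl_eq_0 neg_equal_0_iff_equal by blast
      then show ?thesis using h by simp
    next
      fix j assume i: "i = (1, Suc j)"
      obtain h where h: "h \<in> harm_V (k - 2 * j - 2) (s - 1)" "P = (R ^^ Suc j) (e h)"
        using P(1) unfolding i s2 by blast
      have "yd' j (k - 2 * j - 2) (s - 1) h = 0"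
        using P(2) unfolding h(2) D2[OF h(1)] by (simp add: scl_eq_0)
      then have "e h = 0" using yd'_zero[OF h(1)] s by simp
      then show ?thesis using h(2) by (simp del: funpow.simps)
    next
      fix j assume i: "i = (2, j)"
      obtain h where h: "h \<in> harm_V (k - 2 * j - 1) s" "P = yd j (k - 2 * j - 1) s h"
        using P(1) unfolding i s3 by blast
      have "(R ^^ j) (io h) = 0"
        using P(2) c0[of j] unfolding h(2) D3[OF h(1)] scl_eq_0 by blast
      then have io0: "io h = 0" using Rj_inj[OF io_V[OF h_V[OF h(1)]]] by blast
      show ?thesis
      proof (cases "s + int (k - 2 * j - 1) = 0")
        case True
        \<comment> \<open>Here s = l = 0: the coefficient of io (e h) is zero and io h = 0 kills the
          other word, so P vanishes although h may not.\<close>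
        then show ?thesis unfolding h(2) yd_def io0 True by (simp add: scl_simps)
      next
        case False
        then have "h = 0" using ioh_zero[OF h(1) io0] s by simp
        then show ?thesis using h(2) by (simp add: yd_def scl_simps)
      qed
    qed
  qed (simp_all add: finite_idx)
  then show ?thesis using idx_insert[of "Suc k"] by simp
qed

lemma ker_d_0: "dsum (ker_d 0 s) (idx 0) (summand 0 s)"
proof -
  have "summand 0 s (0, 0) = ker_d 0 s" using dl_0 by (auto simp: summand_def ker_d_def harm_V_def)
  then show ?thesis unfolding dsum_def idx_0 by (auto intro: exI[of _ "\<lambda>_. _"])
qed

text \<open>The induction steps from s to s - 1 and s + 1, so it leaves the range of grades at -1
  and n + 1; there every space is zero.\<close>

lemma ker_d_out:
  assumes s: "s < 0 \<or> n < s"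
  shows "dsum (ker_d k s) (idx k) (summand k s)"
proof -
  have z: "P \<in> V l s \<Longrightarrow> P = 0" for P l using V_range s by blast
  have h: "harm_V l s = {0}" for l using z harm_V_zero by (auto simp: harm_V_def)
  have 1: "(\<lambda>h. (R ^^ j) (e h)) ` harm_V l (s - 1) = {0}" for l j
  proof
    show "(\<lambda>h. (R ^^ j) (e h)) ` harm_V l (s - 1) \<subseteq> {0}"
      using z[OF Rj_V[OF e_V[OF h_V, where s = "s - 1", simplified]]] by blast
    show "{0} \<subseteq> (\<lambda>h. (R ^^ j) (e h)) ` harm_V l (s - 1)"
      using imageI[OF harm_V_zero, of "\<lambda>h. (R ^^ j) (e h)"] by simp
  qed
  have 2: "yd j l s 0 = 0" for j l by (simp add: yd_def scl_simps)
  have w: "summand k s i = {0}" for i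
    unfolding summand_def by (cases i) (simp add: 1 2 h)
  moreover have "ker_d k s = {0}"
    using z V_zero by (auto simp: ker_d_def)
  ultimately show ?thesis unfolding dsum_def w by (auto intro: exI[of _ "\<lambda>_. 0"])
qed

end

text \<open>Both statements have to be proved at once: \<open>ker_d_step\<close> at (k + 1, s)
  consumes the statement for \<open>dl\<close> at (k, s - 1), and its dual consumes the one for d at
  (k, s + 1).\<close>

theorem (in hodge) kernel_decomposition:
  "dsum (ker_d k s) (idx k) (summand k s)" "dsum (ker_dl k s) (idx k) (summand' k s)"
proof -
  interpret D: hodge "\<lambda>k s. V k (n - s)" n dl d io e R by (rule dual)
  have h: "D.harm_V k s = harm_V k (n - s)" for k s
    by (auto simp: D.harm_V_def harm_V_def)
  have k: "D.ker_d k s = ker_dl k (n - s)" "D.ker_dl k s = ker_d k (n - s)" for k s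
    by (simp_all add: D.ker_d_def ker_dl_def D.ker_dl_def ker_d_def)
  have y: "D.yd j l s = yd' j l (n - s)" "D.yd' j l s = yd j l (n - s)" for j l s
    by (simp_all add: D.yd_def yd'_def D.yd'_def yd_def fun_eq_iff)
  have e2: "n - (s - 1) = n - s + 1" "n - (s + 1) = n - s - 1" for s by simp_all
  have s: "D.summand k s = summand' k (n - s)" "D.summand' k s = summand k (n - s)" for k s
    by (simp_all only: D.summand_def summand'_def D.summand'_def summand_def h y e2)
  have e: "n - (n - s) = s" "n - (n - s - 1) = s + 1" for s by simp_all
  have "dsum (ker_d k s) (idx k) (summand k s) \<and> dsum (ker_dl k s) (idx k) (summand' k s)"
  proof (induction k arbitrary: s)
    case 0
    show ?case using ker_d_0[of s] D.ker_d_0[of "n - s"] unfolding k s e by blast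
  next
    case (Suc k)
    show ?case
    proof (cases "0 \<le> s \<and> s \<le> n")
      case True
      show ?thesis
      proof
        show "dsum (ker_d (Suc k) s) (idx (Suc k)) (summand (Suc k) s)"
          using True Suc.IH[of "s - 1"] by (intro ker_d_step) auto
        show "dsum (ker_dl (Suc k) s) (idx (Suc k)) (summand' (Suc k) s)"
          using True Suc.IH[of "s + 1"] D.ker_d_step[of "n - s" k] unfolding k s e by auto
      qed
    next
      case False
      then show ?thesis using ker_d_out[of s "Suc k"] D.ker_d_out[of "n - s" "Suc k"] unfolding k s e by auto
    qed
  qed
  then show "dsum (ker_d k s) (idx k) (summand k s)" "dsum (ker_dl k s) (idx k) (summand' k s)" by auto
qed

section \<open>Clifford-valued polynomials as a model of the relations\<close>

definition grad_poly :: "nat \<Rightarrow> nat \<Rightarrow> int \<Rightarrow> 'a::real_normed_field clfun set" where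
  "grad_poly m k s = (if s < 0 then {0} else hpoly m k (nat s))"

lemma hpoly_high: "P \<in> hpoly m k s \<Longrightarrow> m < s \<Longrightarrow> P = 0"
proof (intro ext)
  fix x A
  assume P: "P \<in> hpoly m k s" and s: "m < s"
  have "\<not> (A \<subseteq> {..<m} \<and> card A = s)"
    using s card_mono[of "{..<m}" A] by auto
  then show "P x A = 0 x A" using hpoly_graded[OF P, of x] by (auto simp: graded_def zero_fun_def)
qed

lemma scl_hpoly: "P \<in> hpoly m k s \<Longrightarrow> scl c P \<in> hpoly m k s"
  unfolding scl_def by (rule hpoly_scale)

lemma x_zero: "xe m 0 = 0" "xi m 0 = 0" "xx m 0 = 0"
  by (auto simp: xe_def xi_def xx_def evec_def ivec_def eps_def iot_def zero_fun_def fun_eq_iff intro!: sum.neutral)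

lemma d_zero: "dd m 0 = 0" "de m 0 = 0"
  by (rule dd_deg_0[OF hpoly_zero] de_deg_0[OF hpoly_zero])+

lemmas zero_ops = x_zero d_zero

lemma hodge_clifford:
  assumes m: "0 < m"
  shows "hodge (grad_poly m :: _ \<Rightarrow> _ \<Rightarrow> 'a::real_normed_field clfun set) (int m) (dd m) (de m) (xe m) (xi m) (xx m)"
proof -
  have c: "P = 0 \<or> (\<exists>t. s = int t \<and> P \<in> hpoly m k t)" if "P \<in> grad_poly m k s" for P :: "'a clfun" and k s
    using that by (cases "s < 0") (simp_all add: grad_poly_def, metis nat_eq_iff2 linorder_not_less)
  have g: "P \<in> grad_poly m k (int t)" if "P \<in> hpoly m k t" for P :: "'a clfun" and k t
    using that by (simp add: grad_poly_def)
  have z: "0 \<in> grad_poly m k s" for k s by (simp add: grad_poly_def hpoly_zero)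
  have pw: "P + Q = R \<longleftrightarrow> (\<forall>x A. P x A + Q x A = R x A)" for P Q R :: "'a clfun" by (auto simp: pointwise)
  have i: "int t + 1 = int (Suc t)" for t by simp
  show ?thesis
  proof
    fix P :: "'a clfun" and k s
    assume P: "P \<in> grad_poly m k s"
    show "scl c P \<in> grad_poly m k s" for c
      using P by (auto simp: grad_poly_def scl_hpoly scl_simps split: if_splits)
    show "s < 0 \<or> int m < s \<Longrightarrow> P = 0"
      using P hpoly_high[of P m k "nat s"] by (auto simp: grad_poly_def split: if_splits)
    show "xe m P \<in> grad_poly m (Suc k) (s + 1)"
      using c[OF P] g[OF xe_hpoly] z by (auto simp: i zero_ops)
    show "xi m P \<in> grad_poly m (Suc k) (s - 1)"
      using c[OF P]
    proof (elim disjE exE conjE)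
      fix t assume "s = int t" "P \<in> hpoly m k t"
      then show ?thesis using g[OF xi_hpoly] z by (cases t) (auto simp: xi_hpoly_0)
    qed (simp add: z zero_ops)
    show "xx m P \<in> grad_poly m (Suc (Suc k)) s"
      using c[OF P] g[OF xx_hpoly] z by (auto simp: zero_ops)
    show "dd m (dd m P) = 0" "de m (de m P) = 0"
      using c[OF P] by (auto simp: zero_ops dd_dd de_de)
    show "xx m P = 0 \<Longrightarrow> P = 0"
      using c[OF P] xx_eq_0[OF m] by auto
    show "dd m (scl c P) = scl c (dd m P)" "de m (scl c P) = scl c (de m P)" for c
      using c[OF P] by (auto simp: zero_ops scl_simps) (auto simp: scl_def dd_scale de_scale)
    show "dd m (xe m P) + xe m (dd m P) = 0" "de m (xi m P) + xi m (de m P) = 0"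
      using c[OF P] by (auto simp: zero_ops) (auto simp: pointwise dd_xe de_xi)
    show "dd m (xi m P) + xi m (dd m P) = scl (- of_int (s + int k)) P"
      "de m (xe m P) + xe m (de m P) = scl (- of_int (int m - s + int k)) P"
      using c[OF P] by (auto simp: zero_ops scl_simps) (auto simp: pointwise dd_xi de_xe)
    show "dd m (xx m P) = xx m (dd m P) + scl (- 2) (xe m P)" "de m (xx m P) = xx m (de m P) + scl (- 2) (xi m P)"
      using c[OF P] by (auto simp: zero_ops scl_simps(4)) (auto simp: pointwise dd_xx de_xx)
  next
    fix P Q :: "'a clfun" and k s
    assume P: "P \<in> grad_poly m k s" and Q: "Q \<in> grad_poly m k s"
    show "P + Q \<in> grad_poly m k s"
      using P Q by (auto simp: grad_poly_def hpoly_add split: if_splits)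
    show "dd m (P + Q) = dd m P + dd m Q" "de m (P + Q) = de m P + de m Q"
      using c[OF P] c[OF Q] by (auto simp: zero_ops dd_add de_add)
  next
    fix P :: "'a clfun" and k s
    assume P: "P \<in> grad_poly m (Suc k) s"
    show "dd m P \<in> grad_poly m k (s + 1)"
      using c[OF P] g[OF dd_hpoly] z by (auto simp: i zero_ops)
    show "de m P \<in> grad_poly m k (s - 1)"
      using c[OF P]
    proof (elim disjE exE conjE)
      fix t assume "s = int t" "P \<in> hpoly m (Suc k) t"
      then show ?thesis using g[OF de_hpoly] z by (cases t) (auto simp: de_hpoly_0)
    qed (simp add: z zero_ops)
  next
    fix P :: "'a clfun" and s
    assume P: "P \<in> grad_poly m 0 s"
    show "dd m P = 0" "de m P = 0" using c[OF P] by (auto simp: zero_ops dd_deg_0 de_deg_0)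
  qed (auto simp: z xe_add xi_add xx_add scl_def xe_scale xi_scale xx_scale xe_xe xi_xi xe_xx xi_xx,
       simp add: pointwise xe_xi)
qed

section \<open>Clifford products in terms of exterior multiplication and contraction\<close>

definition supp :: "nat \<Rightarrow> (nat set \<Rightarrow> 'a::zero) \<Rightarrow> bool" where
  "supp m v \<longleftrightarrow> (\<forall>A. \<not> A \<subseteq> {..<m} \<longrightarrow> v A = 0)"

lemma graded_supp: "graded m s v \<Longrightarrow> supp m v"
  by (auto simp: graded_def supp_def)

lemma supp_eps: "supp m v \<Longrightarrow> j < m \<Longrightarrow> supp m (eps j v)"
  unfolding supp_def eps_def
proof (intro allI impI)
  fix A assume v: "\<forall>A. \<not> A \<subseteq> {..<m} \<longrightarrow> v A = 0" and "j < m" "\<not> A \<subseteq> {..<m}"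
  then have "\<not> A - {j} \<subseteq> {..<m}" by auto
  then show "(if j \<in> A then sg j A * v (A - {j}) else 0) = 0" using v by simp
qed

lemma supp_iot: "supp m v \<Longrightarrow> supp m (iot j v)"
  by (auto simp: supp_def iot_def)

lemma supp_evec: "supp m v \<Longrightarrow> supp m (evec m x v)"
  using supp_eps[of m v] by (auto simp: supp_def evec_def intro!: sum.neutral)

lemma supp_ivec: "supp m v \<Longrightarrow> supp m (ivec m x v)"
  using supp_iot[of m v] by (auto simp: supp_def ivec_def intro!: sum.neutral)

lemma supp_scale: "supp m v \<Longrightarrow> supp m (\<lambda>A. c * (v A :: 'a::comm_ring_1))"
  by (auto simp: supp_def)

lemma supp_add: "supp m v \<Longrightarrow> supp m w \<Longrightarrow> supp m (\<lambda>A. v A + (w A :: 'a::comm_ring_1))"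
  by (auto simp: supp_def)

lemma sum_singletons:
  fixes m :: nat
  assumes "\<And>A. A \<subseteq> {..<m} \<Longrightarrow> card A \<noteq> 1 \<Longrightarrow> f A = 0"
  shows "(\<Sum>A\<in>Pow {..<m}. f A) = (\<Sum>j<m. f {j} :: 'a::comm_monoid_add)"
proof -
  have "(\<Sum>A\<in>Pow {..<m}. f A) = (\<Sum>A\<in>(\<lambda>j. {j}) ` {..<m}. f A)"
  proof (rule sum.mono_neutral_right)
    show "\<forall>A\<in>Pow {..<m} - (\<lambda>j. {j}) ` {..<m}. f A = 0"
    proof
      fix A assume A: "A \<in> Pow {..<m} - (\<lambda>j. {j}) ` {..<m}"
      have "card A \<noteq> 1" using A by (auto simp: card_1_singleton_iff)
      then show "f A = 0" using A assms by blast
    qed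
  qed auto
  also have "\<dots> = (\<Sum>j<m. f {j})" by (subst sum.reindex) (auto simp: inj_on_def)
  finally show ?thesis .
qed

lemma blade_sign_left: "blade_sign {j} B = (if j \<in> B then - sg j B else sg j B)"
proof -
  have "{(a, b). a \<in> {j} \<and> b \<in> B \<and> b < a} = Pair j ` {b \<in> B. b < j}" by auto
  then have "card {(a, b). a \<in> {j} \<and> b \<in> B \<and> b < a} = card {b \<in> B. b < j}"
    by (simp add: card_image inj_on_def)
  then show ?thesis by (auto simp: blade_sign_def sg_def)
qed

text \<open>Only singletons of the left factor contribute to the product. The symmetric difference
  of {j} with C either removes j from C, which is the wedge part, or inserts it, which is the
  contraction part.\<close>

lemma cl_mult_vec:
  assumes "supp m v"
  shows "cl_mult m (cl_vec m x) v = (\<lambda>C. evec m x v C + ivec m x v C)"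
proof
  fix C
  show "cl_mult m (cl_vec m x) v C = evec m x v C + ivec m x v C"
  proof (cases "C \<subseteq> {..<m}")
    case True
    have d: "({j} - C) \<union> (C - {j}) = (if j \<in> C then C - {j} else insert j C)" for j by auto
    have "cl_mult m (cl_vec m x) v C = (\<Sum>j<m. cl_vec m x {j} * v (({j} - C) \<union> (C - {j})) * blade_sign {j} (({j} - C) \<union> (C - {j})))"
      using True unfolding cl_mult_def by (simp, subst sum_singletons) (auto simp: cl_vec_def)
    also have "\<dots> = (\<Sum>j<m. of_real (x j) * (eps j v C + iot j v C))"
      unfolding d by (rule sum.cong[OF refl]) (auto simp: cl_vec_def eps_def iot_def blade_sign_left sg_remove sg_insert)
    finally show ?thesis by (simp add: evec_def ivec_def sum.distrib distrib_left)
  next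
    case False
    then show ?thesis using supp_evec[OF assms, of x] supp_ivec[OF assms, of x] by (auto simp: cl_mult_def supp_def)
  qed
qed

lemma blade_sign_right: "blade_sign A {j} = (-1) ^ (card {a \<in> A. j < a} + (if j \<in> A then 1 else 0))"
proof -
  have "{(a, b). a \<in> A \<and> b \<in> {j} \<and> b < a} = (\<lambda>a. (a, j)) ` {a \<in> A. j < a}" by auto
  then have "card {(a, b). a \<in> A \<and> b \<in> {j} \<and> b < a} = card {a \<in> A. j < a}"
    by (simp add: card_image inj_on_def)
  then show ?thesis by (auto simp: blade_sign_def)
qed

lemma card_split_at:
  assumes "finite A"
  shows "card A = card {a \<in> A. a < j} + card {a \<in> A. (j::nat) < a} + (if j \<in> A then 1 else 0)"
proof -
  have "A = {a \<in> A. a < j} \<union> {a \<in> A. j < a} \<union> (if j \<in> A then {j} else {})"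
    by (auto simp: not_less le_less)
  also have "card \<dots> = card {a \<in> A. a < j} + card {a \<in> A. (j::nat) < a} + (if j \<in> A then 1 else 0)"
    using assms by (subst card_Un_disjoint; auto)+
  finally show ?thesis .
qed

text \<open>The elements of A above j, counted with j itself if it is in A, are those not below j;
  so their number has the parity of card A plus the number below j.\<close>

lemma blade_sign_right':
  assumes "finite A"
  shows "blade_sign A {j} = (-1) ^ card A * (sg j A :: 'a::comm_ring_1)"
proof -
  have "(-1) ^ card A * (sg j A :: 'a) = (-1) ^ (card A + card {a \<in> A. a < j})"
    by (simp add: sg_def power_add)
  also have "\<dots> = (-1) ^ (2 * card {a \<in> A. a < j} + (card {a \<in> A. j < a} + (if j \<in> A then 1 else 0)))"
    by (subst card_split_at[OF assms, of j]) (simp add: add_ac mult_2)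
  also have "\<dots> = blade_sign A {j}" by (simp add: blade_sign_right power_add power_mult)
  finally show ?thesis by simp
qed

lemma cl_mult_vec_right:
  assumes v: "graded m s v"
  shows "cl_mult m v (cl_vec m x) = (\<lambda>C. (-1) ^ s * (evec m x v C - ivec m x v C))"
proof
  fix C
  show "cl_mult m v (cl_vec m x) C = (-1) ^ s * (evec m x v C - ivec m x v C)"
  proof (cases "C \<subseteq> {..<m}")
    case True
    let ?f = "\<lambda>A B. v A * cl_vec m x B * blade_sign A B :: 'a"
    let ?D = "\<lambda>A. (A - C) \<union> (C - A)"
    have "cl_mult m v (cl_vec m x) C = (\<Sum>A\<in>Pow {..<m}. ?f A (?D A))"
      using True by (simp add: cl_mult_def)
    \<comment> \<open>The sum is rewritten over the right factor instead of the left one; only then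
      is it supported on singletons.\<close>
    also have "\<dots> = (\<Sum>B\<in>Pow {..<m}. ?f (?D B) B)"
    proof (rule sum.reindex_bij_witness[of _ ?D ?D])
      fix A assume A: "A \<in> Pow {..<m}"
      show D: "?D (?D A) = A" by auto
      then show "?D (?D A) = A" .
      show "?D A \<in> Pow {..<m}" "?D A \<in> Pow {..<m}" using A True by auto
      show "?f (?D (?D A)) (?D A) = ?f A (?D A)" unfolding D by (rule refl)
    qed
    also have "\<dots> = (\<Sum>j<m. ?f (?D {j}) {j})"
      by (rule sum_singletons) (auto simp: cl_vec_def)
    also have "\<dots> = (\<Sum>j<m. (-1) ^ s * (of_real (x j) * (eps j v C - iot j v C)))"
    proof (rule sum.cong[OF refl])
      fix j assume j: "j \<in> {..<m}"
      have f: "finite (?D {j})" using True finite_subset[OF True] by auto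
      have d: "({j} - C) \<union> (C - {j}) = (if j \<in> C then C - {j} else insert j C)" by auto
      have "v (?D {j}) = 0 \<or> card (?D {j}) = s" using v by (auto simp: graded_def)
      then have "?f (?D {j}) {j} = of_real (x j) * (v (?D {j}) * ((-1) ^ s * sg j (?D {j})))"
        using blade_sign_right'[OF f, of j] j by (auto simp: cl_vec_def)
      also have "v (?D {j}) * ((-1) ^ s * sg j (?D {j})) = (-1) ^ s * (eps j v C - iot j v C)"
        unfolding d by (auto simp: eps_def iot_def sg_remove sg_insert)
      finally show "?f (?D {j}) {j} = (-1) ^ s * (of_real (x j) * (eps j v C - iot j v C))" by simp
    qed
    also have "\<dots> = (-1) ^ s * (evec m x v C - ivec m x v C)"
      by (simp add: evec_def ivec_def sum_distrib_left right_diff_distrib sum_subtractf)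
    finally show ?thesis .
  next
    case False
    then show ?thesis using supp_evec[OF graded_supp[OF v], of x] supp_ivec[OF graded_supp[OF v], of x]
      by (auto simp: cl_mult_def supp_def)
  qed
qed

lemma cl_grade_graded:
  assumes "graded m s v"
  shows "cl_grade g v = (if g = s then v else (\<lambda>_. 0))"
  using assms by (auto simp: cl_grade_def graded_def fun_eq_iff)

lemma cl_mult_zero: "cl_mult m (\<lambda>_. 0) v = (\<lambda>_. 0)" "cl_mult m u (\<lambda>_. 0) = (\<lambda>_. 0)"
  by (simp_all add: cl_mult_def fun_eq_iff)

lemma
  assumes v: "graded m s v"
  shows cl_wedge_vec: "cl_wedge m (cl_vec m x) v = evec m x v"
    and cl_dot_vec: "cl_dot m (cl_vec m x) v = ivec m x v"
proof -
  \<comment> \<open>\<open>cl_wedge\<close> and \<open>cl_dot\<close> sum over grades up to m. A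
    graded v of larger grade is zero, so nothing is missed.\<close>
  have c: "s \<le> m \<or> v = (\<lambda>_. 0)"
  proof (cases "s \<le> m")
    case False
    have "v A = 0" for A
    proof -
      have "\<not> (A \<subseteq> {..<m} \<and> card A = s)" using False card_mono[of "{..<m}" A] by auto
      then show ?thesis using v by (auto simp: graded_def)
    qed
    then show ?thesis by auto
  qed simp
  have z: "evec m x (\<lambda>_. 0) = (\<lambda>_. 0 :: 'a)" "ivec m x (\<lambda>_. 0) = (\<lambda>_. 0 :: 'a)"
    by (auto simp: evec_def ivec_def eps_def iot_def intro!: sum.neutral)
  have p: "(-1) ^ s * ((-1) ^ s * a) = (a::'a)" for a
    by (simp flip: mult.assoc power_mult_distrib)
  show "cl_wedge m (cl_vec m x) v = evec m x v"
  proof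
    fix C
    have "cl_wedge m (cl_vec m x) v C = (\<Sum>g\<le>m. if g = s then evec m x v C else 0)"
      unfolding cl_wedge_def cl_grade_graded[OF v]
      by (intro sum.cong refl) (auto simp: cl_mult_zero cl_mult_vec[OF graded_supp[OF v]] cl_mult_vec_right[OF v] p)
    then show "cl_wedge m (cl_vec m x) v C = evec m x v C" using c z by auto
  qed
  show "cl_dot m (cl_vec m x) v = ivec m x v"
  proof
    fix C
    have "cl_dot m (cl_vec m x) v C = (\<Sum>g\<le>m. if g = s then ivec m x v C else 0)"
      unfolding cl_dot_def cl_grade_graded[OF v]
      by (intro sum.cong refl) (auto simp: cl_mult_zero cl_mult_vec[OF graded_supp[OF v]] cl_mult_vec_right[OF v] p)
    then show "cl_dot m (cl_vec m x) v C = ivec m x v C" using c z by auto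
  qed
qed

definition unit_vec :: "nat \<Rightarrow> nat \<Rightarrow> real" where "unit_vec j = (\<lambda>i. if i = j then 1 else 0)"

lemma evec_unit: "j < m \<Longrightarrow> evec m (unit_vec j) v = eps j v"
  and ivec_unit: "j < m \<Longrightarrow> ivec m (unit_vec j) v = iot j v"
  by (simp_all add: evec_def ivec_def unit_vec_def fun_eq_iff if_distrib[of of_real] if_distrib[of "\<lambda>u. u * _"] cong: if_cong)

lemma cl_basis_vec: "j < m \<Longrightarrow> cl_basis j = (cl_vec m (unit_vec j) :: nat set \<Rightarrow> 'a::real_normed_field)"
  by (auto simp: cl_basis_def cl_vec_def unit_vec_def fun_eq_iff card_1_singleton_iff)

lemma dirac_eq:
  assumes "P \<in> hpoly m k s"
  shows "dirac m P = dd m P + de m P"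
proof (intro ext)
  fix x A
  have g: "supp m (pderiv_cl j P x)" for j
    by (rule graded_supp[OF hpoly_graded[OF pderiv_cl_hpoly_pred[OF assms]]])
  show "dirac m P x A = (dd m P + de m P) x A"
    by (simp add: dirac_def sum_fun_app cl_basis_vec cl_mult_vec[OF g] evec_unit ivec_unit dd_def de_def sum.distrib plus_fun_apply)
qed

lemma dplus_eq:
  assumes "P \<in> hpoly m k s"
  shows "dplus m P = dd m P"
proof (intro ext)
  fix x A
  have g: "graded m s (pderiv_cl j P x)" for j
    by (rule hpoly_graded[OF pderiv_cl_hpoly_pred[OF assms]])
  show "dplus m P x A = dd m P x A"
    by (simp add: dplus_def sum_fun_app cl_basis_vec cl_wedge_vec[OF g] evec_unit dd_def)
qed

lemma dminus_eq:
  assumes "P \<in> hpoly m k s"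
  shows "dminus m P = de m P"
proof (intro ext)
  fix x A
  have g: "graded m s (pderiv_cl j P x)" for j
    by (rule hpoly_graded[OF pderiv_cl_hpoly_pred[OF assms]])
  show "dminus m P x A = de m P x A"
    by (simp add: dminus_def sum_fun_app cl_basis_vec cl_dot_vec[OF g] ivec_unit de_def)
qed

lemma graded_dd: "P \<in> hpoly m k s \<Longrightarrow> graded m (Suc s) (dd m P x)"
  by (cases k) (auto simp: dd_deg_0 graded_def zero_fun_apply hpoly_graded[OF dd_hpoly, unfolded graded_def])

lemma graded_de: "P \<in> hpoly m k (Suc s) \<Longrightarrow> graded m s (de m P x)"
  by (cases k) (auto simp: de_deg_0 graded_def zero_fun_apply hpoly_graded[OF de_hpoly, unfolded graded_def])

text \<open>The two halves of the Dirac operator raise and lower the grade, so their values live on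
  different blades and cannot cancel. In grade 0 the lowering half is zero by itself.\<close>

lemma harm_eq: "harm m s k = {P \<in> hpoly m k s. dd m P = 0 \<and> de m P = 0}"
proof -
  have "dirac m P = 0 \<longleftrightarrow> dd m P = 0 \<and> de m P = 0" if P: "P \<in> hpoly m k s" for P :: "'a clfun"
  proof
    assume "dirac m P = 0"
    then have e: "dd m P x A + de m P x A = 0" for x A by (simp add: dirac_eq[OF P] pointwise)
    have "dd m P x A = 0 \<and> de m P x A = 0" for x A
    proof (cases s)
      case 0
      then have "de m P x A = 0" using P de_hpoly_0[of P m k] by (simp add: zero_fun_apply)
      then show ?thesis using e[of x A] by simp
    next
      case (Suc t)
      have "dd m P x A = 0 \<or> de m P x A = 0"
        using graded_dd[OF P, of x] graded_de[of P m k t x] P Suc unfolding graded_def by (cases "card A = Suc s") auto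
      then show ?thesis using e[of x A] by auto
    qed
    then show "dd m P = 0 \<and> de m P = 0" by (auto simp: pointwise)
  qed (simp add: dirac_eq[OF P])
  then show ?thesis by (auto simp: harm_def)
qed

lemma ker_plus_eq: "ker_plus m s k = {P \<in> hpoly m k s. dd m P = 0}"
  by (auto simp: ker_plus_def dplus_eq)

lemma ker_minus_eq: "ker_minus m s k = {P \<in> hpoly m k s. de m P = 0}"
  by (auto simp: ker_minus_def dminus_eq)

lemma cl_one_supp: "supp m cl_one"
  by (auto simp: supp_def cl_one_def)

lemma cl_mult_one: "supp m v \<Longrightarrow> cl_mult m cl_one v = v"
proof
  fix C assume v: "supp m v"
  have "(\<Sum>A\<in>Pow {..<m}. cl_one A * v ((A - C) \<union> (C - A)) * blade_sign A ((A - C) \<union> (C - A)))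
     = (\<Sum>A\<in>{{}}. cl_one A * v ((A - C) \<union> (C - A)) * blade_sign A ((A - C) \<union> (C - A)))"
    by (rule sum.mono_neutral_right) (auto simp: cl_one_def)
  then show "cl_mult m cl_one v C = v C"
    using v by (auto simp: cl_mult_def cl_one_def blade_sign_def supp_def)
qed

lemma cl_mult_scale_left: "cl_mult m (\<lambda>A. c * u A) v = (\<lambda>A. c * cl_mult m u v A)"
  by (auto simp: cl_mult_def fun_eq_iff sum_distrib_left mult.assoc)

lemma cl_mult_scale_right: "cl_mult m u (\<lambda>A. c * v A) = (\<lambda>A. c * cl_mult m u v A)"
  by (auto simp: cl_mult_def fun_eq_iff sum_distrib_left algebra_simps)

lemma cl_vec_supp: "supp m (cl_vec m x)"
  by (auto simp: supp_def cl_vec_def)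

lemma sg_singleton: "sg j {j} = 1"
proof -
  have "{a \<in> {j}. a < j} = {}" by auto
  then show ?thesis by (simp only: sg_def card.empty power_0)
qed

lemma cl_mult_vec_one: "cl_mult m (cl_vec m x) cl_one = (cl_vec m x :: nat set \<Rightarrow> 'a::real_normed_field)"
proof
  fix C
  have g: "graded m 0 (cl_one :: nat set \<Rightarrow> 'a)" by (auto simp: graded_def cl_one_def)
  have "evec m x (cl_one :: nat set \<Rightarrow> 'a) C = cl_vec m x C"
  proof (cases "\<exists>i<m. C = {i}")
    case True
    then obtain i where i: "i < m" "C = {i}" by blast
    have "evec m x (cl_one :: nat set \<Rightarrow> 'a) C = (\<Sum>j<m. if j = i then of_real (x j) else 0)"
      unfolding evec_def by (intro sum.cong) (auto simp: eps_def i cl_one_def sg_singleton)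
    then show ?thesis using i by (simp add: cl_vec_def)
  next
    case False
    then have "evec m x (cl_one :: nat set \<Rightarrow> 'a) C = 0"
      unfolding evec_def by (intro sum.neutral) (auto simp: eps_def cl_one_def)
    moreover have "cl_vec m x C = (0 :: 'a)" using False by (auto simp: cl_vec_def card_1_singleton_iff)
    ultimately show ?thesis by simp
  qed
  then show "cl_mult m (cl_vec m x) cl_one C = (cl_vec m x C :: 'a)"
    by (simp add: cl_mult_vec[OF cl_one_supp] ivec_graded_0[OF g] zero_fun_apply)
qed

lemma cl_mult_vec_vec:
  fixes v :: "nat set \<Rightarrow> 'a::real_normed_field"
  assumes "supp m v"
  shows "cl_mult m (cl_vec m x) (cl_mult m (cl_vec m x) v) = (\<lambda>C. - of_real (dotp m x x) * v C)"
proof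
  fix C
  have s: "supp m (\<lambda>C. evec m x v C + ivec m x v C)" by (intro supp_add supp_evec supp_ivec assms)
  have e: "(\<lambda>C. evec m x v C + ivec m x v C) = evec m x v + ivec m x v" by (simp add: fun_eq_iff plus_fun_apply)
  show "cl_mult m (cl_vec m x) (cl_mult m (cl_vec m x) v) C = - of_real (dotp m x x) * v C"
    unfolding cl_mult_vec[OF assms] cl_mult_vec[OF s] unfolding e
    using evec_ivec[of m x x v C] by (simp add: evec_add ivec_add plus_fun_apply evec_self ivec_self)
qed

lemma cl_pow_even: "cl_pow m (cl_vec m x) (2 * j) = (\<lambda>C. (- of_real (dotp m x x)) ^ j * (cl_one C :: 'a::real_normed_field))"
proof (induction j)
  case (Suc j)
  have "(cl_pow m (cl_vec m x) (2 * Suc j) :: nat set \<Rightarrow> 'a) = cl_mult m (cl_vec m x) (cl_mult m (cl_vec m x) (cl_pow m (cl_vec m x) (2 * j)))"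
    by (simp add: cl_pow_def)
  also have "\<dots> = (\<lambda>C. - of_real (dotp m x x) * ((- of_real (dotp m x x)) ^ j * cl_one C))"
    unfolding Suc by (rule cl_mult_vec_vec) (intro supp_scale cl_one_supp)
  finally show ?case by (simp add: mult.assoc)
qed (simp add: cl_pow_def)

lemma cl_mult_pow_even:
  fixes v :: "nat set \<Rightarrow> 'a::real_normed_field"
  shows "supp m v \<Longrightarrow> cl_mult m (cl_pow m (cl_vec m x) (2 * j)) v = (\<lambda>C. (- of_real (dotp m x x)) ^ j * v C)"
  by (simp add: cl_pow_even cl_mult_scale_left cl_mult_one)

lemma cl_mult_pow_odd:
  fixes v :: "nat set \<Rightarrow> 'a::real_normed_field"
  assumes "supp m v"
  shows "cl_mult m (cl_pow m (cl_vec m x) (2 * j + 1)) v = (\<lambda>C. (- of_real (dotp m x x)) ^ j * (evec m x v C + ivec m x v C))"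
proof -
  have "(cl_pow m (cl_vec m x) (2 * j + 1) :: nat set \<Rightarrow> 'a) = (\<lambda>C. (- of_real (dotp m x x)) ^ j * cl_vec m x C)"
    using cl_pow_even[of m x j, where 'a = 'a] by (simp add: cl_pow_def cl_mult_scale_right cl_mult_vec_one)
  then show ?thesis by (simp add: cl_mult_scale_left cl_mult_vec[OF assms])
qed

lemma xx_pow: "(xx m ^^ j) P x A = (- of_real (dotp m x x)) ^ j * P x A"
  by (induction j) (auto simp: xx_def)

lemma ydot_eq:
  assumes P: "P \<in> hpoly m d s"
  shows "ydot m s d j P = (xx m ^^ j) (scl (of_int (int s + int d + 2 * int j + 2)) (xe m (xi m P)) + scl (of_int (int s + int d)) (xi m (xe m P)))"
proof (intro ext)
  fix x C
  define a b :: 'a where "a = of_int (int s + int d + 2 * int j + 2)" and "b = of_int (int s + int d)"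
  have g: "graded m s (P x)" by (rule hpoly_graded[OF P])
  have 1: "(\<lambda>A. b * P x A + of_nat (2 * j + 2) * P x A) = (\<lambda>A. a * P x A)"
    by (simp add: b_def a_def algebra_simps fun_eq_iff)
  have 2: "opA s d P x = (\<lambda>A. b * P x A)" by (simp add: opA_def b_def)
  let ?v = "(\<lambda>A. a * ivec m x (P x) A) + (\<lambda>A. b * evec m x (P x) A)"
  have v: "(\<lambda>C. cl_dot m (cl_vec m x) (\<lambda>A. opA s d P x A + of_nat (2*j+2) * P x A) C
          + cl_wedge m (cl_vec m x) (opA s d P x) C) = ?v"
    unfolding 2 1 cl_dot_vec[OF graded_scale[OF g]] cl_wedge_vec[OF graded_scale[OF g]] ivec_scale evec_scale
    by (simp add: fun_eq_iff plus_fun_apply)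
  have sv: "supp m ?v" unfolding plus_fun_def
    by (intro supp_add supp_scale supp_evec supp_ivec graded_supp[OF g])
  show "ydot m s d j P x C = (xx m ^^ j) (scl (of_int (int s + int d + 2 * int j + 2)) (xe m (xi m P)) + scl (of_int (int s + int d)) (xi m (xe m P))) x C"
    unfolding ydot_def v cl_mult_pow_odd[OF sv] xx_pow evec_add ivec_add evec_scale ivec_scale a_def[symmetric] b_def[symmetric]
    by (simp add: plus_fun_apply scl_apply evec_self ivec_self xe_def xi_def)
qed

lemma yhat_eq:
  assumes P: "P \<in> hpoly m d s" and s: "s \<le> m"
  shows "yhat m s d j P = (xx m ^^ j) (scl (of_int (int m - int s + int d + 2 * int j + 2)) (xi m (xe m P)) + scl (of_int (int m - int s + int d)) (xe m (xi m P)))"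
proof (intro ext)
  fix x C
  define a b :: 'a where "a = of_int (int m - int s + int d + 2 * int j + 2)" and "b = of_int (int m - int s + int d)"
  have g: "graded m s (P x)" by (rule hpoly_graded[OF P])
  have 1: "(\<lambda>A. b * P x A + of_nat (2 * j + 2) * P x A) = (\<lambda>A. a * P x A)"
    by (simp add: b_def a_def algebra_simps fun_eq_iff)
  have 2: "opB m s d P x = (\<lambda>A. b * P x A)" using s by (simp add: opB_def b_def of_nat_diff algebra_simps)
  let ?v = "(\<lambda>A. a * evec m x (P x) A) + (\<lambda>A. b * ivec m x (P x) A)"
  have v: "(\<lambda>C. cl_wedge m (cl_vec m x) (\<lambda>A. opB m s d P x A + of_nat (2*j+2) * P x A) C
          + cl_dot m (cl_vec m x) (opB m s d P x) C) = ?v"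
    unfolding 2 1 cl_dot_vec[OF graded_scale[OF g]] cl_wedge_vec[OF graded_scale[OF g]] ivec_scale evec_scale
    by (simp add: fun_eq_iff plus_fun_apply)
  have sv: "supp m ?v" unfolding plus_fun_def
    by (intro supp_add supp_scale supp_evec supp_ivec graded_supp[OF g])
  show "yhat m s d j P x C = (xx m ^^ j) (scl (of_int (int m - int s + int d + 2 * int j + 2)) (xi m (xe m P)) + scl (of_int (int m - int s + int d)) (xe m (xi m P))) x C"
    unfolding yhat_def v cl_mult_pow_odd[OF sv] xx_pow evec_add ivec_add evec_scale ivec_scale a_def[symmetric] b_def[symmetric]
    by (simp add: plus_fun_apply scl_apply evec_self ivec_self xe_def xi_def)
qed

lemma wedge_summand_eq:
  assumes P: "P \<in> hpoly m d s"
  shows "(\<lambda>x. cl_mult m (cl_pow m (cl_vec m x) (2*j)) (cl_wedge m (cl_vec m x) (P x))) = (xx m ^^ j) (xe m P)"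
proof (intro ext)
  fix x A
  have g: "graded m s (P x)" by (rule hpoly_graded[OF P])
  show "cl_mult m (cl_pow m (cl_vec m x) (2*j)) (cl_wedge m (cl_vec m x) (P x)) A = (xx m ^^ j) (xe m P) x A"
    by (simp add: cl_wedge_vec[OF g] cl_mult_pow_even[OF supp_evec[OF graded_supp[OF g]]] xx_pow xe_def)
qed

lemma dot_summand_eq:
  assumes P: "P \<in> hpoly m d s"
  shows "(\<lambda>x. cl_mult m (cl_pow m (cl_vec m x) (2*j)) (cl_dot m (cl_vec m x) (P x))) = (xx m ^^ j) (xi m P)"
proof (intro ext)
  fix x A
  have g: "graded m s (P x)" by (rule hpoly_graded[OF P])
  show "cl_mult m (cl_pow m (cl_vec m x) (2*j)) (cl_dot m (cl_vec m x) (P x)) A = (xx m ^^ j) (xi m P) x A"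
    by (simp add: cl_dot_vec[OF g] cl_mult_pow_even[OF supp_ivec[OF graded_supp[OF g]]] xx_pow xi_def)
qed

lemma harm_hpoly: "P \<in> harm m s k \<Longrightarrow> P \<in> hpoly m k s"
  by (simp add: harm_eq)

theorem
  assumes m: "0 < m" and s: "1 \<le> s" "s < m"
  shows dsum_ker_plus: "dsum (ker_plus m s k :: 'a::real_normed_field clfun set) (idx k) (summands_plus m s k)"
    and dsum_ker_minus: "dsum (ker_minus m s k :: 'a::real_normed_field clfun set) (idx k) (summands_minus m s k)"
proof -
  interpret H: hodge "grad_poly m :: _ \<Rightarrow> _ \<Rightarrow> 'a clfun set" "int m" "dd m" "de m" "xe m" "xi m" "xx m"
    by (rule hodge_clifford[OF m])
  have h: "H.harm_V k (int s) = harm m s k" for k s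
    by (simp add: H.harm_V_def harm_eq grad_poly_def)
  have s1: "int s - 1 = int (s - 1)" "int s + 1 = int (s + 1)" using s by auto
  have "H.summand k (int s) (i, j) = summands_plus m s k (i, j)" for i j
  proof -
    have "(\<lambda>P. (xx m ^^ j) (xe m P)) ` harm m (s - 1) (k - 2 * j - 1)
        = (\<lambda>P x. cl_mult m (cl_pow m (cl_vec m x) (2*j)) (cl_wedge m (cl_vec m x) (P x))) ` (harm m (s - 1) (k - 2 * j - 1) :: 'a clfun set)"
      by (rule image_cong[OF refl]) (simp add: wedge_summand_eq[OF harm_hpoly])
    moreover have "H.yd j (k - 2 * j - 2) (int s) ` harm m s (k - 2 * j - 2) = ydot m s (k - 2 * j - 2) j ` (harm m s (k - 2 * j - 2) :: 'a clfun set)"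
      by (rule image_cong[OF refl]) (simp only: ydot_eq[OF harm_hpoly] H.yd_def)
    ultimately show ?thesis by (simp add: H.summand_def summands_plus_def h s1(1))
  qed
  then have p: "H.summand k (int s) = summands_plus m s k" by auto
  have "H.summand' k (int s) (i, j) = summands_minus m s k (i, j)" for i j
  proof -
    have "(\<lambda>P. (xx m ^^ j) (xi m P)) ` harm m (s + 1) (k - 2 * j - 1)
        = (\<lambda>P x. cl_mult m (cl_pow m (cl_vec m x) (2*j)) (cl_dot m (cl_vec m x) (P x))) ` (harm m (s + 1) (k - 2 * j - 1) :: 'a clfun set)"
      by (rule image_cong[OF refl]) (simp add: dot_summand_eq[OF harm_hpoly])
    moreover have "H.yd' j (k - 2 * j - 2) (int s) ` harm m s (k - 2 * j - 2) = yhat m s (k - 2 * j - 2) j ` (harm m s (k - 2 * j - 2) :: 'a clfun set)"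
      by (rule image_cong[OF refl]) (use s in \<open>simp only: yhat_eq[OF harm_hpoly] H.yd'_def less_imp_le\<close>)
    ultimately show ?thesis by (simp only: H.summand'_def summands_minus_def h s1(2) split_conv)
  qed
  then have q: "H.summand' k (int s) = summands_minus m s k" by auto
  have k: "H.ker_d k (int s) = ker_plus m s k" "H.ker_dl k (int s) = ker_minus m s k"
    by (simp_all add: H.ker_d_def H.ker_dl_def ker_plus_eq ker_minus_eq grad_poly_def)
  show "dsum (ker_plus m s k :: 'a::real_normed_field clfun set) (idx k) (summands_plus m s k)"
    "dsum (ker_minus m s k :: 'a::real_normed_field clfun set) (idx k) (summands_minus m s k)"
    using H.kernel_decomposition[of k "int s"] unfolding k p q by blast+
qed

section \<open>Associativity of the Clifford product\<close>

abbreviation sd :: "'b set \<Rightarrow> 'b set \<Rightarrow> 'b set" where "sd A B \<equiv> (A - B) \<union> (B - A)"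

lemma prod_sym_diff:
  assumes "finite A" "finite B" "\<And>x. f x * f x = (1::'a::comm_ring_1)"
  shows "prod f (sd A B) = prod f A * prod f B"
proof -
  have "prod f A * prod f B = (prod f (A - B) * prod f (A \<inter> B)) * (prod f (B - A) * prod f (A \<inter> B))"
    using prod.Int_Diff[OF assms(1), of f B] prod.Int_Diff[OF assms(2), of f A] by (simp add: mult_ac Int_commute)
  also have "\<dots> = prod f (A - B) * prod f (B - A) * (\<Prod>x\<in>A \<inter> B. f x * f x)"
    by (simp add: prod.distrib mult_ac)
  also have "\<dots> = prod f (A - B) * prod f (B - A)" by (simp add: assms(3))
  also have "\<dots> = prod f (sd A B)" using assms by (intro prod.union_disjoint[symmetric]) auto
  finally show ?thesis by simp
qed

text \<open>As a product over pairs, whose diagonal pairs account for e_a^2 = -1, the sign becomes a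
  character in each argument with respect to symmetric difference. This bimultiplicativity yields
  the cocycle identity behind associativity.\<close>

lemma blade_sign_prod:
  assumes "finite A" "finite B"
  shows "blade_sign A B = (\<Prod>a\<in>A. \<Prod>b\<in>B. if b \<le> a then - 1 else (1::'a::comm_ring_1))"
proof -
  have "(\<Prod>a\<in>A. \<Prod>b\<in>B. if b \<le> a then - 1 else (1::'a)) = (\<Prod>p\<in>A \<times> B. if snd p \<le> fst p then -1 else 1)"
    by (simp add: prod.cartesian_product case_prod_beta)
  also have "\<dots> = (-1) ^ card {p \<in> A \<times> B. snd p \<le> fst p}"
    using assms by (simp add: prod.If_cases Int_def)
  also have "{p \<in> A \<times> B. snd p \<le> fst p} = {(a, b). a \<in> A \<and> b \<in> B \<and> b < a} \<union> (\<lambda>a. (a, a)) ` (A \<inter> B)"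
    by (auto simp: le_less)
  also have "card \<dots> = card {(a, b). a \<in> A \<and> b \<in> B \<and> b < a} + card ((\<lambda>a. (a, a)) ` (A \<inter> B))"
  proof (rule card_Un_disjoint)
    show "finite {(a, b). a \<in> A \<and> b \<in> B \<and> b < a}"
      by (rule finite_subset[OF _ finite_cartesian_product[OF assms]]) auto
  qed (use assms in auto)
  also have "card ((\<lambda>a. (a, a)) ` (A \<inter> B)) = card (A \<inter> B)" by (rule card_image) (auto simp: inj_on_def)
  finally show ?thesis by (simp add: blade_sign_def)
qed

lemma blade_sign_sd:
  assumes "finite A" "finite B" "finite C"
  shows "blade_sign (sd A B) C = blade_sign A C * (blade_sign B C :: 'a::comm_ring_1)"
    and "blade_sign C (sd A B) = blade_sign C A * (blade_sign C B :: 'a::comm_ring_1)"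
proof -
  have s: "finite (sd A B)" using assms by auto
  have sq: "(\<Prod>c\<in>C. f c) * (\<Prod>c\<in>C. f c) = (1::'a)" if "\<And>c. f c * f c = 1" for f
    using that by (simp flip: prod.distrib)
  show "blade_sign (sd A B) C = blade_sign A C * (blade_sign B C :: 'a::comm_ring_1)"
    unfolding blade_sign_prod[OF s assms(3)] blade_sign_prod[OF assms(1,3)] blade_sign_prod[OF assms(2,3)]
    by (rule prod_sym_diff[OF assms(1,2)]) (auto intro!: sq)
  have "(\<Prod>b\<in>sd A B. if b \<le> a then - 1 else 1) = (\<Prod>b\<in>A. if b \<le> a then - 1 else (1::'a)) * (\<Prod>b\<in>B. if b \<le> a then - 1 else 1)" for a
    by (rule prod_sym_diff[OF assms(1,2)]) auto
  then show "blade_sign C (sd A B) = blade_sign C A * (blade_sign C B :: 'a::comm_ring_1)"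
    unfolding blade_sign_prod[OF assms(3) s] blade_sign_prod[OF assms(3,1)] blade_sign_prod[OF assms(3,2)]
    by (simp add: prod.distrib)
qed

lemma blade_sign_square: "blade_sign A B * blade_sign A B = (1::'a::comm_ring_1)"
  by (simp add: blade_sign_def flip: power_mult_distrib)

lemma cl_mult_assoc:
  fixes u v w :: "nat set \<Rightarrow> 'a::comm_ring_1"
  shows "cl_mult m (cl_mult m u v) w = cl_mult m u (cl_mult m v w)"
proof
  fix C
  show "cl_mult m (cl_mult m u v) w C = cl_mult m u (cl_mult m v w) C"
  proof (cases "C \<subseteq> {..<m}")
    case True
    have fin: "finite A" if "A \<in> Pow {..<m}" for A using that finite_subset by auto
    have fC: "finite C" using True fin by auto
    let ?P = "Pow {..<m}"
    have "cl_mult m (cl_mult m u v) w C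
       = (\<Sum>A\<in>?P. \<Sum>B\<in>?P. u B * v (sd B A) * blade_sign B (sd B A) * w (sd A C) * blade_sign A (sd A C))"
      using True by (simp add: cl_mult_def sum_distrib_right)
    also have "\<dots> = (\<Sum>B\<in>?P. \<Sum>A\<in>?P. u B * v (sd B A) * blade_sign B (sd B A) * w (sd A C) * blade_sign A (sd A C))"
      by (rule sum.swap)
    also have "\<dots> = (\<Sum>B\<in>?P. \<Sum>D\<in>?P. u B * (v D * w (sd D (sd B C)) * blade_sign D (sd D (sd B C))) * blade_sign B (sd B C))"
    proof (rule sum.cong[OF refl])
      fix B assume B: "B \<in> ?P"
      have fB: "finite B" using fin[OF B] .
      show "(\<Sum>A\<in>?P. u B * v (sd B A) * blade_sign B (sd B A) * w (sd A C) * blade_sign A (sd A C))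
        = (\<Sum>D\<in>?P. u B * (v D * w (sd D (sd B C)) * blade_sign D (sd D (sd B C))) * blade_sign B (sd B C))"
      \<comment> \<open>For a fixed blade B of u, a blade A of the product u v corresponds to the
        blade \<open>sd B A\<close> of v.\<close>
      proof (rule sum.reindex_bij_witness[of _ "sd B" "sd B"])
        fix A assume A: "A \<in> ?P"
        have fA: "finite A" using fin[OF A] .
        show i: "sd B (sd B A) = A" by auto
        then show "sd B (sd B A) = A" .
        show "sd B A \<in> ?P" "sd B A \<in> ?P" using A B by auto
        have e: "sd (sd B A) (sd B C) = sd A C" by auto
        have "blade_sign (sd B A) (sd A C) * blade_sign B (sd B C)
            = blade_sign B (sd B A) * (blade_sign A (sd A C) :: 'a)"
        proof -
          have f: "finite (sd A C)" using fA fC by auto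
          have "blade_sign (sd B A) (sd A C) * blade_sign B (sd B C)
            = (blade_sign B A * blade_sign B B) * (blade_sign A (sd A C)) * (blade_sign B C * (blade_sign B C :: 'a))"
            by (simp only: blade_sign_sd(1)[OF fB fA f] blade_sign_sd(2)[OF fA fC fB] blade_sign_sd(2)[OF fB fC fB] mult_ac)
          then show ?thesis by (simp add: blade_sign_square blade_sign_sd(2)[OF fB fA fB] mult_ac)
        qed
        then show "u B * (v (sd B A) * w (sd (sd B A) (sd B C)) * blade_sign (sd B A) (sd (sd B A) (sd B C))) * blade_sign B (sd B C)
          = u B * v (sd B A) * blade_sign B (sd B A) * w (sd A C) * blade_sign A (sd A C)"
          unfolding e by (simp add: mult_ac)
      qed
    qed
    also have "\<dots> = cl_mult m u (cl_mult m v w) C"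
    proof -
      have "sd B C \<subseteq> {..<m}" if "B \<in> ?P" for B using that True by auto
      then show ?thesis using True by (simp add: cl_mult_def sum_distrib_left sum_distrib_right)
    qed
    finally show ?thesis .
  next
    case False
    then show ?thesis by (simp add: cl_mult_def)
  qed
qed

section \<open>The action of unit vectors\<close>

text \<open>For a unit vector $\rho$, \<open>reflv\<close> is $x \mapsto \rho^{-1} x \rho$, \<open>Lv\<close> is $v \mapsto \rho v \rho^{-1}$ on
  $s$-vectors, and \<open>Hv\<close> is the H-action of $\rho$ on $s$-vector valued polynomials.\<close>

definition reflv :: "nat \<Rightarrow> (nat \<Rightarrow> real) \<Rightarrow> (nat \<Rightarrow> real) \<Rightarrow> nat \<Rightarrow> real" where
  "reflv m \<rho> x = (\<lambda>i. if i < m then 2 * dotp m \<rho> x * \<rho> i - x i else 0)"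

definition Lv :: "nat \<Rightarrow> nat \<Rightarrow> (nat \<Rightarrow> real) \<Rightarrow> (nat set \<Rightarrow> 'a::real_normed_field) \<Rightarrow> nat set \<Rightarrow> 'a" where
  "Lv m s \<rho> v = (\<lambda>A. (-1) ^ s * (evec m \<rho> (ivec m \<rho> v) A - ivec m \<rho> (evec m \<rho> v) A))"

definition Hv :: "nat \<Rightarrow> nat \<Rightarrow> (nat \<Rightarrow> real) \<Rightarrow> 'a::real_normed_field clfun \<Rightarrow> 'a clfun" where
  "Hv m s \<rho> P = (\<lambda>x. Lv m s \<rho> (P (reflv m \<rho> x)))"

abbreviation unitv :: "nat \<Rightarrow> (nat \<Rightarrow> real) \<Rightarrow> bool" where "unitv m \<rho> \<equiv> dotp m \<rho> \<rho> = 1"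

section \<open>Inverses in Pin(m) and reduction of the H-action to unit vectors\<close>

definition restr :: "nat \<Rightarrow> (nat set \<Rightarrow> 'a::zero) \<Rightarrow> nat set \<Rightarrow> 'a" where
  "restr m v = (\<lambda>A. if A \<subseteq> {..<m} then v A else 0)"

lemma cl_mult_restr: "cl_mult m (restr m u) v = cl_mult m u v" "cl_mult m u (restr m v) = cl_mult m u v"
proof -
  show "cl_mult m (restr m u) v = cl_mult m u v" unfolding cl_mult_def restr_def
    by (intro ext if_cong refl sum.cong) auto
  have "sd A C \<subseteq> {..<m}" if "A \<in> Pow {..<m}" "C \<subseteq> {..<m}" for A C :: "nat set" using that by auto
  then show "cl_mult m u (restr m v) = cl_mult m u v" unfolding cl_mult_def restr_def
    by (intro ext if_cong refl sum.cong) auto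
qed

lemma restr_supp: "supp m v \<Longrightarrow> restr m v = v"
  by (auto simp: restr_def supp_def)

lemma supp_restr: "supp m (restr m v)"
  by (auto simp: restr_def supp_def)

lemma cl_mult_one_left: "cl_mult m cl_one v = restr m v"
  using cl_mult_one[OF supp_restr, of m v] by (simp add: cl_mult_restr)

lemma cl_mult_one_right: "cl_mult m v cl_one = restr m v"
proof
  fix C
  show "cl_mult m v cl_one C = restr m v C"
  proof (cases "C \<subseteq> {..<m}")
    case True
    have "(\<Sum>A\<in>Pow {..<m}. v A * cl_one (sd A C) * blade_sign A (sd A C)) =
       (\<Sum>A\<in>{C}. v A * cl_one (sd A C) * blade_sign A (sd A C))"
      by (rule sum.mono_neutral_right) (use True in \<open>auto simp: cl_one_def\<close>)
    then show ?thesis using True by (simp add: cl_mult_def restr_def cl_one_def blade_sign_def)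
  qed (simp add: cl_mult_def restr_def)
qed

text \<open>The chosen inverse is arbitrary on index sets outside {..<m}, because
  \<open>cl_mult\<close> ignores them; uniqueness holds only after \<open>restr\<close>.\<close>

lemma cl_inv_unique:
  assumes "cl_mult m r t = cl_one" "cl_mult m t r = cl_one"
  shows "restr m (cl_inv m r) = restr m t"
proof -
  have i: "cl_mult m r (cl_inv m r) = cl_one \<and> cl_mult m (cl_inv m r) r = cl_one"
    unfolding cl_inv_def by (rule someI[of _ t]) (use assms in simp)
  have "restr m t = cl_mult m t (cl_mult m r (cl_inv m r))" using i by (simp add: cl_mult_one_right)
  also have "\<dots> = restr m (cl_inv m r)" by (simp add: assms cl_mult_one_left flip: cl_mult_assoc)
  finally show ?thesis by simp
qed

lemma cl_embed_mult: "cl_embed (cl_mult m u v) = (cl_mult m (cl_embed u) (cl_embed v) :: nat set \<Rightarrow> 'a::real_normed_field)"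
  by (auto simp: cl_embed_def cl_mult_def fun_eq_iff blade_sign_def)

lemma cl_embed_restr: "cl_embed (restr m u) = restr m (cl_embed u)"
  by (auto simp: cl_embed_def restr_def)

lemma cl_embed_one: "cl_embed cl_one = cl_one"
  by (auto simp: cl_embed_def cl_one_def)

lemma cl_embed_vec: "cl_embed (cl_vec m x) = cl_vec m x"
  by (auto simp: cl_embed_def cl_vec_def)

lemma Hact_inverse:
  assumes "cl_mult m r t = cl_one" "cl_mult m t r = cl_one"
  shows "Hact m r P = (\<lambda>x. cl_mult m (cl_embed r) (cl_mult m (P (coords (cl_mult m (cl_mult m t (cl_vec m x)) r))) (cl_embed t)))"
proof -
  have u: "restr m (cl_inv m r) = restr m t" by (rule cl_inv_unique[OF assms])
  have 1: "cl_mult m (cl_inv m r) v = cl_mult m t v" for v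
    using u cl_mult_restr(1) by metis
  have 2: "cl_mult m v (cl_embed (cl_inv m r)) = cl_mult m v (cl_embed t)" for v :: "nat set \<Rightarrow> 'a"
    using u cl_mult_restr(2) cl_embed_restr by metis
  show ?thesis unfolding Hact_def 1 2 ..
qed

lemma cl_vec_anticommute:
  "cl_mult m (cl_vec m x) (cl_vec m y) = (\<lambda>C. - cl_mult m (cl_vec m y) (cl_vec m x) C - 2 * of_real (dotp m x y) * (cl_one C :: 'a::real_normed_field))"
proof
  fix C
  let ?o = "cl_one :: nat set \<Rightarrow> 'a"
  have e: "cl_mult m (cl_vec m x) (cl_vec m y) C = evec m x (evec m y ?o) C + evec m x (ivec m y ?o) C + ivec m x (evec m y ?o) C + ivec m x (ivec m y ?o) C" for x y
  proof -
    have "cl_mult m (cl_vec m x) (cl_vec m y) = cl_mult m (cl_vec m x) (evec m y ?o + ivec m y ?o)"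
      by (subst cl_mult_vec_one[of m y, symmetric]) (simp add: cl_mult_vec[OF cl_one_supp] plus_fun_def)
    also have "\<dots> = evec m x (evec m y ?o + ivec m y ?o) + ivec m x (evec m y ?o + ivec m y ?o)"
      by (subst cl_mult_vec) (auto simp: plus_fun_def intro!: supp_add supp_evec supp_ivec cl_one_supp)
    finally show ?thesis by (simp add: evec_add ivec_add plus_fun_apply add_ac)
  qed
  have d: "dotp m y x = dotp m x y" by (simp add: dotp_def mult.commute)
  show "cl_mult m (cl_vec m x) (cl_vec m y) C = - cl_mult m (cl_vec m y) (cl_vec m x) C - 2 * of_real (dotp m x y) * (cl_one C :: 'a)"
    unfolding e using evec_evec[of m x y ?o C] ivec_ivec[of m x y ?o C] evec_ivec[of m x y ?o C] evec_ivec[of m y x ?o C, unfolded d]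
    by algebra
qed

lemma cl_vec_square: "cl_mult m (cl_vec m x) (cl_vec m x) = (\<lambda>C. - of_real (dotp m x x) * (cl_one C :: 'a::real_normed_field))"
  using cl_mult_vec_vec[OF cl_one_supp, of m x, where 'a = 'a] by (simp add: cl_mult_vec_one)

lemma cl_vec_unit_inverse:
  assumes "unitv m \<rho>"
  shows "cl_mult m (cl_vec m \<rho>) (\<lambda>A. - cl_vec m \<rho> A) = (cl_one :: nat set \<Rightarrow> 'a::real_normed_field)"
    and "cl_mult m (\<lambda>A. - cl_vec m \<rho> A) (cl_vec m \<rho>) = (cl_one :: nat set \<Rightarrow> 'a::real_normed_field)"
  using cl_mult_scale_right[of m "cl_vec m \<rho>" "-1" "cl_vec m \<rho> :: nat set \<Rightarrow> 'a"]
    cl_mult_scale_left[of m "-1" "cl_vec m \<rho>" "cl_vec m \<rho> :: nat set \<Rightarrow> 'a"]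
  by (simp_all add: cl_vec_square assms)

lemma cl_mult_add_right: "cl_mult m u (\<lambda>A. v A + w A) = (\<lambda>A. cl_mult m u v A + cl_mult m u w A)"
  by (auto simp: cl_mult_def fun_eq_iff algebra_simps sum.distrib)

text \<open>The inverse of a unit vector is its negative, since its square is -1, and anticommuting
  x past \<rho> gives the formula of \<open>reflv\<close>. It is minus the reflection in the
  hyperplane orthogonal to \<rho>: \<rho> is fixed and its complement is negated. The signs in all
  later transformation laws follow from this.\<close>

lemma reflect_vec:
  assumes "unitv m \<rho>"
  shows "cl_mult m (cl_mult m (\<lambda>A. - cl_vec m \<rho> A) (cl_vec m x)) (cl_vec m \<rho>) = (cl_vec m (reflv m \<rho> x) :: nat set \<Rightarrow> 'a::real_normed_field)"
proof -
  let ?r = "cl_vec m \<rho> :: nat set \<Rightarrow> 'a" and ?x = "cl_vec m x :: nat set \<Rightarrow> 'a"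
  have "cl_mult m (cl_mult m (\<lambda>A. - ?r A) ?x) ?r = cl_mult m (\<lambda>A. - ?r A) (cl_mult m ?x ?r)"
    by (rule cl_mult_assoc)
  also have "cl_mult m ?x ?r = (\<lambda>C. (-1) * cl_mult m ?r ?x C + (- 2 * of_real (dotp m x \<rho>)) * cl_one C)"
    by (subst cl_vec_anticommute) simp
  also have "cl_mult m (\<lambda>A. - ?r A) \<dots> = (\<lambda>A. - cl_mult m (\<lambda>A. - ?r A) (cl_mult m ?r ?x) A - 2 * of_real (dotp m x \<rho>) * - ?r A)"
    by (simp only: cl_mult_add_right cl_mult_scale_right cl_mult_one_right restr_supp[OF supp_scale[OF cl_vec_supp, of _ "-1", simplified]]) simp
  also have "cl_mult m (\<lambda>A. - ?r A) (cl_mult m ?r ?x) = ?x"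
    unfolding cl_mult_assoc[symmetric] cl_vec_unit_inverse(2)[OF assms] by (simp add: cl_mult_one_left restr_supp cl_vec_supp)
  finally show ?thesis
    by (auto simp: fun_eq_iff cl_vec_def reflv_def card_1_singleton_iff dotp_def mult.commute)
qed

lemma coords_vec: "coords (cl_vec m y) = (\<lambda>i. if i < m then y i else 0)"
  by (auto simp: coords_def cl_vec_def fun_eq_iff)

lemma hpoly_cong: "P \<in> hpoly m k s \<Longrightarrow> (\<And>i. i < m \<Longrightarrow> x i = y i) \<Longrightarrow> P x = P y"
  using hp_cong[OF hpoly_hp] by blast

lemma Hact_vec:
  assumes \<rho>: "unitv m \<rho>" and P: "P \<in> hpoly m k s"
  shows "Hact m (cl_vec m \<rho>) P = Hv m s \<rho> P"
proof (intro ext)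
  fix x A
  let ?r = "cl_vec m \<rho> :: nat set \<Rightarrow> 'a"
  let ?v = "P (reflv m \<rho> x)"
  have c: "coords (cl_vec m (reflv m \<rho> x)) = reflv m \<rho> x" by (auto simp: coords_vec reflv_def)
  have e: "cl_embed (\<lambda>A. - cl_vec m \<rho> A) = (\<lambda>A. (-1) * ?r A)"
    by (auto simp: cl_embed_def cl_vec_def fun_eq_iff)
  have g: "graded m s ?v" by (rule hpoly_graded[OF P])
  have s: "supp m ?v" by (rule graded_supp[OF g])
  have s2: "supp m (evec m \<rho> ?v + (\<lambda>C. (-1) * ivec m \<rho> ?v C))"
    unfolding plus_fun_def by (intro supp_add supp_scale supp_evec supp_ivec s)
  have "Hact m (cl_vec m \<rho>) P x = cl_mult m ?r (cl_mult m ?v (\<lambda>A. (-1) * ?r A))"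
    unfolding Hact_inverse[OF cl_vec_unit_inverse[OF \<rho>]] reflect_vec[OF \<rho>] c e cl_embed_vec ..
  also have "\<dots> = (\<lambda>C. (-1) ^ Suc s * cl_mult m ?r (evec m \<rho> ?v + (\<lambda>C. (-1) * ivec m \<rho> ?v C)) C)"
    unfolding cl_mult_scale_right cl_mult_vec_right[OF g] plus_fun_def by (simp add: mult.assoc)
  also have "\<dots> = (\<lambda>C. (-1) ^ Suc s * (evec m \<rho> (evec m \<rho> ?v + (\<lambda>C. (-1) * ivec m \<rho> ?v C)) C + ivec m \<rho> (evec m \<rho> ?v + (\<lambda>C. (-1) * ivec m \<rho> ?v C)) C))"
    by (simp only: cl_mult_vec[OF s2])
  finally show "Hact m (cl_vec m \<rho>) P x A = Hv m s \<rho> P x A"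
    by (simp only: evec_add ivec_add evec_scale ivec_scale plus_fun_apply evec_self ivec_self Hv_def Lv_def) (simp add: algebra_simps)
qed

lemma pin_induct [consumes 1, case_names one mult]:
  assumes "r \<in> pin m" "Q cl_one"
    and "\<And>\<rho> r. unitv m \<rho> \<Longrightarrow> r \<in> pin m \<Longrightarrow> Q r \<Longrightarrow> Q (cl_mult m (cl_vec m \<rho>) r)"
  shows "Q r"
proof -
  obtain xs where xs: "r = foldr (cl_mult m) (map (cl_vec m) xs) cl_one" "\<forall>x \<in> set xs. (\<Sum>i<m. (x i)\<^sup>2) = 1"
    using assms(1) unfolding pin_def by blast
  have "\<forall>x \<in> set xs. unitv m x \<Longrightarrow> foldr (cl_mult m) (map (cl_vec m) xs) cl_one \<in> pin m \<and> Q (foldr (cl_mult m) (map (cl_vec m) xs) cl_one)" for xs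
  proof (induction xs)
    case Nil
    have "cl_one \<in> pin m" unfolding pin_def by (rule CollectI, rule exI[of _ "[]"]) simp
    then show ?case using assms(2) by simp
  next
    case (Cons x xs)
    have "foldr (cl_mult m) (map (cl_vec m) (x # xs)) cl_one \<in> pin m"
      unfolding pin_def using Cons.prems by (intro CollectI exI[of _ "x # xs"]) (auto simp: dotp_def power2_eq_square)
    then show ?case using Cons assms(3) by simp
  qed
  then show ?thesis using xs by (auto simp: dotp_def power2_eq_square)
qed

lemma pin_vec: "unitv m \<rho> \<Longrightarrow> cl_vec m \<rho> \<in> pin m"
  unfolding pin_def by (intro CollectI exI[of _ "[\<rho>]"]) (simp add: cl_mult_vec_one dotp_def power2_eq_square)

lemma pin_inverse: "r \<in> pin m \<Longrightarrow> \<exists>t. cl_mult m r t = cl_one \<and> cl_mult m t r = cl_one"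
proof (induction rule: pin_induct)
  case one
  show ?case by (rule exI[of _ cl_one]) (simp add: cl_mult_one_left restr_supp cl_one_supp)
next
  case (mult \<rho> r)
  then obtain t where t: "cl_mult m r t = cl_one" "cl_mult m t r = cl_one" by blast
  let ?q = "cl_vec m \<rho> :: nat set \<Rightarrow> real" and ?q' = "\<lambda>A. - cl_vec m \<rho> A :: real"
  have "cl_mult m (cl_mult m ?q r) (cl_mult m t ?q') = cl_mult m ?q (cl_mult m (cl_mult m r t) ?q')"
    by (simp only: cl_mult_assoc)
  also have "\<dots> = cl_one" by (simp only: t cl_mult_one_left cl_mult_restr cl_vec_unit_inverse[OF mult(1)])
  finally have 1: "cl_mult m (cl_mult m ?q r) (cl_mult m t ?q') = cl_one" .
  have "cl_mult m (cl_mult m t ?q') (cl_mult m ?q r) = cl_mult m t (cl_mult m (cl_mult m ?q' ?q) r)"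
    by (simp only: cl_mult_assoc)
  also have "\<dots> = cl_one" by (simp only: t cl_mult_one_left cl_mult_restr cl_vec_unit_inverse[OF mult(1)])
  finally show ?case using 1 by blast
qed

lemma Hact_mult:
  assumes \<rho>: "unitv m \<rho>" and r: "r \<in> pin m"
  shows "Hact m (cl_mult m (cl_vec m \<rho>) r) P = Hact m (cl_vec m \<rho>) (Hact m r P)"
proof -
  obtain t where t: "cl_mult m r t = cl_one" "cl_mult m t r = cl_one" using pin_inverse[OF r] by blast
  let ?q = "cl_vec m \<rho> :: nat set \<Rightarrow> real" and ?q' = "\<lambda>A. - cl_vec m \<rho> A :: real"
  have 1: "cl_mult m (cl_mult m ?q r) (cl_mult m t ?q') = cl_one"
  proof -
    have "cl_mult m (cl_mult m ?q r) (cl_mult m t ?q') = cl_mult m ?q (cl_mult m (cl_mult m r t) ?q')"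
      by (simp only: cl_mult_assoc)
    then show ?thesis by (simp only: t cl_mult_one_left cl_mult_restr cl_vec_unit_inverse[OF \<rho>])
  qed
  have 2: "cl_mult m (cl_mult m t ?q') (cl_mult m ?q r) = cl_one"
  proof -
    have "cl_mult m (cl_mult m t ?q') (cl_mult m ?q r) = cl_mult m t (cl_mult m (cl_mult m ?q' ?q) r)"
      by (simp only: cl_mult_assoc)
    then show ?thesis by (simp only: t cl_mult_one_left cl_mult_restr cl_vec_unit_inverse[OF \<rho>])
  qed
  have c: "cl_vec m (coords (cl_mult m (cl_mult m ?q' (cl_vec m x)) ?q)) = cl_mult m (cl_mult m ?q' (cl_vec m x)) ?q" for x
    unfolding reflect_vec[OF \<rho>] coords_vec by (auto simp: cl_vec_def fun_eq_iff card_1_singleton_iff)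
  show ?thesis
    unfolding Hact_inverse[OF 1 2] Hact_inverse[OF t] Hact_inverse[OF cl_vec_unit_inverse[OF \<rho>]] c cl_embed_mult
    by (simp only: cl_mult_assoc)
qed

lemma Hact_one:
  assumes "P \<in> hpoly m k s"
  shows "Hact m cl_one P = P"
proof
  fix x
  have o: "cl_mult m cl_one cl_one = (cl_one :: nat set \<Rightarrow> real)" by (simp add: cl_mult_one_left restr_supp cl_one_supp)
  have "P (coords (cl_vec m x)) = P x" by (rule hpoly_cong[OF assms]) (simp add: coords_vec)
  then show "Hact m cl_one P x = P x"
    unfolding Hact_inverse[OF o o] cl_embed_one cl_mult_one_left cl_mult_one_right
    by (simp add: restr_supp cl_vec_supp graded_supp[OF hpoly_graded[OF assms]])
qed

text \<open>Elements of \<open>pin\<close> are products of unit vectors and the action is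
  multiplicative, so invariance can be tested on single unit vectors, where the action has the
  closed form \<open>Hv\<close>.\<close>

lemma invariant_iff:
  assumes W: "W \<subseteq> hpoly m k s"
  shows "invariant m W \<longleftrightarrow> (\<forall>\<rho>. unitv m \<rho> \<longrightarrow> (\<forall>P\<in>W. Hv m s \<rho> P \<in> W))"
proof
  assume "invariant m W"
  then show "\<forall>\<rho>. unitv m \<rho> \<longrightarrow> (\<forall>P\<in>W. Hv m s \<rho> P \<in> W)"
    using pin_vec Hact_vec W unfolding invariant_def by (metis subsetD)
next
  assume v: "\<forall>\<rho>. unitv m \<rho> \<longrightarrow> (\<forall>P\<in>W. Hv m s \<rho> P \<in> W)"
  have "\<forall>P\<in>W. Hact m r P \<in> W" if "r \<in> pin m" for r
    using that
  proof (induction rule: pin_induct)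
    case one
    then show ?case using Hact_one W by (metis subsetD)
  next
    case (mult \<rho> r)
    show ?case
    proof
      fix P assume P: "P \<in> W"
      have "Hact m r P \<in> W" using mult P by blast
      then show "Hact m (cl_mult m (cl_vec m \<rho>) r) P \<in> W"
        unfolding Hact_mult[OF mult(1,2)] using Hact_vec[OF mult(1)] v mult(1) W by (metis subsetD)
    qed
  qed
  then show "invariant m W" unfolding invariant_def by blast
qed

section \<open>Equivariance of wedge, contraction and derivatives\<close>

lemma evec_cong: "(\<And>i. i < m \<Longrightarrow> x i = y i) \<Longrightarrow> evec m x = evec m y"
  and ivec_cong: "(\<And>i. i < m \<Longrightarrow> x i = y i) \<Longrightarrow> ivec m x = ivec m y"
  by (auto simp: evec_def ivec_def fun_eq_iff intro!: sum.cong)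

lemma evec_uminus: "evec m x (- v) = - evec m x v" and ivec_uminus: "ivec m x (- v) = - ivec m x v"
  using evec_scale[of m x "-1" v] ivec_scale[of m x "-1" v] by (auto simp: fun_eq_iff fun_Compl_def)

lemma evec_diff: "evec m x (v - w) = evec m x v - evec m x w" and ivec_diff: "ivec m x (v - w) = ivec m x v - ivec m x w"
  using evec_add[of m x v "- w"] ivec_add[of m x v "- w"] by (auto simp: evec_uminus ivec_uminus)

definition smul :: "'a::times \<Rightarrow> (nat set \<Rightarrow> 'a) \<Rightarrow> nat set \<Rightarrow> 'a" where
  "smul c v = (\<lambda>A. c * v A)"

lemma evec_smul: "evec m x (smul c v) = smul c (evec m x v)" and ivec_smul: "ivec m x (smul c v) = smul c (ivec m x v)"
  by (simp_all add: smul_def evec_scale ivec_scale)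

lemma smul_simps: "smul c (v + w) = smul c v + smul c w" "smul c (v - w) = smul c v - smul c (w :: nat set \<Rightarrow> 'a::comm_ring_1)"
  "smul c (smul d v) = smul (c * d) v" "smul (-1) v = - v" "smul 1 v = v" "smul c (- v) = - smul c v"
  by (auto simp: smul_def fun_eq_iff algebra_simps plus_fun_apply)

lemma car: "evec m x (ivec m y v) = - smul (of_real (dotp m x y)) v - ivec m y (evec m x v)"
  using evec_ivec[of m x y v] by (auto simp: smul_def fun_eq_iff eq_diff_eq)

lemma car': "ivec m y (evec m x v) = - smul (of_real (dotp m x y)) v - evec m x (ivec m y v)"
  unfolding car[of m x y v] by simp

lemma evec_anti: "evec m x (evec m y v) = - evec m y (evec m x v)"
  and ivec_anti: "ivec m x (ivec m y v) = - ivec m y (ivec m x v)"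
  using evec_evec[of m x y v] ivec_ivec[of m x y v] by (auto simp: fun_eq_iff)

lemma evec_nil: "evec m x (evec m x v) = 0" and ivec_nil: "ivec m x (ivec m x v) = 0"
  by (auto simp: fun_eq_iff evec_self ivec_self zero_fun_apply)

lemma dotp_commute: "dotp m x y = dotp m y x"
  by (simp add: dotp_def mult.commute)

lemma Lv_alt: "Lv m s \<rho> v = smul ((-1) ^ s) (evec m \<rho> (ivec m \<rho> v) - ivec m \<rho> (evec m \<rho> v))"
  by (simp add: Lv_def smul_def)

lemma evec_reflv: "evec m (reflv m \<rho> x) v = smul (2 * of_real (dotp m \<rho> x)) (evec m \<rho> v) - evec m x v"
  and ivec_reflv: "ivec m (reflv m \<rho> x) v = smul (2 * of_real (dotp m \<rho> x)) (ivec m \<rho> v) - ivec m x v"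
proof -
  have "of_real (reflv m \<rho> x j) = 2 * of_real (dotp m \<rho> x) * of_real (\<rho> j) - (of_real (x j) :: 'a)" if "j < m" for j
    using that by (simp add: reflv_def)
  then show "evec m (reflv m \<rho> x) v = smul (2 * of_real (dotp m \<rho> x)) (evec m \<rho> v) - evec m x v"
    "ivec m (reflv m \<rho> x) v = smul (2 * of_real (dotp m \<rho> x)) (ivec m \<rho> v) - ivec m x v"
    by (auto simp: evec_def ivec_def smul_def fun_eq_iff sum_distrib_left left_diff_distrib mult.assoc simp flip: sum_subtractf intro!: sum.cong)
qed

text \<open>Conjugation by \<rho> is an algebra automorphism, so it acts on x and on v separately.
  In terms of \<open>?N\<close> = e i - i e the law carries a minus sign, which is absorbed when
  (-1)^s becomes (-1)^(s+1).\<close>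

lemma Lv_evec:
  assumes "unitv m \<rho>"
  shows "Lv m (Suc s) \<rho> (evec m x v) = evec m (reflv m \<rho> x) (Lv m s \<rho> v)"
proof -
  let ?N = "\<lambda>v. evec m \<rho> (ivec m \<rho> v) - ivec m \<rho> (evec m \<rho> v)"
  let ?p = "of_real (dotp m \<rho> x) :: 'a"
  have 1: "evec m \<rho> (ivec m \<rho> (evec m x v)) = - smul ?p (evec m \<rho> v) + evec m x (evec m \<rho> (ivec m \<rho> v))"
    unfolding car'[of m \<rho> x v] evec_diff evec_uminus evec_smul evec_anti[of m \<rho> x] by (simp add: dotp_commute)
  have 2: "ivec m \<rho> (evec m \<rho> (evec m x v)) = smul ?p (evec m \<rho> v) + evec m x (ivec m \<rho> (evec m \<rho> v))"
    unfolding evec_anti[of m \<rho> x v] ivec_uminus car'[of m \<rho> x "evec m \<rho> v"] by (simp add: dotp_commute)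
  have 3: "evec m \<rho> (?N v) = evec m \<rho> v"
    unfolding evec_diff evec_nil car[of m \<rho> \<rho> "evec m \<rho> v"] by (simp add: assms smul_simps)
  have "?N (evec m x v) = evec m x (?N v) - smul (2 * ?p) (evec m \<rho> v)"
    unfolding 1 2 evec_diff by (simp add: fun_eq_iff smul_def plus_fun_apply algebra_simps)
  also have "\<dots> = - evec m (reflv m \<rho> x) (?N v)" unfolding evec_reflv 3 by simp
  finally show ?thesis unfolding Lv_alt evec_smul by (simp add: fun_eq_iff smul_def)
qed

lemma Lv_ivec:
  assumes "unitv m \<rho>"
  shows "Lv m s \<rho> (ivec m x v) = ivec m (reflv m \<rho> x) (Lv m (Suc s) \<rho> v)"
proof -
  let ?N = "\<lambda>v. evec m \<rho> (ivec m \<rho> v) - ivec m \<rho> (evec m \<rho> v)"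
  let ?p = "of_real (dotp m \<rho> x) :: 'a"
  have 1: "ivec m \<rho> (evec m \<rho> (ivec m x v)) = - smul ?p (ivec m \<rho> v) + ivec m x (ivec m \<rho> (evec m \<rho> v))"
    unfolding car[of m \<rho> x v] ivec_diff ivec_uminus ivec_smul ivec_anti[of m \<rho> x] by simp
  have 2: "evec m \<rho> (ivec m \<rho> (ivec m x v)) = smul ?p (ivec m \<rho> v) + ivec m x (evec m \<rho> (ivec m \<rho> v))"
    unfolding ivec_anti[of m \<rho> x v] evec_uminus car[of m \<rho> x "ivec m \<rho> v"] by simp
  have 3: "ivec m \<rho> (?N v) = - ivec m \<rho> v"
    unfolding ivec_diff ivec_nil car'[of m \<rho> \<rho> "ivec m \<rho> v"] by (simp add: assms smul_simps)
  have "?N (ivec m x v) = ivec m x (?N v) + smul (2 * ?p) (ivec m \<rho> v)"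
    unfolding 1 2 ivec_diff by (simp add: fun_eq_iff smul_def plus_fun_apply algebra_simps)
  also have "\<dots> = - ivec m (reflv m \<rho> x) (?N v)" unfolding ivec_reflv 3 by (simp add: smul_simps)
  finally show ?thesis unfolding Lv_alt ivec_smul by (simp add: fun_eq_iff smul_def)
qed

text \<open>For a unit vector, i e = -1 - e i, so e i - i e = 1 + 2 e i. Moreover -(e i) is a
  projection, whence 1 + 2 e i squares to 1.\<close>

lemma Lv_Lv:
  assumes "unitv m \<rho>"
  shows "Lv m s \<rho> (Lv m s \<rho> v) = v"
proof -
  let ?N = "\<lambda>v. evec m \<rho> (ivec m \<rho> v) - ivec m \<rho> (evec m \<rho> v)"
  have N: "?N v = v + smul 2 (evec m \<rho> (ivec m \<rho> v))" for v
    unfolding car'[of m \<rho> \<rho> v] by (simp add: assms smul_simps fun_eq_iff smul_def plus_fun_apply)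
  have i: "ivec m \<rho> (?N v) = - ivec m \<rho> v" for v
    unfolding ivec_diff ivec_nil car'[of m \<rho> \<rho> "ivec m \<rho> v"] by (simp add: assms smul_simps)
  have NN: "?N (?N v) = v"
  proof -
    have "?N (?N v) = ?N v + smul 2 (evec m \<rho> (ivec m \<rho> (?N v)))" by (rule N)
    also have "\<dots> = ?N v - smul 2 (evec m \<rho> (ivec m \<rho> v))" unfolding i evec_uminus smul_simps(6) by simp
    finally show ?thesis unfolding N by simp
  qed
  have p: "(-1) ^ s * (-1) ^ s = (1::'a)" by (simp flip: power_mult_distrib)
  have s: "?N (smul ((-1) ^ s) v) = smul ((-1) ^ s) (?N v)" for v
    by (simp add: evec_smul ivec_smul smul_simps)
  show ?thesis unfolding Lv_alt s smul_simps(3) NN p by (simp add: smul_simps)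
qed

lemma Lv_graded: "graded m s v \<Longrightarrow> graded m s (Lv m s' \<rho> v)"
proof -
  assume v: "graded m s v"
  have 1: "graded m s (evec m \<rho> (ivec m \<rho> v))"
  proof (cases s)
    case 0
    then have "ivec m \<rho> v = 0" using v ivec_graded_0 by blast
    then show ?thesis by (simp add: graded_def zero_fun_apply)
  next
    case (Suc t)
    then show ?thesis using v by (auto intro: graded_evec graded_ivec)
  qed
  have 2: "graded m s (ivec m \<rho> (evec m \<rho> v))" using v by (auto intro: graded_evec graded_ivec)
  show ?thesis using 1 2 by (auto simp: graded_def Lv_def)
qed

lemma Lv_add: "Lv m s \<rho> (v + w) = Lv m s \<rho> v + Lv m s \<rho> w"
  by (simp add: Lv_def evec_add ivec_add fun_eq_iff plus_fun_apply algebra_simps)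

lemma Lv_scale: "Lv m s \<rho> (\<lambda>A. c * v A) = (\<lambda>A. c * Lv m s \<rho> v A)"
  by (simp add: Lv_def evec_scale ivec_scale fun_eq_iff algebra_simps)

lemma Lv_zero: "Lv m s \<rho> 0 = 0"
  by (simp add: Lv_def fun_eq_iff zero_fun_apply)

lemma Lv_fsum: "Lv m s \<rho> (\<lambda>A. \<Sum>i\<in>I. f i A) = (\<lambda>A. \<Sum>i\<in>I. Lv m s \<rho> (f i) A)"
  by (simp add: Lv_def evec_fsum ivec_fsum fun_eq_iff sum_distrib_left right_diff_distrib sum_subtractf)

lemma dotp_reflv_right: "dotp m x (reflv m \<rho> y) = 2 * dotp m \<rho> y * dotp m x \<rho> - dotp m x y"
proof -
  define c where "c = dotp m \<rho> y"
  have "dotp m x (reflv m \<rho> y) = (\<Sum>j<m. 2 * c * (x j * \<rho> j) - x j * y j)"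
    unfolding dotp_def[of m x] by (intro sum.cong) (auto simp: reflv_def c_def algebra_simps)
  then show ?thesis by (simp add: sum_subtractf dotp_def c_def flip: sum_distrib_left)
qed

lemma reflv_reflv:
  assumes "unitv m \<rho>" "i < m"
  shows "reflv m \<rho> (reflv m \<rho> x) i = x i"
proof -
  show ?thesis using assms by (simp add: reflv_def[of m \<rho> "reflv m \<rho> x"] dotp_reflv_right) (simp add: reflv_def)
qed

text \<open>The matrix of the map is symmetric, so its row i can be written as the image of
  e_i.\<close>

lemma reflv_linear: "i < m \<Longrightarrow> reflv m \<rho> x i = (\<Sum>j<m. reflv m \<rho> (unit_vec i) j * x j)"
proof -
  assume i: "i < m"
  have d: "dotp m \<rho> (unit_vec i) = \<rho> i"
    using i by (simp add: dotp_def unit_vec_def if_distrib[of "\<lambda>u. _ * u"] cong: if_cong)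
  have "(\<Sum>j<m. reflv m \<rho> (unit_vec i) j * x j) = (\<Sum>j<m. 2 * \<rho> i * (\<rho> j * x j) - (if j = i then x j else 0))"
    by (intro sum.cong refl) (simp add: reflv_def d, simp add: unit_vec_def algebra_simps)
  also have "\<dots> = 2 * \<rho> i * dotp m \<rho> x - x i"
    using i by (simp add: sum_subtractf dotp_def sum_distrib_left)
  finally show ?thesis using i by (simp add: reflv_def)
qed

lemma reflv_orthogonal:
  assumes "unitv m \<rho>" "i < m" "l < m"
  shows "(\<Sum>j<m. reflv m \<rho> (unit_vec i) j * reflv m \<rho> (unit_vec l) j) = (if i = l then 1 else 0)"
  using reflv_linear[OF assms(2), of \<rho> "reflv m \<rho> (unit_vec l)"] reflv_reflv[OF assms(1,2), of "unit_vec l"]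
  by (simp add: unit_vec_def)

lemma hp_subst_reflv: "hp m k f \<Longrightarrow> hp m k (\<lambda>x. f (reflv m \<rho> x))"
  by (rule hp_linear_subst(1)[where a = "\<lambda>i. reflv m \<rho> (unit_vec i)"]) (auto simp: reflv_linear)

lemma hpoly_subst_reflv: "P \<in> hpoly m k s \<Longrightarrow> (\<lambda>x. P (reflv m \<rho> x)) \<in> hpoly m k s"
  by (auto simp: hpoly_iff intro: hp_subst_reflv)

lemma pderiv_cl_subst_reflv:
  assumes "P \<in> hpoly m k s" "j < m"
  shows "pderiv_cl j (\<lambda>x. P (reflv m \<rho> x)) x A = (\<Sum>i<m. of_real (reflv m \<rho> (unit_vec i) j) * pderiv_cl i P (reflv m \<rho> x) A)"
  unfolding pderiv_cl_pd
  by (rule hp_linear_subst(2)[OF hpoly_hp[OF assms(1)], where a = "\<lambda>i. reflv m \<rho> (unit_vec i)"]) (auto simp: reflv_linear assms)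

lemma hp_evec: "(\<And>A. hp m k (\<lambda>x. P x A)) \<Longrightarrow> hp m k (\<lambda>x. evec m \<rho> (P x) A)"
  unfolding evec_def by (intro hp_sum hp_scale hp_eps)

lemma hp_ivec: "(\<And>A. hp m k (\<lambda>x. P x A)) \<Longrightarrow> hp m k (\<lambda>x. ivec m \<rho> (P x) A)"
  unfolding ivec_def by (intro hp_sum hp_scale hp_iot)

lemma hp_diff: "hp m k f \<Longrightarrow> hp m k g \<Longrightarrow> hp m k (\<lambda>x. f x - g x)"
  using hp.add[of m k f "\<lambda>x. - g x"] hp_uminus[of m k g] by simp

lemma hp_Lv: "(\<And>A. hp m k (\<lambda>x. P x A)) \<Longrightarrow> hp m k (\<lambda>x. Lv m s \<rho> (P x) A)"
  unfolding Lv_def by (intro hp_scale hp_diff hp_evec hp_ivec)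

lemma pd_evec: "(\<And>A. pdable (\<lambda>x. P x A)) \<Longrightarrow> pd j (\<lambda>x. evec m \<rho> (P x) A) x = evec m \<rho> (pderiv_cl j P x) A \<and> pdable (\<lambda>x. evec m \<rho> (P x) A)"
proof -
  assume p: "\<And>A. pdable (\<lambda>x. P x A)"
  have e: "pdable (\<lambda>x. eps i (P x) A)" for i A by (cases "i \<in> A") (auto simp: eps_def pdable_const intro: pdable_scale p)
  show ?thesis unfolding evec_def by (simp add: pd_sum pd_scale pdable_scale e pd_eps p pdable_sum)
qed

lemma pd_ivec: "(\<And>A. pdable (\<lambda>x. P x A)) \<Longrightarrow> pd j (\<lambda>x. ivec m \<rho> (P x) A) x = ivec m \<rho> (pderiv_cl j P x) A \<and> pdable (\<lambda>x. ivec m \<rho> (P x) A)"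
proof -
  assume p: "\<And>A. pdable (\<lambda>x. P x A)"
  have e: "pdable (\<lambda>x. iot i (P x) A)" for i A
    using pdable_scale[OF p, of "- sg i A"] by (cases "i \<in> A") (auto simp: iot_def pdable_const)
  show ?thesis unfolding ivec_def by (simp add: pd_sum pd_scale pdable_scale e pd_iot p pdable_sum)
qed

lemma pderiv_cl_Lv:
  assumes "P \<in> hpoly m k s"
  shows "pderiv_cl j (\<lambda>x. Lv m s' \<rho> (P x)) x = Lv m s' \<rho> (pderiv_cl j P x)"
proof
  fix A
  have p: "pdable (\<lambda>x. P x A)" for A by (rule hpoly_pdable[OF assms])
  have a: "pdable (\<lambda>x. evec m \<rho> (P x) A)" "pdable (\<lambda>x. ivec m \<rho> (P x) A)" for A
    using pd_evec[OF p] pd_ivec[OF p] by auto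
  have b: "pderiv_cl j (\<lambda>x. evec m \<rho> (P x)) x = evec m \<rho> (pderiv_cl j P x)" "pderiv_cl j (\<lambda>x. ivec m \<rho> (P x)) x = ivec m \<rho> (pderiv_cl j P x)" for x
    using pd_evec[OF p] pd_ivec[OF p] by (auto simp: pderiv_cl_pd[of _ "\<lambda>x. evec m \<rho> (P x)"] pderiv_cl_pd[of _ "\<lambda>x. ivec m \<rho> (P x)"])
  let ?f = "\<lambda>x. evec m \<rho> (ivec m \<rho> (P x)) A" and ?g = "\<lambda>x. ivec m \<rho> (evec m \<rho> (P x)) A"
  have f: "pd j ?f x = evec m \<rho> (ivec m \<rho> (pderiv_cl j P x)) A" "pdable ?f"
    using pd_evec[of "\<lambda>x. ivec m \<rho> (P x)", OF a(2)] b by auto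
  have g: "pd j ?g x = ivec m \<rho> (evec m \<rho> (pderiv_cl j P x)) A" "pdable ?g"
    using pd_ivec[of "\<lambda>x. evec m \<rho> (P x)", OF a(1)] b by auto
  have "pd j (\<lambda>x. (-1) ^ s' * (?f x + (-1) * ?g x)) x = (-1) ^ s' * (pd j ?f x + (-1) * pd j ?g x)"
    by (simp only: pd_scale pdable_scale pdable_add pd_add f(2) g(2))
  moreover have "(\<lambda>x. Lv m s' \<rho> (P x) A) = (\<lambda>x. (-1) ^ s' * (?f x + (-1) * ?g x))" by (simp add: Lv_def)
  ultimately have "pd j (\<lambda>x. Lv m s' \<rho> (P x) A) x = (-1) ^ s' * (pd j ?f x + (-1) * pd j ?g x)" by (simp only:)
  then show "pderiv_cl j (\<lambda>x. Lv m s' \<rho> (P x)) x A = Lv m s' \<rho> (pderiv_cl j P x) A"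
    unfolding pderiv_cl_pd[of j "\<lambda>x. Lv m s' \<rho> (P x)"] f(1) g(1) by (simp add: Lv_def)
qed

lemma Hv_hpoly: "P \<in> hpoly m k s \<Longrightarrow> Hv m s \<rho> P \<in> hpoly m k s"
  unfolding Hv_def
  by (intro hpolyI Lv_graded hp_Lv[where P = "\<lambda>x. P (reflv m \<rho> x)"] hpoly_hp[OF hpoly_subst_reflv]) (auto intro: hpoly_graded hpoly_hp)

lemma pderiv_cl_Hv:
  assumes "P \<in> hpoly m k s" "j < m"
  shows "pderiv_cl j (Hv m s \<rho> P) x A = (\<Sum>i<m. of_real (reflv m \<rho> (unit_vec i) j) * Hv m s \<rho> (pderiv_cl i P) x A)"
proof -
  have e: "pderiv_cl j (\<lambda>x. P (reflv m \<rho> x)) x = (\<lambda>A. \<Sum>i<m. of_real (reflv m \<rho> (unit_vec i) j) * pderiv_cl i P (reflv m \<rho> x) A)"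
    using pderiv_cl_subst_reflv[OF assms] by (auto simp: fun_eq_iff)
  show ?thesis unfolding Hv_def pderiv_cl_Lv[OF hpoly_subst_reflv[OF assms(1)]] e Lv_fsum Lv_scale ..
qed

text \<open>The chain rule brings in the matrix of the reflection. Summed over j it assembles the
  e_j into the reflected e_i, and \<open>Lv_evec\<close> pulls this out as e_i acting before
  \<open>Lv\<close>.\<close>

lemma dd_Hv:
  assumes \<rho>: "unitv m \<rho>" and P: "P \<in> hpoly m k s"
  shows "dd m (Hv m s \<rho> P) = Hv m (Suc s) \<rho> (dd m P)"
proof (intro ext)
  fix x A
  let ?a = "\<lambda>i j. of_real (reflv m \<rho> (unit_vec i) j) :: 'a"
  have e: "pderiv_cl j (Hv m s \<rho> P) x = (\<lambda>A. \<Sum>i<m. ?a i j * Hv m s \<rho> (pderiv_cl i P) x A)" if "j < m" for j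
    using pderiv_cl_Hv[OF P that] by (auto simp: fun_eq_iff)
  have "dd m (Hv m s \<rho> P) x A = (\<Sum>j<m. \<Sum>i<m. ?a i j * eps j (Hv m s \<rho> (pderiv_cl i P) x) A)"
    unfolding dd_def by (rule sum.cong) (auto simp: e eps_fsum eps_scale)
  also have "\<dots> = (\<Sum>i<m. \<Sum>j<m. ?a i j * eps j (Hv m s \<rho> (pderiv_cl i P) x) A)" by (rule sum.swap)
  also have "\<dots> = (\<Sum>i<m. evec m (reflv m \<rho> (unit_vec i)) (Hv m s \<rho> (pderiv_cl i P) x) A)"
    by (simp add: evec_def)
  also have "\<dots> = (\<Sum>i<m. Lv m (Suc s) \<rho> (eps i (pderiv_cl i P (reflv m \<rho> x))) A)"
    unfolding Hv_def Lv_evec[OF \<rho>, symmetric] by (rule sum.cong) (auto simp: evec_unit)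
  finally show "dd m (Hv m s \<rho> P) x A = Hv m (Suc s) \<rho> (dd m P) x A" by (simp add: Hv_def dd_def Lv_fsum)
qed

lemma de_Hv:
  assumes \<rho>: "unitv m \<rho>" and P: "P \<in> hpoly m k (Suc s)"
  shows "de m (Hv m (Suc s) \<rho> P) = Hv m s \<rho> (de m P)"
proof (intro ext)
  fix x A
  let ?a = "\<lambda>i j. of_real (reflv m \<rho> (unit_vec i) j) :: 'a"
  have e: "pderiv_cl j (Hv m (Suc s) \<rho> P) x = (\<lambda>A. \<Sum>i<m. ?a i j * Hv m (Suc s) \<rho> (pderiv_cl i P) x A)" if "j < m" for j
    using pderiv_cl_Hv[OF P that] by (auto simp: fun_eq_iff)
  have "de m (Hv m (Suc s) \<rho> P) x A = (\<Sum>j<m. \<Sum>i<m. ?a i j * iot j (Hv m (Suc s) \<rho> (pderiv_cl i P) x) A)"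
    unfolding de_def by (rule sum.cong) (auto simp: e iot_fsum iot_scale)
  also have "\<dots> = (\<Sum>i<m. \<Sum>j<m. ?a i j * iot j (Hv m (Suc s) \<rho> (pderiv_cl i P) x) A)" by (rule sum.swap)
  also have "\<dots> = (\<Sum>i<m. ivec m (reflv m \<rho> (unit_vec i)) (Hv m (Suc s) \<rho> (pderiv_cl i P) x) A)"
    by (simp add: ivec_def)
  also have "\<dots> = (\<Sum>i<m. Lv m s \<rho> (iot i (pderiv_cl i P (reflv m \<rho> x))) A)"
    unfolding Hv_def Lv_ivec[OF \<rho>, symmetric] by (rule sum.cong) (auto simp: ivec_unit)
  finally show "de m (Hv m (Suc s) \<rho> P) x A = Hv m s \<rho> (de m P) x A" by (simp add: Hv_def de_def Lv_fsum)
qed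

lemma xe_Hv:
  assumes "unitv m \<rho>"
  shows "xe m (Hv m s \<rho> P) = Hv m (Suc s) \<rho> (xe m P)"
proof
  fix x
  have "evec m (reflv m \<rho> (reflv m \<rho> x)) = (evec m x :: _ \<Rightarrow> _ \<Rightarrow> 'a)"
    by (rule evec_cong) (simp add: reflv_reflv[OF assms])
  then show "xe m (Hv m s \<rho> P) x = Hv m (Suc s) \<rho> (xe m P) x"
    by (simp add: xe_def Hv_def Lv_evec[OF assms])
qed

lemma xi_Hv:
  assumes "unitv m \<rho>"
  shows "xi m (Hv m (Suc s) \<rho> P) = Hv m s \<rho> (xi m P)"
proof
  fix x
  have "ivec m (reflv m \<rho> (reflv m \<rho> x)) = (ivec m x :: _ \<Rightarrow> _ \<Rightarrow> 'a)"
    by (rule ivec_cong) (simp add: reflv_reflv[OF assms])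
  then show "xi m (Hv m (Suc s) \<rho> P) x = Hv m s \<rho> (xi m P) x"
    by (simp add: xi_def Hv_def Lv_ivec[OF assms])
qed

lemma dotp_reflv:
  assumes "unitv m \<rho>"
  shows "dotp m (reflv m \<rho> x) (reflv m \<rho> y) = dotp m x y"
proof -
  show ?thesis
    unfolding dotp_reflv_right dotp_commute[of m "reflv m \<rho> x"] by (simp add: assms dotp_commute)
qed

lemma Hv_scl: "Hv m s \<rho> (scl c P) = scl c (Hv m s \<rho> P)"
  by (simp add: Hv_def scl_def Lv_scale fun_eq_iff)

lemma Hv_add: "Hv m s \<rho> (P + Q) = Hv m s \<rho> P + Hv m s \<rho> Q"
  by (simp add: Hv_def fun_eq_iff plus_fun_apply Lv_add)

lemma Hv_zero: "Hv m s \<rho> 0 = 0"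
  by (simp add: Hv_def fun_eq_iff zero_fun_apply Lv_zero)

lemma xx_Hv:
  assumes "unitv m \<rho>"
  shows "xx m (Hv m s \<rho> P) = Hv m s \<rho> (xx m P)"
  by (simp add: xx_def Hv_def dotp_reflv[OF assms] Lv_scale[of m s \<rho> "- of_real _", simplified])

lemma Hv_Hv:
  assumes "unitv m \<rho>" "P \<in> hpoly m k s"
  shows "Hv m s \<rho> (Hv m s \<rho> P) = P"
proof
  fix x
  have "P (reflv m \<rho> (reflv m \<rho> x)) = P x" by (rule hpoly_cong[OF assms(2)]) (simp add: reflv_reflv[OF assms(1)])
  then show "Hv m s \<rho> (Hv m s \<rho> P) x = P x" by (simp add: Hv_def Lv_Lv[OF assms(1)])
qed

section \<open>The Fischer inner product\<close>

text \<open>For complex coefficients this is the real part of the Hermitian product. A real form is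
  enough for orthogonality and treats both fields alike.\<close>

definition ip :: "nat \<Rightarrow> (nat set \<Rightarrow> 'a::real_inner) \<Rightarrow> (nat set \<Rightarrow> 'a) \<Rightarrow> real" where
  "ip m v w = (\<Sum>A\<in>Pow {..<m}. v A \<bullet> w A)"

lemma ip_commute: "ip m v w = ip m w v"
  by (simp add: ip_def inner_commute)

lemma ip_add: "ip m (v + v') w = ip m v w + ip m v' w"
  by (simp add: ip_def inner_add_left sum.distrib plus_fun_apply)

lemma ip_fsum: "ip m (\<lambda>A. \<Sum>i\<in>I. f i A) w = (\<Sum>i\<in>I. ip m (f i) w)"
  by (simp add: ip_def inner_sum_left sum.swap[of _ I])

lemma inner_of_real_mult: "(of_real r * a) \<bullet> b = r * (a \<bullet> (b :: 'a::{real_normed_field, real_inner}))"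
  by (simp add: of_real_def)

lemma ip_of_real: "ip m (\<lambda>A. of_real r * v A) w = r * ip m v (w :: _ \<Rightarrow> 'a::{real_normed_field, real_inner})"
  by (simp add: ip_def inner_of_real_mult sum_distrib_left)

text \<open>Blades containing j are matched with the same blades without j. The minus sign in the
  adjoint is that of e_j^2 = -1.\<close>

lemma ip_eps:
  fixes v w :: "nat set \<Rightarrow> 'a::{real_normed_field, real_inner}"
  assumes "j < m"
  shows "ip m (eps j v) w = - ip m v (iot j w)"
proof -
  have s: "sg j A = (1::'a) \<or> sg j A = (-1::'a)" for A by (simp add: sg_def minus_one_power_iff)
  have "ip m (eps j v) w = (\<Sum>A\<in>{A\<in>Pow {..<m}. j \<in> A}. (sg j A * v (A - {j})) \<bullet> w A)"
    unfolding ip_def by (rule sum.mono_neutral_cong_right) (auto simp: eps_def)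
  also have "\<dots> = (\<Sum>A\<in>{A\<in>Pow {..<m}. j \<notin> A}. (sg j A * v A) \<bullet> w (insert j A))"
    by (rule sum.reindex_bij_witness[of _ "insert j" "\<lambda>A. A - {j}"]) (use assms in \<open>auto simp: sg_remove insert_absorb\<close>)
  also have "\<dots> = (\<Sum>A\<in>{A\<in>Pow {..<m}. j \<notin> A}. - (v A \<bullet> iot j w A))"
  proof (rule sum.cong[OF HOL.refl])
    fix A assume "A \<in> {A \<in> Pow {..<m}. j \<notin> A}"
    then show "(sg j A * v A) \<bullet> w (insert j A) = - (v A \<bullet> iot j w A)"
      using s[of A] by (auto simp: iot_def)
  qed
  also have "\<dots> = (\<Sum>A\<in>Pow {..<m}. - (v A \<bullet> iot j w A))"
    by (rule sum.mono_neutral_left) (auto simp: iot_def)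
  finally show ?thesis by (simp add: ip_def sum_negf)
qed

lemma ip_evec:
  fixes v w :: "nat set \<Rightarrow> 'a::{real_normed_field, real_inner}"
  shows "ip m (evec m x v) w = - ip m v (ivec m x w)"
proof -
  have "ip m (evec m x v) w = (\<Sum>j<m. x j * ip m (eps j v) w)"
    by (simp add: evec_def ip_fsum ip_of_real)
  also have "\<dots> = - (\<Sum>j<m. x j * ip m (iot j w) v)"
    by (simp add: ip_eps ip_commute[of m v] sum_negf)
  also have "\<dots> = - ip m (ivec m x w) v" by (simp add: ivec_def ip_fsum ip_of_real)
  finally show ?thesis by (simp add: ip_commute)
qed

text \<open>\<open>Lv\<close> is self-adjoint, because e i and i e are, and it is an involution;
  hence it is an isometry.\<close>

lemma ip_Lv:
  fixes v w :: "nat set \<Rightarrow> 'a::{real_normed_field, real_inner}"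
  assumes "unitv m \<rho>"
  shows "ip m (Lv m s \<rho> v) (Lv m s \<rho> w) = ip m v w"
proof -
  have e: "Lv m s \<rho> v = (\<lambda>A. of_real ((-1) ^ s) * evec m \<rho> (ivec m \<rho> v) A) + (\<lambda>A. of_real (- ((-1) ^ s)) * ivec m \<rho> (evec m \<rho> v) A)"
    for v :: "nat set \<Rightarrow> 'a"
    by (simp add: Lv_def fun_eq_iff plus_fun_apply algebra_simps)
  have i: "ip m (ivec m \<rho> v) w = - ip m v (evec m \<rho> w)" for v w :: "nat set \<Rightarrow> 'a"
    using ip_evec[of m \<rho> w v] by (simp add: ip_commute)
  have L: "ip m (Lv m s \<rho> v) w = (-1) ^ s * ip m (evec m \<rho> (ivec m \<rho> v)) w + (- ((-1) ^ s)) * ip m (ivec m \<rho> (evec m \<rho> v)) w"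
    for v w :: "nat set \<Rightarrow> 'a"
    unfolding e ip_add ip_of_real ..
  have 1: "ip m (evec m \<rho> (ivec m \<rho> v)) w = ip m (evec m \<rho> (ivec m \<rho> w)) v"
    and 2: "ip m (ivec m \<rho> (evec m \<rho> v)) w = ip m (ivec m \<rho> (evec m \<rho> w)) v" for v w :: "nat set \<Rightarrow> 'a"
    by (simp_all add: ip_evec i ip_commute[of m v])
  have sa: "ip m (Lv m s \<rho> v) w = ip m v (Lv m s \<rho> w)" for v w :: "nat set \<Rightarrow> 'a"
    unfolding ip_commute[of m v "Lv m s \<rho> w"] L 1[of v w] 2[of v w] ..
  show ?thesis unfolding sa Lv_Lv[OF assms] ..
qed

text \<open>The Fischer inner product on polynomials of degree $k$; it is real valued also for complex coefficients.\<close>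

primrec fis :: "nat \<Rightarrow> nat \<Rightarrow> 'a::{real_normed_field, real_inner} clfun \<Rightarrow> 'a clfun \<Rightarrow> real" where
  "fis m 0 P Q = ip m (P (\<lambda>_. 0)) (Q (\<lambda>_. 0))"
| "fis m (Suc k) P Q = (\<Sum>j<m. fis m k (pderiv_cl j P) (pderiv_cl j Q))"

lemma fis_commute: "fis m k P Q = fis m k Q P"
  by (induction k arbitrary: P Q) (auto simp: ip_commute)

lemma fis_add:
  "P \<in> hpoly m k s \<Longrightarrow> P' \<in> hpoly m k s \<Longrightarrow> fis m k (P + P') Q = fis m k P Q + fis m k P' Q"
proof (induction k arbitrary: P P' Q)
  case (Suc k)
  then show ?case by (simp add: pderiv_cl_add[OF Suc.prems] pderiv_cl_hpoly sum.distrib)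
qed (simp add: plus_fun_apply ip_add)

lemma pderiv_cl_scl: "P \<in> hpoly m k s \<Longrightarrow> pderiv_cl j (scl c P) = scl c (pderiv_cl j P)"
  unfolding scl_def by (rule pderiv_cl_scale)

text \<open>Since the norm is multiplicative, multiplication by c is |c| times an isometry;
  polarisation gives the adjoint |c|^2 / c, the conjugate in the complex case. With it, orthogonal
  complements for the real form are still closed under all scalars.\<close>

lemma mult_adjoint:
  fixes c :: "'a::{real_normed_field, real_inner}"
  shows "\<exists>c'. \<forall>a b. (c * a) \<bullet> b = a \<bullet> (c' * b)"
proof (cases "c = 0")
  case True
  then show ?thesis by (intro exI[of _ 0]) simp
next
  case False
  have n: "(c * a) \<bullet> (c * a) = (norm c)\<^sup>2 * (a \<bullet> a)" for a
    by (simp add: norm_mult power_mult_distrib flip: power2_norm_eq_inner)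
  have p: "(c * a) \<bullet> (c * b) = (norm c)\<^sup>2 * (a \<bullet> b)" for a b
    using n[of "a + b"] n[of a] n[of b] by (simp add: inner_add_left inner_add_right inner_commute algebra_simps)
  have "(c * a) \<bullet> b = a \<bullet> ((of_real ((norm c)\<^sup>2) / c) * b)" for a b
  proof -
    have "(c * a) \<bullet> b = (c * a) \<bullet> (c * (b / c))" using False by simp
    also have "\<dots> = (of_real ((norm c)\<^sup>2) * (b / c)) \<bullet> a" unfolding p inner_of_real_mult by (simp add: inner_commute)
    finally show ?thesis by (simp add: inner_commute)
  qed
  then show ?thesis by blast
qed

lemma fis_scl_adjoint:
  assumes c: "\<And>a b. (c * a) \<bullet> b = a \<bullet> (c' * b)"
  shows "P \<in> hpoly m k s \<Longrightarrow> Q \<in> hpoly m k s \<Longrightarrow> fis m k (scl c P) Q = fis m k P (scl c' Q)"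
proof (induction k arbitrary: P Q)
  case 0
  then show ?case by (simp add: ip_def scl_apply c)
next
  case (Suc k)
  then show ?case by (simp add: pderiv_cl_scl[OF Suc.prems(1)] pderiv_cl_scl[OF Suc.prems(2)] pderiv_cl_hpoly)
qed

lemma fis_of_real: "P \<in> hpoly m k s \<Longrightarrow> fis m k (scl (of_real r) P) Q = r * fis m k P Q"
proof (induction k arbitrary: P Q)
  case 0
  then show ?case by (simp add: ip_of_real scl_def)
next
  case (Suc k)
  then show ?case by (simp add: pderiv_cl_scl[OF Suc.prems] pderiv_cl_hpoly sum_distrib_left)
qed

lemma fis_zero: "fis m k 0 Q = 0"
proof (induction k arbitrary: Q)
  case 0
  then show ?case by (simp add: ip_def zero_fun_apply)
next
  case (Suc k)
  have "pderiv_cl j 0 = (0 :: 'a clfun)" for j by (simp add: fun_eq_iff pderiv_cl_pd zero_fun_apply pd_const)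
  then show ?case by (simp add: Suc)
qed

lemma fis_nonneg: "0 \<le> fis m k P P"
  by (induction k arbitrary: P) (auto simp: ip_def intro!: sum_nonneg)

lemma hpoly_0_const: "P \<in> hpoly m 0 s \<Longrightarrow> P x = P y"
  using hp_0_const[OF hpoly_hp] by (auto simp: fun_eq_iff)

lemma fis_definite: "P \<in> hpoly m k s \<Longrightarrow> fis m k P P = 0 \<Longrightarrow> P = 0"
proof (induction k arbitrary: P)
  case 0
  have "P (\<lambda>_. 0) A = 0" for A
  proof (cases "A \<subseteq> {..<m}")
    case True
    then show ?thesis using 0(2) by (auto simp: ip_def sum_nonneg_eq_0_iff)
  next
    case False
    then show ?thesis using hpoly_graded[OF 0(1)] by (auto simp: graded_def)
  qed
  then show ?case using hpoly_0_const[OF 0(1), of _ "\<lambda>_. 0"] by (simp add: fun_eq_iff zero_fun_apply)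
next
  case (Suc k)
  have "fis m k (pderiv_cl j P) (pderiv_cl j P) = 0" if "j < m" for j
    using Suc.prems(2) that by (simp add: sum_nonneg_eq_0_iff fis_nonneg)
  then show ?case using hpoly_zero_if_pderiv_zero[OF Suc.prems(1)] Suc.IH pderiv_cl_hpoly[OF Suc.prems(1)] by blast
qed

lemma hpoly_fsum: "(\<And>i. i \<in> I \<Longrightarrow> f i \<in> hpoly m k s) \<Longrightarrow> (\<Sum>i\<in>I. f i) \<in> hpoly m k s"
  by (induction I rule: infinite_finite_induct) (auto simp: hpoly_zero hpoly_add)

lemma fis_sum: "(\<And>i. i \<in> I \<Longrightarrow> f i \<in> hpoly m k s) \<Longrightarrow> fis m k (\<Sum>i\<in>I. f i) Q = (\<Sum>i\<in>I. fis m k (f i) Q)"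
proof (induction I rule: infinite_finite_induct)
  case (insert x I)
  then show ?case using fis_add[of "f x" m k s "\<Sum>i\<in>I. f i" Q] hpoly_fsum[of I f m k s] by simp
qed (simp_all add: fis_zero)

lemma sum2_app: "(\<Sum>i\<in>I. f i) x A = (\<Sum>i\<in>I. f i x A)" for f :: "'i \<Rightarrow> 'a::real_normed_field clfun"
  by (simp add: sum_fun_app)

text \<open>Induction on the degree: the derivatives of the transformed polynomials are mixed by the
  matrix of the reflection, and its orthogonality collapses the double sum.\<close>

lemma fis_Hv:
  assumes \<rho>: "unitv m \<rho>"
  shows "P \<in> hpoly m k s \<Longrightarrow> Q \<in> hpoly m k s \<Longrightarrow> fis m k (Hv m s \<rho> P) (Hv m s \<rho> Q) = fis m k P Q"
proof (induction k arbitrary: P Q)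
  case 0
  then show ?case using hpoly_0_const[OF 0(1), of "reflv m \<rho> (\<lambda>_. 0)" "\<lambda>_. 0"] hpoly_0_const[OF 0(2), of "reflv m \<rho> (\<lambda>_. 0)" "\<lambda>_. 0"]
    by (simp add: Hv_def ip_Lv[OF \<rho>])
next
  case (Suc k)
  let ?a = "\<lambda>i j. reflv m \<rho> (unit_vec i) j"
  let ?H = "\<lambda>i P. Hv m s \<rho> (pderiv_cl i P) :: 'a clfun"
  have e: "pderiv_cl j (Hv m s \<rho> P) = (\<Sum>i<m. scl (of_real (?a i j)) (?H i P))" if "P \<in> hpoly m (Suc k) s" "j < m" for j P
    using pderiv_cl_Hv[OF that] by (simp add: fun_eq_iff sum2_app scl_apply)
  have h: "?H i P \<in> hpoly m k s" if "P \<in> hpoly m (Suc k) s" for i P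
    by (rule Hv_hpoly[OF pderiv_cl_hpoly[OF that]])
  have f: "fis m k (\<Sum>i<m. scl (of_real (?a i j)) (?H i P)) R = (\<Sum>i<m. ?a i j * fis m k (?H i P) R)" if "P \<in> hpoly m (Suc k) s" for P R j
    using fis_sum[of "{..<m}" "\<lambda>i. scl (of_real (?a i j)) (?H i P)" m k s R] scl_hpoly[OF h[OF that]] fis_of_real[OF h[OF that]] by simp
  have "fis m (Suc k) (Hv m s \<rho> P) (Hv m s \<rho> Q)
      = (\<Sum>j<m. \<Sum>i<m. \<Sum>l<m. ?a i j * ?a l j * fis m k (?H i P) (?H l Q))"
    by (simp add: e[OF Suc.prems(1)] e[OF Suc.prems(2)] f[OF Suc.prems(1)] f[OF Suc.prems(2)] fis_commute[of m k "?H _ P"] sum_distrib_left mult.assoc)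
  also have "\<dots> = (\<Sum>i<m. \<Sum>l<m. \<Sum>j<m. ?a i j * ?a l j * fis m k (?H i P) (?H l Q))"
    by (subst sum.swap, rule sum.cong[OF refl], rule sum.swap)
  also have "\<dots> = (\<Sum>i<m. \<Sum>l<m. if l = i then fis m k (?H i P) (?H i Q) else 0)"
    by (intro sum.cong refl) (auto simp: sum_distrib_right[symmetric] reflv_orthogonal[OF \<rho>])
  also have "\<dots> = (\<Sum>i<m. fis m k (pderiv_cl i P) (pderiv_cl i Q))"
    using Suc.IH[OF pderiv_cl_hpoly[OF Suc.prems(1)] pderiv_cl_hpoly[OF Suc.prems(2)]] by simp
  finally show ?case by simp
qed

section \<open>Zonal polynomials and existence of orthogonal projections\<close>

definition zonal :: "nat \<Rightarrow> (nat set \<Rightarrow> 'a) \<Rightarrow> 'a::real_normed_field clfun" where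
  "zonal k w = (\<lambda>x A. of_real (x 0) ^ k * w A)"

lemma zonal_hpoly:
  assumes "0 < m" "graded m s w"
  shows "zonal k w \<in> hpoly m k s"
proof (induction k)
  case 0
  have "hp m 0 (\<lambda>x. w A)" for A by (rule hp.const)
  then show ?case using assms by (auto simp: zonal_def hpoly_iff)
next
  case (Suc k)
  have "hp m (Suc k) (\<lambda>x. of_real (x 0) * zonal k w x A)" for A
    by (intro hp.mulx hpoly_hp[OF Suc]) (rule assms)
  then show ?case using assms by (auto simp: zonal_def hpoly_iff graded_def mult.assoc)
qed

lemma pderiv_cl_zonal:
  assumes "0 < m" "graded m s w"
  shows "pderiv_cl j (zonal (Suc k) w) = (if j = 0 then scl (of_nat (Suc k)) (zonal k w) else 0)"
proof (induction k)
  case 0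
  have e: "(\<lambda>x. zonal (Suc 0) w x A) = (\<lambda>x. of_real (x 0) * w A)" for A by (simp add: zonal_def)
  have "pderiv_cl j (zonal (Suc 0) w) x A = (if j = 0 then w A else 0)" for x A
    unfolding pderiv_cl_pd e pd_mulx[OF pdable_const] by (simp add: pd_const)
  then show ?case by (simp add: fun_eq_iff zonal_def scl_apply zero_fun_apply)
next
  case (Suc k)
  have e: "(\<lambda>x. zonal (Suc (Suc k)) w x A) = (\<lambda>x. of_real (x 0) * zonal (Suc k) w x A)" for A by (simp add: zonal_def mult_ac)
  have "pderiv_cl j (zonal (Suc (Suc k)) w) x A = (if 0 = j then zonal (Suc k) w x A else 0) + of_real (x 0) * pderiv_cl j (zonal (Suc k) w) x A" for x A
    unfolding pderiv_cl_pd e pd_mulx[OF hpoly_pdable[OF zonal_hpoly[OF assms]]] ..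
  then show ?case unfolding Suc by (simp add: fun_eq_iff zonal_def scl_apply zero_fun_apply algebra_simps)
qed

text \<open>The reproducing property at e_0. Only repeated differentiation in x_0 sees x_0^k. One
  factor k! comes from differentiating x_0^k; the other relates the k-th x_0-derivative of P to P at
  e_0, by Euler's identity at each stage.\<close>

lemma fis_zonal:
  assumes "0 < m" "graded m s w"
  shows "P \<in> hpoly m k s \<Longrightarrow> fis m k P (zonal k w) = (fact k)\<^sup>2 * ip m (P (unit_vec 0)) w"
proof (induction k arbitrary: P)
  case 0
  then show ?case using hpoly_0_const[OF 0, of "\<lambda>_. 0" "unit_vec 0"] by (simp add: zonal_def)
next
  case (Suc k)
  have d: "pderiv_cl 0 P \<in> hpoly m k s" by (rule pderiv_cl_hpoly[OF Suc.prems])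
  have e: "pderiv_cl 0 P (unit_vec 0) = (\<lambda>A. of_real (real (Suc k)) * P (unit_vec 0) A)"
  proof
    fix A
    have "(\<Sum>j<m. of_real (unit_vec 0 j) * pderiv_cl j P (unit_vec 0) A) = (\<Sum>j<m. if j = 0 then pderiv_cl 0 P (unit_vec 0) A else 0)"
      by (intro sum.cong) (auto simp: unit_vec_def)
    then show "pderiv_cl 0 P (unit_vec 0) A = of_real (real (Suc k)) * P (unit_vec 0) A"
      using hpoly_euler[OF Suc.prems, of "unit_vec 0" A] assms(1) by simp
  qed
  have "fis m (Suc k) P (zonal (Suc k) w) = (\<Sum>j<m. if j = 0 then fis m k (pderiv_cl 0 P) (scl (of_real (real (Suc k))) (zonal k w)) else 0)"
    unfolding fis.simps by (intro sum.cong) (auto simp: pderiv_cl_zonal[OF assms] fis_zero fis_commute[of m k _ 0] simp del: of_nat_Suc)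
  also have "\<dots> = fis m k (scl (of_real (real (Suc k))) (zonal k w)) (pderiv_cl 0 P)"
    using assms(1) by (simp add: fis_commute)
  also have "\<dots> = real (Suc k) * ((fact k)\<^sup>2 * ip m (pderiv_cl 0 P (unit_vec 0)) w)"
    unfolding fis_of_real[OF zonal_hpoly[OF assms]] fis_commute[of m k "zonal k w"] Suc.IH[OF d] ..
  also have "\<dots> = (fact (Suc k))\<^sup>2 * ip m (P (unit_vec 0)) w"
    unfolding e ip_of_real by (simp add: power2_eq_square)
  finally show ?case .
qed

definition rsubspace :: "'a::real_normed_field clfun set \<Rightarrow> bool" where
  "rsubspace U \<longleftrightarrow> 0 \<in> U \<and> (\<forall>P\<in>U. \<forall>Q\<in>U. P + Q \<in> U) \<and> (\<forall>r. \<forall>P\<in>U. scl (of_real r) P \<in> U)"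

definition rlinear_on :: "'a::real_normed_field clfun set \<Rightarrow> ('a clfun \<Rightarrow> real) \<Rightarrow> bool" where
  "rlinear_on U f \<longleftrightarrow> (\<forall>P\<in>U. \<forall>Q\<in>U. f (P + Q) = f P + f Q) \<and> (\<forall>r. \<forall>P\<in>U. f (scl (of_real r) P) = r * f P)"

text \<open>Finite dimensionality in the form needed to construct orthogonal projections.\<close>

definition separating :: "'a::real_normed_field clfun set \<Rightarrow> ('a clfun \<Rightarrow> real) set \<Rightarrow> bool" where
  "separating U T \<longleftrightarrow> finite T \<and> (\<forall>f\<in>T. rlinear_on U f) \<and> (\<forall>P\<in>U. (\<forall>f\<in>T. f P = 0) \<longrightarrow> P = 0)"

lemma hpoly_separating:
  "\<exists>T. separating (hpoly m k s :: 'a::{real_normed_field, euclidean_space} clfun set) T"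
proof (induction k)
  case 0
  let ?T = "(\<lambda>(A, b) P. P (\<lambda>_. 0) A \<bullet> b) ` (Pow {..<m} \<times> (Basis :: 'a set))"
  have A: "\<forall>P\<in>hpoly m 0 s. (\<forall>f\<in>?T. f P = 0) \<longrightarrow> P = 0"
  proof (intro ballI impI)
    fix P :: "'a clfun" assume P: "P \<in> hpoly m 0 s" and z: "\<forall>f\<in>?T. f P = 0"
    have "P (\<lambda>_. 0) A = 0" for A
    proof (cases "A \<subseteq> {..<m}")
      case True
      then show ?thesis using z by (auto intro!: euclidean_eqI[of _ 0])
    next
      case False
      then show ?thesis using hpoly_graded[OF P] by (auto simp: graded_def)
    qed
    then show "P = 0" using hpoly_0_const[OF P, of _ "\<lambda>_. 0"] by (simp add: fun_eq_iff zero_fun_apply)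
  qed
  have B: "\<forall>f\<in>?T. rlinear_on (hpoly m 0 s) f"
    by (auto simp: rlinear_on_def plus_fun_apply scl_apply inner_add_left inner_of_real_mult)
  have "finite ?T" by simp
  then show ?case unfolding separating_def by (intro exI[of _ ?T] conjI A B)
next
  case (Suc k)
  then obtain T where sep: "separating (hpoly m k s :: 'a clfun set) T" by (rule exE)
  have T: "finite T" "\<forall>f\<in>T. rlinear_on (hpoly m k s) f"
    "\<forall>P\<in>hpoly m k s. (\<forall>f\<in>T. f P = 0) \<longrightarrow> P = (0 :: 'a clfun)"
    using sep unfolding separating_def by blast+
  let ?T = "(\<lambda>(j, f) P. f (pderiv_cl j P)) ` ({..<m} \<times> T)"
  have B: "\<forall>f\<in>?T. rlinear_on (hpoly m (Suc k) s) f"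
    using T(2) by (auto simp: rlinear_on_def pderiv_cl_add pderiv_cl_scl pderiv_cl_hpoly)
  have A: "\<forall>P\<in>hpoly m (Suc k) s. (\<forall>f\<in>?T. f P = 0) \<longrightarrow> P = 0"
  proof (intro ballI impI)
    fix P :: "'a clfun" assume P: "P \<in> hpoly m (Suc k) s" and z: "\<forall>f\<in>?T. f P = 0"
    show "P = 0"
    proof (rule hpoly_zero_if_pderiv_zero[OF P])
      fix j assume "j < m"
      then have "\<forall>f\<in>T. f (pderiv_cl j P) = 0" using z by auto
      then show "pderiv_cl j P = 0" using T(3) pderiv_cl_hpoly[OF P] by simp
    qed
  qed
  have "finite ?T" using T(1) by simp
  then show ?case unfolding separating_def by (intro exI[of _ ?T] conjI A B)
qed

text \<open>Induction on the separating functionals. The kernel U' of f in U is separated by the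
  remaining ones. Either it is all of U, or some u0 lies outside; then u0 minus its projection is a
  normal n of U' in U, and the projection of v to U is the one to U' plus the component along
  n.\<close>

lemma projection_exists:
  fixes U :: "'a::{real_normed_field, euclidean_space} clfun set"
  assumes "finite T"
  shows "rsubspace U \<Longrightarrow> U \<subseteq> hpoly m k s \<Longrightarrow> (\<And>f. f \<in> T \<Longrightarrow> rlinear_on U f) \<Longrightarrow>
    (\<And>P. P \<in> U \<Longrightarrow> (\<forall>f\<in>T. f P = 0) \<Longrightarrow> P = 0) \<Longrightarrow> v \<in> hpoly m k s \<Longrightarrow>
    \<exists>u\<in>U. \<forall>p\<in>U. fis m k u p = fis m k v p"
  using assms
proof (induction T arbitrary: U v rule: finite_induct)
  case empty
  have "fis m k 0 p = fis m k v p" if "p \<in> U" for p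
    using empty(4)[OF that] by (simp add: fis_zero fis_commute[of m k v 0])
  then show ?case using empty(1) by (intro bexI[of _ 0]) (simp_all add: rsubspace_def)
next
  case (insert f T)
  note U = insert.prems(1)
  have lin: "f (P + Q) = f P + f Q" "f (scl (of_real r) P) = r * f P" if "P \<in> U" "Q \<in> U" for P Q r
    using insert.prems(3)[of f] that by (auto simp: rlinear_on_def)
  have Uadd: "P + Q \<in> U" if "P \<in> U" "Q \<in> U" for P Q using U that by (auto simp: rsubspace_def)
  have Uscl: "scl (of_real r) P \<in> U" if "P \<in> U" for P r using U that by (auto simp: rsubspace_def)
  have Uh: "P \<in> hpoly m k s" if "P \<in> U" for P using that insert.prems(2) by auto
  define U' where "U' = {P \<in> U. f P = 0}"
  have z: "0 \<in> U" using U by (simp add: rsubspace_def)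
  have f0: "f 0 = 0" using lin(1)[OF z z] by simp
  have U': "rsubspace U'" using U lin f0 by (auto simp: rsubspace_def U'_def)
  have IH: "\<exists>u\<in>U'. \<forall>p\<in>U'. fis m k u p = fis m k v p" if "v \<in> hpoly m k s" for v
  proof (rule insert.IH[OF U' _ _ _ that])
    show "U' \<subseteq> hpoly m k s" using insert.prems(2) by (auto simp: U'_def)
    show "rlinear_on U' g" if "g \<in> T" for g
      using insert.prems(3)[of g] that by (auto simp: rlinear_on_def U'_def)
    show "P = 0" if "P \<in> U'" "\<forall>f\<in>T. f P = 0" for P
      using insert.prems(4)[of P] that by (auto simp: U'_def)
  qed
  show ?case
  proof (cases "\<exists>u0\<in>U. f u0 \<noteq> 0")
    case False
    then have "U' = U" by (auto simp: U'_def)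
    then show ?thesis using IH[OF insert.prems(5)] by simp
  next
    case True
    then obtain u0 where u0: "u0 \<in> U" "f u0 \<noteq> 0" by blast
    obtain q where q: "q \<in> U'" "\<forall>p\<in>U'. fis m k q p = fis m k u0 p" using IH[OF Uh[OF u0(1)]] by blast
    have qU: "q \<in> U" "f q = 0" using q(1) by (auto simp: U'_def)
    define n where "n = u0 + scl (of_real (-1)) q"
    have n: "n \<in> U" unfolding n_def by (intro Uadd Uscl u0 qU)
    have fn: "f n = f u0" unfolding n_def using lin(1)[OF u0(1) Uscl[OF qU(1)], of "-1"] lin(2)[OF qU(1) qU(1), of "-1"] qU(2) by simp
    have nU': "fis m k n p = 0" if "p \<in> U'" for p
      unfolding n_def using fis_add[OF Uh[OF u0(1)] Uh[OF Uscl[OF qU(1)]], of "-1" p] fis_of_real[OF Uh[OF qU(1)], of "-1" p] q(2) that by simp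
    have "n \<noteq> 0" using fn u0(2) f0 by auto
    then have nn: "fis m k n n \<noteq> 0" using fis_definite[OF Uh[OF n]] by blast
    obtain v' where v': "v' \<in> U'" "\<forall>p\<in>U'. fis m k v' p = fis m k v p" using IH[OF insert.prems(5)] by blast
    have v'U: "v' \<in> U" using v'(1) by (auto simp: U'_def)
    define c where "c = fis m k v n / fis m k n n"
    define u where "u = v' + scl (of_real c) n"
    have u: "u \<in> U" unfolding u_def by (intro Uadd Uscl v'U n)
    have fu: "fis m k u p = fis m k v' p + c * fis m k n p" for p
      unfolding u_def fis_add[OF Uh[OF v'U] Uh[OF Uscl[OF n]]] fis_of_real[OF Uh[OF n]] ..
    have "fis m k u p = fis m k v p" if p: "p \<in> U" for p
    proof -
      define t where "t = f p / f u0"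
      define p' where "p' = p + scl (of_real (- t)) n"
      have "f p' = 0" unfolding p'_def using lin(1)[OF p Uscl[OF n], of "- t"] lin(2)[OF n n, of "- t"] fn u0(2) by (simp add: t_def)
      moreover have "p' \<in> U" unfolding p'_def by (rule Uadd[OF p Uscl[OF n]])
      ultimately have p': "p' \<in> U'" by (simp add: U'_def)
      have pp: "p = p' + scl (of_real t) n" by (simp add: p'_def pointwise)
      have fp: "fis m k w p = fis m k w p' + t * fis m k w n" for w
      proof -
        have "fis m k p w = fis m k p' w + t * fis m k n w"
          by (subst pp) (use p' in \<open>simp add: fis_add[OF Uh Uh[OF Uscl[OF n]]] U'_def fis_of_real[OF Uh[OF n]]\<close>)
        then show ?thesis by (simp add: fis_commute)
      qed
      have 1: "fis m k u p' = fis m k v p'" using fu[of p'] nU'[OF p'] v'(2) p' by simp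
      have "fis m k v' n = 0" using nU'[OF v'(1)] by (simp add: fis_commute)
      then have 2: "fis m k u n = fis m k v n" using fu[of n] nn by (simp add: c_def)
      show ?thesis unfolding fp 1 2 ..
    qed
    then show ?thesis using u by blast
  qed
qed

lemma orthogonal_projection:
  fixes U :: "'a::{real_normed_field, euclidean_space} clfun set"
  assumes "rsubspace U" "U \<subseteq> hpoly m k s" "v \<in> hpoly m k s"
  shows "\<exists>u\<in>U. \<forall>p\<in>U. fis m k u p = fis m k v p"
proof -
  obtain T where sep: "separating (hpoly m k s :: 'a clfun set) T" using hpoly_separating by (rule exE)
  have T: "finite T" "\<And>f. f \<in> T \<Longrightarrow> rlinear_on (hpoly m k s) f"
    "\<And>P. P \<in> hpoly m k s \<Longrightarrow> \<forall>f\<in>T. f P = 0 \<Longrightarrow> P = 0"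
    using sep by (simp_all add: separating_def)
  have r: "rlinear_on U f" if "f \<in> T" for f
    using T(2)[OF that] assms(2) unfolding rlinear_on_def by (simp add: subset_iff)
  show ?thesis
    by (rule projection_exists[OF T(1) assms(1,2) r T(3)[OF subsetD[OF assms(2)]] assms(3)])
qed

section \<open>Irreducibility of the spaces of harmonic polynomials\<close>

lemma neg_eq_self: "- x = x \<longleftrightarrow> x = (0::'a::real_normed_field)" "x = - x \<longleftrightarrow> x = 0"
proof -
  show "- x = x \<longleftrightarrow> x = 0"
    by (metis add_eq_0_iff mult_2 mult_eq_0_iff neg_equal_0_iff_equal zero_neq_numeral)
  then show "x = - x \<longleftrightarrow> x = 0" by auto
qed

text \<open>The unit vector \<rho> is the bisector x + r e_a, normalised; it degenerates just for x
  = -r e_a. The clause on zero coordinates ensures that, for x orthogonal to e_0 and a different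
  from 0, \<rho> is orthogonal to e_0 and so belongs to the stabiliser of the axis.\<close>

lemma reflect_to_axis:
  assumes a: "a < m" and r: "0 < r" "r\<^sup>2 = dotp m x x"
  shows "(\<forall>i<m. x i = - r * unit_vec a i) \<or>
    (\<exists>\<rho>. unitv m \<rho> \<and> (\<forall>i<m. reflv m \<rho> x i = r * unit_vec a i) \<and> (\<forall>i. x i = 0 \<longrightarrow> i \<noteq> a \<longrightarrow> \<rho> i = 0))"
proof -
  define z where "z = (\<lambda>i. x i + r * unit_vec a i)"
  have da: "dotp m y (unit_vec a) = y a" for y
    using a by (simp add: dotp_def unit_vec_def if_distrib[of "\<lambda>u. _ * u"] cong: if_cong)
  have zy: "dotp m y z = dotp m y x + r * y a" for y
  proof -
    have "dotp m y z = dotp m y x + r * dotp m y (unit_vec a)"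
      by (simp add: dotp_def z_def algebra_simps sum.distrib sum_distrib_left)
    then show ?thesis by (simp add: da)
  qed
  have zx: "dotp m z x = r\<^sup>2 + r * x a" using zy[of x] by (simp add: dotp_commute r(2))
  have zz: "dotp m z z = 2 * (r\<^sup>2 + r * x a)"
    unfolding zy[of z] zx by (simp add: z_def unit_vec_def power2_eq_square algebra_simps)
  show ?thesis
  proof (cases "dotp m z z = 0")
    case True
    have "x i = - r * unit_vec a i" if "i < m" for i
      using dotp_self_eq_0[OF True that] by (simp add: z_def)
    then show ?thesis by blast
  next
    case False
    have pos: "0 < dotp m z z" using False by (simp add: dotp_def order_less_le sum_nonneg)
    define c where "c = 1 / sqrt (dotp m z z)"
    have c2: "c * c * dotp m z z = 1" using pos by (simp add: c_def)
    define \<rho> where "\<rho> = (\<lambda>i. c * z i)"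
    have "dotp m \<rho> \<rho> = c * c * dotp m z z" by (simp add: dotp_def \<rho>_def sum_distrib_left mult_ac)
    then have u: "unitv m \<rho>" using c2 by simp
    have "dotp m \<rho> x = c * (r\<^sup>2 + r * x a)"
      using zx by (simp add: dotp_def \<rho>_def sum_distrib_left[symmetric] mult.assoc)
    then have d: "2 * dotp m \<rho> x = c * dotp m z z" by (simp add: zz)
    have "reflv m \<rho> x i = r * unit_vec a i" if "i < m" for i
    proof -
      have "reflv m \<rho> x i = 2 * dotp m \<rho> x * \<rho> i - x i" using that by (simp add: reflv_def)
      also have "\<dots> = (c * c * dotp m z z) * z i - x i" unfolding d by (simp add: \<rho>_def)
      finally have "reflv m \<rho> x i = (c * c * dotp m z z) * z i - x i" .
      then show ?thesis unfolding c2 by (simp add: z_def)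
    qed
    moreover have "\<rho> i = 0" if "x i = 0" "i \<noteq> a" for i using that by (simp add: \<rho>_def z_def unit_vec_def)
    ultimately show ?thesis using u by blast
  qed
qed

lemma hpoly_homogeneous: "P \<in> hpoly m k s \<Longrightarrow> (\<And>i. i < m \<Longrightarrow> y i = t * x i) \<Longrightarrow> P y = (\<lambda>A. of_real t ^ k * P x A)"
  by (rule ext) (rule hp_homogeneous[OF hpoly_hp])

lemma evec_coeffs: "(\<And>i. i < m \<Longrightarrow> y i = t * x i) \<Longrightarrow> evec m y v = (\<lambda>A. of_real t * evec m x v A)"
  and ivec_coeffs: "(\<And>i. i < m \<Longrightarrow> y i = t * x i) \<Longrightarrow> ivec m y v = (\<lambda>A. of_real t * ivec m x v A)"
  by (auto simp: evec_def ivec_def fun_eq_iff sum_distrib_left mult.assoc intro!: sum.cong)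

lemma Lv_eq_0: "unitv m \<rho> \<Longrightarrow> Lv m s \<rho> v = 0 \<Longrightarrow> v = 0"
  using Lv_Lv[of m \<rho> s v] by (simp add: Lv_zero)

definition Hinv :: "nat \<Rightarrow> nat \<Rightarrow> 'a::real_normed_field clfun set \<Rightarrow> bool" where
  "Hinv m s W \<longleftrightarrow> (\<forall>\<rho>. unitv m \<rho> \<longrightarrow> (\<forall>P\<in>W. Hv m s \<rho> P \<in> W))"

text \<open>The anticommutator of \<open>dd\<close> and \<open>xi\<close> is the scalar -(s + k),
  which is nonzero here.\<close>

lemma dd_xi_harm:
  assumes "P \<in> hpoly m k s" "dd m P = 0" "xi m P = 0" "0 < s + k"
  shows "P = 0"
proof -
  have z: "(of_nat s + of_nat k) * P x A = 0" for x A
  proof -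
    have "- (of_nat s + of_nat k) * P x A = 0"
      unfolding dd_xi[OF assms(1), symmetric] assms(2,3) d_zero x_zero zero_fun_apply by simp
    then show ?thesis by (simp only: mult_minus_left neg_equal_0_iff_equal)
  qed
  have "of_nat s + of_nat k \<noteq> (0::'a)" using assms(4) by (simp flip: of_nat_add)
  then show ?thesis using z by (auto simp: fun_eq_iff zero_fun_apply)
qed

lemma de_xe_harm:
  assumes "P \<in> hpoly m k s" "de m P = 0" "xe m P = 0" "s \<le> m" "0 < m - s + k"
  shows "P = 0"
proof -
  have z: "(of_nat m - of_nat s + of_nat k) * P x A = 0" for x A
  proof -
    have "- (of_nat m - of_nat s + of_nat k) * P x A = 0"
      unfolding de_xe[OF assms(1), symmetric] assms(2,3) d_zero x_zero zero_fun_apply by simp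
    then show ?thesis by (simp only: mult_minus_left neg_equal_0_iff_equal)
  qed
  have e: "of_nat m - of_nat s + of_nat k = (of_nat (m - s + k) :: 'a)" using assms(4) by (simp add: of_nat_diff)
  have "of_nat (m - s + k) \<noteq> (0::'a)" using assms(5) by (simp only: of_nat_eq_0_iff)
  then have "P x A = 0" for x A using z[of x A] unfolding e mult_eq_0_iff by blast
  then show ?thesis by (simp add: fun_eq_iff zero_fun_apply)
qed

section \<open>Families equivariant under the stabiliser of the axis e_0\<close>

definition blade :: "nat set \<Rightarrow> nat set \<Rightarrow> 'a::zero_neq_one" where
  "blade B = (\<lambda>A. if A = B then 1 else 0)"

definition axis_free :: "nat \<Rightarrow> nat \<Rightarrow> (nat set \<Rightarrow> 'a::zero) \<Rightarrow> bool" where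
  "axis_free m t \<omega> \<longleftrightarrow> graded m t \<omega> \<and> (\<forall>A. 0 \<in> A \<longrightarrow> \<omega> A = 0)"

lemma axis_free_blade: "B \<subseteq> {1..<m} \<Longrightarrow> card B = t \<Longrightarrow> axis_free m t (blade B)"
  by (auto simp: axis_free_def blade_def graded_def)

lemma axis_free_add: "axis_free m t \<omega> \<Longrightarrow> axis_free m t \<omega>' \<Longrightarrow> axis_free m t (\<omega> + (\<omega>' :: nat set \<Rightarrow> 'a::comm_ring_1))"
  by (auto simp: axis_free_def graded_def plus_fun_apply)

lemma axis_free_scale: "axis_free m t \<omega> \<Longrightarrow> axis_free m t (\<lambda>A. c * (\<omega> A :: 'a::comm_ring_1))"
  by (auto simp: axis_free_def graded_def)

lemma axis_free_zero: "axis_free m t (0 :: nat set \<Rightarrow> 'a::comm_ring_1)"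
  by (auto simp: axis_free_def graded_def zero_fun_apply)

text \<open>A vector without e_0 component neither creates nor removes the index 0, so the t-vectors
  of the hyperplane are preserved and the transformation law of \<open>axis_family\<close> makes
  sense.\<close>

lemma axis_free_Lv:
  assumes "\<rho> 0 = 0" "axis_free m t \<omega>"
  shows "axis_free m t (Lv m t' \<rho> \<omega>)"
proof -
  have e: "evec m \<rho> v A = 0" "ivec m \<rho> v A = 0" if "\<forall>A. 0 \<in> A \<longrightarrow> v A = 0" "0 \<in> A" for v :: "nat set \<Rightarrow> 'a" and A
  proof -
    have "of_real (\<rho> j) * eps j v A = 0" "of_real (\<rho> j) * iot j v A = 0" for j
      using that assms(1) by (cases "j = 0"; auto simp: eps_def iot_def)+
    then show "evec m \<rho> v A = 0" "ivec m \<rho> v A = 0" unfolding evec_def ivec_def by (simp_all only: sum.neutral_const)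
  qed
  have w: "\<forall>A. 0 \<in> A \<longrightarrow> \<omega> A = 0" using assms(2) by (simp add: axis_free_def)
  have "Lv m t' \<rho> \<omega> A = 0" if "0 \<in> A" for A
    unfolding Lv_def using e(1)[of "ivec m \<rho> \<omega>" A] e(2)[of "evec m \<rho> \<omega>" A] e[OF w] that by simp
  then show ?thesis using assms(2) Lv_graded by (auto simp: axis_free_def)
qed

lemma axis_free_induct [consumes 1, case_names blade add scale zero]:
  fixes \<omega> :: "nat set \<Rightarrow> 'a::real_normed_field"
  assumes "axis_free m t \<omega>"
    and blade: "\<And>B. B \<subseteq> {1..<m} \<Longrightarrow> card B = t \<Longrightarrow> Q (blade B)"
    and add: "\<And>\<omega> \<omega>'. axis_free m t \<omega> \<Longrightarrow> axis_free m t \<omega>' \<Longrightarrow> Q \<omega> \<Longrightarrow> Q \<omega>' \<Longrightarrow> Q (\<omega> + \<omega>')"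
    and scale: "\<And>c \<omega>. axis_free m t \<omega> \<Longrightarrow> Q \<omega> \<Longrightarrow> Q (\<lambda>A. c * \<omega> A)"
    and zero: "Q 0"
  shows "Q \<omega>"
proof -
  let ?S = "{B. B \<subseteq> {1..<m} \<and> card B = t}"
  have fin: "finite ?S" by (rule finite_subset[of _ "Pow {1..<m}"]) auto
  have "axis_free m t (\<Sum>B\<in>S. (\<lambda>A. \<omega> B * blade B A)) \<and> Q (\<Sum>B\<in>S. (\<lambda>A. \<omega> B * blade B A))" if "finite S" "S \<subseteq> ?S" for S
    using that
  proof (induction S rule: finite_induct)
    case empty
    then show ?case using zero axis_free_zero[of m t] by simp
  next
    case (insert B S)
    have 1: "axis_free m t (\<lambda>A. \<omega> B * blade B A)" "Q (\<lambda>A. \<omega> B * blade B A)"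
      using insert.prems axis_free_blade[of B m t] blade[of B] by (auto intro!: axis_free_scale scale)
    have 2: "axis_free m t (\<Sum>B\<in>S. (\<lambda>A. \<omega> B * blade B A))" "Q (\<Sum>B\<in>S. (\<lambda>A. \<omega> B * blade B A))" using insert by auto
    show ?case unfolding sum.insert[OF insert.hyps] using axis_free_add[OF 1(1) 2(1)] add[OF 1(1) 2(1) 1(2) 2(2)] by blast
  qed
  from this[OF fin] have q: "Q (\<Sum>B\<in>?S. (\<lambda>A. \<omega> B * blade B A))" by blast
  have "(\<Sum>B\<in>?S. (\<lambda>A. \<omega> B * blade B A)) = \<omega>"
  proof
    fix A
    have "(\<Sum>B\<in>?S. (\<lambda>A. \<omega> B * blade B A)) A = (\<Sum>B\<in>?S. if B = A then \<omega> B else 0)"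
      unfolding sum_fun_app by (intro sum.cong) (auto simp: blade_def)
    also have "\<dots> = (if A \<in> ?S then \<omega> A else 0)" using fin by simp
    also have "\<dots> = \<omega> A"
    proof (cases "A \<in> ?S")
      case False
      have "0 \<notin> A \<and> A \<subseteq> {..<m} \<Longrightarrow> A \<subseteq> {1..<m}" by (auto simp: subset_iff Suc_le_eq) (metis gr0I)
      then have "\<omega> A = 0" using False assms(1) by (auto simp: axis_free_def graded_def)
      then show ?thesis using False by simp
    qed simp
    finally show "(\<Sum>B\<in>?S. (\<lambda>A. \<omega> B * blade B A)) A = \<omega> A" .
  qed
  then show ?thesis using q by simp
qed

text \<open>Families indexed by the $t$-vectors $\omega$ orthogonal to $e_0$ that transform like
  $\omega \mapsto x_0^k\, e_0 \wedge \omega$ under the stabiliser of the line through $e_0$. By \<open>axis_family_support1\<close> and \<open>axis_family_zero\<close>,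
  two such families are linearly dependent.\<close>

definition axis_family :: "nat \<Rightarrow> nat \<Rightarrow> nat \<Rightarrow> ((nat set \<Rightarrow> 'a::real_normed_field) \<Rightarrow> 'a clfun) \<Rightarrow> bool" where
  "axis_family m k t w \<longleftrightarrow>
     (\<forall>\<omega>. axis_free m t \<omega> \<longrightarrow> w \<omega> \<in> harm m (Suc t) k) \<and>
     (\<forall>\<omega> \<omega>'. axis_free m t \<omega> \<longrightarrow> axis_free m t \<omega>' \<longrightarrow> w (\<omega> + \<omega>') = w \<omega> + w \<omega>') \<and>
     (\<forall>c \<omega>. axis_free m t \<omega> \<longrightarrow> w (\<lambda>A. c * \<omega> A) = scl c (w \<omega>)) \<and>
     (\<forall>\<rho> \<omega>. unitv m \<rho> \<longrightarrow> \<rho> 0 = 0 \<longrightarrow> axis_free m t \<omega> \<longrightarrow>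
        Hv m (Suc t) \<rho> (w \<omega>) = scl ((-1) ^ Suc k) (w (Lv m t \<rho> \<omega>))) \<and>
     (\<forall>\<omega>. axis_free m t \<omega> \<longrightarrow> Hv m (Suc t) (unit_vec 0) (w \<omega>) = scl ((-1) ^ t) (w \<omega>))"

lemma Lv_unit:
  assumes "j < m"
  shows "Lv m s (unit_vec j) v A = (-1) ^ s * (if j \<in> A then - 1 else 1) * v A"
  unfolding Lv_def evec_unit[OF assms] ivec_unit[OF assms]
  by (auto simp: eps_def iot_def sg_remove sg_insert insert_absorb)

lemma dotp_unit: "a < m \<Longrightarrow> dotp m (unit_vec a) y = y a"
  by (simp add: dotp_def unit_vec_def if_distrib[of "\<lambda>u. u * _"] cong: if_cong)

lemma unitv_unit: "a < m \<Longrightarrow> unitv m (unit_vec a)"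
  by (simp add: dotp_unit) (simp add: unit_vec_def)

context
  fixes m k t :: nat and w :: "(nat set \<Rightarrow> 'a::real_normed_field) \<Rightarrow> 'a clfun"
  assumes axis_family: "axis_family m k t w" and tm: "Suc t < m"
begin

lemma axis_family_harm: "axis_free m t \<omega> \<Longrightarrow> w \<omega> \<in> harm m (Suc t) k"
  and axis_family_add: "axis_free m t \<omega> \<Longrightarrow> axis_free m t \<omega>' \<Longrightarrow> w (\<omega> + \<omega>') = w \<omega> + w \<omega>'"
  and axis_family_scale: "axis_free m t \<omega> \<Longrightarrow> w (\<lambda>A. c * \<omega> A) = scl c (w \<omega>)"
  and axis_family_Hv: "unitv m \<rho> \<Longrightarrow> \<rho> 0 = 0 \<Longrightarrow> axis_free m t \<omega> \<Longrightarrow> Hv m (Suc t) \<rho> (w \<omega>) = scl ((-1) ^ Suc k) (w (Lv m t \<rho> \<omega>))"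
  and axis_family_Hv0: "axis_free m t \<omega> \<Longrightarrow> Hv m (Suc t) (unit_vec 0) (w \<omega>) = scl ((-1) ^ t) (w \<omega>)"
  using axis_family by (simp_all add: axis_family_def)

lemma axis_family_hpoly: "axis_free m t \<omega> \<Longrightarrow> w \<omega> \<in> hpoly m k (Suc t)"
  by (rule harm_hpoly[OF axis_family_harm])

lemma axis_family_zero0: "w 0 = 0"
proof -
  have "w (\<lambda>A. 0 * (0 :: nat set \<Rightarrow> 'a) A) = scl 0 (w 0)" by (rule axis_family_scale[OF axis_free_zero])
  then show ?thesis by (simp add: scl_simps zero_fun_def)
qed

text \<open>For j other than 1 the unit vector e_j sends the point e_1 to -e_1 and acts diagonally
  on blades. Comparing signs in the transformation laws then restricts the blades A on which the
  value at e_1 can be nonzero.\<close>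

lemma axis_family_support:
  assumes B: "B \<subseteq> {1..<m}" "card B = t" and A: "w (blade B) (unit_vec 1) A \<noteq> 0"
  shows "\<And>j. 2 \<le> j \<Longrightarrow> j < m \<Longrightarrow> j \<in> A \<longleftrightarrow> j \<in> B" "0 \<in> A \<longleftrightarrow> even k" "A \<subseteq> {..<m}" "card A = Suc t"
proof -
  have l: "axis_free m t (blade B :: nat set \<Rightarrow> 'a)" by (rule axis_free_blade[OF B])
  have g: "graded m (Suc t) (w (blade B) x)" for x by (rule hpoly_graded[OF axis_family_hpoly[OF l]])
  show "A \<subseteq> {..<m}" "card A = Suc t" using g[of "unit_vec 1"] A by (auto simp: graded_def)
  let ?v = "w (blade B) (unit_vec 1)"
  have neg: "w (blade B) (reflv m (unit_vec j) (unit_vec 1)) = (\<lambda>A. (-1) ^ k * ?v A)" if "j < m" "j \<noteq> 1" for j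
  proof -
    have "w (blade B) (reflv m (unit_vec j) (unit_vec 1)) = (\<lambda>A. of_real (-1) ^ k * ?v A)"
      by (rule hpoly_homogeneous[OF axis_family_hpoly[OF l]]) (use that in \<open>simp add: reflv_def dotp_unit, simp add: unit_vec_def\<close>)
    then show ?thesis by simp
  qed
  show "0 \<in> A \<longleftrightarrow> even k"
  proof -
    have m: "0 < m" using tm by simp
    have "Hv m (Suc t) (unit_vec 0) (w (blade B)) (unit_vec 1) A = (-1) ^ t * ?v A"
      using axis_family_Hv0[OF l] by (simp add: scl_apply)
    then have "(-1) ^ Suc t * (if 0 \<in> A then - 1 else 1) * ((-1) ^ k * ?v A) = (-1) ^ t * ?v A"
      unfolding Hv_def Lv_unit[OF m] using neg[OF m] by simp
    then show ?thesis using A by (auto simp: minus_one_power_iff neg_eq_self split: if_splits)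
  qed
  fix j :: nat assume j: "2 \<le> j" "j < m"
  have Lb: "Lv m t (unit_vec j) (blade B) = (\<lambda>A. ((-1) ^ t * (if j \<in> B then - 1 else 1)) * blade B A :: 'a)"
    by (auto simp: fun_eq_iff Lv_unit[OF j(2)] blade_def)
  have z: "unit_vec j 0 = 0" using j by (simp add: unit_vec_def)
  have "Hv m (Suc t) (unit_vec j) (w (blade B)) (unit_vec 1) A = (-1) ^ Suc k * (((-1) ^ t * (if j \<in> B then - 1 else 1)) * ?v A)"
    unfolding axis_family_Hv[OF unitv_unit[OF j(2)] z l] Lb axis_family_scale[OF l] by (simp add: scl_apply)
  then have "(-1) ^ Suc t * (if j \<in> A then - 1 else 1) * ((-1) ^ k * ?v A) = (-1) ^ Suc k * (((-1) ^ t * (if j \<in> B then - 1 else 1)) * ?v A)"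
    unfolding Hv_def Lv_unit[OF j(2)] using neg[OF j(2)] j(1) by simp
  then show "j \<in> A \<longleftrightarrow> j \<in> B" using A by (auto simp: minus_one_power_iff neg_eq_self split: if_splits)
qed

text \<open>A agrees with B outside {0, 1} and has one element more, so it contains exactly one of 0
  and 1, and the parity of k tells which. Thus the value at e_1 is governed by a single
  scalar.\<close>

lemma axis_family_support1:
  assumes B: "B \<subseteq> {2..<m}" "card B = t" and A: "w (blade B) (unit_vec 1) A \<noteq> 0"
  shows "A = insert (if even k then 0 else 1) B"
proof -
  have B': "B \<subseteq> {1..<m}" using B by auto
  note s = axis_family_support[OF B' B(2) A]
  have fB: "finite B" using B finite_subset by blast
  have fA: "finite A" using s(3) finite_subset by blast
  have AB: "A - {0, 1} = B"
  proof
    show "A - {0, 1} \<subseteq> B"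
    proof
      fix j assume "j \<in> A - {0, 1}"
      then show "j \<in> B" using s(1)[of j] s(3) by (cases "2 \<le> j") auto
    qed
    show "B \<subseteq> A - {0, 1}" using s(1) B by fastforce
  qed
  have "1 \<in> A \<longleftrightarrow> odd k"
  proof
    assume "1 \<in> A"
    show "odd k"
    proof
      assume "even k"
      then have "A = insert 0 (insert 1 B)" using AB s(2) \<open>1 \<in> A\<close> by auto
      moreover have "0 \<notin> insert 1 B" "1 \<notin> B" using B by auto
      ultimately show False using s(4) fB B(2) by simp
    qed
  next
    assume "odd k"
    show "1 \<in> A"
    proof (rule ccontr)
      assume "1 \<notin> A"
      then have "A = B" using AB s(2) \<open>odd k\<close> by auto
      then show False using s(4) B(2) by simp
    qed
  qed
  then show ?thesis using AB s(2) by auto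
qed

text \<open>B has only t - 1 elements besides 1, and A agrees with it outside {0, 1}; to reach t + 1
  elements A must contain both 0 and 1.\<close>

lemma axis_family_support2:
  assumes B: "B \<subseteq> {1..<m}" "card B = t" "1 \<in> B" and A: "w (blade B) (unit_vec 1) A \<noteq> 0"
  shows "0 \<in> A" "1 \<in> A"
proof -
  note s = axis_family_support[OF B(1,2) A]
  have fB: "finite B" using B finite_subset by blast
  have AB: "A - {0, 1} = B - {1}"
  proof
    show "A - {0, 1} \<subseteq> B - {1}"
    proof
      fix j assume "j \<in> A - {0, 1}"
      then show "j \<in> B - {1}" using s(1)[of j] s(3) by (cases "2 \<le> j") auto
    qed
    show "B - {1} \<subseteq> A - {0, 1}"
    proof
      fix j assume j: "j \<in> B - {1}"
      then have "2 \<le> j" "j < m" using B by fastforce+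
      then show "j \<in> A - {0, 1}" using s(1)[of j] j by auto
    qed
  qed
  define X where "X = B - {1}"
  have c: "Suc (card X) = t" unfolding X_def using B fB by (metis card_Suc_Diff1)
  have f: "finite X" using fB by (simp add: X_def)
  have b: "\<not> A \<subseteq> insert a X" for a
  proof
    assume "A \<subseteq> insert a X"
    then have "card A \<le> card (insert a X)" using f by (intro card_mono) auto
    also have "\<dots> \<le> t" using c f by (simp add: card_insert_if)
    finally show False using s(4) by simp
  qed
  show "0 \<in> A" "1 \<in> A" using b[of 1] b[of 0] AB unfolding X_def by auto
qed

end

lemma sg_nonzero: "sg j A \<noteq> (0::'a::real_normed_field)"
  by (simp add: sg_def)

lemma evec_two:
  assumes "i < m" "j < m" "i \<noteq> j"
  shows "evec m (\<lambda>l. if l = i then a else if l = j then b else 0) v = (\<lambda>A. of_real a * eps i v A + of_real b * eps j v A)"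
    and "ivec m (\<lambda>l. if l = i then a else if l = j then b else 0) v = (\<lambda>A. of_real a * iot i v A + of_real b * iot j v A)"
proof -
  have e: "of_real (if l = i then a else if l = j then b else 0) * z = (if l = i then of_real a * z else 0) + (if l = j then of_real b * z else (0::'a))"
    for l z using assms(3) by auto
  show "evec m (\<lambda>l. if l = i then a else if l = j then b else 0) v = (\<lambda>A. of_real a * eps i v A + of_real b * eps j v A)"
    "ivec m (\<lambda>l. if l = i then a else if l = j then b else 0) v = (\<lambda>A. of_real a * iot i v A + of_real b * iot j v A)"
    using assms unfolding evec_def ivec_def e by (simp_all add: sum.distrib)
qed

text \<open>The unit vector (e_i - e_j) / sqrt 2 exchanges e_i and e_j up to sign, hence it replaces
  i by j in a blade up to a nonzero constant.\<close>

lemma Lv_swap_blade: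
  fixes i j m :: nat
  defines "\<rho> \<equiv> \<lambda>l. if l = i then 1 / sqrt 2 else if l = j then - 1 / sqrt 2 else 0"
  assumes ij: "i < m" "j < m" "i \<in> B" "j \<notin> B"
  shows "unitv m \<rho>" "\<exists>c. c \<noteq> 0 \<and> Lv m s \<rho> (blade B) = (\<lambda>A. c * (blade (insert j (B - {i})) A :: 'a::real_normed_field))"
proof -
  have ne: "i \<noteq> j" using ij by auto
  let ?C = "B - {i}"
  have "dotp m \<rho> \<rho> = (\<Sum>l<m. (if l = i then 1/2 else 0) + (if l = j then 1/2 else 0))"
    unfolding dotp_def \<rho>_def by (intro sum.cong refl) (use ne in auto)
  then show u: "unitv m \<rho>" using ij by (simp add: sum.distrib)
  let ?r = "of_real (1 / sqrt 2) :: 'a"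
  have rr: "?r * ?r = 1 / 2"
    by (simp flip: of_real_mult of_real_divide) (simp add: of_real_divide)
  have r': "of_real (- 1 / sqrt 2) = - ?r" by simp
  have "iot i (blade B) A = - sg i ?C * (blade ?C A :: 'a)" for A
  proof (cases "A = ?C")
    case True
    then show ?thesis using ij by (simp add: iot_def blade_def insert_absorb)
  next
    case False
    then have "i \<notin> A \<Longrightarrow> insert i A \<noteq> B" by auto
    then show ?thesis using False by (simp add: iot_def blade_def)
  qed
  moreover have "iot j (blade B) A = (0::'a)" for A using ij by (auto simp: iot_def blade_def)
  ultimately have I: "ivec m \<rho> (blade B) = (\<lambda>A. - ?r * sg i ?C * (blade ?C A :: 'a))"
    unfolding \<rho>_def evec_two(2)[OF ij(1,2) ne] r' by (simp add: mult.assoc)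
  have e: "eps l (blade ?C) A = sg l ?C * (blade (insert l ?C) A :: 'a)" if "l \<notin> ?C" for l A
  proof (cases "A = insert l ?C")
    case True
    then show ?thesis using that by (simp add: eps_def blade_def sg_insert)
  next
    case False
    then have "l \<in> A \<Longrightarrow> A - {l} \<noteq> ?C" by auto
    then show ?thesis using False by (simp add: eps_def blade_def)
  qed
  have iB: "insert i ?C = B" using ij by auto
  have E: "evec m \<rho> (blade ?C) = (\<lambda>A. ?r * (sg i ?C * blade B A) - ?r * (sg j ?C * (blade (insert j ?C) A :: 'a)))"
    unfolding \<rho>_def evec_two(1)[OF ij(1,2) ne] r' using e[of i] e[of j] ij by (simp add: iB insert_absorb)
  have N: "evec m \<rho> (ivec m \<rho> v) A - ivec m \<rho> (evec m \<rho> v) A = v A + 2 * evec m \<rho> (ivec m \<rho> v) A" for v :: "nat set \<Rightarrow> 'a" and A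
    using evec_ivec[of m \<rho> \<rho> v A] u by (simp add: algebra_simps eq_neg_iff_add_eq_0)
  have "Lv m s \<rho> (blade B) A = ((-1) ^ s * sg i ?C * sg j ?C) * (blade (insert j ?C) A :: 'a)" for A
  proof -
    have "evec m \<rho> (ivec m \<rho> (blade B)) A = - ?r * sg i ?C * (?r * (sg i ?C * blade B A) - ?r * (sg j ?C * blade (insert j ?C) A))"
      unfolding I evec_scale E ..
    also have "\<dots> = (?r * ?r) * (sg i ?C * sg j ?C * blade (insert j ?C) A) - (?r * ?r) * ((sg i ?C * sg i ?C) * blade B A)"
      by (simp add: algebra_simps)
    finally show ?thesis unfolding Lv_def N rr sg_square by simp
  qed
  moreover have "(-1) ^ s * sg i ?C * sg j ?C \<noteq> (0::'a)" by (simp add: sg_def)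
  ultimately show "\<exists>c. c \<noteq> 0 \<and> Lv m s \<rho> (blade B) = (\<lambda>A. c * (blade (insert j (B - {i})) A :: 'a))" by blast
qed

context
  fixes m k t :: nat and w :: "(nat set \<Rightarrow> 'a::real_normed_field) \<Rightarrow> 'a clfun"
  assumes axis_family: "axis_family m k t w" and tm: "Suc t < m"
begin

text \<open>As i and j are at least 2, the exchanging vector is orthogonal to e_0 and e_1: it is
  admissible in the transformation law and moves the evaluation point e_1 only to -e_1.\<close>

lemma axis_family_swap:
  assumes B: "B \<subseteq> {2..<m}" "card B = t" and z: "w (blade B) (unit_vec 1) = 0"
    and ij: "i \<in> B" "j \<notin> B" "2 \<le> j" "j < m"
  shows "w (blade (insert j (B - {i}))) (unit_vec 1) = 0"
proof -
  let ?B = "insert j (B - {i})"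
  define \<rho> :: "nat \<Rightarrow> real" where "\<rho> = (\<lambda>l. if l = i then 1 / sqrt 2 else if l = j then - 1 / sqrt 2 else 0)"
  have i: "2 \<le> i" "i < m" using B ij by auto
  note sw = Lv_swap_blade[OF i(2) ij(4,1,2), folded \<rho>_def]
  obtain c where c: "c \<noteq> 0" "Lv m t \<rho> (blade B) = (\<lambda>A. c * (blade ?B A :: 'a))" using sw(2) by blast
  have l: "axis_free m t (blade B :: nat set \<Rightarrow> 'a)" using B by (intro axis_free_blade) auto
  have l': "axis_free m t (blade ?B :: nat set \<Rightarrow> 'a)"
  proof (rule axis_free_blade)
    show "?B \<subseteq> {1..<m}" using B ij by auto
    have "finite B" using B finite_subset by blast
    then show "card ?B = t" using B ij by (auto simp: card_insert_if card_Diff_singleton) (metis Suc_pred card_gt_0_iff empty_iff)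
  qed
  have r0: "\<rho> 0 = 0" using i ij by (simp add: \<rho>_def)
  have d: "dotp m \<rho> (unit_vec 1) = 0"
    unfolding dotp_commute[of m \<rho>] using tm i ij by (simp add: dotp_unit \<rho>_def)
  have "w (blade B) (reflv m \<rho> (unit_vec 1)) = (\<lambda>A. of_real (-1) ^ k * w (blade B) (unit_vec 1) A)"
    by (rule hpoly_homogeneous[OF axis_family_hpoly[OF axis_family tm l]]) (simp add: reflv_def d del: One_nat_def)
  then have "w (blade B) (reflv m \<rho> (unit_vec 1)) = 0" by (simp add: z fun_eq_iff zero_fun_apply del: One_nat_def)
  then have "Hv m (Suc t) \<rho> (w (blade B)) (unit_vec 1) = 0" by (simp add: Hv_def Lv_zero)
  then have "(-1) ^ Suc k * (c * w (blade ?B) (unit_vec 1) A) = 0" for A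
    unfolding axis_family_Hv[OF axis_family tm sw(1) r0 l] c(2) axis_family_scale[OF axis_family tm l'] by (auto simp: pointwise)
  then show ?thesis using c(1) by (auto simp: fun_eq_iff zero_fun_apply)
qed

text \<open>Any two t-subsets of {2..<m} are connected by exchanging one element at a time; the
  induction is on the number of elements of B0 still outside B.\<close>

lemma axis_family_zero_blades:
  assumes B0: "B0 \<subseteq> {2..<m}" "card B0 = t" "w (blade B0) (unit_vec 1) = 0"
    and B: "B \<subseteq> {2..<m}" "card B = t"
  shows "w (blade B) (unit_vec 1) = 0"
  using B0
proof (induction "card (B0 - B)" arbitrary: B0)
  case 0
  have f: "finite B0" "finite B" using 0 B finite_subset by blast+
  then have "B0 \<subseteq> B" using 0(1) by auto
  then have "B0 = B" using f 0 B by (metis card_subset_eq)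
  then show ?case using 0 by simp
next
  case (Suc n)
  have f: "finite B0" "finite B" using Suc.prems B finite_subset by blast+
  obtain i where i: "i \<in> B0" "i \<notin> B" using Suc.hyps(2) by (metis Diff_iff card.empty equals0I nat.distinct(1))
  have "\<not> B \<subseteq> B0" using f i Suc.prems B by (metis card_subset_eq)
  then obtain j where j: "j \<in> B" "j \<notin> B0" by blast
  have j2: "2 \<le> j" "j < m" using j B by auto
  let ?B = "insert j (B0 - {i})"
  have e: "?B - B = (B0 - B) - {i}" using j by auto
  have "card (?B - B) = n" unfolding e using Suc.hyps(2) i f by simp
  moreover have "?B \<subseteq> {2..<m}" using Suc.prems j2 by auto
  moreover have "card ?B = t" using f i j Suc.prems by (simp add: card_insert_if card_Diff_singleton) (metis Suc_pred card_gt_0_iff empty_iff)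
  ultimately show ?case
    using Suc.hyps(1)[of ?B] axis_family_swap[OF Suc.prems i(1) j(2) j2] by auto
qed

context
  fixes B0 assumes B0: "B0 \<subseteq> {2..<m}" "card B0 = t" "w (blade B0) (unit_vec 1) = 0"
begin

text \<open>Blades containing 1 are covered by the support statement alone: their values contain
  both indices 0 and 1, so both wedges kill them. On the other blades the value vanishes by
  propagation from B0.\<close>

lemma axis_family_zero_axis:
  assumes "axis_free m t \<omega>"
  shows "eps 0 (w \<omega> (unit_vec 1)) = 0 \<and> eps 1 (w \<omega> (unit_vec 1)) = 0"
  using assms
proof (induction rule: axis_free_induct)
  case (blade B)
  show ?case
  proof (cases "1 \<in> B")
    case True
    have "w (blade B) (unit_vec 1) A = 0" if "0 \<notin> A \<or> 1 \<notin> A" for A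
      using axis_family_support2[OF axis_family tm blade True] that by blast
    then show ?thesis by (auto simp: eps_def fun_eq_iff zero_fun_apply)
  next
    case False
    have "B \<subseteq> {2..<m}"
    proof
      fix x assume "x \<in> B"
      then show "x \<in> {2..<m}" using blade(1) False by (cases "x = 1") auto
    qed
    then show ?thesis using axis_family_zero_blades[OF B0 _ blade(2)] by simp
  qed
next
  case (add \<omega> \<omega>')
  have e: "w (\<omega> + \<omega>') (unit_vec 1) = w \<omega> (unit_vec 1) + w \<omega>' (unit_vec 1)"
    unfolding axis_family_add[OF axis_family tm add(1,2)] by (rule plus_fun_apply)
  show ?case unfolding e eps_add using add(3,4) by simp
next
  case (scale c \<omega>)
  have "eps j (scl c (w \<omega>) x) = (\<lambda>A. c * eps j (w \<omega> x) A)" for j x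
    unfolding scl_def eps_scale ..
  then show ?case unfolding axis_family_scale[OF axis_family tm scale(1)] using scale(2) by (simp add: fun_eq_iff zero_fun_apply)
next
  case zero
  have "w 0 (unit_vec 1) = 0" unfolding axis_family_zero0[OF axis_family tm] by (rule zero_fun_apply)
  then show ?case by (simp only: eps_zero simp_thms)
qed

text \<open>A nonzero y orthogonal to e_0 is a negative multiple of e_1 or is carried to a positive
  one by a unit vector orthogonal to e_0. The second case turns the two wedges into those with e_0
  and e_1 at e_1, applied to the transformed \<omega>.\<close>

lemma axis_family_zero_hyperplane:
  assumes l: "axis_free m t \<omega>" and y0: "y 0 = 0"
  shows "eps 0 (w \<omega> y) = 0 \<and> evec m y (w \<omega> y) = 0"
proof -
  have m1: "1 < m" "0 < m" using tm by auto
  have hom: ?thesis if "\<And>i. i < m \<Longrightarrow> y i = c * unit_vec 1 i" for c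
  proof -
    have 1: "w \<omega> y = (\<lambda>A. of_real c ^ k * w \<omega> (unit_vec 1) A)" by (rule hpoly_homogeneous[OF axis_family_hpoly[OF axis_family tm l] that])
    have 2: "evec m y v = (\<lambda>A. of_real c * eps 1 v A)" for v :: "nat set \<Rightarrow> 'a"
      by (subst evec_unit[OF m1(1), symmetric], rule evec_coeffs, rule that)
    show ?thesis unfolding 2 unfolding 1 eps_scale using axis_family_zero_axis[OF l] by (simp add: fun_eq_iff zero_fun_apply)
  qed
  define r where "r = sqrt (dotp m y y)"
  have nn: "0 \<le> dotp m y y" by (simp add: dotp_def sum_nonneg)
  have r2: "r\<^sup>2 = dotp m y y" using nn by (simp add: r_def)
  show ?thesis
  proof (cases "dotp m y y = 0")
    case True
    show ?thesis by (rule hom[of 0]) (simp add: dotp_self_eq_0[OF True])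
  next
    case False
    then have r: "0 < r" using nn by (simp add: r_def)
    from reflect_to_axis[OF m1(1) r r2] consider
      (a) "\<forall>i<m. y i = - r * unit_vec 1 i"
      | (b) \<rho> where "unitv m \<rho>" "\<forall>i<m. reflv m \<rho> y i = r * unit_vec 1 i" "\<rho> 0 = 0"
      using y0 by (metis zero_neq_one)
    then show ?thesis
    proof cases
      case a
      show ?thesis by (rule hom[of "- r"]) (use a in blast)
    next
      case b
      let ?v = "w \<omega> y"
      let ?\<omega> = "Lv m t \<rho> \<omega>"
      have l': "axis_free m t ?\<omega>" using b(3) l by (rule axis_free_Lv)
      have "w \<omega> (reflv m \<rho> (reflv m \<rho> y)) = ?v"
        by (rule hpoly_cong[OF axis_family_hpoly[OF axis_family tm l]]) (simp add: reflv_reflv[OF b(1)])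
      then have "Lv m (Suc t) \<rho> ?v = Hv m (Suc t) \<rho> (w \<omega>) (reflv m \<rho> y)" by (simp add: Hv_def)
      also have "\<dots> = (\<lambda>A. (-1) ^ Suc k * w ?\<omega> (reflv m \<rho> y) A)"
        unfolding axis_family_Hv[OF axis_family tm b(1,3) l] by (simp add: scl_def)
      also have "w ?\<omega> (reflv m \<rho> y) = (\<lambda>A. of_real r ^ k * w ?\<omega> (unit_vec 1) A)"
        by (rule hpoly_homogeneous[OF axis_family_hpoly[OF axis_family tm l']]) (use b(2) in blast)
      finally have L: "Lv m (Suc t) \<rho> ?v = (\<lambda>A. (-1) ^ Suc k * (of_real r ^ k * w ?\<omega> (unit_vec 1) A))" .
      have z: "eps 0 (Lv m (Suc t) \<rho> ?v) = 0" "eps 1 (Lv m (Suc t) \<rho> ?v) = 0"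
        using axis_family_zero_axis[OF l'] unfolding L eps_scale by (simp_all add: fun_eq_iff zero_fun_apply)
      have "Lv m (Suc (Suc t)) \<rho> (evec m (unit_vec 0) ?v) = evec m (reflv m \<rho> (unit_vec 0)) (Lv m (Suc t) \<rho> ?v)"
        by (rule Lv_evec[OF b(1)])
      also have "\<dots> = (\<lambda>A. of_real (-1) * evec m (unit_vec 0) (Lv m (Suc t) \<rho> ?v) A)"
        by (rule evec_coeffs) (use b(3) in \<open>simp add: reflv_def dotp_commute[of m \<rho>] dotp_unit[OF m1(2)]\<close>)
      also have "\<dots> = 0" unfolding evec_unit[OF m1(2)] z by (simp add: fun_eq_iff zero_fun_apply)
      finally have 1: "eps 0 ?v = 0" using Lv_eq_0[OF b(1)] evec_unit[OF m1(2)] by metis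
      have "Lv m (Suc (Suc t)) \<rho> (evec m y ?v) = evec m (reflv m \<rho> y) (Lv m (Suc t) \<rho> ?v)"
        by (rule Lv_evec[OF b(1)])
      also have "\<dots> = (\<lambda>A. of_real r * evec m (unit_vec 1) (Lv m (Suc t) \<rho> ?v) A)"
        by (rule evec_coeffs) (use b(2) in blast)
      also have "\<dots> = 0" unfolding evec_unit[OF m1(1)] z by (simp add: fun_eq_iff zero_fun_apply)
      finally have 2: "evec m y ?v = 0" using Lv_eq_0[OF b(1)] by metis
      show ?thesis using 1 2 by blast
    qed
  qed
qed

end

end

section \<open>Restriction of null solutions to the hyperplane x_0 = 0\<close>

definition cut0 :: "(nat \<Rightarrow> real) \<Rightarrow> nat \<Rightarrow> real" where "cut0 x = x(0 := 0)"

lemma cut0_linear: "i < m \<Longrightarrow> cut0 x i = (\<Sum>j<m. (if i = j \<and> i \<noteq> 0 then 1 else 0) * x j)"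
  by (cases "i = 0") (auto simp: cut0_def if_distrib[of "\<lambda>u. u * _"] cong: if_cong)

lemma cut0_hpoly: "P \<in> hpoly m k s \<Longrightarrow> (\<lambda>x. P (cut0 x)) \<in> hpoly m k s"
  unfolding hpoly_iff using hp_linear_subst(1)[of m k _ cut0, OF _ cut0_linear] by blast

lemma pderiv_cl_cut0:
  assumes "P \<in> hpoly m k s" "j < m"
  shows "pderiv_cl j (\<lambda>x. P (cut0 x)) x A = (if j = 0 then 0 else pderiv_cl j P (cut0 x) A)"
proof -
  have "pderiv_cl j (\<lambda>x. P (cut0 x)) x A = (\<Sum>i<m. of_real (if i = j \<and> i \<noteq> 0 then 1 else 0) * pderiv_cl i P (cut0 x) A)"
    unfolding pderiv_cl_pd by (rule hp_linear_subst(2)[OF hpoly_hp[OF assms(1)] cut0_linear assms(2)])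
  also have "\<dots> = (\<Sum>i<m. if i = j then (if j = 0 then 0 else pderiv_cl j P (cut0 x) A) else 0)"
    by (intro sum.cong) auto
  finally show ?thesis using assms(2) by simp
qed

lemma dirac_sum_harm: "P \<in> harm m s k \<Longrightarrow> (\<Sum>j<m. eps j (pderiv_cl j P x) A + iot j (pderiv_cl j P x) A) = 0"
  by (auto simp: harm_eq dd_def de_def fun_eq_iff zero_fun_apply sum.distrib)

text \<open>\<open>eps j\<close> plus \<open>iot j\<close> is Clifford multiplication by e_j, which
  is injective; its two terms are supported on disjoint collections of blades.\<close>

lemma eps_iot_eq_0: "(\<And>A. eps j v A + iot j v A = 0) \<Longrightarrow> v = 0"
proof -
  assume z: "\<And>A. eps j v A + iot j v A = 0"
  have "v A = 0" for A
  proof (cases "j \<in> A")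
    case True
    then have "sg j (A - {j}) * v A = (0::'a)" using z[of "A - {j}"] by (simp add: eps_def iot_def insert_absorb)
    then have "sg j (A - {j}) * (sg j (A - {j}) * v A) = 0" by simp
    then show ?thesis by (simp only: sg_square_left)
  next
    case False
    then have "sg j (insert j A) * v A = (0::'a)" using z[of "insert j A"] by (simp add: eps_def iot_def)
    then have "sg j (insert j A) * (sg j (insert j A) * v A) = 0" by simp
    then show ?thesis by (simp only: sg_square_left)
  qed
  then show "v = 0" by (simp add: fun_eq_iff zero_fun_apply)
qed

lemma pderiv_cl_zero: "pderiv_cl j 0 = 0"
  by (simp add: fun_eq_iff pderiv_cl_pd zero_fun_apply pd_const)

lemma dd_pderiv: "P \<in> hpoly m k s \<Longrightarrow> dd m (pderiv_cl i P) = pderiv_cl i (dd m P)"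
  and de_pderiv: "P \<in> hpoly m k s \<Longrightarrow> de m (pderiv_cl i P) = pderiv_cl i (de m P)"
proof -
  assume P: "P \<in> hpoly m k s"
  have p: "pdable (\<lambda>x. pderiv_cl j P x A)" for j A by (rule hpoly_pdable[OF pderiv_cl_hpoly_pred[OF P]])
  have q: "pdable (\<lambda>x. eps j (pderiv_cl j P x) A)" "pdable (\<lambda>x. iot j (pderiv_cl j P x) A)" for j A
    by (rule pdable_hp[OF hp_eps[OF hpoly_hp[OF pderiv_cl_hpoly_pred[OF P]]]] pdable_hp[OF hp_iot[OF hpoly_hp[OF pderiv_cl_hpoly_pred[OF P]]]])+
  show "dd m (pderiv_cl i P) = pderiv_cl i (dd m P)"
    unfolding dd_def pderiv_cl_commute[OF P, of _ i]
    by (intro ext) (simp add: pderiv_cl_pd[of i "\<lambda>x A. \<Sum>j<m. _ j x A"] pd_sum q pd_eps p)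
  show "de m (pderiv_cl i P) = pderiv_cl i (de m P)"
    unfolding de_def pderiv_cl_commute[OF P, of _ i]
    by (intro ext) (simp add: pderiv_cl_pd[of i "\<lambda>x A. \<Sum>j<m. _ j x A"] pd_sum q pd_iot p)
qed

text \<open>Uniqueness in the Cauchy--Kovalevskaya theorem: a null solution of the Dirac operator is determined by its
  restriction to a hyperplane.\<close>

lemma harm_zero_if_zero_on_hyperplane:
  assumes "0 < m"
  shows "P \<in> harm m s k \<Longrightarrow> (\<And>x. P (cut0 x) = 0) \<Longrightarrow> P = 0"
proof (induction k arbitrary: P)
  case 0
  then show ?case using hpoly_0_const[OF harm_hpoly[OF 0(1)]] by (metis (no_types, lifting) ext zero_fun_apply)
next
  case (Suc k)
  have P: "P \<in> hpoly m (Suc k) s" by (rule harm_hpoly[OF Suc.prems(1)])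
  have d: "pderiv_cl j P \<in> harm m s k" for j
    using Suc.prems(1) pderiv_cl_hpoly[OF P] by (simp add: harm_eq dd_pderiv[OF P] de_pderiv[OF P] pderiv_cl_zero)
  have z: "pderiv_cl j P = 0" if "j < m" "j \<noteq> 0" for j
  proof (rule Suc.IH[OF d])
    fix x
    have "(\<lambda>x. P (cut0 x)) = 0" using Suc.prems(2) by (simp add: fun_eq_iff zero_fun_apply)
    then have "pderiv_cl j (\<lambda>x. P (cut0 x)) x A = 0" for A by (simp add: pderiv_cl_zero zero_fun_apply)
    then show "pderiv_cl j P (cut0 x) = 0"
      using pderiv_cl_cut0[OF P that(1), of x] that(2) by (simp add: fun_eq_iff zero_fun_apply)
  qed
  \<comment> \<open>With all tangential derivatives gone, the Dirac equation reduces to e_0 times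
    the normal derivative.\<close>
  have "pderiv_cl 0 P x = 0" for x
  proof (rule eps_iot_eq_0[of 0])
    fix A
    have "(\<Sum>j<m. eps j (pderiv_cl j P x) A + iot j (pderiv_cl j P x) A)
        = (\<Sum>j<m. if j = 0 then eps 0 (pderiv_cl 0 P x) A + iot 0 (pderiv_cl 0 P x) A else 0)"
      by (intro sum.cong) (auto simp: z zero_fun_apply)
    then show "eps 0 (pderiv_cl 0 P x) A + iot 0 (pderiv_cl 0 P x) A = 0"
      using dirac_sum_harm[OF Suc.prems(1), of x A] assms by simp
  qed
  then have "pderiv_cl 0 P = 0" by (simp add: fun_eq_iff zero_fun_apply)
  then show ?case using hpoly_zero_if_pderiv_zero[OF P] z by metis
qed

text \<open>The restriction q to the hyperplane, extended constantly in x_0, satisfies x wedge q = 0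
  and is killed by \<open>de\<close>. The anticommutator of these two operators is a nonzero scalar,
  so q = 0, and a null solution vanishing on the hyperplane is zero.\<close>

lemma axis_family_zero:
  fixes w :: "(nat set \<Rightarrow> 'a::real_normed_field) \<Rightarrow> 'a clfun"
  assumes axis_family: "axis_family m k t w" and tm: "Suc t < m"
    and B0: "B0 \<subseteq> {2..<m}" "card B0 = t" "w (blade B0) (unit_vec 1) = 0" and l: "axis_free m t \<omega>"
  shows "w \<omega> = 0"
proof -
  have m: "0 < m" using tm by simp
  let ?P = "w \<omega>"
  have H: "?P \<in> harm m (Suc t) k" by (rule axis_family_harm[OF axis_family tm l])
  have P: "?P \<in> hpoly m k (Suc t)" by (rule harm_hpoly[OF H])
  define q where "q = (\<lambda>x. ?P (cut0 x))"
  have q: "q \<in> hpoly m k (Suc t)" unfolding q_def by (rule cut0_hpoly[OF P])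
  have h: "eps 0 (q x) = 0" "evec m (cut0 x) (q x) = 0" for x
    using axis_family_zero_hyperplane[OF axis_family tm B0 l, of "cut0 x"] unfolding q_def by (simp_all only: cut0_def fun_upd_same)
  have e0: "q x A = 0" if "0 \<notin> A" for x A
  proof -
    have "sg 0 (insert 0 A) * q x A = 0"
      using fun_cong[OF h(1)[of x], of "insert 0 A"] that by (simp add: eps_def zero_fun_apply)
    then show ?thesis by (simp add: sg_nonzero)
  qed
  have "xe m q = 0"
  proof
    fix x
    have "evec m x v A = evec m (cut0 x) v A + of_real (x 0) * eps 0 v A" for v :: "nat set \<Rightarrow> 'a" and A
    proof -
      have "evec m x v A = (\<Sum>j<m. of_real (cut0 x j) * eps j v A + (if j = 0 then of_real (x 0) * eps 0 v A else 0))"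
        unfolding evec_def by (intro sum.cong) (auto simp: cut0_def)
      then show ?thesis using m by (simp add: sum.distrib evec_def)
    qed
    then show "xe m q x = 0 x" by (simp add: xe_def fun_eq_iff h zero_fun_apply)
  qed
  \<comment> \<open>Every component of q contains the index 0. At blades without 0 only the
    contraction by e_0 could contribute, but q does not depend on x_0; at blades with 0 that
    contraction is absent, and the other terms are those of \<open>de m ?P\<close> on the
    hyperplane.\<close>
  moreover have "de m q = 0"
  proof (intro ext)
    fix x A
    have dq: "pderiv_cl j q x = (if j = 0 then 0 else pderiv_cl j ?P (cut0 x))" if "j < m" for j
      using pderiv_cl_cut0[OF P that, of x] by (auto simp: q_def fun_eq_iff zero_fun_apply)
    have dq0: "pderiv_cl j q x B = 0" if "0 \<notin> B" for j B
      using e0[OF that] by (simp add: pderiv_cl_pd pd_const)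
    show "de m q x A = 0 x A"
    proof (cases "0 \<in> A")
      case False
      have "iot j (pderiv_cl j q x) A = 0" if "j < m" for j
        using dq[OF that] dq0[of "insert j A" j] False by (cases "j = 0") (auto simp: iot_def zero_fun_apply)
      then show ?thesis by (simp add: de_def zero_fun_apply)
    next
      case True
      have "de m q x A = (\<Sum>j<m. iot j (pderiv_cl j ?P (cut0 x)) A)"
        unfolding de_def by (rule sum.cong) (use True in \<open>auto simp: dq iot_def zero_fun_apply\<close>)
      also have "\<dots> = de m ?P (cut0 x) A" by (simp add: de_def)
      also have "\<dots> = 0" using H by (simp add: harm_eq zero_fun_apply)
      finally show ?thesis by (simp add: zero_fun_apply)
    qed
  qed
  ultimately have "q = 0" using de_xe_harm[OF q] tm by simp
  then have "w \<omega> (cut0 x) = 0" for x unfolding q_def by (metis zero_fun_apply)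
  then show ?thesis by (rule harm_zero_if_zero_on_hyperplane[OF m H])
qed

section \<open>Projecting zonal polynomials to invariant subspaces\<close>

definition orth_proj :: "nat \<Rightarrow> nat \<Rightarrow> 'a::{real_normed_field, euclidean_space} clfun set \<Rightarrow> 'a clfun \<Rightarrow> 'a clfun" where
  "orth_proj m k U v = (SOME u. u \<in> U \<and> (\<forall>p\<in>U. fis m k u p = fis m k v p))"

lemma fsubspace_iff: "fsubspace W \<longleftrightarrow> 0 \<in> W \<and> (\<forall>P\<in>W. \<forall>Q\<in>W. P + Q \<in> W) \<and> (\<forall>c. \<forall>P\<in>W. scl c P \<in> W)"
  by (simp add: fsubspace_def scl_def)

lemma fsubspace_0: "fsubspace W \<Longrightarrow> 0 \<in> W"
  and fsubspace_add: "fsubspace W \<Longrightarrow> P \<in> W \<Longrightarrow> Q \<in> W \<Longrightarrow> P + Q \<in> W"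
  and fsubspace_scl: "fsubspace W \<Longrightarrow> P \<in> W \<Longrightarrow> scl c P \<in> W"
  by (simp_all add: fsubspace_iff)

context
  fixes U :: "'a::{real_normed_field, euclidean_space} clfun set" and m k s :: nat
  assumes U: "fsubspace U" "U \<subseteq> hpoly m k s"
begin

lemma U_hpoly: "P \<in> U \<Longrightarrow> P \<in> hpoly m k s"
  using U(2) by blast

lemma orth_proj_in: "v \<in> hpoly m k s \<Longrightarrow> orth_proj m k U v \<in> U"
  and orth_proj_fis: "v \<in> hpoly m k s \<Longrightarrow> p \<in> U \<Longrightarrow> fis m k (orth_proj m k U v) p = fis m k v p"
proof -
  have r: "rsubspace U" using U(1) by (simp add: rsubspace_def fsubspace_iff)
  have *: "orth_proj m k U v \<in> U \<and> (\<forall>p\<in>U. fis m k (orth_proj m k U v) p = fis m k v p)" if "v \<in> hpoly m k s" for v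
  proof -
    have "\<exists>u. u \<in> U \<and> (\<forall>p\<in>U. fis m k u p = fis m k v p)" using orthogonal_projection[OF r U(2) that] by blast
    then show ?thesis unfolding orth_proj_def by (rule someI_ex)
  qed
  show "v \<in> hpoly m k s \<Longrightarrow> orth_proj m k U v \<in> U" "v \<in> hpoly m k s \<Longrightarrow> p \<in> U \<Longrightarrow> fis m k (orth_proj m k U v) p = fis m k v p"
    using * by blast+
qed

lemma orth_proj_eqI:
  assumes v: "v \<in> hpoly m k s" and u: "u \<in> U" "\<And>p. p \<in> U \<Longrightarrow> fis m k u p = fis m k v p"
  shows "orth_proj m k U v = u"
proof -
  let ?d = "orth_proj m k U v + scl (of_real (-1)) u"
  have d: "?d \<in> U" by (intro fsubspace_add fsubspace_scl U orth_proj_in v u)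
  have "fis m k ?d ?d = fis m k (orth_proj m k U v) ?d + (-1) * fis m k u ?d"
    using fis_add[OF U_hpoly[OF orth_proj_in[OF v]] scl_hpoly[OF U_hpoly[OF u(1)]], of "of_real (-1)" ?d]
      fis_of_real[OF U_hpoly[OF u(1)], of "-1" ?d] by simp
  also have "\<dots> = 0" using orth_proj_fis[OF v d] u(2)[OF d] by simp
  finally have "?d = 0" using fis_definite[OF U_hpoly[OF d]] by blast
  then show ?thesis by (simp add: scl_simps)
qed

lemma orth_proj_add: "v \<in> hpoly m k s \<Longrightarrow> v' \<in> hpoly m k s \<Longrightarrow> orth_proj m k U (v + v') = orth_proj m k U v + orth_proj m k U v'"
  by (rule orth_proj_eqI) (auto intro!: hpoly_add fsubspace_add U orth_proj_in simp: fis_add[OF U_hpoly[OF orth_proj_in] U_hpoly[OF orth_proj_in]] fis_add orth_proj_fis)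

text \<open>Linearity over the whole field although the form is only real: the scalar moves to the
  test vector as its adjoint, and U is closed under all scalars.\<close>

lemma orth_proj_scl:
  assumes v: "v \<in> hpoly m k s"
  shows "orth_proj m k U (scl c v) = scl c (orth_proj m k U v)"
proof (rule orth_proj_eqI)
  obtain c' where c': "\<And>a b. (c * a) \<bullet> b = a \<bullet> (c' * b)" using mult_adjoint[of c] by blast
  fix p assume p: "p \<in> U"
  show "fis m k (scl c (orth_proj m k U v)) p = fis m k (scl c v) p"
    unfolding fis_scl_adjoint[OF c' U_hpoly[OF orth_proj_in[OF v]] U_hpoly[OF p]] fis_scl_adjoint[OF c' v U_hpoly[OF p]]
    by (rule orth_proj_fis[OF v fsubspace_scl[OF U(1) p]])
qed (intro scl_hpoly v fsubspace_scl U orth_proj_in)+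

lemma orth_proj_Hv:
  assumes H: "Hinv m s U" and \<rho>: "unitv m \<rho>" and v: "v \<in> hpoly m k s"
  shows "orth_proj m k U (Hv m s \<rho> v) = Hv m s \<rho> (orth_proj m k U v)"
proof (rule orth_proj_eqI)
  have HU: "Hv m s \<rho> p \<in> U" if "p \<in> U" for p using H \<rho> that by (simp add: Hinv_def)
  show "Hv m s \<rho> v \<in> hpoly m k s" by (rule Hv_hpoly[OF v])
  show "Hv m s \<rho> (orth_proj m k U v) \<in> U" by (rule HU[OF orth_proj_in[OF v]])
  fix p assume p: "p \<in> U"
  have e: "p = Hv m s \<rho> (Hv m s \<rho> p)" by (rule Hv_Hv[OF \<rho> U_hpoly[OF p], symmetric])
  have "fis m k (Hv m s \<rho> (orth_proj m k U v)) p = fis m k (orth_proj m k U v) (Hv m s \<rho> p)"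
    by (subst e) (rule fis_Hv[OF \<rho> U_hpoly[OF orth_proj_in[OF v]] U_hpoly[OF HU[OF p]]])
  also have "\<dots> = fis m k v (Hv m s \<rho> p)" by (rule orth_proj_fis[OF v HU[OF p]])
  also have "\<dots> = fis m k (Hv m s \<rho> v) p"
    by (subst (2) e) (rule fis_Hv[OF \<rho> v U_hpoly[OF HU[OF p]], symmetric])
  finally show "fis m k (Hv m s \<rho> (orth_proj m k U v)) p = fis m k (Hv m s \<rho> v) p" .
qed

end

lemma graded_eps0: "0 < m \<Longrightarrow> axis_free m t \<omega> \<Longrightarrow> graded m (Suc t) (eps 0 \<omega>)"
  by (simp add: axis_free_def graded_eps)

text \<open>A unit vector orthogonal to e_0 negates both the coordinate x_0 and the vector e_0,
  which makes k + 1 signs.\<close>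

lemma Hv_zonal:
  assumes m: "0 < m" and \<rho>: "unitv m \<rho>" "\<rho> 0 = 0"
  shows "Hv m (Suc t) \<rho> (zonal k (eps 0 \<omega>)) = scl ((-1) ^ Suc k) (zonal k (eps 0 (Lv m t \<rho> \<omega>)))"
proof (intro ext)
  fix x A
  have g0: "reflv m \<rho> x 0 = - x 0" using m \<rho> by (simp add: reflv_def)
  have "Lv m (Suc t) \<rho> (eps 0 \<omega>) = evec m (reflv m \<rho> (unit_vec 0)) (Lv m t \<rho> \<omega>)"
    using Lv_evec[OF \<rho>(1), of t "unit_vec 0" \<omega>] by (simp add: evec_unit[OF m])
  also have "\<dots> = (\<lambda>A. of_real (-1) * evec m (unit_vec 0) (Lv m t \<rho> \<omega>) A)"
    by (rule evec_coeffs) (simp add: reflv_def dotp_commute[of m \<rho> "unit_vec 0"] dotp_unit[OF m] \<rho>(2))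
  finally have L: "Lv m (Suc t) \<rho> (eps 0 \<omega>) = (\<lambda>A. - eps 0 (Lv m t \<rho> \<omega>) A)" by (simp add: evec_unit[OF m])
  show "Hv m (Suc t) \<rho> (zonal k (eps 0 \<omega>)) x A = scl ((-1) ^ Suc k) (zonal k (eps 0 (Lv m t \<rho> \<omega>))) x A"
    unfolding Hv_def zonal_def Lv_scale L g0 by (simp add: scl_apply power_minus[of "of_real _"])
qed

lemma Hv_zonal0:
  assumes m: "0 < m" and l: "axis_free m t \<omega>"
  shows "Hv m (Suc t) (unit_vec 0) (zonal k (eps 0 \<omega>)) = scl ((-1) ^ t) (zonal k (eps 0 \<omega>))"
proof (intro ext)
  fix x A
  have g0: "reflv m (unit_vec 0) x 0 = x 0" using m by (simp add: reflv_def dotp_unit) (simp add: unit_vec_def)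
  have "Lv m (Suc t) (unit_vec 0) (eps 0 \<omega>) A = (-1) ^ t * eps 0 \<omega> A" for A
    unfolding Lv_unit[OF m] by (simp add: eps_def)
  then have L: "Lv m (Suc t) (unit_vec 0) (eps 0 \<omega>) = (\<lambda>A. (-1) ^ t * eps 0 \<omega> A)" by (rule ext)
  show "Hv m (Suc t) (unit_vec 0) (zonal k (eps 0 \<omega>)) x A = scl ((-1) ^ t) (zonal k (eps 0 \<omega>)) x A"
    unfolding Hv_def zonal_def Lv_scale L g0 by (simp add: scl_apply)
qed

lemma zonal_add: "zonal k (v + w) = zonal k v + zonal k w"
  by (simp add: zonal_def fun_eq_iff plus_fun_apply distrib_left)

lemma zonal_scl: "zonal k (\<lambda>A. c * v A) = scl c (zonal k v)"
  by (simp add: zonal_def fun_eq_iff scl_apply)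

lemma axis_family_orth_proj:
  fixes U :: "'a::{real_normed_field, euclidean_space} clfun set"
  assumes m: "0 < m" and U: "fsubspace U" "U \<subseteq> harm m (Suc t) k" "Hinv m (Suc t) U"
  shows "axis_family m k t (\<lambda>\<omega>. orth_proj m k U (zonal k (eps 0 \<omega>)))"
proof -
  have Uh: "U \<subseteq> hpoly m k (Suc t)" using U(2) harm_hpoly by blast
  have z: "zonal k (eps 0 \<omega>) \<in> hpoly m k (Suc t)" if "axis_free m t \<omega>" for \<omega> :: "nat set \<Rightarrow> 'a"
    by (rule zonal_hpoly[OF m graded_eps0[OF m that]])
  show ?thesis unfolding axis_family_def
  proof (intro conjI allI impI)
    fix \<omega> :: "nat set \<Rightarrow> 'a" assume l: "axis_free m t \<omega>"
    show "orth_proj m k U (zonal k (eps 0 \<omega>)) \<in> harm m (Suc t) k" using orth_proj_in[OF U(1) Uh z[OF l]] U(2) by blast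
    show "orth_proj m k U (zonal k (eps 0 (\<lambda>A. c * \<omega> A))) = scl c (orth_proj m k U (zonal k (eps 0 \<omega>)))" for c
      unfolding eps_scale zonal_scl by (rule orth_proj_scl[OF U(1) Uh z[OF l]])
    show "Hv m (Suc t) (unit_vec 0) (orth_proj m k U (zonal k (eps 0 \<omega>))) = scl ((- 1) ^ t) (orth_proj m k U (zonal k (eps 0 \<omega>)))"
      unfolding orth_proj_Hv[OF U(1) Uh U(3) unitv_unit[OF m] z[OF l], symmetric] Hv_zonal0[OF m l] by (rule orth_proj_scl[OF U(1) Uh z[OF l]])
    show "orth_proj m k U (zonal k (eps 0 (\<omega> + \<omega>'))) = orth_proj m k U (zonal k (eps 0 \<omega>)) + orth_proj m k U (zonal k (eps 0 \<omega>'))" if "axis_free m t \<omega>'" for \<omega>'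
      unfolding eps_add zonal_add by (rule orth_proj_add[OF U(1) Uh z[OF l] z[OF that]])
    show "Hv m (Suc t) \<rho> (orth_proj m k U (zonal k (eps 0 \<omega>))) = scl ((- 1) ^ Suc k) (orth_proj m k U (zonal k (eps 0 (Lv m t \<rho> \<omega>))))"
      if \<rho>: "unitv m \<rho>" "\<rho> 0 = 0" for \<rho>
    proof -
      have l': "axis_free m t (Lv m t \<rho> \<omega>)" using \<rho>(2) l by (rule axis_free_Lv)
      show ?thesis unfolding orth_proj_Hv[OF U(1) Uh U(3) \<rho>(1) z[OF l], symmetric] Hv_zonal[OF m \<rho>] by (rule orth_proj_scl[OF U(1) Uh z[OF l']])
    qed
  qed
qed

text \<open>By the reproducing property no P in U has a component with the index 0 at the point e_0,
  which says x dot P(x) = 0 for x = e_0. Invariance of U spreads this to all x; then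
  \<open>xi\<close> and \<open>dd\<close> both kill P, and their anticommutator forces P =
  0.\<close>

lemma orth_proj_nonzero:
  fixes U :: "'a::{real_normed_field, euclidean_space} clfun set"
  assumes m: "0 < m" and U: "fsubspace U" "U \<subseteq> harm m (Suc t) k" "Hinv m (Suc t) U"
    and z: "\<And>\<omega>. axis_free m t \<omega> \<Longrightarrow> orth_proj m k U (zonal k (eps 0 \<omega>)) = 0"
  shows "U = {0}"
proof -
  have Uh: "U \<subseteq> hpoly m k (Suc t)" using U(2) harm_hpoly by blast
  have sg0: "sg 0 A = (1::'a)" for A by (simp add: sg_def)
  have axis: "P (unit_vec 0) A = 0" if P: "P \<in> U" and A: "0 \<in> A" for P A
  proof (cases "A \<subseteq> {..<m} \<and> card A = Suc t")
    case True
    let ?B = "A - {0}"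
    let ?p = "P (unit_vec 0) A"
    \<comment> \<open>Scaling the blade by the coefficient ?p itself makes the pairing its squared
      norm; the bare blade would test only the real part in the complex case.\<close>
    let ?\<omega> = "\<lambda>C. ?p * blade ?B C"
    have fA: "finite A" using True finite_subset by blast
    have "?B \<subseteq> {1..<m}" using True by (auto simp: subset_iff Suc_le_eq)
    moreover have "card ?B = t" using True fA A by simp
    ultimately have l: "axis_free m t ?\<omega>" by (intro axis_free_scale axis_free_blade)
    have zh: "zonal k (eps 0 ?\<omega>) \<in> hpoly m k (Suc t)" by (rule zonal_hpoly[OF m graded_eps0[OF m l]])
    have "fis m k P (zonal k (eps 0 ?\<omega>)) = 0"
      using orth_proj_fis[OF U(1) Uh zh P] by (simp add: z[OF l] fis_zero fis_commute)
    then have "ip m (P (unit_vec 0)) (eps 0 ?\<omega>) = 0"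
      using fis_zonal[OF m graded_eps0[OF m l], of P k] P Uh by auto
    also have "eps 0 ?\<omega> = (\<lambda>C. if C = A then ?p else 0)"
    proof
      fix C
      have "0 \<in> C \<Longrightarrow> C - {0} = A - {0} \<longleftrightarrow> C = A" using A by blast
      then show "eps 0 ?\<omega> C = (if C = A then ?p else 0)" using A by (auto simp: eps_def blade_def sg0)
    qed
    also have "ip m (P (unit_vec 0)) (\<lambda>C. if C = A then ?p else 0) = (\<Sum>C\<in>Pow {..<m}. if C = A then ?p \<bullet> ?p else 0)"
      unfolding ip_def by (intro sum.cong) auto
    also have "\<dots> = ?p \<bullet> ?p" using True by simp
    finally show ?thesis by simp
  next
    case False
    then show ?thesis using hpoly_graded[of P m k "Suc t" "unit_vec 0"] P Uh by (auto simp: graded_def)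
  qed
  have i0: "iot 0 (P (unit_vec 0)) = 0" if "P \<in> U" for P
    using axis[OF that] by (auto simp: iot_def fun_eq_iff zero_fun_apply)
  have "P = 0" if P: "P \<in> U" for P
  proof -
    have Ph: "P \<in> hpoly m k (Suc t)" using P Uh by blast
    have hom: "ivec m y (P y) = 0" if "\<And>i. i < m \<Longrightarrow> y i = c * unit_vec 0 i" for c y
    proof -
      have 1: "P y = (\<lambda>A. of_real c ^ k * P (unit_vec 0) A)" by (rule hpoly_homogeneous[OF Ph that])
      have 2: "ivec m y v = (\<lambda>A. of_real c * iot 0 v A)" for v :: "nat set \<Rightarrow> 'a"
        by (subst ivec_unit[OF m, symmetric], rule ivec_coeffs, rule that)
      show ?thesis unfolding 2 unfolding 1 iot_scale i0[OF P] by (simp add: fun_eq_iff zero_fun_apply)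
    qed
    have "ivec m y (P y) = 0" for y
    proof -
      define r where "r = sqrt (dotp m y y)"
      have nn: "0 \<le> dotp m y y" by (simp add: dotp_def sum_nonneg)
      have r2: "r\<^sup>2 = dotp m y y" using nn by (simp add: r_def)
      show ?thesis
      proof (cases "dotp m y y = 0")
        case True
        show ?thesis by (rule hom[of y 0]) (simp add: dotp_self_eq_0[OF True])
      next
        case False
        then have r: "0 < r" using nn by (simp add: r_def)
        from reflect_to_axis[OF m r r2] consider
          (a) "\<forall>i<m. y i = - r * unit_vec 0 i"
          | (b) \<rho> where "unitv m \<rho>" "\<forall>i<m. reflv m \<rho> y i = r * unit_vec 0 i" by blast
        then show ?thesis
        proof cases
          case a
          show ?thesis by (rule hom[of y "- r"]) (use a in blast)
        next
          case b
          have Q: "Hv m (Suc t) \<rho> P \<in> U" using U(3) b(1) P by (simp add: Hinv_def)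
          have "P (reflv m \<rho> (reflv m \<rho> y)) = P y"
            by (rule hpoly_cong[OF Ph]) (simp add: reflv_reflv[OF b(1)])
          then have L: "Lv m (Suc t) \<rho> (P y) = Hv m (Suc t) \<rho> P (reflv m \<rho> y)" by (simp add: Hv_def)
          have 1: "Hv m (Suc t) \<rho> P (reflv m \<rho> y) = (\<lambda>A. of_real r ^ k * Hv m (Suc t) \<rho> P (unit_vec 0) A)"
            by (rule hpoly_homogeneous[OF Hv_hpoly[OF Ph]]) (use b(2) in blast)
          have 2: "ivec m (reflv m \<rho> y) v = (\<lambda>A. of_real r * iot 0 v A)" for v :: "nat set \<Rightarrow> 'a"
            by (subst ivec_unit[OF m, symmetric], rule ivec_coeffs) (use b(2) in blast)
          have "Lv m t \<rho> (ivec m y (P y)) = ivec m (reflv m \<rho> y) (Lv m (Suc t) \<rho> (P y))"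
            by (rule Lv_ivec[OF b(1)])
          also have "\<dots> = 0" unfolding 2 unfolding L 1 iot_scale i0[OF Q] by (simp add: fun_eq_iff zero_fun_apply)
          finally show ?thesis by (rule Lv_eq_0[OF b(1)])
        qed
      qed
    qed
    then have "xi m P = 0" by (simp add: xi_def fun_eq_iff zero_fun_apply)
    moreover have "dd m P = 0" using P U(2) by (auto simp: harm_eq)
    ultimately show ?thesis using dd_xi_harm[OF Ph] by simp
  qed
  then show ?thesis using fsubspace_0[OF U(1)] by blast
qed

lemma harm_fsubspace: "fsubspace (harm m s k)"
  unfolding fsubspace_iff harm_eq
  by (auto simp: hpoly_zero d_zero hpoly_add scl_hpoly dd_add de_add)
    (auto simp: scl_def dd_scale de_scale fun_eq_iff zero_fun_apply)

lemma harm_Hinv: "Hinv m s (harm m s k)"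
  unfolding Hinv_def
proof (intro allI impI ballI)
  fix \<rho> and P :: "'a clfun" assume \<rho>: "unitv m \<rho>" and P: "P \<in> harm m s k"
  have Ph: "P \<in> hpoly m k s" by (rule harm_hpoly[OF P])
  have "dd m (Hv m s \<rho> P) = 0" using P by (simp add: dd_Hv[OF \<rho> Ph] harm_eq Hv_zero)
  moreover have "de m (Hv m s \<rho> P) = 0"
  proof (cases s)
    case 0
    then show ?thesis using Hv_hpoly[OF Ph, of \<rho>] by (simp add: de_hpoly_0)
  next
    case (Suc t)
    then show ?thesis using P de_Hv[OF \<rho>, of P k t] Ph by (simp add: harm_eq Hv_zero)
  qed
  ultimately show "Hv m s \<rho> P \<in> harm m s k" using Hv_hpoly[OF Ph] by (simp add: harm_eq)
qed

lemma scl_lincomb_zero: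
  fixes a b :: "'a::real_normed_field"
  shows "\<exists>\<alpha> \<beta>. (\<alpha> \<noteq> 0 \<or> \<beta> \<noteq> 0) \<and> \<alpha> * a + \<beta> * b = 0"
proof (cases "a = 0")
  case True
  then show ?thesis by (intro exI[of _ 1] exI[of _ 0]) simp
next
  case False
  then show ?thesis by (intro exI[of _ "b"] exI[of _ "- a"]) simp
qed

lemma axis_family_lincomb:
  assumes "axis_family m k t u" "axis_family m k t v"
  shows "axis_family m k t (\<lambda>\<omega>. scl \<alpha> (u \<omega>) + scl \<beta> (v \<omega>))"
proof -
  have uv: "\<And>\<omega>. axis_free m t \<omega> \<Longrightarrow> u \<omega> \<in> harm m (Suc t) k" "\<And>\<omega>. axis_free m t \<omega> \<Longrightarrow> v \<omega> \<in> harm m (Suc t) k"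
    using assms by (simp_all add: axis_family_def)
  show ?thesis unfolding axis_family_def
  proof (intro conjI allI impI)
    fix \<omega> :: "nat set \<Rightarrow> 'a" assume l: "axis_free m t \<omega>"
    show "scl \<alpha> (u \<omega>) + scl \<beta> (v \<omega>) \<in> harm m (Suc t) k"
      by (intro fsubspace_add fsubspace_scl harm_fsubspace uv l)
    show "scl \<alpha> (u (\<omega> + \<omega>')) + scl \<beta> (v (\<omega> + \<omega>')) = scl \<alpha> (u \<omega>) + scl \<beta> (v \<omega>) + (scl \<alpha> (u \<omega>') + scl \<beta> (v \<omega>'))" if "axis_free m t \<omega>'" for \<omega>'
    proof -
      have 1: "u (\<omega> + \<omega>') = u \<omega> + u \<omega>'" and 2: "v (\<omega> + \<omega>') = v \<omega> + v \<omega>'"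
        using assms l that unfolding axis_family_def by blast+
      show ?thesis unfolding 1 2 scl_simps by (simp only: add_ac)
    qed
    show "scl \<alpha> (u (\<lambda>A. c * \<omega> A)) + scl \<beta> (v (\<lambda>A. c * \<omega> A)) = scl c (scl \<alpha> (u \<omega>) + scl \<beta> (v \<omega>))" for c
    proof -
      have 1: "u (\<lambda>A. c * \<omega> A) = scl c (u \<omega>)" and 2: "v (\<lambda>A. c * \<omega> A) = scl c (v \<omega>)"
        using assms l unfolding axis_family_def by blast+
      show ?thesis unfolding 1 2 scl_simps by (simp only: mult.commute)
    qed
    show "Hv m (Suc t) \<rho> (scl \<alpha> (u \<omega>) + scl \<beta> (v \<omega>)) = scl ((- 1) ^ Suc k) (scl \<alpha> (u (Lv m t \<rho> \<omega>)) + scl \<beta> (v (Lv m t \<rho> \<omega>)))"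
      if "unitv m \<rho>" "\<rho> 0 = 0" for \<rho>
    proof -
      have 1: "Hv m (Suc t) \<rho> (u \<omega>) = scl ((-1) ^ Suc k) (u (Lv m t \<rho> \<omega>))" and 2: "Hv m (Suc t) \<rho> (v \<omega>) = scl ((-1) ^ Suc k) (v (Lv m t \<rho> \<omega>))"
        using assms l that unfolding axis_family_def by blast+
      show ?thesis unfolding Hv_add Hv_scl 1 2 scl_simps by (simp only: mult.commute)
    qed
    show "Hv m (Suc t) (unit_vec 0) (scl \<alpha> (u \<omega>) + scl \<beta> (v \<omega>)) = scl ((- 1) ^ t) (scl \<alpha> (u \<omega>) + scl \<beta> (v \<omega>))"
    proof -
      have 1: "Hv m (Suc t) (unit_vec 0) (u \<omega>) = scl ((-1) ^ t) (u \<omega>)" and 2: "Hv m (Suc t) (unit_vec 0) (v \<omega>) = scl ((-1) ^ t) (v \<omega>)"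
        using assms l unfolding axis_family_def by blast+
      show ?thesis unfolding Hv_add Hv_scl 1 2 scl_simps by (simp only: mult.commute)
    qed
  qed
qed

definition simple_space :: "nat \<Rightarrow> nat \<Rightarrow> 'a::real_normed_field clfun set \<Rightarrow> bool" where
  "simple_space m s W \<longleftrightarrow> (\<forall>U. fsubspace U \<longrightarrow> U \<subseteq> W \<longrightarrow> Hinv m s U \<longrightarrow> U = {0} \<or> U = W)"

text \<open>Projecting $x_0^k\, e_0 \wedge \omega$ to an invariant subspace \<open>U\<close> and to its orthogonal complement gives
  two families of the kind above. They are linearly dependent, but have values in complementary spaces, so one of
  them vanishes; then so does the corresponding space.\<close>

theorem harm_simple:
  assumes "1 \<le> s" "s < m"
  shows "simple_space m s (harm m s k :: 'a::{real_normed_field, euclidean_space} clfun set)"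
  unfolding simple_space_def
proof (intro allI impI)
  fix U :: "'a clfun set"
  assume U: "fsubspace U" "U \<subseteq> harm m s k" "Hinv m s U"
  obtain t where t: "s = Suc t" using assms(1) by (cases s) auto
  have m: "0 < m" and tm: "Suc t < m" using assms t by auto
  have hh: "harm m s k \<subseteq> (hpoly m k s :: 'a clfun set)" using harm_hpoly by blast
  have Uh: "U \<subseteq> hpoly m k s" using U(2) hh by blast
  define U2 where "U2 = {Q \<in> harm m s k. \<forall>P\<in>U. fis m k Q P = 0}"
  have U2h: "Q \<in> hpoly m k s" if "Q \<in> U2" for Q using that harm_hpoly by (auto simp: U2_def)
  have "fsubspace U2" unfolding fsubspace_iff
  proof (intro conjI ballI allI)
    show "0 \<in> U2" unfolding U2_def by (intro CollectI conjI fsubspace_0[OF harm_fsubspace] ballI fis_zero)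
    show "P + Q \<in> U2" if "P \<in> U2" "Q \<in> U2" for P Q
    proof -
      have "P \<in> harm m s k" "Q \<in> harm m s k" using that by (simp_all add: U2_def)
      then have "P + Q \<in> harm m s k" by (rule fsubspace_add[OF harm_fsubspace])
      then show ?thesis using that fis_add[OF U2h[OF that(1)] U2h[OF that(2)]] by (simp add: U2_def)
    qed
    show "scl c Q \<in> U2" if Q: "Q \<in> U2" for c Q
    proof -
      obtain c' where c': "\<And>a b. (c * a) \<bullet> b = a \<bullet> (c' * b)" using mult_adjoint[of c] by blast
      have "fis m k (scl c Q) P = 0" if "P \<in> U" for P
        unfolding fis_scl_adjoint[OF c' U2h[OF Q] subsetD[OF Uh that]]
        using Q fsubspace_scl[OF U(1) that] by (simp add: U2_def)
      moreover have "scl c Q \<in> harm m s k" by (rule fsubspace_scl[OF harm_fsubspace]) (use Q in \<open>simp add: U2_def\<close>)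
      ultimately show ?thesis by (simp add: U2_def)
    qed
  qed
  moreover have "U2 \<subseteq> harm m s k" by (auto simp: U2_def)
  moreover have "Hinv m s U2" unfolding Hinv_def
  proof (intro allI impI ballI)
    fix \<rho> Q assume \<rho>: "unitv m \<rho>" and Q: "Q \<in> U2"
    have "fis m k (Hv m s \<rho> Q) P = 0" if P: "P \<in> U" for P
    proof -
      have HP: "Hv m s \<rho> P \<in> U" using U(3) \<rho> P by (simp add: Hinv_def)
      have "fis m k (Hv m s \<rho> Q) (Hv m s \<rho> (Hv m s \<rho> P)) = fis m k Q (Hv m s \<rho> P)"
        by (rule fis_Hv[OF \<rho> U2h[OF Q] subsetD[OF Uh HP]])
      then show ?thesis unfolding Hv_Hv[OF \<rho> subsetD[OF Uh P]] using Q HP by (simp add: U2_def)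
    qed
    then show "Hv m s \<rho> Q \<in> U2" using Q harm_Hinv[of m s k, where 'a = 'a] \<rho> by (simp add: U2_def Hinv_def)
  qed
  ultimately have U2: "fsubspace U2" "U2 \<subseteq> harm m s k" "Hinv m s U2" by blast+
  have disj: "P = 0" if "P \<in> U" "P \<in> U2" for P
    using that fis_definite[OF U2h[OF that(2)]] by (simp add: U2_def)
  define u where "u = (\<lambda>\<omega>. orth_proj m k U (zonal k (eps 0 \<omega>)))"
  define v where "v = (\<lambda>\<omega>. orth_proj m k U2 (zonal k (eps 0 \<omega>)))"
  have fu: "axis_family m k t u" and fv: "axis_family m k t v"
    unfolding u_def v_def using axis_family_orth_proj[OF m] U U2 unfolding t by blast+
  have zh: "zonal k (eps 0 \<omega>) \<in> hpoly m k s" if "axis_free m t \<omega>" for \<omega> :: "nat set \<Rightarrow> 'a"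
    unfolding t by (rule zonal_hpoly[OF m graded_eps0[OF m that]])
  have uU: "u \<omega> \<in> U" and vU: "v \<omega> \<in> U2" if "axis_free m t \<omega>" for \<omega>
    unfolding u_def v_def using orth_proj_in[OF U(1) Uh zh[OF that]] orth_proj_in[OF U2(1) _ zh[OF that]] U2(2) hh by auto
  let ?B0 = "{2..<t + 2}"
  have B0: "?B0 \<subseteq> {2..<m}" "card ?B0 = t" using tm by auto
  define A where "A = insert (if even k then 0 else 1) ?B0"
  \<comment> \<open>At e_1 both families have at most the one component A on this blade, so a single
    scalar relation makes the combination vanish there. The blade exists because s < m leaves room
    for t indices from 2 on.\<close>
  obtain \<alpha> \<beta> where ab: "\<alpha> \<noteq> 0 \<or> \<beta> \<noteq> 0" "\<alpha> * u (blade ?B0) (unit_vec 1) A + \<beta> * v (blade ?B0) (unit_vec 1) A = 0"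
    using scl_lincomb_zero by blast
  define w where "w = (\<lambda>\<omega>. scl \<alpha> (u \<omega>) + scl \<beta> (v \<omega>))"
  have fw: "axis_family m k t w" unfolding w_def by (rule axis_family_lincomb[OF fu fv])
  have "w (blade ?B0) (unit_vec 1) C = 0" for C
  proof (cases "C = A")
    case True
    then show ?thesis using ab(2) by (simp add: w_def plus_fun_apply scl_apply del: One_nat_def)
  next
    case False
    then show ?thesis using axis_family_support1[OF fw tm B0] unfolding A_def by blast
  qed
  then have w0: "w (blade ?B0) (unit_vec 1) = 0" by (simp add: fun_eq_iff zero_fun_apply del: One_nat_def)
  have wz: "w \<omega> = 0" if "axis_free m t \<omega>" for \<omega> by (rule axis_family_zero[OF fw tm B0 w0 that])
  have "(\<forall>\<omega>. axis_free m t \<omega> \<longrightarrow> u \<omega> = 0) \<or> (\<forall>\<omega>. axis_free m t \<omega> \<longrightarrow> v \<omega> = 0)"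
  proof (cases "\<alpha> = 0")
    case True
    then have "\<beta> \<noteq> 0" using ab(1) by simp
    then show ?thesis using wz True by (auto simp: w_def scl_simps scl_eq_0)
  next
    case False
    have "u \<omega> = 0" if l: "axis_free m t \<omega>" for \<omega>
    proof -
      have "scl \<alpha> (u \<omega>) = scl (- \<beta>) (v \<omega>)" using wz[OF l] by (simp add: w_def scl_simps eq_neg_iff_add_eq_0)
      then have "scl \<alpha> (u \<omega>) \<in> U2" using fsubspace_scl[OF U2(1) vU[OF l]] by simp
      then have "scl \<alpha> (u \<omega>) = 0" by (rule disj[OF fsubspace_scl[OF U(1) uU[OF l]]])
      then show ?thesis using False by (simp add: scl_eq_0)
    qed
    then show ?thesis by blast
  qed
  then show "U = {0} \<or> U = harm m s k"
  proof
    assume "\<forall>\<omega>. axis_free m t \<omega> \<longrightarrow> u \<omega> = 0"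
    then have "U = {0}" using orth_proj_nonzero[OF m] U unfolding u_def t by blast
    then show ?thesis by blast
  next
    assume "\<forall>\<omega>. axis_free m t \<omega> \<longrightarrow> v \<omega> = 0"
    then have U20: "U2 = {0}" using orth_proj_nonzero[OF m] U2 unfolding v_def t by blast
    have "P \<in> U" if P: "P \<in> harm m s k" for P
    proof -
      have Ph: "P \<in> hpoly m k s" by (rule harm_hpoly[OF P])
      let ?q = "orth_proj m k U P"
      have q: "?q \<in> U" by (rule orth_proj_in[OF U(1) Uh Ph])
      let ?d = "P + scl (of_real (-1)) ?q"
      have "fis m k ?d p = 0" if "p \<in> U" for p
        using fis_add[OF Ph scl_hpoly[OF subsetD[OF Uh q]], of "of_real (-1)" p] fis_of_real[OF subsetD[OF Uh q], of "-1" p]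
          orth_proj_fis[OF U(1) Uh Ph that] by simp
      moreover have "?d \<in> harm m s k"
        by (intro fsubspace_add fsubspace_scl harm_fsubspace P subsetD[OF U(2) q])
      ultimately have "?d \<in> U2" by (simp add: U2_def)
      then have "?d = 0" using U20 by blast
      then have "P = ?q" by (simp add: scl_simps)
      then show ?thesis using q by metis
    qed
    then show ?thesis using U(2) by blast
  qed
qed

section \<open>Separation of the summands by their degrees\<close>

text \<open>Trigonometric polynomials of degree at most \<open>n\<close> in the angles $\pi l / N$. For $n < N$ they are orthogonal
  to $l \mapsto (-1)^l$ over a full period.\<close>

inductive trig_poly :: "nat \<Rightarrow> nat \<Rightarrow> (nat \<Rightarrow> 'a::real_normed_field) \<Rightarrow> bool" for N where
  const: "trig_poly N 0 (\<lambda>l. c)"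
| add: "trig_poly N n f \<Longrightarrow> trig_poly N n g \<Longrightarrow> trig_poly N n (\<lambda>l. f l + g l)"
| cos: "trig_poly N n f \<Longrightarrow> trig_poly N (Suc n) (\<lambda>l. of_real (cos (pi * real l / real N)) * f l)"
| sin: "trig_poly N n f \<Longrightarrow> trig_poly N (Suc n) (\<lambda>l. of_real (sin (pi * real l / real N)) * f l)"
| lift: "trig_poly N n f \<Longrightarrow> trig_poly N (Suc n) f"

lemma trig_poly_scale: "trig_poly N n f \<Longrightarrow> trig_poly N n (\<lambda>l. c * f l)"
proof (induction rule: trig_poly.induct)
  case (cos n f)
  then show ?case using trig_poly.cos[OF cos.IH] by (simp add: mult.left_commute)
next
  case (sin n f)
  then show ?case using trig_poly.sin[OF sin.IH] by (simp add: mult.left_commute)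
qed (auto simp: distrib_left intro: trig_poly.intros)

lemma trig_poly_zero: "trig_poly N n (\<lambda>l. 0)"
  by (induction n) (auto intro: trig_poly.intros)

text \<open>Absorbing the alternating sign as a half turn gives a geometric sum over a 2N-th root of
  unity with exponent q + N. This exponent lies strictly between 0 and 2N, so the root is not
  1.\<close>

lemma alternating_trig_sum:
  fixes q :: int
  assumes "\<bar>q\<bar> < int N"
  shows "(\<Sum>l<2 * N. (-1) ^ l * cos (of_int q * (pi * real l / real N))) = 0"
    and "(\<Sum>l<2 * N. (-1) ^ l * sin (of_int q * (pi * real l / real N))) = 0"
proof -
  have N: "0 < N" using assms by linarith
  define z where "z = cis (pi * (of_int q + real N) / real N)"
  have zl: "z ^ l = (-1) ^ l * cis (of_int q * (pi * real l / real N))" for l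
  proof -
    have "z ^ l = cis (real l * (pi * (of_int q + real N) / real N))" unfolding z_def by (rule Complex.DeMoivre)
    also have "real l * (pi * (of_int q + real N) / real N) = of_int q * (pi * real l / real N) + real l * pi"
      using N by (simp add: field_simps)
    also have "cis \<dots> = cis (of_int q * (pi * real l / real N)) * cis pi ^ l" by (simp only: cis_mult Complex.DeMoivre)
    finally show ?thesis by (simp add: mult.commute)
  qed
  have "z \<noteq> 1"
  proof
    assume "z = 1"
    then have "cos (pi * (of_int q + real N) / real N) = 1" by (simp add: z_def complex_eq_iff)
    then obtain n :: int where n: "pi * (of_int q + real N) / real N = of_int n * 2 * pi"
      using cos_one_2pi_int by auto
    then have "pi * (of_int q + real N) = pi * (of_int n * 2 * real N)" using N by (simp add: field_simps)
    then have "of_int q + real N = of_int n * 2 * real N" by (simp only: mult_cancel_left pi_neq_zero) simp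
    then have "of_int (q + int N) = (of_int (2 * n * int N) :: real)" by simp
    then have e: "q + int N = 2 * n * int N" by (simp only: of_int_eq_iff)
    have "0 < q + int N" "q + int N < 2 * int N" using assms by auto
    then have "0 < n * int N" "n * int N < 1 * int N" using e by auto
    then have "0 < n" "n < 1" using N by (simp_all add: zero_less_mult_iff mult_less_cancel_right)
    then show False by simp
  qed
  moreover have "z ^ (2 * N) = 1"
  proof -
    have "z ^ (2 * N) = (-1) ^ (2 * N) * cis (of_int q * (pi * real (2 * N) / real N))" by (rule zl)
    also have "of_int q * (pi * real (2 * N) / real N) = 2 * pi * of_int q" using N by (simp add: field_simps)
    finally show ?thesis by (simp add: cis_multiple_2pi)
  qed
  ultimately have "(\<Sum>l<2 * N. z ^ l) = 0" by (simp add: geometric_sum)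
  then have c: "(\<Sum>l<2 * N. (-1) ^ l * cis (of_int q * (pi * real l / real N))) = 0" by (simp add: zl)
  have rm: "Re ((-1) ^ l * w) = (-1) ^ l * Re w" "Im ((-1) ^ l * w) = (-1) ^ l * Im w" for l w
    by (cases "even l"; simp)+
  show "(\<Sum>l<2 * N. (-1) ^ l * cos (of_int q * (pi * real l / real N))) = 0"
    "(\<Sum>l<2 * N. (-1) ^ l * sin (of_int q * (pi * real l / real N))) = 0"
    using arg_cong[OF c, of Re] arg_cong[OF c, of Im] by (simp_all add: rm)
qed

lemma trig_product_formulas:
  fixes a b :: real
  shows "cos a * cos b = 1/2 * cos (a + b) + 1/2 * cos (a - b)"
    and "sin a * cos b = 1/2 * sin (a + b) + 1/2 * sin (a - b)"
    and "cos a * sin b = 1/2 * sin (a + b) + (-1/2) * sin (a - b)"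
    and "sin a * sin b = (-1/2) * cos (a + b) + 1/2 * cos (a - b)"
  by (simp_all add: cos_add cos_diff sin_add sin_diff field_simps)

text \<open>The induction has to carry a frequency q. The product formulas trade a factor cos or sin
  for the frequencies q + 1 and q - 1 while the degree drops by one, so the bound on |q| + n is
  preserved.\<close>

lemma trig_poly_sum:
  fixes q :: int
  shows "trig_poly N n f \<Longrightarrow> \<bar>q\<bar> + int n < int N \<Longrightarrow>
    (\<Sum>l<2 * N. of_real ((-1) ^ l * cos (of_int q * (pi * real l / real N))) * f l) = 0 \<and>
    (\<Sum>l<2 * N. of_real ((-1) ^ l * sin (of_int q * (pi * real l / real N))) * f l) = 0"
proof (induction arbitrary: q rule: trig_poly.induct)
  case (const c)
  have q: "\<bar>q\<bar> < int N" using const by simp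
  show ?case unfolding sum_distrib_right[symmetric] of_real_sum[symmetric] alternating_trig_sum[OF q] by simp
next
  case (add n f g)
  then show ?case by (simp add: distrib_left sum.distrib)
next
  case (cos n f)
  let ?\<alpha> = "\<lambda>l. pi * real l / real N"
  have shift: "of_int (q + 1) * ?\<alpha> l = of_int q * ?\<alpha> l + ?\<alpha> l" "of_int (q - 1) * ?\<alpha> l = of_int q * ?\<alpha> l - ?\<alpha> l" for l
    by (simp_all only: of_int_add of_int_diff of_int_1 distrib_right left_diff_distrib mult_1)
  have c: "of_real ((-1) ^ l * cos (of_int q * ?\<alpha> l)) * (of_real (cos (?\<alpha> l)) * f l) =
    of_real (1/2) * (of_real ((-1) ^ l * cos (of_int (q + 1) * ?\<alpha> l)) * f l) + of_real (1/2) * (of_real ((-1) ^ l * cos (of_int (q - 1) * ?\<alpha> l)) * f l)" for l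
  proof -
    have "cos (of_int q * ?\<alpha> l) * cos (?\<alpha> l) = 1/2 * cos (of_int (q + 1) * ?\<alpha> l) + 1/2 * cos (of_int (q - 1) * ?\<alpha> l)"
      unfolding shift by (rule trig_product_formulas)
    then have "of_real ((-1) ^ l) * of_real (cos (of_int q * ?\<alpha> l) * cos (?\<alpha> l)) * f l = of_real ((-1) ^ l) * of_real (1/2 * cos (of_int (q + 1) * ?\<alpha> l) + 1/2 * cos (of_int (q - 1) * ?\<alpha> l)) * f l"
      by (simp only:)
    then show ?thesis by (simp only: of_real_mult of_real_add distrib_left distrib_right mult_ac)
  qed
  have s: "of_real ((-1) ^ l * sin (of_int q * ?\<alpha> l)) * (of_real (cos (?\<alpha> l)) * f l) =
    of_real (1/2) * (of_real ((-1) ^ l * sin (of_int (q + 1) * ?\<alpha> l)) * f l) + of_real (1/2) * (of_real ((-1) ^ l * sin (of_int (q - 1) * ?\<alpha> l)) * f l)" for l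
  proof -
    have "sin (of_int q * ?\<alpha> l) * cos (?\<alpha> l) = 1/2 * sin (of_int (q + 1) * ?\<alpha> l) + 1/2 * sin (of_int (q - 1) * ?\<alpha> l)"
      unfolding shift by (rule trig_product_formulas)
    then have "of_real ((-1) ^ l) * of_real (sin (of_int q * ?\<alpha> l) * cos (?\<alpha> l)) * f l = of_real ((-1) ^ l) * of_real (1/2 * sin (of_int (q + 1) * ?\<alpha> l) + 1/2 * sin (of_int (q - 1) * ?\<alpha> l)) * f l"
      by (simp only:)
    then show ?thesis by (simp only: of_real_mult of_real_add distrib_left distrib_right mult_ac)
  qed
  have q: "\<bar>q + 1\<bar> + int n < int N" "\<bar>q - 1\<bar> + int n < int N" using cos.prems by auto
  show ?case unfolding c s sum.distrib sum_distrib_left[symmetric]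
    using cos.IH[OF q(1)] cos.IH[OF q(2)] by (simp only: mult_zero_right add_0_right simp_thms)
next
  case (sin n f)
  let ?\<alpha> = "\<lambda>l. pi * real l / real N"
  have shift: "of_int (q + 1) * ?\<alpha> l = of_int q * ?\<alpha> l + ?\<alpha> l" "of_int (q - 1) * ?\<alpha> l = of_int q * ?\<alpha> l - ?\<alpha> l" for l
    by (simp_all only: of_int_add of_int_diff of_int_1 distrib_right left_diff_distrib mult_1)
  have c: "of_real ((-1) ^ l * cos (of_int q * ?\<alpha> l)) * (of_real (sin (?\<alpha> l)) * f l) =
    of_real (1/2) * (of_real ((-1) ^ l * sin (of_int (q + 1) * ?\<alpha> l)) * f l) + of_real (-1/2) * (of_real ((-1) ^ l * sin (of_int (q - 1) * ?\<alpha> l)) * f l)" for l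
  proof -
    have "cos (of_int q * ?\<alpha> l) * sin (?\<alpha> l) = 1/2 * sin (of_int (q + 1) * ?\<alpha> l) + (-1/2) * sin (of_int (q - 1) * ?\<alpha> l)"
      unfolding shift by (rule trig_product_formulas)
    then have "of_real ((-1) ^ l) * of_real (cos (of_int q * ?\<alpha> l) * sin (?\<alpha> l)) * f l = of_real ((-1) ^ l) * of_real (1/2 * sin (of_int (q + 1) * ?\<alpha> l) + (-1/2) * sin (of_int (q - 1) * ?\<alpha> l)) * f l"
      by (simp only:)
    then show ?thesis by (simp only: of_real_mult of_real_add distrib_left distrib_right mult_ac)
  qed
  have s: "of_real ((-1) ^ l * sin (of_int q * ?\<alpha> l)) * (of_real (sin (?\<alpha> l)) * f l) =
    of_real (-1/2) * (of_real ((-1) ^ l * cos (of_int (q + 1) * ?\<alpha> l)) * f l) + of_real (1/2) * (of_real ((-1) ^ l * cos (of_int (q - 1) * ?\<alpha> l)) * f l)" for l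
  proof -
    have "sin (of_int q * ?\<alpha> l) * sin (?\<alpha> l) = (-1/2) * cos (of_int (q + 1) * ?\<alpha> l) + 1/2 * cos (of_int (q - 1) * ?\<alpha> l)"
      unfolding shift by (rule trig_product_formulas)
    then have "of_real ((-1) ^ l) * of_real (sin (of_int q * ?\<alpha> l) * sin (?\<alpha> l)) * f l = of_real ((-1) ^ l) * of_real ((-1/2) * cos (of_int (q + 1) * ?\<alpha> l) + 1/2 * cos (of_int (q - 1) * ?\<alpha> l)) * f l"
      by (simp only:)
    then show ?thesis by (simp only: of_real_mult of_real_add distrib_left distrib_right mult_ac)
  qed
  have q: "\<bar>q + 1\<bar> + int n < int N" "\<bar>q - 1\<bar> + int n < int N" using sin.prems by auto
  show ?case unfolding c s sum.distrib sum_distrib_left[symmetric]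
    using sin.IH[OF q(1)] sin.IH[OF q(2)] by (simp only: mult_zero_right add_0_right simp_thms)
next
  case (lift n f)
  then show ?case by simp
qed

section \<open>Reflections along directions in the plane of e_0 and e_1\<close>

definition plane_vec :: "real \<Rightarrow> nat \<Rightarrow> real" where
  "plane_vec \<phi> = (\<lambda>i. if i = 0 then cos \<phi> else if i = 1 then sin \<phi> else 0)"

lemma dotp_plane_vec: "2 \<le> m \<Longrightarrow> dotp m (plane_vec \<phi>) x = cos \<phi> * x 0 + sin \<phi> * x 1"
proof -
  assume m: "2 \<le> m"
  have "dotp m (plane_vec \<phi>) x = (\<Sum>i<m. (if i = 0 then cos \<phi> * x 0 else 0) + (if i = 1 then sin \<phi> * x 1 else 0))"
    unfolding dotp_def by (intro sum.cong) (auto simp: plane_vec_def)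
  then show ?thesis using m by (simp add: sum.distrib)
qed

lemma unitv_plane_vec: "2 \<le> m \<Longrightarrow> unitv m (plane_vec \<phi>)"
  by (simp add: dotp_plane_vec) (simp add: plane_vec_def flip: power2_eq_square)

lemma reflv_plane_vec:
  assumes "2 \<le> m" "i < m"
  shows "reflv m (plane_vec \<phi>) x i = (if i = 0 then cos (2 * \<phi>) * x 0 + sin (2 * \<phi>) * x 1
    else if i = 1 then sin (2 * \<phi>) * x 0 - cos (2 * \<phi>) * x 1 else - x i)"
proof -
  have c: "cos (2 * \<phi>) = 2 * cos \<phi> * cos \<phi> - 1" by (simp add: cos_double_cos power2_eq_square)
  have c': "cos (2 * \<phi>) = 1 - 2 * sin \<phi> * sin \<phi>" by (simp add: cos_double_sin power2_eq_square)
  consider "i = 0" | "i = 1" | "i \<noteq> 0" "i \<noteq> 1" by blast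
  then show ?thesis
  proof cases
    case 1
    then show ?thesis using assms by (simp add: reflv_def dotp_plane_vec[OF assms(1)] c sin_double) (simp add: plane_vec_def algebra_simps)
  next
    case 2
    then show ?thesis using assms by (simp add: reflv_def dotp_plane_vec[OF assms(1)] c' sin_double) (simp add: plane_vec_def algebra_simps)
  next
    case 3
    then show ?thesis using assms by (simp add: reflv_def) (simp add: plane_vec_def)
  qed
qed

text \<open>The unit vector enters quadratically, and the double angle formulas make the action
  affine in cos and sin of 2 \<phi>. So the values add just one to the trigonometric degree, in
  every grade.\<close>

lemma Lv_plane_vec:
  assumes m: "2 \<le> m"
  shows "Lv m s (plane_vec \<phi>) v A = (-1) ^ s * (v A + (1 + of_real (cos (2 * \<phi>))) * eps 0 (iot 0 v) A
     + of_real (sin (2 * \<phi>)) * (eps 0 (iot 1 v) A + eps 1 (iot 0 v) A) + (1 - of_real (cos (2 * \<phi>))) * eps 1 (iot 1 v) A)"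
proof -
  have e: "evec m (plane_vec \<phi>) v = (\<lambda>A. of_real (cos \<phi>) * eps 0 v A + of_real (sin \<phi>) * eps 1 v A)"
    and i: "ivec m (plane_vec \<phi>) v = (\<lambda>A. of_real (cos \<phi>) * iot 0 v A + of_real (sin \<phi>) * iot 1 v A)" for v :: "nat set \<Rightarrow> 'a"
    using evec_two[of 0 m 1 "cos \<phi>" "sin \<phi>" v] m unfolding plane_vec_def by auto
  have ii: "(\<lambda>A. of_real (cos \<phi>) * iot 0 v A + of_real (sin \<phi>) * iot 1 v A)
     = (\<lambda>A. of_real (cos \<phi>) * iot 0 v A) + (\<lambda>A. of_real (sin \<phi>) * iot 1 v A)" by (simp add: fun_eq_iff plus_fun_apply)
  have c1: "2 * (of_real (cos \<phi>) * of_real (cos \<phi>)) = (1 + of_real (cos (2 * \<phi>)) :: 'a)"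
    by (simp add: cos_double_cos power2_eq_square)
  have c2: "2 * (of_real (sin \<phi>) * of_real (sin \<phi>)) = (1 - of_real (cos (2 * \<phi>)) :: 'a)"
    by (simp add: cos_double_sin power2_eq_square)
  have c3: "2 * (of_real (sin \<phi>) * of_real (cos \<phi>)) = (of_real (sin (2 * \<phi>)) :: 'a)"
    by (simp add: sin_double)
  let ?X = "evec m (plane_vec \<phi>) (ivec m (plane_vec \<phi>) v) A"
  let ?Y = "of_real (cos \<phi>) * of_real (cos \<phi>) * eps 0 (iot 0 v) A
     + of_real (sin \<phi>) * of_real (cos \<phi>) * (eps 0 (iot 1 v) A + eps 1 (iot 0 v) A) + of_real (sin \<phi>) * of_real (sin \<phi>) * eps 1 (iot 1 v) A"
  have 1: "?X - ivec m (plane_vec \<phi>) (evec m (plane_vec \<phi>) v) A = v A + 2 * ?X"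
    using evec_ivec[of m "plane_vec \<phi>" "plane_vec \<phi>" v A] unitv_plane_vec[OF m, of \<phi>] by (simp add: algebra_simps eq_neg_iff_add_eq_0)
  have 2: "?X = ?Y"
    unfolding e i ii eps_add eps_scale plus_fun_apply by (simp add: algebra_simps)
  have "2 * ?Y = (2 * (of_real (cos \<phi>) * of_real (cos \<phi>))) * eps 0 (iot 0 v) A
     + (2 * (of_real (sin \<phi>) * of_real (cos \<phi>))) * (eps 0 (iot 1 v) A + eps 1 (iot 0 v) A) + (2 * (of_real (sin \<phi>) * of_real (sin \<phi>))) * eps 1 (iot 1 v) A"
    by (simp only: distrib_left mult.assoc)
  then have 3: "v A + 2 * ?Y = v A + (1 + of_real (cos (2 * \<phi>))) * eps 0 (iot 0 v) A
     + of_real (sin (2 * \<phi>)) * (eps 0 (iot 1 v) A + eps 1 (iot 0 v) A) + (1 - of_real (cos (2 * \<phi>))) * eps 1 (iot 1 v) A"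
    unfolding c1 c2 c3 by (simp only: add.assoc)
  show ?thesis unfolding Lv_def 1 unfolding 2 unfolding 3 ..
qed

text \<open>Each coordinate of the reflected point is affine in cos and sin of the angle pi l / N;
  halving the angle in the unit vector cancels the doubling.\<close>

lemma trig_poly_hp:
  assumes m: "2 \<le> m"
  shows "hp m k f \<Longrightarrow> trig_poly N k (\<lambda>l. f (reflv m (plane_vec (pi * real l / real N / 2)) x))"
proof (induction rule: hp.induct)
  case (mulx k f i)
  let ?\<alpha> = "\<lambda>l. pi * real l / real N"
  let ?g = "\<lambda>l. reflv m (plane_vec (?\<alpha> l / 2)) x"
  have r: "?g l i = (if i = 0 then cos (?\<alpha> l) * x 0 + sin (?\<alpha> l) * x 1
    else if i = 1 then sin (?\<alpha> l) * x 0 - cos (?\<alpha> l) * x 1 else - x i)" for l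
    using reflv_plane_vec[OF m mulx.hyps(2), of "?\<alpha> l / 2" x] by simp
  note c = trig_poly.cos[OF mulx.IH] and s = trig_poly.sin[OF mulx.IH]
  consider "i = 0" | "i = 1" | "i \<noteq> 0" "i \<noteq> 1" by blast
  then show ?case
  proof cases
    case 1
    have "trig_poly N (Suc k) (\<lambda>l. of_real (x 0) * (of_real (cos (?\<alpha> l)) * f (?g l)) + of_real (x 1) * (of_real (sin (?\<alpha> l)) * f (?g l)))"
      by (intro trig_poly.add trig_poly_scale c s)
    then show ?thesis unfolding r using 1 by (simp add: algebra_simps)
  next
    case 2
    have "trig_poly N (Suc k) (\<lambda>l. of_real (x 0) * (of_real (sin (?\<alpha> l)) * f (?g l)) + of_real (- x 1) * (of_real (cos (?\<alpha> l)) * f (?g l)))"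
      by (intro trig_poly.add trig_poly_scale c s)
    then show ?thesis unfolding r using 2 by (simp add: algebra_simps)
  next
    case 3
    have "trig_poly N (Suc k) (\<lambda>l. of_real (- x i) * f (?g l))" by (intro trig_poly.lift trig_poly_scale mulx.IH)
    then show ?thesis unfolding r using 3 by simp
  qed
qed (auto intro: trig_poly.intros trig_poly_zero)

lemma trig_poly_eps: "(\<And>A. trig_poly N n (\<lambda>l. V l A)) \<Longrightarrow> trig_poly N n (\<lambda>l. eps j (V l) A)"
  by (cases "j \<in> A") (auto simp: eps_def intro: trig_poly_scale trig_poly_zero)

lemma trig_poly_iot: "(\<And>A. trig_poly N n (\<lambda>l. V l A)) \<Longrightarrow> trig_poly N n (\<lambda>l. iot j (V l) A)"
  using trig_poly_scale[of N n _ "- sg j A"] by (cases "j \<in> A") (auto simp: iot_def trig_poly_zero)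

lemma trig_poly_Hv:
  assumes m: "2 \<le> m" and P: "P \<in> hpoly m d s"
  shows "trig_poly N (Suc d) (\<lambda>l. Hv m s (plane_vec (pi * real l / real N / 2)) P x A)"
proof -
  let ?\<alpha> = "\<lambda>l. pi * real l / real N"
  define V where "V = (\<lambda>l. P (reflv m (plane_vec (?\<alpha> l / 2)) x))"
  have V: "trig_poly N d (\<lambda>l. V l A)" for A unfolding V_def by (rule trig_poly_hp[OF m hpoly_hp[OF P]])
  let ?E = "\<lambda>i j l. eps i (iot j (V l)) A"
  have E: "trig_poly N d (?E i j)" for i j by (intro trig_poly_eps trig_poly_iot V)
  have "trig_poly N (Suc d) (\<lambda>l. (-1) ^ s * (V l A + (?E 0 0 l + of_real (cos (?\<alpha> l)) * ?E 0 0 l)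
    + of_real (sin (?\<alpha> l)) * (?E 0 1 l + ?E 1 0 l) + (?E 1 1 l + (-1) * (of_real (cos (?\<alpha> l)) * ?E 1 1 l))))"
    by (intro trig_poly_scale trig_poly.add trig_poly.lift[OF V] trig_poly.lift[OF E] trig_poly.cos trig_poly.sin E)
  moreover have "Hv m s (plane_vec (?\<alpha> l / 2)) P x A = (-1) ^ s * (V l A + (?E 0 0 l + of_real (cos (?\<alpha> l)) * ?E 0 0 l)
    + of_real (sin (?\<alpha> l)) * (?E 0 1 l + ?E 1 0 l) + (?E 1 1 l + (-1) * (of_real (cos (?\<alpha> l)) * ?E 1 1 l)))" for l
  proof -
    have "2 * (?\<alpha> l / 2) = ?\<alpha> l" by simp
    then have "Hv m s (plane_vec (?\<alpha> l / 2)) P x A = (-1) ^ s * (V l A + (1 + of_real (cos (?\<alpha> l))) * ?E 0 0 l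
      + of_real (sin (?\<alpha> l)) * (?E 0 1 l + ?E 1 0 l) + (1 - of_real (cos (?\<alpha> l))) * ?E 1 1 l)"
      using Lv_plane_vec[OF m, of s "?\<alpha> l / 2" "V l" A] unfolding Hv_def V_def by (simp only:)
    then show ?thesis by (simp add: distrib_right left_diff_distrib)
  qed
  ultimately show ?thesis by (simp only:)
qed

text \<open>This element of the group algebra kills polynomials of degree less than $N - 1$, but has the eigenvector
  \<open>top_vec\<close> of degree $N - 1$ with a nonzero eigenvalue; so it tells degrees apart.\<close>

definition altsum :: "nat \<Rightarrow> nat \<Rightarrow> nat \<Rightarrow> 'a::real_normed_field clfun \<Rightarrow> 'a clfun" where
  "altsum m s N P = (\<Sum>l<2 * N. scl ((-1) ^ l) (Hv m s (plane_vec (pi * real l / real N / 2)) P))"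

lemma altsum_zero:
  assumes m: "2 \<le> m" and P: "P \<in> hpoly m d s" and d: "Suc d < N"
  shows "altsum m s N P = 0"
proof (intro ext)
  fix x A
  have "(\<Sum>l<2 * N. of_real ((-1) ^ l * cos (of_int 0 * (pi * real l / real N))) * Hv m s (plane_vec (pi * real l / real N / 2)) P x A) = 0"
    using trig_poly_sum[OF trig_poly_Hv[OF m P, of N x A], of 0] d by simp
  then show "altsum m s N P x A = 0 x A" by (simp add: altsum_def sum2_app scl_apply zero_fun_apply)
qed

definition plane_coord :: "(nat \<Rightarrow> real) \<Rightarrow> complex" where "plane_coord x = Complex (x 0) (x 1)"

text \<open>The Cauchy-Riemann equations for z^d, carried together with homogeneity through the
  recursion z^(d+1) = z z^d, which mixes real and imaginary parts.\<close>

lemma hp_power_plane_coord: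
  assumes "2 \<le> m"
  shows "hp m d (\<lambda>x. of_real (Re (plane_coord x ^ d)) :: 'a::real_normed_field) \<and> hp m d (\<lambda>x. of_real (Im (plane_coord x ^ d)) :: 'a) \<and>
    (\<forall>x. pd 0 (\<lambda>x. of_real (Re (plane_coord x ^ d)) :: 'a) x = pd 1 (\<lambda>x. of_real (Im (plane_coord x ^ d))) x) \<and>
    (\<forall>x. pd 1 (\<lambda>x. of_real (Re (plane_coord x ^ d)) :: 'a) x = - pd 0 (\<lambda>x. of_real (Im (plane_coord x ^ d))) x) \<and>
    (\<forall>j x. 2 \<le> j \<longrightarrow> pd j (\<lambda>x. of_real (Re (plane_coord x ^ d)) :: 'a) x = 0 \<and> pd j (\<lambda>x. of_real (Im (plane_coord x ^ d)) :: 'a) x = 0)"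
proof (induction d)
  case 0
  have "hp m 0 (\<lambda>x. 1 :: 'a)" "hp m 0 (\<lambda>x. 0 :: 'a)" by (rule hp.const)+
  then show ?case by (simp add: pd_const)
next
  case (Suc d)
  let ?p = "\<lambda>x. of_real (Re (plane_coord x ^ d)) :: 'a" and ?q = "\<lambda>x. of_real (Im (plane_coord x ^ d)) :: 'a"
  have h: "hp m d ?p" "hp m d ?q" using Suc by blast+
  have e: "(\<lambda>x. of_real (Re (plane_coord x ^ Suc d)) :: 'a) = (\<lambda>x. of_real (x 0) * ?p x + (-1) * (of_real (x 1) * ?q x))"
    "(\<lambda>x. of_real (Im (plane_coord x ^ Suc d)) :: 'a) = (\<lambda>x. of_real (x 0) * ?q x + of_real (x 1) * ?p x)"
    by (simp_all add: plane_coord_def fun_eq_iff)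
  have p: "pdable ?p" "pdable ?q" using h pdable_hp by blast+
  have dp: "pd j (\<lambda>x. of_real (x 0) * ?p x + (-1) * (of_real (x 1) * ?q x)) x
      = ((if 0 = j then ?p x else 0) + of_real (x 0) * pd j ?p x) + (-1) * ((if 1 = j then ?q x else 0) + of_real (x 1) * pd j ?q x)" for j x
    by (simp only: pd_add pd_scale pdable_scale pdable_mulx pd_mulx p)
  have dq: "pd j (\<lambda>x. of_real (x 0) * ?q x + of_real (x 1) * ?p x) x
      = ((if 0 = j then ?q x else 0) + of_real (x 0) * pd j ?q x) + ((if 1 = j then ?p x else 0) + of_real (x 1) * pd j ?p x)" for j x
    by (simp only: pd_add pdable_mulx pd_mulx p)
  have i: "0 < m" "1 < m" using assms by auto
  have "hp m (Suc d) (\<lambda>x. of_real (x 0) * ?p x + (-1) * (of_real (x 1) * ?q x))"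
    "hp m (Suc d) (\<lambda>x. of_real (x 0) * ?q x + of_real (x 1) * ?p x)"
    by (rule hp.add[OF hp.mulx hp_scale[OF hp.mulx]] hp.add[OF hp.mulx hp.mulx]; rule h i)+
  moreover have cr: "pd 0 ?p x = pd 1 ?q x" "pd 1 ?p x = - pd 0 ?q x" "2 \<le> j \<Longrightarrow> pd j ?p x = 0 \<and> pd j ?q x = 0" for j x
    using Suc by blast+
  ultimately show ?case unfolding e dp dq by (auto simp: cr(1,2) cr(3)[simplified])
qed

text \<open>The real part of $\overline{z}^d$ times $e_0$ plus its imaginary part times $e_1$, where $z = x_0 + i x_1$,
  multiplied by $e_2 \wedge \dots \wedge e_{t+1}$.\<close>

definition top_vec :: "nat \<Rightarrow> nat \<Rightarrow> 'a::real_normed_field clfun" where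
  "top_vec t d = (\<lambda>x A. of_real (Re (plane_coord x ^ d)) * eps 0 (blade {2..<t + 2}) A - of_real (Im (plane_coord x ^ d)) * eps 1 (blade {2..<t + 2}) A)"

lemma iot_blade: "j \<notin> B \<Longrightarrow> iot j (blade B) = 0"
  by (auto simp: iot_def blade_def fun_eq_iff zero_fun_apply)

text \<open>The vector part is the conjugate of z^d, whose divergence and curl vanish by the
  Cauchy-Riemann equations. The constant blade contains neither e_0 nor e_1, so contractions by
  these see the vector part alone.\<close>

lemma top_vec_harm:
  assumes m: "2 \<le> m" and t: "Suc t < m"
  shows "(top_vec t d :: 'a::real_normed_field clfun) \<in> harm m (Suc t) d"
proof -
  let ?b = "blade {2..<t + 2} :: nat set \<Rightarrow> 'a"
  let ?p = "\<lambda>x. of_real (Re (plane_coord x ^ d)) :: 'a" and ?q = "\<lambda>x. of_real (Im (plane_coord x ^ d)) :: 'a"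
  have h: "hp m d ?p" "hp m d ?q" and cr: "\<And>x. pd 0 ?p x = pd 1 ?q x" "\<And>x. pd 1 ?p x = - pd 0 ?q x"
    "\<And>j x. 2 \<le> j \<Longrightarrow> pd j ?p x = 0" "\<And>j x. 2 \<le> j \<Longrightarrow> pd j ?q x = 0"
    using hp_power_plane_coord[OF m, of d, where 'a = 'a] by blast+
  have p: "pdable ?p" "pdable ?q" using h pdable_hp by blast+
  have i: "0 < m" "1 < m" using m by auto
  have "{2..<t + 2} \<subseteq> {..<m}" "card {2..<t + 2} = t" using t by auto
  then have g: "graded m t ?b" by (auto simp: graded_def blade_def)
  have e: "(top_vec t d x A :: 'a) = eps 0 ?b A * ?p x + (- eps 1 ?b A) * ?q x" for x A by (simp add: top_vec_def)
  have hpoly: "(top_vec t d :: 'a clfun) \<in> hpoly m d (Suc t)"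
  proof (rule hpolyI)
    show "graded m (Suc t) (top_vec t d x :: nat set \<Rightarrow> 'a)" for x
      using graded_eps[OF g i(1)] graded_eps[OF g i(2)] by (auto simp: top_vec_def graded_def)
    show "hp m d (\<lambda>x. top_vec t d x A :: 'a)" for A unfolding e by (intro hp.add hp_scale h)
  qed
  have D: "pderiv_cl j (top_vec t d :: 'a clfun) x = (\<lambda>A. pd j ?p x * eps 0 ?b A) + (\<lambda>A. (- pd j ?q x) * eps 1 ?b A)" for j x
  proof
    fix A
    have "pd j (\<lambda>x. eps 0 ?b A * ?p x + (- eps 1 ?b A) * ?q x) x = eps 0 ?b A * pd j ?p x + (- eps 1 ?b A) * pd j ?q x"
      by (simp only: pd_add pd_scale pdable_scale p)
    then show "pderiv_cl j (top_vec t d :: 'a clfun) x A = ((\<lambda>A. pd j ?p x * eps 0 ?b A) + (\<lambda>A. (- pd j ?q x) * eps 1 ?b A)) A"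
      unfolding pderiv_cl_pd e by (simp add: plus_fun_apply algebra_simps)
  qed
  have i0: "iot 0 ?b = 0" "iot 1 ?b = 0" by (rule iot_blade; simp)+
  have two: "(\<Sum>j<m. F j) = F 0 + F 1" if "\<And>j. 2 \<le> j \<Longrightarrow> F j = 0" for F :: "nat \<Rightarrow> 'a"
  proof -
    have "(\<Sum>j<m. F j) = (\<Sum>j\<in>{0, 1}. F j)"
      by (rule sum.mono_neutral_right) (use m that in \<open>auto simp: numeral_2_eq_2 not_less_eq_eq\<close>)
    then show ?thesis by simp
  qed
  have "dd m (top_vec t d :: 'a clfun) x A = 0" for x A
  proof -
    have F: "eps j (pderiv_cl j (top_vec t d :: 'a clfun) x) A = pd j ?p x * eps j (eps 0 ?b) A + (- pd j ?q x) * eps j (eps 1 ?b) A" for j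
      unfolding D eps_add eps_scale plus_fun_apply ..
    have "dd m (top_vec t d :: 'a clfun) x A = (pd 0 ?p x * eps 0 (eps 0 ?b) A + (- pd 0 ?q x) * eps 0 (eps 1 ?b) A)
      + (pd 1 ?p x * eps 1 (eps 0 ?b) A + (- pd 1 ?q x) * eps 1 (eps 1 ?b) A)"
      unfolding dd_def F by (rule two) (simp add: cr)
    then show ?thesis unfolding cr(2) using eps_eps[of 0 1 ?b A] by (simp add: eps_self cr(1))
  qed
  moreover have "de m (top_vec t d :: 'a clfun) x A = 0" for x A
  proof -
    have F: "iot j (pderiv_cl j (top_vec t d :: 'a clfun) x) A = pd j ?p x * iot j (eps 0 ?b) A + (- pd j ?q x) * iot j (eps 1 ?b) A" for j
      unfolding D iot_add iot_scale plus_fun_apply ..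
    have "de m (top_vec t d :: 'a clfun) x A = (pd 0 ?p x * iot 0 (eps 0 ?b) A + (- pd 0 ?q x) * iot 0 (eps 1 ?b) A)
      + (pd 1 ?p x * iot 1 (eps 0 ?b) A + (- pd 1 ?q x) * iot 1 (eps 1 ?b) A)"
      unfolding de_def F by (rule two) (simp add: cr)
    moreover have "iot 0 (eps 0 ?b) A = - ?b A" "iot 1 (eps 1 ?b) A = - ?b A" "iot 0 (eps 1 ?b) A = 0" "iot 1 (eps 0 ?b) A = 0"
      using eps_iot[of 0 0 ?b A] eps_iot[of 1 1 ?b A] eps_iot[of 1 0 ?b A] eps_iot[of 0 1 ?b A]
      unfolding i0 eps_zero zero_fun_apply by simp_all
    ultimately show ?thesis by (simp add: cr)
  qed
  ultimately show ?thesis using hpoly by (simp add: harm_eq fun_eq_iff zero_fun_apply)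
qed

lemma top_vec_nonzero: "top_vec t d \<noteq> (0 :: 'a::real_normed_field clfun)"
proof
  assume "top_vec t d = (0 :: 'a clfun)"
  then have "top_vec t d (unit_vec 0) (insert 0 {2..<t + 2}) = (0 :: 'a)" by (simp add: zero_fun_apply)
  moreover have "plane_coord (unit_vec 0) = 1" by (simp add: plane_coord_def unit_vec_def complex_eq_iff)
  ultimately show False by (simp add: top_vec_def eps_def blade_def sg_def)
qed

text \<open>On the plane the reflection is z |-> cis \<alpha> times the conjugate of z. Acting on
  the argument it contributes cis \<alpha> to the power d and on the value once more, in total the
  power d + 1 = N, which is (-1)^l at \<alpha> = pi l / N. The factor (-1)^t comes from the blade
  orthogonal to the plane.\<close>

lemma Hv_top_vec:
  assumes m: "2 \<le> m" and t: "Suc t < m" and N: "N = Suc d"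
  shows "Hv m (Suc t) (plane_vec (pi * real l / real N / 2)) (top_vec t d :: 'a::real_normed_field clfun) = scl ((-1) ^ t * (-1) ^ l) (top_vec t d)"
proof (intro ext)
  fix x A
  let ?\<alpha> = "pi * real l / real N"
  let ?\<rho> = "plane_vec (?\<alpha> / 2)"
  let ?b = "blade {2..<t + 2} :: nat set \<Rightarrow> 'a"
  let ?u = "\<lambda>x i. if i = 0 then Re (cnj (plane_coord x ^ d)) else if i = 1 then Im (cnj (plane_coord x ^ d)) else 0 :: real"
  have i: "0 < m" "1 < m" using m by auto
  have T: "(top_vec t d x :: nat set \<Rightarrow> 'a) = evec m (?u x) ?b" for x
    using evec_two(1)[of 0 m 1 "Re (cnj (plane_coord x ^ d))" "Im (cnj (plane_coord x ^ d))" ?b] i by (simp add: top_vec_def del: complex_cnj_power)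
  have i0: "iot 0 ?b = 0" "iot 1 ?b = 0" by (rule iot_blade; simp)+
  have "Lv m t ?\<rho> ?b A = (-1) ^ t * ?b A" for A
    unfolding Lv_plane_vec[OF m] i0 eps_zero zero_fun_apply by simp
  then have Lb: "Lv m t ?\<rho> ?b = (\<lambda>A. (-1) ^ t * ?b A)" by (rule ext)
  have z: "plane_coord (reflv m ?\<rho> y) = cis ?\<alpha> * cnj (plane_coord y)" for y
    using reflv_plane_vec[OF m i(1), of "?\<alpha> / 2" y] reflv_plane_vec[OF m i(2), of "?\<alpha> / 2" y]
    by (simp add: plane_coord_def complex_eq_iff)
  have "plane_coord (reflv m ?\<rho> (?u (reflv m ?\<rho> x))) = cis ?\<alpha> * cnj (plane_coord (?u (reflv m ?\<rho> x)))" by (rule z)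
  also have "plane_coord (?u y) = cnj (plane_coord y ^ d)" for y by (simp add: plane_coord_def complex_eq_iff)
  also have "cis ?\<alpha> * cnj (cnj (plane_coord (reflv m ?\<rho> x) ^ d)) = cis ?\<alpha> ^ N * cnj (plane_coord x ^ d)"
    unfolding z unfolding N power_Suc power_mult_distrib complex_cnj_mult complex_cnj_power complex_cnj_cnj by (simp only: mult_ac)
  also have "cis ?\<alpha> ^ N = (-1) ^ l"
  proof -
    have "cis ?\<alpha> ^ N = cis (real N * ?\<alpha>)" by (simp add: Complex.DeMoivre)
    also have "real N * ?\<alpha> = real l * pi" using N by (simp add: field_simps)
    also have "cis (real l * pi) = cis pi ^ l" by (rule Complex.DeMoivre[symmetric])
    finally show ?thesis by simp
  qed
  finally have Z: "plane_coord (reflv m ?\<rho> (?u (reflv m ?\<rho> x))) = (-1) ^ l * cnj (plane_coord x ^ d)" .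
  have rm: "Re ((-1) ^ l * w) = (-1) ^ l * Re w" "Im ((-1) ^ l * w) = (-1) ^ l * Im w" for w
    by (cases "even l"; simp)+
  have R: "reflv m ?\<rho> (?u (reflv m ?\<rho> x)) j = (-1) ^ l * ?u x j" if "j < m" for j
  proof -
    consider "j = 0" | "j = 1" | "j \<noteq> 0" "j \<noteq> 1" by blast
    then show ?thesis
    proof cases
      case 1
      then show ?thesis using arg_cong[OF Z, of Re] unfolding rm plane_coord_def[of "reflv m ?\<rho> _"] by simp
    next
      case 2
      then show ?thesis using arg_cong[OF Z, of Im] unfolding rm plane_coord_def[of "reflv m ?\<rho> _"] by simp
    next
      case 3
      then show ?thesis unfolding reflv_plane_vec[OF m that] by simp
    qed
  qed
  have "Hv m (Suc t) ?\<rho> (top_vec t d :: 'a clfun) x = evec m (reflv m ?\<rho> (?u (reflv m ?\<rho> x))) (Lv m t ?\<rho> ?b)"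
    unfolding Hv_def T by (rule Lv_evec[OF unitv_plane_vec[OF m]])
  also have "\<dots> = (\<lambda>A. of_real ((-1) ^ l) * evec m (?u x) (Lv m t ?\<rho> ?b) A)"
    by (rule evec_coeffs[OF R])
  finally show "Hv m (Suc t) ?\<rho> (top_vec t d :: 'a clfun) x A = scl ((-1) ^ t * (-1) ^ l) (top_vec t d) x A"
    unfolding Lb evec_scale by (simp add: scl_apply T)
qed

lemma altsum_top_vec:
  assumes m: "2 \<le> m" and t: "Suc t < m" and N: "N = Suc d"
  shows "altsum m (Suc t) N (top_vec t d :: 'a::real_normed_field clfun) = scl ((-1) ^ t * of_nat (2 * N)) (top_vec t d)"
proof (intro ext)
  fix x A
  have e: "(-1) ^ l * ((-1) ^ t * (-1) ^ l * c) = (-1) ^ t * (c::'a)" for l :: nat and c by (cases "even l") auto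
  show "altsum m (Suc t) N (top_vec t d :: 'a clfun) x A = scl ((-1) ^ t * of_nat (2 * N)) (top_vec t d) x A"
    unfolding altsum_def Hv_top_vec[OF m t N] by (simp add: sum2_app scl_apply e)
qed

section \<open>Equivariant images\<close>

text \<open>Intertwiners from a-vector valued polynomials of degree d to s-vector valued ones of
  degree k. Both grades are recorded because \<open>Hv\<close> depends on the grade.\<close>

definition equivariant :: "nat \<Rightarrow> nat \<Rightarrow> nat \<Rightarrow> nat \<Rightarrow> nat \<Rightarrow> ('a::real_normed_field clfun \<Rightarrow> 'a clfun) \<Rightarrow> bool" where
  "equivariant m a d s k T \<longleftrightarrow>
    (\<forall>P\<in>hpoly m d a. T P \<in> hpoly m k s) \<and>
    (\<forall>P\<in>hpoly m d a. \<forall>Q\<in>hpoly m d a. T (P + Q) = T P + T Q) \<and>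
    (\<forall>c. \<forall>P\<in>hpoly m d a. T (scl c P) = scl c (T P)) \<and>
    (\<forall>\<rho>. unitv m \<rho> \<longrightarrow> (\<forall>P\<in>hpoly m d a. T (Hv m a \<rho> P) = Hv m s \<rho> (T P)))"

lemma equivariantD:
  assumes "equivariant m a d s k T" "P \<in> hpoly m d a"
  shows "T P \<in> hpoly m k s" "Q \<in> hpoly m d a \<Longrightarrow> T (P + Q) = T P + T Q" "T (scl c P) = scl c (T P)"
    "unitv m \<rho> \<Longrightarrow> T (Hv m a \<rho> P) = Hv m s \<rho> (T P)"
  using assms unfolding equivariant_def by blast+

lemma equivariant_comp: "equivariant m a d b e S \<Longrightarrow> equivariant m b e s k T \<Longrightarrow> equivariant m a d s k (\<lambda>P. T (S P))"
  unfolding equivariant_def by (simp add: Hv_hpoly)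

lemma equivariant_add: "equivariant m a d s k S \<Longrightarrow> equivariant m a d s k T \<Longrightarrow> equivariant m a d s k (\<lambda>P. S P + T P)"
  unfolding equivariant_def by (simp add: hpoly_add Hv_add scl_simps add_ac)

lemma equivariant_scl: "equivariant m a d s k T \<Longrightarrow> equivariant m a d s k (\<lambda>P. scl c (T P))"
  unfolding equivariant_def by (simp add: scl_hpoly Hv_scl scl_simps mult.commute)

lemma equivariant_id: "equivariant m a d a d (\<lambda>P. P)"
  by (simp add: equivariant_def)

lemma equivariant_xe: "equivariant m a d (Suc a) (Suc d) (xe m)"
  by (auto simp: equivariant_def xe_hpoly xe_add xe_Hv xe_scale scl_def)

lemma equivariant_xi: "equivariant m (Suc a) d a (Suc d) (xi m)"
  by (auto simp: equivariant_def xi_hpoly xi_add xi_Hv xi_scale scl_def)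

lemma equivariant_xx: "equivariant m a d a (d + 2) (xx m)"
  by (auto simp: equivariant_def xx_hpoly xx_add xx_Hv xx_scale scl_def)

lemma equivariant_xx_pow: "equivariant m a d a (d + 2 * j) (xx m ^^ j)"
proof (induction j)
  case (Suc j)
  then show ?case using equivariant_comp[OF Suc.IH equivariant_xx] by (simp add: comp_def)
qed (simp add: id_def equivariant_id)

lemma equivariant_xe_xi: "equivariant m (Suc a) d (Suc a) (d + 2) (\<lambda>P. xe m (xi m P))"
  and equivariant_xi_xe: "equivariant m a d a (d + 2) (\<lambda>P. xi m (xe m P))"
  using equivariant_comp[OF equivariant_xi equivariant_xe] equivariant_comp[OF equivariant_xe equivariant_xi] by fastforce+

lemma equivariant_zero: "equivariant m a d s k T \<Longrightarrow> T 0 = 0"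
  using equivariantD(3)[OF _ hpoly_zero, of m a d s k T 0] by (simp add: scl_simps)

lemma simple_line:
  assumes "\<And>P. P \<in> W \<Longrightarrow> \<exists>c. P = scl c e"
  shows "simple_space m s W"
  unfolding simple_space_def
proof (intro allI impI)
  fix U assume U: "fsubspace U" "U \<subseteq> W"
  show "U = {0} \<or> U = W"
  proof (cases "U = {0}")
    case False
    then obtain P where P: "P \<in> U" "P \<noteq> 0" using fsubspace_0[OF U(1)] by blast
    obtain c where c: "P = scl c e" using assms P(1) U(2) by blast
    then have c0: "c \<noteq> 0" using P(2) by (auto simp: scl_simps)
    have "Q \<in> U" if "Q \<in> W" for Q
    proof -
      obtain q where q: "Q = scl q e" using assms[OF \<open>Q \<in> W\<close>] by blast
      have "Q = scl (q / c) P" using c0 by (simp add: q c scl_simps)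
      then show ?thesis using fsubspace_scl[OF U(1) P(1)] by simp
    qed
    then show ?thesis using U(2) by blast
  qed simp
qed

text \<open>In grade 0 contraction with x is zero and in grade m wedging with x is zero, so the
  anticommutator with \<open>dd\<close> or \<open>de\<close> leaves no null solutions of positive
  degree. These grades arise as s - 1 and s + 1 in the summands.\<close>

lemma harm_extreme_zero:
  assumes P: "P \<in> harm m a (Suc d)" and a: "a = 0 \<or> a = m"
  shows "P = 0"
proof -
  have h: "P \<in> hpoly m (Suc d) a" "dd m P = 0" "de m P = 0" using P by (simp_all add: harm_eq)
  show ?thesis using a
  proof
    assume "a = 0"
    then show ?thesis using dd_xi_harm[OF h(1,2)] xi_hpoly_0 h(1) by blast
  next
    assume "a = m"
    then show ?thesis using de_xe_harm[OF h(1,3) hpoly_high[OF xe_hpoly[OF h(1)]]] by simp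
  qed
qed

lemma harm_extreme_line:
  assumes P: "P \<in> harm m a 0" and a: "a = 0 \<or> a = m"
  shows "\<exists>c. P = scl c (\<lambda>x. blade {..<a})"
proof (intro exI ext)
  fix x A
  have h: "P \<in> hpoly m 0 a" by (rule harm_hpoly[OF P])
  have g: "graded m a (P x)" by (rule hpoly_graded[OF h])
  have A: "A = {..<a}" if "A \<subseteq> {..<m}" "card A = a"
    using a that card_subset_eq[of "{..<m}" A] finite_subset[of A "{..<m}"] by auto
  have "P x = P 0" by (rule hpoly_0_const[OF h])
  then show "P x A = scl (P 0 {..<a}) (\<lambda>x. blade {..<a}) x A"
    using g A by (cases "A = {..<a}") (auto simp: scl_apply blade_def graded_def)
qed

lemma harm_simple_all:
  assumes "a \<le> m"
  shows "simple_space m a (harm m a d :: 'a::{real_normed_field, euclidean_space} clfun set)"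
proof (cases "a = 0 \<or> a = m")
  case True
  show ?thesis
  proof (cases d)
    case 0
    then show ?thesis using simple_line harm_extreme_line[OF _ True] by blast
  next
    case (Suc d')
    show ?thesis
    proof (rule simple_line[where e = 0])
      fix P :: "'a clfun" assume "P \<in> harm m a d"
      then show "\<exists>c. P = scl c 0" using harm_extreme_zero[OF _ True] Suc by (simp add: scl_simps)
    qed
  qed
next
  case False
  then show ?thesis using harm_simple[of a m d] assms by simp
qed

text \<open>A nonzero summand seen as an image of a harmonic space. As in Schur's lemma,
  irreducibility of the source makes T injective on it and the image irreducible; both follow by
  pulling back invariant subspaces.\<close>

locale equivariant_image =
  fixes m a d s k :: nat and T :: "'a::{real_normed_field, euclidean_space} clfun \<Rightarrow> 'a clfun"
  assumes T: "equivariant m a d s k T" and am: "a \<le> m" and nonzero: "T ` harm m a d \<noteq> {0}"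
begin

lemma pullback_trivial:
  assumes U: "fsubspace U" "Hinv m s U"
  shows "{P \<in> harm m a d. T P \<in> U} = {0} \<or> harm m a d \<subseteq> {P. T P \<in> U}"
proof -
  let ?K = "{P \<in> harm m a d. T P \<in> U}"
  have "fsubspace ?K" unfolding fsubspace_iff
  proof (intro conjI ballI allI)
    show "0 \<in> ?K" using fsubspace_0[OF harm_fsubspace, of m a d, where 'a = 'a] fsubspace_0[OF U(1)] equivariant_zero[OF T] by simp
    show "P + Q \<in> ?K" if "P \<in> ?K" "Q \<in> ?K" for P Q
      using that fsubspace_add[OF harm_fsubspace] fsubspace_add[OF U(1)] equivariantD(2)[OF T harm_hpoly harm_hpoly] by auto
    show "scl c P \<in> ?K" if "P \<in> ?K" for c P
      using that fsubspace_scl[OF harm_fsubspace] fsubspace_scl[OF U(1)] equivariantD(3)[OF T harm_hpoly] by auto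
  qed
  moreover have "Hinv m a ?K" unfolding Hinv_def
  proof (intro allI impI ballI)
    fix \<rho> P assume \<rho>: "unitv m \<rho>" and P: "P \<in> ?K"
    have "Hv m a \<rho> P \<in> harm m a d" using harm_Hinv[of m a d, where 'a = 'a] \<rho> P by (simp add: Hinv_def)
    moreover have "T (Hv m a \<rho> P) \<in> U" using P U(2) \<rho> by (simp add: equivariantD(4)[OF T harm_hpoly \<rho>] Hinv_def)
    ultimately show "Hv m a \<rho> P \<in> ?K" by simp
  qed
  ultimately have "?K = {0} \<or> ?K = harm m a d"
    using harm_simple_all[OF am, of d, where 'a = 'a] unfolding simple_space_def by blast
  then show ?thesis by blast
qed

lemma image_injective: "P \<in> harm m a d \<Longrightarrow> T P = 0 \<Longrightarrow> P = 0"
proof -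
  assume P: "P \<in> harm m a d" "T P = 0"
  have "fsubspace {0 :: 'a clfun}" by (auto simp: fsubspace_iff scl_simps)
  moreover have "Hinv m s {0 :: 'a clfun}" by (simp add: Hinv_def Hv_zero)
  ultimately have c: "{P \<in> harm m a d. T P \<in> {0}} = {0} \<or> harm m a d \<subseteq> {P. T P \<in> {0}}" by (rule pullback_trivial)
  have "\<not> harm m a d \<subseteq> {P. T P \<in> {0}}"
  proof
    assume "harm m a d \<subseteq> {P. T P \<in> {0}}"
    then have "T ` harm m a d \<subseteq> {0}" by blast
    moreover have "0 \<in> T ` harm m a d"
      using fsubspace_0[OF harm_fsubspace, of m a d, where 'a = 'a] equivariant_zero[OF T] by (metis imageI)
    ultimately show False using nonzero by blast
  qed
  then show "P = 0" using c P by blast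
qed

lemma image_hpoly: "T ` harm m a d \<subseteq> hpoly m k s"
  using equivariantD(1)[OF T harm_hpoly] by blast

lemma image_fsubspace: "fsubspace (T ` harm m a d)"
  unfolding fsubspace_iff
proof (intro conjI ballI allI)
  show "0 \<in> T ` harm m a d"
    using fsubspace_0[OF harm_fsubspace, of m a d, where 'a = 'a] equivariant_zero[OF T] by (metis imageI)
  fix W assume "W \<in> T ` harm m a d"
  then obtain P where P: "P \<in> harm m a d" "W = T P" by blast
  show "scl c W \<in> T ` harm m a d" for c
    unfolding P(2) equivariantD(3)[OF T harm_hpoly[OF P(1)], symmetric] by (intro imageI fsubspace_scl harm_fsubspace P)
  fix W' assume "W' \<in> T ` harm m a d"
  then obtain P' where P': "P' \<in> harm m a d" "W' = T P'" by blast
  show "W + W' \<in> T ` harm m a d"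
    unfolding P(2) P'(2) equivariantD(2)[OF T harm_hpoly[OF P(1)] harm_hpoly[OF P'(1)], symmetric]
    by (intro imageI fsubspace_add harm_fsubspace P P')
qed

lemma image_Hinv: "Hinv m s (T ` harm m a d)"
  unfolding Hinv_def
proof (intro allI impI ballI)
  fix \<rho> W assume \<rho>: "unitv m \<rho>" and "W \<in> T ` harm m a d"
  then obtain P where P: "P \<in> harm m a d" "W = T P" by blast
  have "Hv m a \<rho> P \<in> harm m a d" using harm_Hinv[of m a d, where 'a = 'a] \<rho> P by (simp add: Hinv_def)
  then show "Hv m s \<rho> W \<in> T ` harm m a d"
    unfolding P(2) equivariantD(4)[OF T harm_hpoly[OF P(1)] \<rho>, symmetric] by (rule imageI)
qed

lemma image_irreducible: "irreducible_sub m (T ` harm m a d)"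
  unfolding irreducible_sub_def
proof (intro conjI allI impI nonzero image_fsubspace)
  show "invariant m (T ` harm m a d)" unfolding invariant_iff[OF image_hpoly] using image_Hinv by (simp add: Hinv_def)
  fix U assume U: "fsubspace U \<and> U \<subseteq> T ` harm m a d \<and> invariant m U"
  then have "U \<subseteq> hpoly m k s" using image_hpoly by blast
  then have "Hinv m s U" using U invariant_iff unfolding Hinv_def by blast
  then have c: "{P \<in> harm m a d. T P \<in> U} = {0} \<or> harm m a d \<subseteq> {P. T P \<in> U}" using pullback_trivial U by blast
  then show "U = {0} \<or> U = T ` harm m a d"
  proof
    assume e: "{P \<in> harm m a d. T P \<in> U} = {0}"
    have "u = 0" if u: "u \<in> U" for u
    proof -
      obtain P where P: "P \<in> harm m a d" "u = T P" using U u by blast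
      then have "P = 0" using e u by blast
      then show ?thesis using P(2) equivariant_zero[OF T] by simp
    qed
    then show ?thesis using U fsubspace_0 by blast
  next
    assume "harm m a d \<subseteq> {P. T P \<in> U}"
    then show ?thesis using U by blast
  qed
qed

lemma altsum_image:
  assumes P: "P \<in> hpoly m d a" and m: "2 \<le> m"
  shows "altsum m s N (T P) = T (altsum m a N P)"
proof -
  have "(\<Sum>l\<in>L. scl (c l) (Hv m a (plane_vec (f l)) P)) \<in> hpoly m d a \<and>
    T (\<Sum>l\<in>L. scl (c l) (Hv m a (plane_vec (f l)) P)) = (\<Sum>l\<in>L. scl (c l) (Hv m s (plane_vec (f l)) (T P)))"
    for c :: "nat \<Rightarrow> 'a" and f and L :: "nat set"
    by (induction L rule: infinite_finite_induct)
      (auto simp: hpoly_zero equivariant_zero[OF T] hpoly_add scl_hpoly Hv_hpoly P equivariantD(2,3)[OF T] equivariantD(4)[OF T P unitv_plane_vec[OF m]])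
  then show ?thesis unfolding altsum_def by simp
qed

lemma altsum_image_zero:
  assumes "2 \<le> m" "Suc d < N" "W \<in> T ` harm m a d"
  shows "altsum m s N W = 0"
proof -
  obtain P where P: "P \<in> harm m a d" "W = T P" using assms(3) by blast
  show ?thesis unfolding P(2) altsum_image[OF harm_hpoly[OF P(1)] assms(1)]
    using altsum_zero[OF assms(1) harm_hpoly[OF P(1)] assms(2)] equivariant_zero[OF T] by simp
qed

lemma altsum_image_nonzero:
  assumes m: "2 \<le> m" and d: "0 < d"
  obtains W c where "W \<in> T ` harm m a d" "W \<noteq> 0" "c \<noteq> 0" "altsum m s (Suc d) W = scl c W"
proof -
  obtain d' where d': "d = Suc d'" using d by (cases d) auto
  have z: "0 \<in> harm m a d" by (rule fsubspace_0[OF harm_fsubspace])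
  \<comment> \<open>Degree d > 0 and a nonzero image exclude the extreme grades, where only
    constants are harmonic; \<open>top_vec\<close> exists in the remaining ones.\<close>
  have "\<not> (a = 0 \<or> a = m)"
  proof
    assume "a = 0 \<or> a = m"
    then have "harm m a d \<subseteq> {0}" using harm_extreme_zero[of _ m a d'] d' by blast
    then have "T ` harm m a d = {0}" using z equivariant_zero[OF T] by auto
    then show False using nonzero by simp
  qed
  then obtain t where t: "a = Suc t" "Suc t < m" using am by (cases a) auto
  let ?v = "top_vec t d :: 'a clfun"
  let ?c = "(-1) ^ t * of_nat (2 * Suc d) :: 'a"
  have v: "?v \<in> harm m a d" using top_vec_harm[OF m t(2)] t(1) by simp
  have "T ?v \<noteq> 0" using image_injective[OF v] top_vec_nonzero by blast
  moreover have "altsum m s (Suc d) (T ?v) = scl ?c (T ?v)"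
    using altsum_image[OF harm_hpoly[OF v] m] altsum_top_vec[OF m t(2) refl, where 'a = 'a] equivariantD(3)[OF T harm_hpoly[OF v]]
    by (simp only: t(1))
  moreover have "?c \<noteq> 0" by (simp del: of_nat_Suc of_nat_mult)
  ultimately show thesis using that v by blast
qed

end

lemma intertwiner_altsum:
  assumes W: "fsubspace W" "W \<subseteq> hpoly m k s" "Hinv m s W" "f ` W \<subseteq> hpoly m k s"
    and f: "\<forall>c P Q. P \<in> W \<and> Q \<in> W \<longrightarrow> f ((\<lambda>x A. c * P x A) + Q) = (\<lambda>x A. c * f P x A) + f Q"
    and H: "\<forall>r\<in>pin m. \<forall>P\<in>W. f (Hact m r P) = Hact m r (f P)"
    and m: "2 \<le> m" and P: "P \<in> W"
  shows "f 0 = 0" "f (scl c P) = scl c (f P)" "f (altsum m s N P) = altsum m s N (f P)"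
proof -
  have lin: "f (scl c P + Q) = scl c (f P) + f Q" if "P \<in> W" "Q \<in> W" for c P Q
    using f that unfolding scl_def by blast
  have z: "0 \<in> W" by (rule fsubspace_0[OF W(1)])
  show f0: "f 0 = 0" using lin[OF z z, of 1] by (simp add: scl_simps)
  show "f (scl c P) = scl c (f P)" using lin[OF P z, of c] f0 by simp
  have Hf: "f (Hv m s \<rho> P) = Hv m s \<rho> (f P)" "Hv m s \<rho> P \<in> W" if \<rho>: "unitv m \<rho>" for \<rho>
  proof -
    have "P \<in> hpoly m k s" "f P \<in> hpoly m k s" using W P by blast+
    then show "f (Hv m s \<rho> P) = Hv m s \<rho> (f P)" using H P pin_vec[OF \<rho>] Hact_vec[OF \<rho>] by metis
    show "Hv m s \<rho> P \<in> W" using W(3) \<rho> P by (simp add: Hinv_def)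
  qed
  have "(\<Sum>l\<in>L. scl (c l) (Hv m s (plane_vec (g l)) P)) \<in> W \<and>
    f (\<Sum>l\<in>L. scl (c l) (Hv m s (plane_vec (g l)) P)) = (\<Sum>l\<in>L. scl (c l) (Hv m s (plane_vec (g l)) (f P)))"
    for c and g and L :: "nat set"
    by (induction L rule: infinite_finite_induct)
      (auto simp: z f0 lin Hf[OF unitv_plane_vec[OF m]] intro!: fsubspace_add[OF W(1)] fsubspace_scl[OF W(1)])
  then show "f (altsum m s N P) = altsum m s N (f P)" unfolding altsum_def by simp
qed

text \<open>For N one more than the larger degree, \<open>altsum\<close> annihilates the image with
  the smaller degree and has an eigenvector with nonzero eigenvalue in the other. An intertwiner
  commutes with it; as the intertwiner has a direction, the two orders of the degrees are separate
  cases.\<close>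

lemma images_not_isomorphic:
  fixes T1 T2 :: "'a::{real_normed_field, euclidean_space} clfun \<Rightarrow> 'a clfun"
  assumes 1: "equivariant_image m a1 d1 s k T1" and 2: "equivariant_image m a2 d2 s k T2"
    and m: "2 \<le> m" and d: "d1 \<noteq> d2"
  shows "\<not> isomorphic_rep m (T1 ` harm m a1 d1) (T2 ` harm m a2 d2)"
proof
  interpret E1: equivariant_image m a1 d1 s k T1 by (rule 1)
  interpret E2: equivariant_image m a2 d2 s k T2 by (rule 2)
  let ?W1 = "T1 ` harm m a1 d1" and ?W2 = "T2 ` harm m a2 d2"
  assume "isomorphic_rep m ?W1 ?W2"
  then obtain f where b: "bij_betw f ?W1 ?W2"
    and f: "\<forall>c P Q. P \<in> ?W1 \<and> Q \<in> ?W1 \<longrightarrow> f ((\<lambda>x A. c * P x A) + Q) = (\<lambda>x A. c * f P x A) + f Q"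
      "\<forall>r\<in>pin m. \<forall>P\<in>?W1. f (Hact m r P) = Hact m r (f P)"
    unfolding isomorphic_rep_def by blast
  have fi: "f ` ?W1 = ?W2" and inj: "inj_on f ?W1" using b by (auto simp: bij_betw_def)
  have sub: "f ` ?W1 \<subseteq> hpoly m k s" unfolding fi by (rule E2.image_hpoly)
  note A = intertwiner_altsum[OF E1.image_fsubspace E1.image_hpoly E1.image_Hinv sub f m]
  show False
  proof (cases "d1 < d2")
    case True
    obtain W c where W: "W \<in> ?W2" "W \<noteq> 0" "c \<noteq> 0" "altsum m s (Suc d2) W = scl c W"
      using E2.altsum_image_nonzero[OF m] True by auto
    obtain P where P: "P \<in> ?W1" "W = f P" using W(1) fi by blast
    have "scl c W = f (altsum m s (Suc d2) P)" using A(3)[OF P(1)] W(4) P(2) by simp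
    also have "altsum m s (Suc d2) P = 0" by (rule E1.altsum_image_zero[OF m _ P(1)]) (use True in simp)
    finally show False using A(1)[OF P(1)] W(2,3) by (simp add: scl_eq_0)
  next
    case False
    then have lt: "d2 < d1" using d by simp
    obtain W c where W: "W \<in> ?W1" "W \<noteq> 0" "c \<noteq> 0" "altsum m s (Suc d1) W = scl c W"
      using E1.altsum_image_nonzero[OF m] lt by auto
    have "scl c (f W) = f (altsum m s (Suc d1) W)" using A(2)[OF W(1)] W(4) by simp
    also have "\<dots> = altsum m s (Suc d1) (f W)" by (rule A(3)[OF W(1)])
    also have "\<dots> = 0" by (rule E2.altsum_image_zero[OF m]) (use lt W(1) fi in auto)
    finally have "f W = f 0" using W(3) A(1)[OF W(1)] by (simp add: scl_eq_0)
    then show False using inj_onD[OF inj _ W(1) fsubspace_0[OF E1.image_fsubspace]] W(2) by blast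
  qed
qed

section \<open>Assembling the multiplicity-free decompositions\<close>

definition idx_deg :: "nat \<Rightarrow> nat \<times> nat \<Rightarrow> nat" where
  "idx_deg k = (\<lambda>(i, j). k - 2 * j - i)"

text \<open>The degrees k - 2j - 1 differ from k in parity, while the degrees k - 2j - 2 share its
  parity and lie below it.\<close>

lemma idx_deg_inj: "inj_on (idx_deg k) (idx k)"
  unfolding inj_on_def idx_def idx_deg_def by (auto, presburger+)

lemma mf_decompI:
  fixes W :: "nat \<times> nat \<Rightarrow> 'a::{real_normed_field, euclidean_space} clfun set"
  assumes V: "dsum V (idx k) W" and m: "2 \<le> m"
    and W: "\<And>i. i \<in> idx k \<Longrightarrow> \<exists>a T. a \<le> m \<and> equivariant m a (idx_deg k i) s k T \<and> W i = T ` harm m a (idx_deg k i)"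
  shows "mf_decomp m V (idx k) W"
proof -
  have E: "\<exists>a T. equivariant_image m a (idx_deg k i) s k T \<and> W i = T ` harm m a (idx_deg k i)" if "i \<in> idx k" "W i \<noteq> {0}" for i
    using W[OF that(1)] that(2) unfolding equivariant_image_def by metis
  have irr: "irreducible_sub m (W i)" if "i \<in> idx k" "W i \<noteq> {0}" for i
    using E[OF that] equivariant_image.image_irreducible by metis
  have iso: "\<not> isomorphic_rep m (W i) (W j)" if "i \<in> idx k" "j \<in> idx k" "i \<noteq> j" "W i \<noteq> {0}" "W j \<noteq> {0}" for i j
  proof -
    have "idx_deg k i \<noteq> idx_deg k j" using inj_onD[OF idx_deg_inj] that by blast
    then show ?thesis using E[OF that(1,4)] E[OF that(2,5)] images_not_isomorphic[OF _ _ m] by metis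
  qed
  show ?thesis unfolding mf_decomp_def
    by (intro conjI conjunct1[OF V[unfolded dsum_def]] conjunct2[OF V[unfolded dsum_def]] ballI impI irr iso) simp_all
qed

lemma mf_decomp_ker_plus:
  assumes m: "2 \<le> m" and s: "1 \<le> s" "s < m"
  shows "mf_decomp m (ker_plus m s k :: 'a::{real_normed_field, euclidean_space} clfun set) (idx k) (summands_plus m s k)"
proof (rule mf_decompI[where s = s])
  show "dsum (ker_plus m s k :: 'a clfun set) (idx k) (summands_plus m s k)" using m s by (intro dsum_ker_plus) auto
  obtain t where t: "s = Suc t" using s by (cases s) auto
  fix i assume i: "i \<in> idx k"
  then consider "i = (0, 0)" | j where "i = (1, j)" "2 * j + 1 \<le> k" | j where "i = (2, j)" "2 * j + 2 \<le> k"
    by (auto simp: idx_def)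
  then show "\<exists>a T. a \<le> m \<and> equivariant m a (idx_deg k i) s k T \<and> (summands_plus m s k i :: 'a clfun set) = T ` harm m a (idx_deg k i)"
  proof cases
    case 1
    have D: "idx_deg k i = k" and I: "summands_plus m s k i = (\<lambda>P :: 'a clfun. P) ` harm m s k"
      by (simp_all add: 1 idx_deg_def summands_plus_def)
    show ?thesis unfolding D I
      by (intro exI[of _ s] exI[of _ "\<lambda>P :: 'a clfun. P"] conjI equivariant_id refl) (use s in simp)
  next
    case (2 j)
    let ?d = "k - 2 * j - 1"
    have X: "equivariant m (s - 1) ?d (Suc (s - 1)) (Suc ?d + 2 * j) (\<lambda>P :: 'a clfun. (xx m ^^ j) (xe m P))"
      by (rule equivariant_comp[OF equivariant_xe equivariant_xx_pow])
    have e: "Suc ?d + 2 * j = k" "Suc (s - 1) = s" using 2 s by auto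
    have I: "summands_plus m s k i = (\<lambda>P :: 'a clfun. (xx m ^^ j) (xe m P)) ` harm m (s - 1) ?d"
      unfolding 2 summands_plus_def by (simp only: split_conv) (simp add: wedge_summand_eq[OF harm_hpoly] cong: image_cong)
    have D: "idx_deg k i = ?d" by (simp add: 2 idx_deg_def)
    show ?thesis unfolding D I
      by (intro exI[of _ "s - 1"] exI[of _ "\<lambda>P :: 'a clfun. (xx m ^^ j) (xe m P)"] conjI X[unfolded e] refl) (use s in simp)
  next
    case (3 j)
    let ?d = "k - 2 * j - 2"
    let ?T = "\<lambda>P :: 'a clfun. (xx m ^^ j) (scl (of_int (int s + int ?d + 2 * int j + 2)) (xe m (xi m P)) + scl (of_int (int s + int ?d)) (xi m (xe m P)))"
    have X: "equivariant m s ?d s (?d + 2 + 2 * j) ?T"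
      unfolding t by (intro equivariant_comp[OF _ equivariant_xx_pow] equivariant_add equivariant_scl equivariant_xe_xi equivariant_xi_xe)
    have e: "?d + 2 + 2 * j = k" using 3 by auto
    have I: "summands_plus m s k i = ?T ` harm m s ?d"
      unfolding 3 summands_plus_def by (simp only: split_conv) (simp add: ydot_eq[OF harm_hpoly] cong: image_cong)
    have D: "idx_deg k i = ?d" by (simp add: 3 idx_deg_def)
    show ?thesis unfolding D I
      by (intro exI[of _ s] exI[of _ ?T] conjI X[unfolded e] refl) (use s in simp)
  qed
qed (rule m)

lemma mf_decomp_ker_minus:
  assumes m: "2 \<le> m" and s: "1 \<le> s" "s < m"
  shows "mf_decomp m (ker_minus m s k :: 'a::{real_normed_field, euclidean_space} clfun set) (idx k) (summands_minus m s k)"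
proof (rule mf_decompI[where s = s])
  show "dsum (ker_minus m s k :: 'a clfun set) (idx k) (summands_minus m s k)" using m s by (intro dsum_ker_minus) auto
  obtain t where t: "s = Suc t" using s by (cases s) auto
  fix i assume i: "i \<in> idx k"
  then consider "i = (0, 0)" | j where "i = (1, j)" "2 * j + 1 \<le> k" | j where "i = (2, j)" "2 * j + 2 \<le> k"
    by (auto simp: idx_def)
  then show "\<exists>a T. a \<le> m \<and> equivariant m a (idx_deg k i) s k T \<and> (summands_minus m s k i :: 'a clfun set) = T ` harm m a (idx_deg k i)"
  proof cases
    case 1
    have D: "idx_deg k i = k" and I: "summands_minus m s k i = (\<lambda>P :: 'a clfun. P) ` harm m s k"
      by (simp_all add: 1 idx_deg_def summands_minus_def)
    show ?thesis unfolding D I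
      by (intro exI[of _ s] exI[of _ "\<lambda>P :: 'a clfun. P"] conjI equivariant_id refl) (use s in simp)
  next
    case (2 j)
    let ?d = "k - 2 * j - 1"
    have X: "equivariant m (Suc s) ?d s (Suc ?d + 2 * j) (\<lambda>P :: 'a clfun. (xx m ^^ j) (xi m P))"
      by (rule equivariant_comp[OF equivariant_xi equivariant_xx_pow])
    have e: "Suc ?d + 2 * j = k" using 2 by auto
    have I: "summands_minus m s k i = (\<lambda>P :: 'a clfun. (xx m ^^ j) (xi m P)) ` harm m (Suc s) ?d"
      unfolding 2 summands_minus_def by (simp only: split_conv) (simp add: dot_summand_eq[OF harm_hpoly] cong: image_cong)
    have D: "idx_deg k i = ?d" by (simp add: 2 idx_deg_def)
    show ?thesis unfolding D I
      by (intro exI[of _ "Suc s"] exI[of _ "\<lambda>P :: 'a clfun. (xx m ^^ j) (xi m P)"] conjI X[unfolded e] refl) (use s in simp)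
  next
    case (3 j)
    let ?d = "k - 2 * j - 2"
    let ?T = "\<lambda>P :: 'a clfun. (xx m ^^ j) (scl (of_int (int m - int s + int ?d + 2 * int j + 2)) (xi m (xe m P)) + scl (of_int (int m - int s + int ?d)) (xe m (xi m P)))"
    have X: "equivariant m s ?d s (?d + 2 + 2 * j) ?T"
      unfolding t by (intro equivariant_comp[OF _ equivariant_xx_pow] equivariant_add equivariant_scl equivariant_xe_xi equivariant_xi_xe)
    have e: "?d + 2 + 2 * j = k" using 3 by auto
    have I: "summands_minus m s k i = ?T ` harm m s ?d"
      unfolding 3 summands_minus_def by (simp only: split_conv) (simp add: yhat_eq[OF harm_hpoly less_imp_le[OF s(2)]] cong: image_cong)
    have D: "idx_deg k i = ?d" by (simp add: 3 idx_deg_def)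
    show ?thesis unfolding D I
      by (intro exI[of _ s] exI[of _ ?T] conjI X[unfolded e] refl) (use s in simp)
  qed
qed (rule m)

theorem theorem3:
  fixes m s k :: nat
  assumes "2 \<le> m" and "1 \<le> s" and "s \<le> m - 1"
  shows "mf_decomp m (ker_plus m s k :: real clfun set) (idx k) (summands_plus m s k)
       \<and> mf_decomp m (ker_plus m s k :: complex clfun set) (idx k) (summands_plus m s k)
       \<and> mf_decomp m (ker_minus m s k :: real clfun set) (idx k) (summands_minus m s k)
       \<and> mf_decomp m (ker_minus m s k :: complex clfun set) (idx k) (summands_minus m s k)"
proof -
  have "s < m" using assms by linarith
  then show ?thesis by (intro conjI mf_decomp_ker_plus mf_decomp_ker_minus assms)
qed

end
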